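(* Let $n \geq 1$ and let $G$ be a generalized Baumslag-Solitar group of rank $n$. Then the following conditions are equivalent: (i) $G$ is self-similar; (ii) $G$ is residually finite; (iii) $G$ is linear over $\mathbb{Q}$.
   Context: Generalized Baumslag-Solitar group of rank $n \ge 1$: the fundamental group of a finite connected graph of groups (loops are allowed) in which every vertex group and every edge group is isomorphic to $\mathbb{Z}^n$ and every edge group embeds as a subgroup of finite index in each of the corresponding vertex groups. Fundamental group of a graph of groups: let $X$ be a finite connected graph, $V(X)$ its vertices, $A$ an orientation of its edges $E(X)$, with $o(e)$ and $\tau(e)$ the beginning and the end of $e \in A$. For each $v\in V(X)$ a group $G_v$ is given, and for each $e \in A$ a subgroup $G_e \le G_{o(e)}$ and an isomorphism $\phi_e : G_e \to \phi_e(G_e) \leq G_{\tau(e)}$. Let $T$ be a maximal subtree of $X$. The fundamental group is generated by the groups $G_v$ ($v\in V(X)$) and elements $t_e$ ($e \in A$), subject to the relations of each $G_v$, the relations $t_e g t_e^{-1} = \phi_e(g)$ for $e\in A$, $g\in G_e$, and $t_e = 1$ for $e \in A \cap E(T)$. Self-similar: for an integer $m\ge 2$ let $\mathcal{T}_m$ be the rooted tree in which every vertex has exactly $m$ descendants (children). Each automorphism $g$ of $\mathcal{T}_m$ can be written as $g = (g_0,\dots,g_{m-1})\sigma$, where $\sigma\in S_m$ is the permutation induced by $g$ on the first level and $g_0,\dots,g_{m-1} \in \mathrm{Aut}(\mathcal{T}_m)$ (the states of $g$) describe the action of $g$ on the $m$ subtrees rooted at the first-level vertices, each such subtree being identified with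 $\mathcal{T}_m$ in the standard way. A group $G$ is self-similar if for some $m$ it has a faithful action on $\mathcal{T}_m$ by automorphisms such that, viewing $G \le \mathrm{Aut}(\mathcal{T}_m)$, all states $g_0,\dots,g_{m-1}$ of every $g\in G$ belong to $G$. A group is linear over $\mathbb{Q}$ if it embeds in $GL_k(\mathbb{Q})$ for some $k$. *)

theory Defs
  imports
    "HOL-Algebra.Group_Action"
    "HOL-Algebra.Product_Groups"
    "Graph_Theory.Digraph_Component"
    "Jordan_Normal_Form.Matrix"
begin

section \<open>Groups given by generators and relations\<close>

text \<open>
  A letter \<open>(True, s)\<close> stands for the generator \<open>s\<close> and \<open>(False, s)\<close> for its formal inverse.
  A relation is a pair of words that are to become equal.
\<close>

type_synonym 's word = "(bool \<times> 's) list"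

definition words :: "'s set \<Rightarrow> 's word set" where
  "words S = lists (UNIV \<times> S)"

inductive_set pres_rel :: "'s set \<Rightarrow> ('s word \<times> 's word) set \<Rightarrow> ('s word \<times> 's word) set"
  for S R where
    refl: "w \<in> words S \<Longrightarrow> (w, w) \<in> pres_rel S R"
  | sym: "(u, w) \<in> pres_rel S R \<Longrightarrow> (w, u) \<in> pres_rel S R"
  | trans: "(u, v) \<in> pres_rel S R \<Longrightarrow> (v, w) \<in> pres_rel S R \<Longrightarrow> (u, w) \<in> pres_rel S R"
  | cong: "(u, w) \<in> pres_rel S R \<Longrightarrow> x \<in> words S \<Longrightarrow> y \<in> words S \<Longrightarrow>
      (x @ u @ y, x @ w @ y) \<in> pres_rel S R"
  | cancel: "s \<in> S \<Longrightarrow> ([(b, s), (\<not> b, s)], []) \<in> pres_rel S R"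
  | relation: "(u, w) \<in> R \<Longrightarrow> u \<in> words S \<Longrightarrow> w \<in> words S \<Longrightarrow> (u, w) \<in> pres_rel S R"

definition presented_group :: "'s set \<Rightarrow> ('s word \<times> 's word) set \<Rightarrow> 's word set monoid" where
  "presented_group S R =
    \<lparr>carrier = words S // pres_rel S R,
     monoid.mult = (\<lambda>A B. \<Union>a\<in>A. \<Union>b\<in>B. pres_rel S R `` {a @ b}),
     one = pres_rel S R `` {[]}\<rparr>"

lemma words_Nil [simp]: "[] \<in> words S"
  by (simp add: words_def)

lemma words_Cons [simp]: "(b, s) # w \<in> words S \<longleftrightarrow> s \<in> S \<and> w \<in> words S"
  by (auto simp: words_def)

lemma words_append [simp]: "u @ w \<in> words S \<longleftrightarrow> u \<in> words S \<and> w \<in> words S"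
  by (auto simp: words_def)

lemma pres_rel_words:
  "(u, w) \<in> pres_rel S R \<Longrightarrow> u \<in> words S \<and> w \<in> words S"
  by (induction rule: pres_rel.induct) auto

lemma equiv_pres_rel: "equiv (words S) (pres_rel S R)"
proof (rule equivI)
  show "refl_on (words S) (pres_rel S R)"
    by (auto simp: refl_on_def intro: pres_rel.refl)
  show "pres_rel S R \<subseteq> words S \<times> words S"
    by (auto dest: pres_rel_words)
  show "sym_on UNIV (pres_rel S R)"
    by (auto intro: symI pres_rel.sym)
  show "trans (pres_rel S R)"
    by (auto intro: transI pres_rel.trans)
qed

lemma pres_rel_append:
  assumes "(u, u') \<in> pres_rel S R" "(w, w') \<in> pres_rel S R"
  shows "(u @ w, u' @ w') \<in> pres_rel S R"
proof -
  have "(u @ w, u' @ w) \<in> pres_rel S R"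
    using pres_rel.cong[OF assms(1), of "[]" w] pres_rel_words[OF assms(2)] by simp
  moreover have "(u' @ w, u' @ w') \<in> pres_rel S R"
    using pres_rel.cong[OF assms(2), of u' "[]"] pres_rel_words[OF assms(1)] by simp
  ultimately show ?thesis by (rule pres_rel.trans)
qed

lemma pres_rel_mult:
  assumes "u \<in> words S" "w \<in> words S"
  shows "(pres_rel S R `` {u}) \<otimes>\<^bsub>presented_group S R\<^esub> (pres_rel S R `` {w})
    = pres_rel S R `` {u @ w}"
proof -
  have eq: "pres_rel S R `` {a @ b} = pres_rel S R `` {u @ w}"
    if "a \<in> pres_rel S R `` {u}" "b \<in> pres_rel S R `` {w}" for a b
    using that by (metis Image_singleton_iff equiv_class_eq equiv_pres_rel pres_rel_append)
  have "u \<in> pres_rel S R `` {u}" "w \<in> pres_rel S R `` {w}"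
    using assms by (auto intro: pres_rel.refl)
  with eq show ?thesis
    unfolding presented_group_def monoid.simps by blast
qed

lemma pres_rel_inverse:
  "w \<in> words S \<Longrightarrow> \<exists>w'\<in>words S. (w' @ w, []) \<in> pres_rel S R"
proof (induction w)
  case Nil
  have "([] @ [], []) \<in> pres_rel S R" by (simp add: pres_rel.refl)
  then show ?case by (intro bexI[of _ "[]"]) simp_all
next
  case (Cons a w)
  obtain b s where a: "a = (b, s)" by (cases a)
  with Cons obtain w' where w': "w' \<in> words S" "(w' @ w, []) \<in> pres_rel S R" and s: "s \<in> S"
    and w: "w \<in> words S"
    by auto
  have "(w' @ [(\<not> b, s), (b, s)] @ w, w' @ [] @ w) \<in> pres_rel S R"
    using pres_rel.cong[OF pres_rel.cancel[OF s, of "\<not> b"] w'(1) w] by simp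
  then have "((w' @ [(\<not> b, s)]) @ a # w, []) \<in> pres_rel S R"
    using w'(2) a by (auto intro: pres_rel.trans)
  moreover have "w' @ [(\<not> b, s)] \<in> words S" using w' s by simp
  ultimately show ?case by blast
qed

lemma group_presented_group: "group (presented_group S R)"
proof (rule groupI)
  let ?r = "pres_rel S R" and ?G = "presented_group S R"
  have carr: "carrier ?G = words S // ?r" and one: "\<one>\<^bsub>?G\<^esub> = ?r `` {[]}"
    by (simp_all add: presented_group_def)
  show "\<one>\<^bsub>?G\<^esub> \<in> carrier ?G" by (simp add: carr one quotientI)
  fix x assume "x \<in> carrier ?G"
  then obtain u where u: "u \<in> words S" "x = ?r `` {u}" by (auto simp: carr elim: quotientE)
  show "\<one>\<^bsub>?G\<^esub> \<otimes>\<^bsub>?G\<^esub> x = x" using u by (simp add: one pres_rel_mult)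
  obtain u' where u': "u' \<in> words S" "(u' @ u, []) \<in> ?r" using pres_rel_inverse[OF u(1)] by blast
  then have "(?r `` {u'}) \<otimes>\<^bsub>?G\<^esub> x = \<one>\<^bsub>?G\<^esub>"
    using u equiv_class_eq[OF equiv_pres_rel] by (simp add: one pres_rel_mult)
  then show "\<exists>y\<in>carrier ?G. y \<otimes>\<^bsub>?G\<^esub> x = \<one>\<^bsub>?G\<^esub>"
    using u' by (auto simp: carr quotientI)
  fix y assume "y \<in> carrier ?G"
  then obtain v where v: "v \<in> words S" "y = ?r `` {v}" by (auto simp: carr elim: quotientE)
  show "x \<otimes>\<^bsub>?G\<^esub> y \<in> carrier ?G" using u v by (simp add: carr pres_rel_mult quotientI)
  fix z assume "z \<in> carrier ?G"
  then obtain w where "w \<in> words S" "z = ?r `` {w}" by (auto simp: carr elim: quotientE)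
  then show "x \<otimes>\<^bsub>?G\<^esub> y \<otimes>\<^bsub>?G\<^esub> z = x \<otimes>\<^bsub>?G\<^esub> (y \<otimes>\<^bsub>?G\<^esub> z)"
    using u v by (simp add: pres_rel_mult)
qed


section \<open>Maximal subtrees\<close>

text \<open>
  An oriented graph is a \<^typ>\<open>('v, 'e) pre_digraph\<close>: every geometric edge is represented by exactly
  one arc, running from \<^const>\<open>tail\<close> to \<^const>\<open>head\<close>. Loops and multiple arcs are allowed. The
  library's \<^const>\<open>tree\<close> only excludes directed cycles, whereas a subtree must not contain
  undirected circuits either; so circuits traverse arcs in both directions here
  (\<open>(e, False)\<close> is \<open>e\<close> traversed backwards). The library's \<^const>\<open>connected\<close> already ignores the
  orientation and demands a vertex.
\<close>

definition step_src :: "('v, 'e) pre_digraph \<Rightarrow> 'e \<times> bool \<Rightarrow> 'v" where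
  "step_src D s = (if snd s then tail D (fst s) else head D (fst s))"

definition step_tgt :: "('v, 'e) pre_digraph \<Rightarrow> 'e \<times> bool \<Rightarrow> 'v" where
  "step_tgt D s = (if snd s then head D (fst s) else tail D (fst s))"

definition circuit :: "('v, 'e) pre_digraph \<Rightarrow> ('e \<times> bool) list \<Rightarrow> bool" where
  "circuit D p \<longleftrightarrow> p \<noteq> [] \<and> fst ` set p \<subseteq> arcs D \<and>
    (\<forall>i. Suc i < length p \<longrightarrow> step_tgt D (p ! i) = step_src D (p ! Suc i)) \<and>
    step_tgt D (last p) = step_src D (hd p) \<and>
    distinct (map fst p) \<and> distinct (map (step_src D) p)"

definition undirected_tree :: "('v, 'e) pre_digraph \<Rightarrow> bool" where
  "undirected_tree D \<longleftrightarrow> connected D \<and> (\<nexists>p. circuit D p)"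

definition maximal_subtree :: "('v, 'e) pre_digraph \<Rightarrow> ('v, 'e) pre_digraph \<Rightarrow> bool" where
  "maximal_subtree D T \<longleftrightarrow> pre_digraph.max_subgraph D undirected_tree T"


section \<open>Graphs of groups and their fundamental groups\<close>

record ('v, 'e, 'a) gog =
  base :: "('v, 'e) pre_digraph"
  vgrp :: "'v \<Rightarrow> 'a monoid"
  esub :: "'e \<Rightarrow> 'a set"
  emap :: "'e \<Rightarrow> 'a \<Rightarrow> 'a"

definition egrp :: "('v, 'e, 'a) gog \<Rightarrow> 'e \<Rightarrow> 'a monoid" where
  "egrp \<Gamma> e = (vgrp \<Gamma> (tail (base \<Gamma>) e))\<lparr>carrier := esub \<Gamma> e\<rparr>"

definition finite_connected_graph_of_groups :: "('v, 'e, 'a) gog \<Rightarrow> bool" where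
  "finite_connected_graph_of_groups \<Gamma> \<longleftrightarrow>
    fin_digraph (base \<Gamma>) \<and> connected (base \<Gamma>) \<and>
    (\<forall>v\<in>verts (base \<Gamma>). group (vgrp \<Gamma> v)) \<and>
    (\<forall>e\<in>arcs (base \<Gamma>).
      subgroup (esub \<Gamma> e) (vgrp \<Gamma> (tail (base \<Gamma>) e)) \<and>
      subgroup (emap \<Gamma> e ` esub \<Gamma> e) (vgrp \<Gamma> (head (base \<Gamma>) e)) \<and>
      emap \<Gamma> e \<in> iso (egrp \<Gamma> e)
        ((vgrp \<Gamma> (head (base \<Gamma>) e))\<lparr>carrier := emap \<Gamma> e ` esub \<Gamma> e\<rparr>))"

datatype ('v, 'e, 'a) fg_gen = Elt 'v 'a | Stable 'e

definition fg_gens :: "('v, 'e, 'a) gog \<Rightarrow> ('v, 'e, 'a) fg_gen set" where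
  "fg_gens \<Gamma> = {Elt v g | v g. v \<in> verts (base \<Gamma>) \<and> g \<in> carrier (vgrp \<Gamma> v)}
    \<union> Stable ` arcs (base \<Gamma>)"

text \<open>The relations of a vertex group are those of its multiplication table.\<close>

definition fg_rels ::
  "('v, 'e, 'a) gog \<Rightarrow> ('v, 'e) pre_digraph \<Rightarrow> (('v, 'e, 'a) fg_gen word \<times> ('v, 'e, 'a) fg_gen word) set"
where
  "fg_rels \<Gamma> T =
    {([(True, Elt v g), (True, Elt v h)], [(True, Elt v (g \<otimes>\<^bsub>vgrp \<Gamma> v\<^esub> h))]) | v g h.
       v \<in> verts (base \<Gamma>) \<and> g \<in> carrier (vgrp \<Gamma> v) \<and> h \<in> carrier (vgrp \<Gamma> v)}
    \<union> {([(True, Stable e), (True, Elt (tail (base \<Gamma>) e) g), (False, Stable e)],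
        [(True, Elt (head (base \<Gamma>) e) (emap \<Gamma> e g))]) | e g.
       e \<in> arcs (base \<Gamma>) \<and> g \<in> esub \<Gamma> e}
    \<union> {([(True, Stable e)], []) | e. e \<in> arcs (base \<Gamma>) \<inter> arcs T}"

definition fundamental_group ::
  "('v, 'e, 'a) gog \<Rightarrow> ('v, 'e) pre_digraph \<Rightarrow> ('v, 'e, 'a) fg_gen word set monoid" where
  "fundamental_group \<Gamma> T = presented_group (fg_gens \<Gamma>) (fg_rels \<Gamma> T)"


section \<open>Generalized Baumslag--Solitar groups\<close>

definition Zn :: "nat \<Rightarrow> (nat \<Rightarrow> int) monoid" where
  "Zn n = product_group {..<n} (\<lambda>_. integer_group)"

definition GBS_graph_of_groups :: "nat \<Rightarrow> ('v, 'e, 'a) gog \<Rightarrow> bool" where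
  "GBS_graph_of_groups n \<Gamma> \<longleftrightarrow>
    finite_connected_graph_of_groups \<Gamma> \<and>
    (\<forall>v\<in>verts (base \<Gamma>). vgrp \<Gamma> v \<cong> Zn n) \<and>
    (\<forall>e\<in>arcs (base \<Gamma>). egrp \<Gamma> e \<cong> Zn n \<and>
      finite (rcosets\<^bsub>vgrp \<Gamma> (tail (base \<Gamma>) e)\<^esub> (esub \<Gamma> e)) \<and>
      finite (rcosets\<^bsub>vgrp \<Gamma> (head (base \<Gamma>) e)\<^esub> (emap \<Gamma> e ` esub \<Gamma> e)))"


section \<open>Self-similarity, residual finiteness and linearity\<close>

text \<open>
  The vertices of the \<open>m\<close>-ary rooted tree are the words over \<open>{..<m}\<close>, the children of \<open>w\<close> being
  the words \<open>w @ [i]\<close>. Automorphisms are extensional functions, as in \<^const>\<open>BijGroup\<close>.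
\<close>

abbreviation tree_verts :: "nat \<Rightarrow> nat list set" where
  "tree_verts m \<equiv> lists {..<m}"

definition child :: "nat \<Rightarrow> nat list \<Rightarrow> nat list \<Rightarrow> bool" where
  "child m u w \<longleftrightarrow> (\<exists>i<m. w = u @ [i])"

definition tree_automorphisms :: "nat \<Rightarrow> (nat list \<Rightarrow> nat list) set" where
  "tree_automorphisms m = {f \<in> Bij (tree_verts m). f [] = [] \<and>
    (\<forall>u\<in>tree_verts m. \<forall>w\<in>tree_verts m. child m u w \<longleftrightarrow> child m (f u) (f w))}"

text \<open>
  The state \<open>f\<^sub>i\<close> is determined by \<open>f (i # w) = \<sigma> i # f\<^sub>i w\<close>, where \<open>\<sigma>\<close> is the action of
  \<open>f\<close> on the first level.
\<close>

definition state :: "nat \<Rightarrow> (nat list \<Rightarrow> nat list) \<Rightarrow> nat \<Rightarrow> nat list \<Rightarrow> nat list" where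
  "state m f i = (\<lambda>w\<in>tree_verts m. tl (f (i # w)))"

definition self_similar :: "('g, 'b) monoid_scheme \<Rightarrow> bool" where
  "self_similar G \<longleftrightarrow> (\<exists>m\<ge>2. \<exists>\<psi>. faithful_action G (tree_verts m) \<psi> \<and>
    \<psi> ` carrier G \<subseteq> tree_automorphisms m \<and>
    (\<forall>g\<in>carrier G. \<forall>i<m. state m (\<psi> g) i \<in> \<psi> ` carrier G))"

definition residually_finite :: "('g, 'b) monoid_scheme \<Rightarrow> bool" where
  "residually_finite G \<longleftrightarrow> (\<forall>g\<in>carrier G. g \<noteq> \<one>\<^bsub>G\<^esub> \<longrightarrow>
    (\<exists>N. N \<lhd> G \<and> finite (rcosets\<^bsub>G\<^esub> N) \<and> g \<notin> N))"

definition GL_rat :: "nat \<Rightarrow> rat mat monoid" where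
  "GL_rat k = units_of (ring_mat TYPE(rat) k ())"

definition linear_over_rat :: "('g, 'b) monoid_scheme \<Rightarrow> bool" where
  "linear_over_rat G \<longleftrightarrow> (\<exists>k. \<exists>\<rho>\<in>hom G (GL_rat k). inj_on \<rho> (carrier G))"

end

theory Submission
  imports Defs "HOL-Algebra.Multiplicative_Group"
begin

text \<open>
  Self-similar groups and finitely generated linear groups are residually finite. Conversely, let
  \<open>G\<close> be residually finite. The vertex groups are commensurable, and elements of the profinite
  closure of a vertex group \<open>H\<close> commute with everything that commutes with \<open>H\<close>. Either some vertex
  group has no power of its closure inside itself; then any two conjugates of vertex groups lie in a
  third one, so that their union \<open>B\<close> is an abelian normal subgroup with free quotient. Or all vertex
  groups have finite exponent in their closures; then they contain a common normal subgroup \<open>B\<close> of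
  finite index, and a subgroup of finite index of \<open>G\<close> is free modulo \<open>B\<close>.

  \<open>G\<close> acts on \<open>B\<close> through rational affine maps. Together with a linear representation of the free
  quotient this makes \<open>G\<close> linear. A group is self-similar if it has finitely many homomorphisms from
  subgroups of finite index to itself under which only the trivial normal subgroup is invariant. The
  endomorphism raising vertex groups to a power \<open>p\<close> and fixing the stable letters has finite index
  image; its inverse excludes invariant subgroups of \<open>B\<close>, because nothing but \<open>0\<close> in a finitely
  generated subring of \<open>\<rat>\<close> is divisible by all powers of \<open>p\<close>. Invariant subgroups outside \<open>B\<close> are
  excluded by such homomorphisms for free groups, which come from conjugation by diagonal matrices in
  Sanov's representation.
\<close>

text \<open>Two obstacles shape the proof. A nontrivial subgroup of the vertex groups need not be
  normal in \<open>G\<close>, as BS(2,3) shows, and the natural \<open>B\<close> need not be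
  finitely generated, as BS(1,m) shows. Residual finiteness enters only through commutation with
  closures. If no third conjugate contains two given conjugates of vertex groups, there is a bridge
  between their fixed subtrees in the Bass-Serre tree. It is fixed by everything commuting with
  both, in particular by suitable powers of the closure of any vertex group; so that closure has
  finite exponent over the vertex group. When this happens for all vertex groups, their closures
  replace them, because within a suitable normal subgroup of finite index closures agree at both
  ends of an edge. The exponent of the endomorphism has the form \<open>p = 1 + q * k\<close>:
  \<open>q\<close>-th powers of vertex elements lie in \<open>B\<close>, so the endomorphism is the
  identity modulo \<open>B\<close>, while \<open>k\<close> is chosen to make \<open>p\<close> prime
  to the denominators of the affine representation. As \<open>B\<close> may be infinitely generated,
  it is handled through its finite subsets, each of which lies in one conjugate of a vertex
  group.\<close>

context group begin

section \<open>Cosets and subgroups of finite index\<close>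

lemma cancel_inv [simp]:
  "a \<in> carrier G ==> c \<in> carrier G ==> a \<otimes> (inv a \<otimes> c) = c"
  "a \<in> carrier G ==> c \<in> carrier G ==> inv a \<otimes> (a \<otimes> c) = c"
  by (simp_all add: m_assoc[symmetric])

lemmas word_simps = m_assoc inv_mult_group

lemma rcoset_eqI:
  assumes "subgroup H G" "x \<in> carrier G" "y \<in> carrier G" "x \<otimes> inv y \<in> H"
  shows "H #> x = H #> y"
proof -
  have "x = (x \<otimes> inv y) \<otimes> y"
    using assms by (simp add: m_assoc)
  then have "x \<in> H #> y"
    unfolding r_coset_def using assms(4) by blast
  then show ?thesis
    using repr_independence assms by metis
qed

lemma rcoset_eqD:
  assumes "subgroup H G" "x \<in> carrier G" "y \<in> carrier G" "H #> x = H #> y"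
  shows "x \<otimes> inv y \<in> H"
proof -
  have "x \<in> H #> y"
    using rcos_self[OF assms(2,1)] assms(4) by simp
  then obtain h where "h \<in> H" "x = h \<otimes> y"
    unfolding r_coset_def by blast
  moreover have "h \<in> carrier G"
    using assms(1) \<open>h \<in> H\<close> subgroup.mem_carrier by metis
  ultimately show ?thesis
    using assms(3) by (simp add: m_assoc)
qed

text \<open>The values of \<open>f\<close> separate the cosets, so one element chosen for each value
  represents all of them. Every later proof of finite index supplies such an invariant
  \<open>f\<close>.\<close>

lemma finite_rcosetsI:
  assumes "subgroup H G" "finite (f ` carrier G)"
    and eq: "!!x y. x \<in> carrier G ==> y \<in> carrier G ==> f x = f y ==> x \<otimes> inv y \<in> H"
  shows "finite (rcosets H)"
proof -
  define c where "c a = (SOME x. x \<in> carrier G \<and> f x = a)" for a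
  have "H #> x = H #> c (f x)" if x: "x \<in> carrier G" for x
  proof -
    have "c (f x) \<in> carrier G \<and> f (c (f x)) = f x"
      unfolding c_def by (rule someI[of _ x]) (simp add: x)
    then show ?thesis
      using rcoset_eqI[OF assms(1) x, of "c (f x)"] eq[OF x, of "c (f x)"] by simp
  qed
  then have "rcosets H \<subseteq> (\<lambda>a. H #> c a) ` (f ` carrier G)"
    unfolding RCOSETS_def by blast
  then show ?thesis
    using assms(2) finite_surj by metis
qed

text \<open>Inversion exchanges left and right cosets. \<open>rcosets\<close> counts right ones,
  while actions on cosets lead to left ones.\<close>

lemma finite_rcosetsI_left:
  assumes "subgroup H G" "finite (f ` carrier G)"
    and eq: "!!x y. x \<in> carrier G ==> y \<in> carrier G ==> f x = f y ==> inv x \<otimes> y \<in> H"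
  shows "finite (rcosets H)"
proof (rule finite_rcosetsI[OF assms(1), of "\<lambda>x. f (inv x)"])
  show "finite ((\<lambda>x. f (inv x)) ` carrier G)"
    by (rule finite_subset[OF _ assms(2)]) auto
  show "x \<otimes> inv y \<in> H" if "x \<in> carrier G" "y \<in> carrier G" "f (inv x) = f (inv y)" for x y
    using eq[of "inv x" "inv y"] that by simp
qed

text \<open>Representatives of the left cosets \<open>x H\<close>, obtained as inverses of
  representatives of the right cosets of the inverse elements.\<close>

lemma finite_rcosets_rep:
  assumes H: "subgroup H G" and fin: "finite (rcosets H)"
  obtains rep where "finite (rep ` carrier G)"
    "!!x. x \<in> carrier G ==> rep x \<in> carrier G"
    "!!x. x \<in> carrier G ==> inv (rep x) \<otimes> x \<in> H"
    "!!x y. x \<in> carrier G ==> y \<in> carrier G ==> inv x \<otimes> y \<in> H ==> rep x = rep y"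
proof
  define c where "c Y = (SOME z. z \<in> Y)" for Y :: "'a set"
  define rep where "rep x = inv (c (H #> inv x))" for x
  have c: "c (H #> inv x) \<in> H #> inv x" if "x \<in> carrier G" for x
    unfolding c_def using rcos_self[OF _ H, of "inv x"] that by (metis inv_closed someI)
  have "rep ` carrier G \<subseteq> (\<lambda>Y. inv (c Y)) ` (rcosets H)"
    unfolding rep_def using rcosetsI[OF subgroup.subset[OF H]] by auto
  then show "finite (rep ` carrier G)"
    using fin finite_surj by metis
  show rep: "rep x \<in> carrier G" if "x \<in> carrier G" for x
    using c[OF that] r_coset_subset_G[OF subgroup.subset[OF H], of "inv x"] that
    unfolding rep_def by blast
  show "inv (rep x) \<otimes> x \<in> H" if x: "x \<in> carrier G" for x
  proof -
    obtain h where h: "h \<in> H" "c (H #> inv x) = h \<otimes> inv x"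
      using c[OF x] unfolding r_coset_def by blast
    moreover have "h \<in> carrier G"
      using H h subgroup.mem_carrier by metis
    ultimately show ?thesis
      using x by (simp add: rep_def m_assoc)
  qed
  show "rep x = rep y" if "x \<in> carrier G" "y \<in> carrier G" "inv x \<otimes> y \<in> H" for x y
    using rcoset_eqI[OF H, of "inv x" "inv y"] that by (simp add: rep_def)
qed

lemma finite_rcosets_Int:
  assumes H: "subgroup H G" "finite (rcosets H)" and K: "subgroup K G" "finite (rcosets K)"
  shows "finite (rcosets (H \<inter> K))"
proof (rule finite_rcosetsI)
  show "subgroup (H \<inter> K) G"
    using H K subgroups_Inter_pair by blast
  have "(\<lambda>x. (H #> x, K #> x)) ` carrier G \<subseteq> (rcosets H) \<times> (rcosets K)"
    unfolding RCOSETS_def by auto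
  then show "finite ((\<lambda>x. (H #> x, K #> x)) ` carrier G)"
    using H K by (meson finite_SigmaI finite_subset)
qed (use H K rcoset_eqD in auto)

text \<open>The order of the quotient group is such an exponent, by Lagrange's theorem.\<close>

lemma normal_pow_mem:
  assumes N: "N \<lhd> G" and fin: "finite (rcosets N)"
  obtains m :: nat where "m \<ge> 1" "!!x. x \<in> carrier G ==> x [^] m \<in> N"
proof
  interpret normal N G by fact
  let ?m = "order (G Mod N)"
  interpret Q: group "G Mod N"
    by (rule factorgroup_is_group)
  have car: "carrier (G Mod N) = rcosets N"
    by (simp add: FactGroup_def)
  show "?m \<ge> 1"
    using fin Q.order_gt_0_iff_finite car by (simp add: Suc_leI)
  fix x assume x: "x \<in> carrier G"
  have pow: "(N #> x) [^]\<^bsub>G Mod N\<^esub> k = N #> (x [^] k)" for k :: nat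
    using x subset by (induction k) (simp_all add: rcos_sum)
  have "N #> (x [^] ?m) = N"
    using Q.pow_order_eq_1[of "N #> x"] pow[of ?m] x by (simp add: car FactGroup_def rcosetsI subset)
  then show "x [^] ?m \<in> N"
    using rcos_self[OF nat_pow_closed[OF x] subgroup_axioms, of ?m] by simp
qed

end


section \<open>Virtual homomorphisms and self-similarity\<close>

definition virtual_hom ::
  "('g, 'b) monoid_scheme => ('h, 'c) monoid_scheme => 'g set => ('g => 'h) => bool" where
  "virtual_hom G Q L \<phi> \<longleftrightarrow> subgroup L G \<and> finite (rcosets\<^bsub>G\<^esub> L) \<and> \<phi> \<in> hom (G\<lparr>carrier := L\<rparr>) Q"

text \<open>The known criterion for the faithfulness of the tree action that a family of virtual
  endomorphisms generates: the kernel of that action is the largest subgroup \<open>K\<close> of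
  this kind.\<close>

definition trivial_core :: "('g, 'b) monoid_scheme => ('g set \<times> ('g => 'g)) set => bool" where
  "trivial_core G F \<longleftrightarrow>
    (\<forall>K. K \<lhd> G \<longrightarrow> (\<forall>(L, \<phi>) \<in> F. K \<subseteq> L \<and> \<phi> ` K \<subseteq> K) \<longrightarrow> K = {\<one>\<^bsub>G\<^esub>})"

text \<open>The wreath recursion induced by a virtual homomorphism, on the cosets of its domain.\<close>

lemma (in group) virtual_hom_recursion:
  assumes "virtual_hom G Q L \<phi>" "group Q"
  obtains X :: "'a set" and \<sigma> \<tau> where
    "finite X" "\<one> \<in> X"
    "!!g x. g \<in> carrier G ==> x \<in> X ==> \<sigma> g x \<in> X"
    "!!g x. g \<in> carrier G ==> x \<in> X ==> \<tau> g x \<in> carrier Q"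
    "!!x. x \<in> X ==> \<sigma> \<one> x = x"
    "!!g h x. g \<in> carrier G ==> h \<in> carrier G ==> x \<in> X ==> \<sigma> (g \<otimes> h) x = \<sigma> g (\<sigma> h x)"
    "!!g h x. g \<in> carrier G ==> h \<in> carrier G ==> x \<in> X ==>
      \<tau> (g \<otimes> h) x = \<tau> g (\<sigma> h x) \<otimes>\<^bsub>Q\<^esub> \<tau> h x"
    "!!g. g \<in> carrier G ==> \<sigma> g \<one> = \<one> ==> g \<in> L"
    "!!g. g \<in> carrier G ==> \<sigma> g \<one> = \<one> ==> \<tau> g \<one> = \<phi> g"
proof -
  have L: "subgroup L G" "finite (rcosets L)" and \<phi>: "\<phi> \<in> hom (G\<lparr>carrier := L\<rparr>) Q"
    using assms(1) by (auto simp: virtual_hom_def)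
  obtain rep0 where rep0: "finite (rep0 ` carrier G)"
    "!!x. x \<in> carrier G ==> rep0 x \<in> carrier G"
    "!!x. x \<in> carrier G ==> inv (rep0 x) \<otimes> x \<in> L"
    "!!x y. x \<in> carrier G ==> y \<in> carrier G ==> inv x \<otimes> y \<in> L ==> rep0 x = rep0 y"
    using finite_rcosets_rep[OF L] by metis
  have Linv: "inv a \<otimes> b \<in> L" if "inv b \<otimes> a \<in> L" "a \<in> carrier G" "b \<in> carrier G" for a b
    using subgroup.m_inv_closed[OF L(1) that(1)] that by (simp add: inv_mult_group)
  have LT: "inv a \<otimes> c \<in> L" if "inv a \<otimes> b \<in> L" "inv b \<otimes> c \<in> L"
    "a \<in> carrier G" "b \<in> carrier G" "c \<in> carrier G" for a b c
  proof -
    have "inv a \<otimes> c = (inv a \<otimes> b) \<otimes> (inv b \<otimes> c)"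
      using that(3-5) by (simp add: m_assoc)
    then show ?thesis
      using subgroup.m_closed[OF L(1) that(1,2)] by simp
  qed
  \<comment> \<open>The coset \<open>L\<close> itself is represented by \<open>\<one>\<close>, so
    that its stabiliser is \<open>L\<close> and the cocycle there is \<open>\<phi>\<close> without
    any conjugation.\<close>
  define rep where "rep x = (if x \<in> L then \<one> else rep0 x)" for x
  have Lc: "L \<subseteq> carrier G"
    using L(1) by (rule subgroup.subset)
  have rep1: "rep x \<in> carrier G" if "x \<in> carrier G" for x
    using rep0(2)[OF that] by (simp add: rep_def)
  have rep2: "inv (rep x) \<otimes> x \<in> L" if "x \<in> carrier G" for x
    using rep0(3)[OF that] that by (simp add: rep_def)
  have repfin: "finite (rep ` carrier G)"
    by (rule finite_subset[of _ "insert \<one> (rep0 ` carrier G)"]) (auto simp: rep_def rep0(1))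
  have rep3: "rep x = rep y" if xy: "x \<in> carrier G" "y \<in> carrier G" "inv x \<otimes> y \<in> L" for x y
  proof -
    have "y \<in> L" if "x \<in> L"
      using subgroup.m_closed[OF L(1) that xy(3)] xy by (simp add: inv_solve_left m_assoc[symmetric])
    moreover have "x \<in> L" if "y \<in> L"
      using LT[of "\<one>" y x] Linv[OF xy(3) xy(2,1)] xy(1,2) that by simp
    ultimately show ?thesis
      using rep0(4)[OF xy] by (auto simp: rep_def)
  qed
  define X where "X = rep ` carrier G"
  define \<sigma> where "\<sigma> g x = rep (g \<otimes> x)" for g x
  \<comment> \<open>The Schreier cocycle: \<open>g \<otimes> x\<close> and its representative differ
    by an element of \<open>L\<close>, to which \<open>\<phi>\<close> applies.\<close>
  define \<tau> where "\<tau> g x = \<phi> (inv (rep (g \<otimes> x)) \<otimes> (g \<otimes> x))" for g x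
  have Xc: "X \<subseteq> carrier G"
    using rep1 by (auto simp: X_def)
  have \<sigma>2: "rep (g \<otimes> h \<otimes> x) = rep (g \<otimes> rep (h \<otimes> x))"
    if "g \<in> carrier G" "h \<in> carrier G" "x \<in> carrier G" for g h x
  proof (rule rep3[symmetric])
    have "inv (g \<otimes> rep (h \<otimes> x)) \<otimes> (g \<otimes> h \<otimes> x) = inv (rep (h \<otimes> x)) \<otimes> (h \<otimes> x)"
      using that rep1[of "h \<otimes> x"] by (simp add: word_simps)
    then show "inv (g \<otimes> rep (h \<otimes> x)) \<otimes> (g \<otimes> h \<otimes> x) \<in> L"
      using rep2[of "h \<otimes> x"] that by simp
  qed (use that rep1 in auto)
  have rep_one: "rep \<one> = \<one>"
    using subgroup.one_closed[OF L(1)] by (simp add: rep_def)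
  show ?thesis
  proof (rule that[of X \<sigma> \<tau>])
    show "finite X" by (simp add: X_def repfin)
    show "\<one> \<in> X" using rep_one X_def by force
    show "\<sigma> g x \<in> X" if "g \<in> carrier G" "x \<in> X" for g x
      using that Xc by (auto simp: \<sigma>_def X_def)
    show "\<tau> g x \<in> carrier Q" if "g \<in> carrier G" "x \<in> X" for g x
    proof -
      have "inv (rep (g \<otimes> x)) \<otimes> (g \<otimes> x) \<in> L"
        using rep2[of "g \<otimes> x"] that Xc by auto
      then show ?thesis
        using \<phi> by (auto simp: \<tau>_def hom_def)
    qed
    show "\<sigma> \<one> x = x" if x: "x \<in> X" for x
    proof -
      obtain y where y: "y \<in> carrier G" "x = rep y"
        using x by (auto simp: X_def)
      then show ?thesis
        using rep3[OF rep1 _ rep2] rep1 by (simp add: \<sigma>_def)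
    qed
    show "\<sigma> (g \<otimes> h) x = \<sigma> g (\<sigma> h x)" if "g \<in> carrier G" "h \<in> carrier G" "x \<in> X" for g h x
      using \<sigma>2[of g h x] that Xc by (auto simp: \<sigma>_def)
    show "\<tau> (g \<otimes> h) x = \<tau> g (\<sigma> h x) \<otimes>\<^bsub>Q\<^esub> \<tau> h x"
      if gh: "g \<in> carrier G" "h \<in> carrier G" and xX: "x \<in> X" for g h x
    proof -
      have x: "x \<in> carrier G" using xX Xc by blast
      let ?y = "rep (h \<otimes> x)"
      let ?z = "rep (g \<otimes> h \<otimes> x)"
      have yz: "?y \<in> carrier G" "?z \<in> carrier G"
        using rep1 gh x by auto
      have a: "inv ?z \<otimes> (g \<otimes> ?y) \<in> L" "inv ?y \<otimes> (h \<otimes> x) \<in> L"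
        using rep2[of "g \<otimes> ?y"] rep2[of "h \<otimes> x"] \<sigma>2[OF gh x] gh x yz by auto
      have "inv ?z \<otimes> (g \<otimes> h \<otimes> x) = (inv ?z \<otimes> (g \<otimes> ?y)) \<otimes> (inv ?y \<otimes> (h \<otimes> x))"
        using gh x yz by (simp add: m_assoc)
      then show ?thesis
        using \<phi> a \<sigma>2[OF gh x] by (simp add: \<tau>_def \<sigma>_def hom_def)
    qed
    show "g \<in> L" if "g \<in> carrier G" "\<sigma> g \<one> = \<one>" for g
      using rep2[of g] that by (simp add: \<sigma>_def)
    show "\<tau> g \<one> = \<phi> g" if "g \<in> carrier G" "\<sigma> g \<one> = \<one>" for g
      using that by (simp add: \<tau>_def \<sigma>_def)
  qed
qed


lemma (in group) virtual_hom_comp: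
  assumes M: "virtual_hom G Q M h" and L: "virtual_hom Q R L \<phi>" and Q: "group Q"
  shows "virtual_hom G R {x \<in> M. h x \<in> L} (\<phi> \<circ> h)"
proof -
  interpret Q: group Q by fact
  have M: "subgroup M G" "finite (rcosets M)" "h \<in> hom (G\<lparr>carrier := M\<rparr>) Q"
    and L: "subgroup L Q" "finite (rcosets\<^bsub>Q\<^esub> L)" "\<phi> \<in> hom (Q\<lparr>carrier := L\<rparr>) R"
    using M L by (auto simp: virtual_hom_def)
  interpret h: group_hom "G\<lparr>carrier := M\<rparr>" Q h
    using M Q subgroup_imp_group by (simp add: group_hom_def group_hom_axioms_def)
  have Mc: "x \<in> carrier G" if "x \<in> M" for x
    using subgroup.mem_carrier[OF M(1) that] .
  have hM: "h x \<in> carrier Q" if "x \<in> M" for x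
    using h.hom_closed that by simp
  have hmult: "h (x \<otimes> y) = h x \<otimes>\<^bsub>Q\<^esub> h y" if "x \<in> M" "y \<in> M" for x y
    using h.hom_mult that by simp
  have hinv: "h (inv x) = inv\<^bsub>Q\<^esub> (h x)" if "x \<in> M" for x
    using h.hom_inv[of x] m_inv_consistent[OF M(1) that] that by simp
  have sub: "subgroup {x \<in> M. h x \<in> L} G"
  proof (rule subgroupI)
    have "h \<one> = \<one>\<^bsub>Q\<^esub>" using h.hom_one by simp
    then show "{x \<in> M. h x \<in> L} \<noteq> {}"
      using subgroup.one_closed[OF M(1)] subgroup.one_closed[OF L(1)] by force
  qed (use M(1) L(1) Mc hmult hinv in \<open>auto simp: subgroup.m_closed subgroup.m_inv_closed\<close>)
  obtain rep where rep: "finite (rep ` carrier G)"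
    "!!x. x \<in> carrier G ==> rep x \<in> carrier G"
    "!!x. x \<in> carrier G ==> inv (rep x) \<otimes> x \<in> M"
    using finite_rcosets_rep[OF M(1,2)] by metis
  \<comment> \<open>A left coset of the new domain is determined by the left coset of
    \<open>M\<close> containing it and, within that, by the coset of the image under
    \<open>h\<close>. The inner coset is inverted because \<open>rcosets\<close> are right
    cosets.\<close>
  define f where "f x = (rep x, L #>\<^bsub>Q\<^esub> inv\<^bsub>Q\<^esub> (h (inv (rep x) \<otimes> x)))" for x
  have "finite (rcosets {x \<in> M. h x \<in> L})"
  proof (rule finite_rcosetsI_left[OF sub, of f])
    have "f ` carrier G \<subseteq> rep ` carrier G \<times> rcosets\<^bsub>Q\<^esub> L"
      using rep hM Q.rcosetsI[OF subgroup.subset[OF L(1)]] by (auto simp: f_def)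
    then show "finite (f ` carrier G)"
      using rep(1) L(2) by (meson finite_SigmaI finite_subset)
    fix x y assume xy: "x \<in> carrier G" "y \<in> carrier G" "f x = f y"
    let ?a = "inv (rep x) \<otimes> x" and ?b = "inv (rep x) \<otimes> y"
    have r: "rep y = rep x" using xy(3) by (simp add: f_def)
    have ab: "?a \<in> M" "?b \<in> M" using rep(3)[OF xy(1)] rep(3)[OF xy(2)] r by auto
    have "L #>\<^bsub>Q\<^esub> inv\<^bsub>Q\<^esub> (h ?a) = L #>\<^bsub>Q\<^esub> inv\<^bsub>Q\<^esub> (h ?b)"
      using xy(3) r by (simp add: f_def)
    then have "inv\<^bsub>Q\<^esub> (h ?a) \<otimes>\<^bsub>Q\<^esub> h ?b \<in> L"
      using Q.rcoset_eqD[OF L(1), of "inv\<^bsub>Q\<^esub> (h ?a)" "inv\<^bsub>Q\<^esub> (h ?b)"] hM[OF ab(1)] hM[OF ab(2)]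
      by simp
    moreover have "inv ?a \<otimes> ?b = inv x \<otimes> y"
      using xy rep(2)[OF xy(1)] by (simp add: word_simps)
    ultimately show "inv x \<otimes> y \<in> {x \<in> M. h x \<in> L}"
      using ab hmult[of "inv ?a" ?b] hinv[of ?a] subgroup.m_inv_closed[OF M(1) ab(1)]
        subgroup.m_closed[OF M(1), of "inv ?a" ?b] by simp
  qed
  moreover have "\<phi> \<circ> h \<in> hom (G\<lparr>carrier := {x \<in> M. h x \<in> L}\<rparr>) R"
    using L(3) hmult by (auto simp: hom_def)
  ultimately show ?thesis
    using sub by (simp add: virtual_hom_def)
qed

lemma (in group) virtual_hom_of_hom:
  assumes "h \<in> hom G Q" shows "virtual_hom G Q (carrier G) h"
proof -
  have "rcosets (carrier G) = {carrier G}"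
    by (auto simp: RCOSETS_def coset_join2 subgroup_self)
  then show ?thesis
    using assms by (simp add: virtual_hom_def subgroup_self)
qed

section \<open>Actions on rooted trees defined by wreath recursions\<close>

primrec wreath_act :: "('g => nat => nat) => ('g => nat => 'g) => nat list => 'g => nat list" where
  "wreath_act \<sigma> \<tau> [] g = []"
| "wreath_act \<sigma> \<tau> (i # w) g = \<sigma> g i # wreath_act \<sigma> \<tau> w (\<tau> g i)"

locale wreath_recursion = group G for G (structure) +
  fixes m :: nat and \<sigma> :: "'a => nat => nat" and \<tau> :: "'a => nat => 'a"
  assumes m: "m \<ge> 2"
    and \<sigma>_less: "!!g i. g \<in> carrier G ==> i < m ==> \<sigma> g i < m"
    and \<tau>_closed: "!!g i. g \<in> carrier G ==> i < m ==> \<tau> g i \<in> carrier G"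
    and \<sigma>_one: "!!i. i < m ==> \<sigma> \<one> i = i"
    and \<sigma>_mult: "!!g h i. g \<in> carrier G ==> h \<in> carrier G ==> i < m ==>
      \<sigma> (g \<otimes> h) i = \<sigma> g (\<sigma> h i)"
    and \<tau>_mult: "!!g h i. g \<in> carrier G ==> h \<in> carrier G ==> i < m ==>
      \<tau> (g \<otimes> h) i = \<tau> g (\<sigma> h i) \<otimes> \<tau> h i"
    and core: "!!K. K \<lhd> G ==>
      (!!k i. k \<in> K ==> i < m ==> \<sigma> k i = i \<and> \<tau> k i \<in> K) ==> K = {\<one>}"
begin

abbreviation act :: "nat list => 'a => nat list" where
  "act \<equiv> wreath_act \<sigma> \<tau>"

definition \<psi> :: "'a => nat list => nat list" where
  "\<psi> g = (\<lambda>w\<in>tree_verts m. act w g)"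

lemma \<tau>_one: "i < m ==> \<tau> \<one> i = \<one>"
  using \<tau>_mult[of \<one> \<one> i] \<tau>_closed[of \<one> i] \<sigma>_one[of i] by simp

lemma act_closed: "w \<in> tree_verts m ==> g \<in> carrier G ==> act w g \<in> tree_verts m"
  by (induction w arbitrary: g) (auto simp: \<sigma>_less \<tau>_closed)

lemma act_one: "w \<in> tree_verts m ==> act w \<one> = w"
  by (induction w) (auto simp: \<sigma>_one \<tau>_one)

lemma act_mult:
  "w \<in> tree_verts m ==> g \<in> carrier G ==> h \<in> carrier G ==> act w (g \<otimes> h) = act (act w h) g"
  by (induction w arbitrary: g h) (auto simp: \<sigma>_mult \<tau>_mult \<sigma>_less \<tau>_closed)

lemma act_snoc:
  "u \<in> tree_verts m ==> i < m ==> g \<in> carrier G ==> \<exists>j<m. act (u @ [i]) g = act u g @ [j]"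
  by (induction u arbitrary: g) (auto simp: \<sigma>_less \<tau>_closed)

lemma act_inv:
  assumes "w \<in> tree_verts m" "g \<in> carrier G"
  shows "act (act w g) (inv g) = w" "act (act w (inv g)) g = w"
  using act_mult[OF assms(1), of "inv g" g] act_mult[OF assms(1), of g "inv g"] assms act_one
  by auto

lemma \<psi>_Bij:
  assumes "g \<in> carrier G" shows "\<psi> g \<in> Bij (tree_verts m)"
proof -
  have "bij_betw (\<psi> g) (tree_verts m) (tree_verts m)"
    by (rule bij_betw_byWitness[where f' = "\<psi> (inv g)"])
      (use assms in \<open>simp_all add: \<psi>_def act_inv act_closed image_subset_iff del: in_lists_conv_set\<close>)
  then show ?thesis
    by (simp add: Bij_def \<psi>_def)
qed

lemma child_act:
  assumes "child m u w" "u \<in> tree_verts m" "g \<in> carrier G"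
  shows "child m (act u g) (act w g)"
  using assms act_snoc unfolding child_def by blast

lemma \<psi>_automorphism:
  assumes g: "g \<in> carrier G" shows "\<psi> g \<in> tree_automorphisms m"
proof -
  have "child m u w \<longleftrightarrow> child m (act u g) (act w g)"
    if "u \<in> tree_verts m" "w \<in> tree_verts m" for u w
    using child_act[OF _ that(1) g] child_act[of "act u g" "act w g" "inv g"] that g
    by (auto simp: act_inv act_closed simp del: in_lists_conv_set)
  then show ?thesis
    using \<psi>_Bij[OF g] by (simp add: tree_automorphisms_def \<psi>_def)
qed

lemma \<psi>_hom: "\<psi> \<in> hom G (BijGroup (tree_verts m))"
proof (rule homI)
  fix g h assume gh: "g \<in> carrier G" "h \<in> carrier G"
  have "\<psi> (g \<otimes> h) = compose (tree_verts m) (\<psi> g) (\<psi> h)"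
    using gh by (auto simp: \<psi>_def compose_def act_mult act_closed simp del: in_lists_conv_set)
  then show "\<psi> (g \<otimes> h) = \<psi> g \<otimes>\<^bsub>BijGroup (tree_verts m)\<^esub> \<psi> h"
    using gh by (simp add: BijGroup_def \<psi>_Bij)
qed (simp add: BijGroup_def \<psi>_Bij)

lemma state_\<psi>:
  assumes "g \<in> carrier G" "i < m" shows "state m (\<psi> g) i = \<psi> (\<tau> g i)"
  using assms by (auto simp: state_def \<psi>_def)

text \<open>The kernel of the action fixes the first level and contains the states of its elements,
  so the assumption \<open>core\<close> makes it trivial.\<close>

lemma self_similar: "self_similar G"
proof -
  interpret \<psi>: group_hom G "BijGroup (tree_verts m)" \<psi>
    using \<psi>_hom group_BijGroup group_axioms
    by (simp add: group_hom_def group_hom_axioms_def)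
  let ?K = "kernel G (BijGroup (tree_verts m)) \<psi>"
  have K: "k \<in> ?K \<longleftrightarrow> k \<in> carrier G \<and> (\<forall>w\<in>tree_verts m. act w k = w)" for k
    unfolding kernel_def by (auto simp: BijGroup_def \<psi>_def fun_eq_iff restrict_def)
  have "?K = {\<one>}"
  proof (rule core)
    show "?K \<lhd> G" by (rule \<psi>.normal_kernel)
    fix k i assume k: "k \<in> ?K" and i: "i < m"
    have "act (i # w) k = i # w" if "w \<in> tree_verts m" for w
      using k i that unfolding K by (metis Cons_in_lists_iff lessThan_iff)
    then have "\<sigma> k i = i" "!!w. w \<in> tree_verts m ==> act w (\<tau> k i) = w"
      using lists.Nil by auto
    then show "\<sigma> k i = i \<and> \<tau> k i \<in> ?K"
      using k i \<tau>_closed unfolding K by blast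
  qed
  then have "inj_on \<psi> (carrier G)"
    using \<psi>.inj_iff_trivial_ker by simp
  then have "faithful_action G (tree_verts m) \<psi>"
    using \<psi>.group_hom_axioms
    by (simp add: faithful_action_def faithful_action_axioms_def group_action_def)
  then show ?thesis
    unfolding self_similar_def
    using m \<psi>_automorphism state_\<psi> \<tau>_closed
    by (intro exI[of _ m] conjI exI[of _ \<psi>]) auto
qed

end

text \<open>Transport along a bijection: the tree has the alphabet \<open>{..<m}\<close>, whereas
  the recursions arise on sets of cosets.\<close>

lemma (in group) self_similarI:
  fixes X :: "'x set"
  assumes X: "finite X" "card X \<ge> 2"
    and \<sigma>: "!!g x. g \<in> carrier G ==> x \<in> X ==> \<sigma> g x \<in> X"
    and \<tau>: "!!g x. g \<in> carrier G ==> x \<in> X ==> \<tau> g x \<in> carrier G"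
    and \<sigma>_one: "!!x. x \<in> X ==> \<sigma> \<one> x = x"
    and \<sigma>_mult: "!!g h x. g \<in> carrier G ==> h \<in> carrier G ==> x \<in> X ==>
      \<sigma> (g \<otimes> h) x = \<sigma> g (\<sigma> h x)"
    and \<tau>_mult: "!!g h x. g \<in> carrier G ==> h \<in> carrier G ==> x \<in> X ==>
      \<tau> (g \<otimes> h) x = \<tau> g (\<sigma> h x) \<otimes> \<tau> h x"
    and core: "!!K. K \<lhd> G ==>
      (!!k x. k \<in> K ==> x \<in> X ==> \<sigma> k x = x \<and> \<tau> k x \<in> K) ==> K = {\<one>}"
  shows "self_similar G"
proof -
  obtain b where b: "bij_betw b X {..<card X}"
    using ex_bij_betw_finite_nat[OF X(1)] by (auto simp: atLeast0LessThan)
  define c where "c = inv_into X b"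
  have bc: "b (c i) = i" "c i \<in> X" if "i < card X" for i
    using b that by (auto simp: c_def bij_betw_def f_inv_into_f inv_into_into)
  have cb: "c (b x) = x" "b x < card X" if "x \<in> X" for x
    using b that by (auto simp: c_def bij_betw_def)
  have "wreath_recursion G (card X) (\<lambda>g i. b (\<sigma> g (c i))) (\<lambda>g i. \<tau> g (c i))"
  proof (rule wreath_recursion.intro[OF group_axioms], rule wreath_recursion_axioms.intro)
    fix K assume K: "K \<lhd> G"
      and *: "!!k i. k \<in> K ==> i < card X ==> b (\<sigma> k (c i)) = i \<and> \<tau> k (c i) \<in> K"
    show "K = {\<one>}"
    proof (rule core[OF K])
      fix k x assume kx: "k \<in> K" "x \<in> X"
      then have "k \<in> carrier G"
        using subgroup.mem_carrier[OF normal_imp_subgroup[OF K]] by simp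
      then have "\<sigma> k x \<in> X"
        using \<sigma> kx(2) by blast
      then have "\<sigma> k x = c (b (\<sigma> k x))"
        using cb(1) by simp
      moreover have "b (\<sigma> k x) = b x" "\<tau> k x \<in> K"
        using *[OF kx(1) cb(2)[OF kx(2)]] unfolding cb(1)[OF kx(2)] by auto
      ultimately show "\<sigma> k x = x \<and> \<tau> k x \<in> K"
        using cb(1)[OF kx(2)] by simp
    qed
  qed (simp_all add: X(2) \<sigma> \<tau> \<sigma>_one \<sigma>_mult \<tau>_mult bc cb)
  then show ?thesis
    by (rule wreath_recursion.self_similar)
qed

text \<open>Several virtual endomorphisms act on the disjoint union of the coset spaces of their domains,
  so the action need not be transitive on the first level.\<close>

lemma (in group) self_similar_of_virtual_homs:
  fixes F :: "('a set \<times> ('a => 'a)) set"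
  assumes F: "finite F" "card F \<ge> 2" "!!L \<phi>. (L, \<phi>) \<in> F ==> virtual_hom G G L \<phi>"
    and core: "trivial_core G F"
  shows "self_similar G"
proof -
  let ?P = "\<lambda>f X \<sigma> \<tau>. finite X \<and> \<one> \<in> X \<and>
    (\<forall>g\<in>carrier G. \<forall>x\<in>X. \<sigma> g x \<in> X) \<and> (\<forall>g\<in>carrier G. \<forall>x\<in>X. \<tau> g x \<in> carrier G) \<and>
    (\<forall>x\<in>X. \<sigma> \<one> x = x) \<and>
    (\<forall>g\<in>carrier G. \<forall>h\<in>carrier G. \<forall>x\<in>X. \<sigma> (g \<otimes> h) x = \<sigma> g (\<sigma> h x)) \<and>
    (\<forall>g\<in>carrier G. \<forall>h\<in>carrier G. \<forall>x\<in>X. \<tau> (g \<otimes> h) x = \<tau> g (\<sigma> h x) \<otimes> \<tau> h x) \<and>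
    (\<forall>g\<in>carrier G. \<sigma> g \<one> = \<one> \<longrightarrow> g \<in> fst f \<and> \<tau> g \<one> = snd f g)"
  have "\<exists>D. \<forall>f\<in>F. ?P f (fst (D f)) (fst (snd (D f))) (snd (snd (D f)))"
  proof (rule bchoice, rule ballI)
    fix f assume "f \<in> F"
    then have "virtual_hom G G (fst f) (snd f)"
      using F(3) by simp
    from virtual_hom_recursion[OF this group_axioms]
    obtain X \<sigma> \<tau> where "finite X" "\<one> \<in> X"
      "!!g x. g \<in> carrier G ==> x \<in> X ==> \<sigma> g x \<in> X"
      "!!g x. g \<in> carrier G ==> x \<in> X ==> \<tau> g x \<in> carrier G"
      "!!x. x \<in> X ==> \<sigma> \<one> x = x"
      "!!g h x. g \<in> carrier G ==> h \<in> carrier G ==> x \<in> X ==> \<sigma> (g \<otimes> h) x = \<sigma> g (\<sigma> h x)"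
      "!!g h x. g \<in> carrier G ==> h \<in> carrier G ==> x \<in> X ==>
        \<tau> (g \<otimes> h) x = \<tau> g (\<sigma> h x) \<otimes> \<tau> h x"
      "!!g. g \<in> carrier G ==> \<sigma> g \<one> = \<one> ==> g \<in> fst f"
      "!!g. g \<in> carrier G ==> \<sigma> g \<one> = \<one> ==> \<tau> g \<one> = snd f g"
      by blast
    then show "\<exists>d. ?P f (fst d) (fst (snd d)) (snd (snd d))"
      by (intro exI[of _ "(X, \<sigma>, \<tau>)"]) simp
  qed
  then obtain D where D: "\<forall>f\<in>F. ?P f (fst (D f)) (fst (snd (D f))) (snd (snd (D f)))"
    by blast
  define X \<sigma> \<tau> where "X f = fst (D f)" and "\<sigma> f = fst (snd (D f))"
    and "\<tau> f = snd (snd (D f))" for f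
  have *: "\<forall>f\<in>F. finite (X f) \<and> \<one> \<in> X f \<and>
    (\<forall>g\<in>carrier G. \<forall>x\<in>X f. \<sigma> f g x \<in> X f) \<and> (\<forall>g\<in>carrier G. \<forall>x\<in>X f. \<tau> f g x \<in> carrier G) \<and>
    (\<forall>x\<in>X f. \<sigma> f \<one> x = x) \<and>
    (\<forall>g\<in>carrier G. \<forall>h\<in>carrier G. \<forall>x\<in>X f. \<sigma> f (g \<otimes> h) x = \<sigma> f g (\<sigma> f h x)) \<and>
    (\<forall>g\<in>carrier G. \<forall>h\<in>carrier G. \<forall>x\<in>X f. \<tau> f (g \<otimes> h) x = \<tau> f g (\<sigma> f h x) \<otimes> \<tau> f h x) \<and>
    (\<forall>g\<in>carrier G. \<sigma> f g \<one> = \<one> \<longrightarrow> g \<in> fst f \<and> \<tau> f g \<one> = snd f g)"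
    using D unfolding X_def \<sigma>_def \<tau>_def .
  show ?thesis
  proof (rule self_similarI[of "Sigma F X" "\<lambda>g p. (fst p, \<sigma> (fst p) g (snd p))"
        "\<lambda>g p. \<tau> (fst p) g (snd p)"])
    show fin: "finite (Sigma F X)"
      using * F(1) by blast
    \<comment> \<open>Every member of \<open>F\<close> contributes at least the letter of its
      trivial coset.\<close>
    have "inj_on (\<lambda>f. (f, \<one>)) F" "(\<lambda>f. (f, \<one>)) ` F \<subseteq> Sigma F X"
      using * by (simp_all add: inj_on_def image_subset_iff)
    then show "card (Sigma F X) \<ge> 2"
      using F(2) fin card_mono card_image by (metis le_trans)
    fix K assume K: "K \<lhd> G" and inv: "!!k x. k \<in> K ==> x \<in> Sigma F X ==>
      (fst x, \<sigma> (fst x) k (snd x)) = x \<and> \<tau> (fst x) k (snd x) \<in> K"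
    \<comment> \<open>At the letter \<open>(f, \<one>)\<close> the recursion returns the domain and
      the map of \<open>f\<close> themselves.\<close>
    have "fst f \<supseteq> K \<and> snd f ` K \<subseteq> K" if f: "f \<in> F" for f
    proof -
      have "k \<in> fst f \<and> snd f k \<in> K" if k: "k \<in> K" for k
      proof -
        have "k \<in> carrier G"
          using subgroup.mem_carrier[OF normal_imp_subgroup[OF K] k] .
        moreover have "\<sigma> f k \<one> = \<one>" "\<tau> f k \<one> \<in> K"
          using inv[OF k, of "(f, \<one>)"] bspec[OF * f] f by simp_all
        ultimately show ?thesis
          using bspec[OF * f] by simp
      qed
      then show ?thesis by blast
    qed
    then show "K = {\<one>}"
      using core K unfolding trivial_core_def by (metis (no_types, lifting) case_prod_beta')
  next
    fix p :: "('a set \<times> ('a => 'a)) \<times> 'a"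
    assume p: "p \<in> Sigma F X"
    then have f: "fst p \<in> F" "snd p \<in> X (fst p)"
      by auto
    note ** = bspec[OF * f(1)]
    show "(fst p, \<sigma> (fst p) \<one> (snd p)) = p"
      using ** f by (simp add: prod_eq_iff)
    fix g h assume g: "g \<in> carrier G"
    show "(fst p, \<sigma> (fst p) g (snd p)) \<in> Sigma F X" "\<tau> (fst p) g (snd p) \<in> carrier G"
      using ** f g by simp_all
    assume h: "h \<in> carrier G"
    show "(fst p, \<sigma> (fst p) (g \<otimes> h) (snd p)) =
        (fst (fst p, \<sigma> (fst p) h (snd p)),
         \<sigma> (fst (fst p, \<sigma> (fst p) h (snd p))) g (snd (fst p, \<sigma> (fst p) h (snd p))))"
      and "\<tau> (fst p) (g \<otimes> h) (snd p) =
        \<tau> (fst (fst p, \<sigma> (fst p) h (snd p))) g (snd (fst p, \<sigma> (fst p) h (snd p))) \<otimes> \<tau> (fst p) h (snd p)"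
      using ** f g h by simp_all
  qed
qed

text \<open>A nontrivial element moves some vertex, by faithfulness. The pointwise stabiliser of the
  level of this vertex is normal, has finite index and omits the element.\<close>

lemma self_similar_residually_finite:
  assumes G: "group G" and ss: "self_similar G"
  shows "residually_finite G"
  unfolding residually_finite_def
proof (intro ballI impI)
  fix g assume g: "g \<in> carrier G" "g \<noteq> \<one>\<^bsub>G\<^esub>"
  obtain m \<psi> where \<psi>: "faithful_action G (tree_verts m) \<psi>"
    "\<psi> ` carrier G \<subseteq> tree_automorphisms m"
    using ss by (auto simp: self_similar_def)
  interpret G: group G by fact
  interpret \<psi>: faithful_action G "tree_verts m" \<psi> by fact
  have len: "length (f w) = length w \<and> f w \<in> tree_verts m"
    if f: "f \<in> tree_automorphisms m" and "w \<in> tree_verts m" for f w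
    using \<open>w \<in> tree_verts m\<close>
  proof (induction w rule: rev_induct)
    case Nil
    then show ?case using f by (simp add: tree_automorphisms_def)
  next
    case (snoc i w)
    then have "w \<in> tree_verts m" "child m w (w @ [i])"
      by (auto simp: child_def)
    then have "child m (f w) (f (w @ [i]))" "w @ [i] \<in> tree_verts m"
      using f snoc by (auto simp: tree_automorphisms_def)
    then show ?case
      using snoc \<open>w \<in> tree_verts m\<close> by (auto simp: child_def)
  qed
  have "\<psi> g \<noteq> \<psi> \<one>\<^bsub>G\<^esub>"
    using \<psi>.faithful g by (auto dest: inj_onD)
  then obtain w where "\<psi> g w \<noteq> (\<lambda>w\<in>tree_verts m. w) w"
    unfolding \<psi>.id_eq_one[symmetric] by blast
  moreover have "\<psi> g w = undefined" if "w \<notin> tree_verts m"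
    using \<psi>.bij_prop0[OF g(1)] that by (simp add: Bij_def extensional_def)
  ultimately have w: "w \<in> tree_verts m" "\<psi> g w \<noteq> w"
    by (auto simp: restrict_def split: if_splits)
  define E where "E = {u \<in> tree_verts m. length u = length w}"
  have finE: "finite E"
    using finite_lists_length_eq[of "{..<m}" "length w"] by (simp add: E_def lists_eq_set)
  define N where "N = {h \<in> carrier G. \<forall>u\<in>E. \<psi> h u = u}"
  have EE: "\<psi> h u \<in> E" if "h \<in> carrier G" "u \<in> E" for h u
    using len[of "\<psi> h" u] \<psi>(2) that by (auto simp: E_def)
  have mult: "\<psi> (h \<otimes>\<^bsub>G\<^esub> k) u = \<psi> h (\<psi> k u)" if "h \<in> carrier G" "k \<in> carrier G" "u \<in> E" for h k u
    using \<psi>.composition_rule that by (auto simp: E_def)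
  have one: "\<psi> \<one>\<^bsub>G\<^esub> u = u" if "u \<in> E" for u
    using that unfolding E_def \<psi>.id_eq_one[symmetric] by simp
  have inv: "\<psi> (inv\<^bsub>G\<^esub> h) (\<psi> h u) = u" "\<psi> h (\<psi> (inv\<^bsub>G\<^esub> h) u) = u"
    if "h \<in> carrier G" "u \<in> E" for h u
    using mult[of "inv\<^bsub>G\<^esub> h" h u] mult[of h "inv\<^bsub>G\<^esub> h" u] that one by auto
  have N: "subgroup N G"
  proof (rule G.subgroupI)
    show "inv\<^bsub>G\<^esub> a \<in> N" if "a \<in> N" for a
      using that inv(1) unfolding N_def by fastforce
  qed (use one mult in \<open>auto simp: N_def\<close>)
  have "N \<lhd> G"
  proof (rule G.normal_invI[OF N])
    fix x h assume xh: "x \<in> carrier G" "h \<in> N"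
    have "\<psi> (x \<otimes>\<^bsub>G\<^esub> h \<otimes>\<^bsub>G\<^esub> inv\<^bsub>G\<^esub> x) u = u" if "u \<in> E" for u
      using xh that EE[of "inv\<^bsub>G\<^esub> x" u] by (simp add: mult inv N_def)
    then show "x \<otimes>\<^bsub>G\<^esub> h \<otimes>\<^bsub>G\<^esub> inv\<^bsub>G\<^esub> x \<in> N"
      using xh by (simp add: N_def)
  qed
  moreover have "finite (rcosets\<^bsub>G\<^esub> N)"
  proof (rule G.finite_rcosetsI[OF N])
    show "finite ((\<lambda>h. restrict (\<psi> h) E) ` carrier G)"
      by (rule finite_subset[of _ "E \<rightarrow>\<^sub>E E"]) (use EE finE in \<open>auto intro: finite_PiE\<close>)
    fix x y assume xy: "x \<in> carrier G" "y \<in> carrier G" "restrict (\<psi> x) E = restrict (\<psi> y) E"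
    have "\<psi> (x \<otimes>\<^bsub>G\<^esub> inv\<^bsub>G\<^esub> y) u = u" if u: "u \<in> E" for u
    proof -
      have "\<psi> x (\<psi> (inv\<^bsub>G\<^esub> y) u) = \<psi> y (\<psi> (inv\<^bsub>G\<^esub> y) u)"
        using fun_cong[OF xy(3), of "\<psi> (inv\<^bsub>G\<^esub> y) u"] EE[of "inv\<^bsub>G\<^esub> y" u] xy(2) u by simp
      then show ?thesis
        using xy u by (simp add: mult inv)
    qed
    then show "x \<otimes>\<^bsub>G\<^esub> inv\<^bsub>G\<^esub> y \<in> N"
      using xy by (simp add: N_def)
  qed
  moreover have "g \<notin> N"
    using w by (auto simp: N_def E_def)
  ultimately show "\<exists>N. N \<lhd> G \<and> finite (rcosets\<^bsub>G\<^esub> N) \<and> g \<notin> N"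
    by blast
qed

section \<open>Free groups\<close>

definition inv_letter :: "bool \<times> 's => bool \<times> 's" where
  "inv_letter a = (\<not> fst a, snd a)"

definition rcons :: "bool \<times> 's => 's word => 's word" where
  "rcons a w = (if w \<noteq> [] \<and> hd w = inv_letter a then tl w else a # w)"

definition reduced :: "'s word => bool" where
  "reduced w \<longleftrightarrow> successively (\<lambda>a b. b \<noteq> inv_letter a) w"

definition inv_word :: "'s word => 's word" where
  "inv_word w = rev (map inv_letter w)"

text \<open>The product lets \<open>u\<close> act on reduced words letter by letter. Associativity
  then reduces to the fact that \<open>rcons\<close> with a letter and with its inverse cancel,
  which is van der Waerden's argument.\<close>

definition free_group :: "'s set => 's word monoid" where
  "free_group S = \<lparr>carrier = {w \<in> words S. reduced w}, monoid.mult = foldr rcons, one = []\<rparr>"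

lemma inv_letter_simps [simp]:
  "inv_letter (inv_letter a) = a" "snd (inv_letter a) = snd a" "inv_letter a \<noteq> a"
  "inv_letter a = inv_letter b \<longleftrightarrow> a = b" "inv_letter (c, s) = (\<not> c, s)"
  by (auto simp: inv_letter_def prod_eq_iff)

lemma words_iff: "w \<in> words S \<longleftrightarrow> snd ` set w \<subseteq> S"
  by (auto simp: words_def)

lemma reduced_simps [simp]:
  "reduced []" "reduced [a]"
  "reduced (a # b # w) \<longleftrightarrow> b \<noteq> inv_letter a \<and> reduced (b # w)"
  by (auto simp: reduced_def)

lemma reduced_Cons: "reduced (a # w) \<longleftrightarrow> (w = [] \<or> hd w \<noteq> inv_letter a) \<and> reduced w"
  by (cases w) auto

lemma reduced_append:
  "reduced (u @ v) \<longleftrightarrow> reduced u \<and> reduced v \<and> (u = [] \<or> v = [] \<or> hd v \<noteq> inv_letter (last u))"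
  by (auto simp: reduced_def successively_append_iff)

lemma reduced_inv_word [simp]: "reduced (inv_word w) \<longleftrightarrow> reduced w"
proof (induction w)
  case (Cons a w)
  have "last (inv_word w) = inv_letter (hd w)" if "w \<noteq> []"
    using that by (cases w) (auto simp: inv_word_def)
  then show ?case
    using Cons by (auto simp: inv_word_def reduced_append reduced_Cons)
qed (simp add: inv_word_def)

lemma inv_word_simps [simp]:
  "inv_word (inv_word w) = w" "length (inv_word w) = length w" "inv_word [] = []"
  "inv_word w = [] \<longleftrightarrow> w = []" "snd ` set (inv_word w) = snd ` set w"
  by (auto simp: inv_word_def rev_map comp_def image_image)

lemma last_inv_word: "w \<noteq> [] ==> last (inv_word w) = inv_letter (hd w)"
  by (cases w) (auto simp: inv_word_def)

lemma hd_inv_word: "w \<noteq> [] ==> hd (inv_word w) = inv_letter (last w)"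
  by (auto simp: inv_word_def hd_rev last_map)

lemma reduced_rcons: "reduced w ==> reduced (rcons a w)"
  by (cases w) (auto simp: rcons_def reduced_Cons)

lemma reduced_foldr_rcons: "reduced w ==> reduced (foldr rcons u w)"
  by (induction u) (auto simp: reduced_rcons)

lemma rcons_words: "snd a \<in> S ==> w \<in> words S ==> rcons a w \<in> words S"
  by (cases w) (auto simp: rcons_def words_iff)

lemma foldr_rcons_words: "u \<in> words S ==> w \<in> words S ==> foldr rcons u w \<in> words S"
  by (induction u) (auto simp: rcons_words)

lemma rcons_cancel: "reduced w ==> rcons (inv_letter a) (rcons a w) = w"
  by (cases w; cases "tl w") (auto simp: rcons_def)

lemma foldr_rcons_rcons:
  assumes "reduced v" "reduced w"
  shows "foldr rcons (rcons a v) w = rcons a (foldr rcons v w)"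
proof (cases "v \<noteq> [] \<and> hd v = inv_letter a")
  case True
  then obtain v' where "v = inv_letter a # v'" by (cases v) auto
  moreover have "rcons a v = v'"
    by (simp add: \<open>v = _\<close> rcons_def)
  ultimately show ?thesis
    using rcons_cancel[of "foldr rcons v' w" "inv_letter a"] assms
    by (simp add: reduced_foldr_rcons)
qed (auto simp: rcons_def[of a v])

lemma foldr_rcons_assoc:
  "reduced v ==> reduced w ==> foldr rcons (foldr rcons u v) w = foldr rcons u (foldr rcons v w)"
  by (induction u) (auto simp: foldr_rcons_rcons reduced_foldr_rcons)

lemma foldr_rcons_reduced: "reduced (u @ w) ==> foldr rcons u w = u @ w"
  by (induction u) (auto simp: reduced_Cons rcons_def)

lemma foldr_rcons_inv_word: "reduced v ==> foldr rcons (inv_word w) (foldr rcons w v) = v"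
  by (induction w arbitrary: v) (auto simp: inv_word_def rcons_cancel reduced_foldr_rcons)

lemma carrier_free_group: "w \<in> carrier (free_group S) \<longleftrightarrow> w \<in> words S \<and> reduced w"
  by (simp add: free_group_def)

lemma mult_free_group: "u \<otimes>\<^bsub>free_group S\<^esub> w = foldr rcons u w"
  by (simp add: free_group_def)

lemma one_free_group: "\<one>\<^bsub>free_group S\<^esub> = []"
  by (simp add: free_group_def)

lemmas free_group_simps = carrier_free_group mult_free_group one_free_group

lemma inv_word_closed: "w \<in> carrier (free_group S) ==> inv_word w \<in> carrier (free_group S)"
  by (simp add: free_group_simps words_iff reduced_inv_word)

lemma inv_word_mult: "reduced w ==> foldr rcons (inv_word w) w = []"
  using foldr_rcons_inv_word[of "[]" w] foldr_rcons_reduced[of w "[]"] by simp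

lemma group_free_group [simp]: "group (free_group S)"
proof (rule groupI)
  show "\<exists>y\<in>carrier (free_group S). y \<otimes>\<^bsub>free_group S\<^esub> x = \<one>\<^bsub>free_group S\<^esub>"
    if "x \<in> carrier (free_group S)" for x
    using that inv_word_closed[OF that]
    by (intro bexI[of _ "inv_word x"]) (auto simp: free_group_simps inv_word_mult)
qed (auto simp: free_group_simps foldr_rcons_assoc reduced_foldr_rcons foldr_rcons_words)

lemma inv_free_group: "w \<in> carrier (free_group S) ==> inv\<^bsub>free_group S\<^esub> w = inv_word w"
  using group.inv_equality[OF group_free_group, where y = "inv_word w" and x = w and S1 = S]
    inv_word_closed[of w S]
  by (simp add: free_group_simps inv_word_mult)

abbreviation free_gen :: "'s => 's word" where
  "free_gen s \<equiv> [(True, s)]"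

lemma free_gen_closed: "free_gen s \<in> carrier (free_group S) \<longleftrightarrow> s \<in> S"
  by (simp add: free_group_simps)

text \<open>Nothing cancels at either end of \<open>m\<close>, so the three words are concatenated.
  This measures paths in the Cayley tree that run along \<open>m\<close>.\<close>

lemma length_mult_reduced:
  assumes "reduced u" "reduced m" "reduced v" "m \<noteq> []"
    "u = [] \<or> hd u \<noteq> hd m" "v = [] \<or> hd v \<noteq> inv_letter (last m)"
  shows "length (foldr rcons (inv_word u) (foldr rcons m v)) = length u + length m + length v"
proof -
  have "reduced (m @ v)" "reduced (inv_word u @ m @ v)"
    using assms by (auto simp: reduced_append reduced_inv_word last_inv_word)
  then show ?thesis
    by (simp add: foldr_rcons_reduced)
qed


subsection \<open>Evaluation of words\<close>

context group begin

definition letter_val :: "('s => 'a) => bool \<times> 's => 'a" where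
  "letter_val f a = (if fst a then f (snd a) else inv (f (snd a)))"

definition eval_word :: "('s => 'a) => 's word => 'a" where
  "eval_word f w = foldr (\<lambda>a x. letter_val f a \<otimes> x) w \<one>"

lemma eval_word_simps [simp]:
  "eval_word f [] = \<one>" "eval_word f (a # w) = letter_val f a \<otimes> eval_word f w"
  by (simp_all add: eval_word_def)

lemma letter_val_closed: "f ` S \<subseteq> carrier G ==> snd a \<in> S ==> letter_val f a \<in> carrier G"
  by (auto simp: letter_val_def)

lemma eval_word_closed: "f ` S \<subseteq> carrier G ==> w \<in> words S ==> eval_word f w \<in> carrier G"
  by (induction w) (auto simp: words_iff letter_val_closed)

lemma eval_word_append:
  "f ` S \<subseteq> carrier G ==> u \<in> words S ==> w \<in> words S ==>
    eval_word f (u @ w) = eval_word f u \<otimes> eval_word f w"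
  by (induction u) (auto simp: words_iff letter_val_closed eval_word_closed m_assoc)

lemma eval_word_rcons:
  assumes f: "f ` S \<subseteq> carrier G" and a: "snd a \<in> S" and w: "w \<in> words S"
  shows "eval_word f (rcons a w) = letter_val f a \<otimes> eval_word f w"
proof (cases "w \<noteq> [] \<and> hd w = inv_letter a")
  case True
  then obtain w' where w': "w = inv_letter a # w'" by (cases w) auto
  have "letter_val f a \<otimes> letter_val f (inv_letter a) = \<one>"
    using f a by (auto simp: letter_val_def inv_letter_def)
  then show ?thesis
    using w' w f a letter_val_closed[OF f, of a] letter_val_closed[OF f, of "inv_letter a"]
      eval_word_closed[OF f, of w']
    by (simp add: rcons_def words_iff m_assoc[symmetric])
qed (auto simp: rcons_def)

lemma eval_word_foldr_rcons:
  assumes f: "f ` S \<subseteq> carrier G" and u: "u \<in> words S" and w: "w \<in> words S"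
  shows "eval_word f (foldr rcons u w) = eval_word f u \<otimes> eval_word f w"
  using u
proof (induction u)
  case (Cons a u)
  then have u: "u \<in> words S" "snd a \<in> S" by (auto simp: words_iff)
  then show ?case
    using Cons eval_word_rcons[OF f u(2) foldr_rcons_words[OF u(1) w]] letter_val_closed[OF f u(2)]
      eval_word_closed[OF f] w by (simp add: m_assoc)
qed (use eval_word_closed[OF f w] in simp)

lemma eval_word_hom: "f ` S \<subseteq> carrier G ==> eval_word f \<in> hom (free_group S) G"
  by (auto simp: hom_def free_group_simps eval_word_closed eval_word_foldr_rcons)

lemma eval_free_gen: "f s \<in> carrier G ==> eval_word f (free_gen s) = f s"
  by (simp add: letter_val_def)

lemma eval_word_cong: "(!!s. s \<in> S ==> f s = g s) ==> w \<in> words S ==> eval_word f w = eval_word g w"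
  by (induction w) (auto simp: words_iff letter_val_def)

end

lemma free_hom_eq_eval_word:
  assumes "h \<in> hom (free_group S) G" "group G" "w \<in> carrier (free_group S)"
  shows "h w = group.eval_word G (\<lambda>s. h (free_gen s)) w"
proof -
  interpret h: group_hom "free_group S" G h
    using assms by (simp add: group_hom_def group_hom_axioms_def)
  have w: "w \<in> words S" "reduced w"
    using assms(3) by (auto simp: free_group_simps)
  then show ?thesis
  proof (induction w)
    case Nil
    then show ?case using h.hom_one by (simp add: free_group_simps)
  next
    case (Cons a w)
    obtain b s where a: "a = (b, s)" by (cases a)
    have c: "free_gen s \<in> carrier (free_group S)" "[a] \<in> carrier (free_group S)"
      "w \<in> carrier (free_group S)"
      using Cons.prems a by (auto simp: free_group_simps reduced_Cons)
    have "h [a] = h.H.letter_val (\<lambda>s. h (free_gen s)) a"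
      using h.hom_inv[OF c(1)] inv_free_group[OF c(1)]
      by (cases b) (auto simp: a h.H.letter_val_def inv_word_def)
    moreover have "[a] \<otimes>\<^bsub>free_group S\<^esub> w = a # w"
      using foldr_rcons_reduced[of "[a]" w] Cons.prems unfolding mult_free_group by auto
    ultimately show ?case
      using h.hom_mult[OF c(2,3)] Cons.IH c(3) by (simp add: carrier_free_group)
  qed
qed

lemma free_hom_ext:
  assumes "h \<in> hom (free_group S) G" "k \<in> hom (free_group S) G" "group G"
    "!!s. s \<in> S ==> h (free_gen s) = k (free_gen s)" "w \<in> carrier (free_group S)"
  shows "h w = k w"
  using free_hom_eq_eval_word[OF assms(1,3,5)] free_hom_eq_eval_word[OF assms(2,3,5)]
    group.eval_word_cong[OF assms(3), of S "\<lambda>s. h (free_gen s)" "\<lambda>s. k (free_gen s)" w] assms(4,5)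
  by (simp add: free_group_simps)

section \<open>Virtual endomorphisms of free groups\<close>

type_synonym mat2 = "int \<times> int \<times> int \<times> int"

fun mat2_mult :: "mat2 => mat2 => mat2" where
  "mat2_mult (a, b, c, d) (a', b', c', d') = (a*a' + b*c', a*b' + b*d', c*a' + d*c', c*b' + d*d')"

fun mat2_apply :: "mat2 => int \<times> int => int \<times> int" where
  "mat2_apply (a, b, c, d) (u, v) = (a*u + b*v, c*u + d*v)"

fun mat2_adj :: "mat2 => mat2" where
  "mat2_adj (a, b, c, d) = (d, -b, -c, a)"

text \<open>Sanov's group. It is free on \<open>(1, 2, 0, 1)\<close> and \<open>(1, 0, 2, 1)\<close>; being an arithmetic group,
  it has a virtual endomorphism given by conjugation with \<open>diag(2, 1)\<close>.\<close>

definition sanov :: "mat2 monoid" where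
  "sanov = \<lparr>carrier = {(a, b, c, d). a*d - b*c = 1 \<and> a mod 4 = 1 \<and> d mod 4 = 1 \<and> even b \<and> even c},
    monoid.mult = mat2_mult, one = (1, 0, 0, 1)\<rparr>"

definition half_conj :: "mat2 => mat2" where
  "half_conj = (\<lambda>(a, b, c, d). (a, 2*b, c div 2, d))"

text \<open>Divisibility by 4 keeps the lower left entry even after it has been halved.\<close>

definition half_dom :: "mat2 set" where
  "half_dom = {(a, b, c, d) \<in> carrier sanov. 4 dvd c}"

lemma sanov_simps:
  "(a, b, c, d) \<in> carrier sanov \<longleftrightarrow>
    a*d - b*c = 1 \<and> a mod 4 = 1 \<and> d mod 4 = 1 \<and> even b \<and> even c"
  "x \<otimes>\<^bsub>sanov\<^esub> y = mat2_mult x y" "\<one>\<^bsub>sanov\<^esub> = (1, 0, 0, 1)"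
  by (simp_all add: sanov_def)

lemma mat2_apply_mult: "mat2_apply (mat2_mult x y) z = mat2_apply x (mat2_apply y z)"
  by (cases x; cases y; cases z) (simp add: algebra_simps)

lemma mod4_mult_add:
  fixes a a' b c :: int
  assumes "a mod 4 = 1" "a' mod 4 = 1" "even b" "even c"
  shows "(a * a' + b * c) mod 4 = 1"
proof -
  obtain b' c' where "b = 2 * b'" "c = 2 * c'"
    using assms by (auto elim!: evenE)
  then have "a * a' + b * c = a * a' + 4 * (b' * c')" by simp
  moreover have "a * a' mod 4 = 1"
    using assms mod_mult_eq[of a 4 a'] by simp
  ultimately show ?thesis by simp
qed

lemma group_sanov [simp]: "group sanov"
proof (rule groupI)
  fix x y assume xy: "x \<in> carrier sanov" "y \<in> carrier sanov"
  obtain a b c d where x: "x = (a, b, c, d)" by (cases x)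
  obtain a' b' c' d' where y: "y = (a', b', c', d')" by (cases y)
  have "(a*a' + b*c') * (c*b' + d*d') - (a*b' + b*d') * (c*a' + d*c')
    = (a*d - b*c) * (a'*d' - b'*c')" by (simp add: algebra_simps)
  moreover have "(c * b' + d * d') mod 4 = 1"
    using mod4_mult_add[of d d' c b'] xy by (simp add: x y sanov_simps add.commute)
  ultimately show "x \<otimes>\<^bsub>sanov\<^esub> y \<in> carrier sanov"
    using xy mod4_mult_add[of a a' b c'] by (simp add: x y sanov_simps)
next
  fix x y z :: mat2
  show "x \<otimes>\<^bsub>sanov\<^esub> y \<otimes>\<^bsub>sanov\<^esub> z = x \<otimes>\<^bsub>sanov\<^esub> (y \<otimes>\<^bsub>sanov\<^esub> z)"
    by (cases x; cases y; cases z) (simp add: sanov_simps algebra_simps)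
next
  fix x assume x: "x \<in> carrier sanov"
  then show "\<one>\<^bsub>sanov\<^esub> \<otimes>\<^bsub>sanov\<^esub> x = x"
    by (cases x) (simp add: sanov_simps)
  show "\<exists>y\<in>carrier sanov. y \<otimes>\<^bsub>sanov\<^esub> x = \<one>\<^bsub>sanov\<^esub>"
    using x by (intro bexI[of _ "mat2_adj x"]; cases x) (auto simp: sanov_simps algebra_simps)
qed (simp add: sanov_simps)

lemma inv_sanov: "x \<in> carrier sanov ==> inv\<^bsub>sanov\<^esub> x = mat2_adj x"
proof (rule group.inv_equality[OF group_sanov])
  assume x: "x \<in> carrier sanov"
  show "mat2_adj x \<otimes>\<^bsub>sanov\<^esub> x = \<one>\<^bsub>sanov\<^esub>" "mat2_adj x \<in> carrier sanov"
    using x by (cases x; auto simp: sanov_simps algebra_simps)+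
qed

lemma subgroup_half_dom: "subgroup half_dom sanov"
proof (rule group.subgroupI)
  have "(1, 0, 0, 1) \<in> half_dom"
    by (simp add: half_dom_def sanov_simps)
  then show "half_dom \<noteq> {}"
    by blast
  show "inv\<^bsub>sanov\<^esub> x \<in> half_dom" if "x \<in> half_dom" for x
  proof -
    have x: "x \<in> carrier sanov"
      using that by (auto simp: half_dom_def)
    then have "mat2_adj x \<in> carrier sanov"
      using group.inv_closed[OF group_sanov x] by (simp add: inv_sanov)
    then show ?thesis
      using that x by (cases x) (auto simp: half_dom_def inv_sanov)
  qed
  show "x \<otimes>\<^bsub>sanov\<^esub> y \<in> half_dom" if "x \<in> half_dom" "y \<in> half_dom" for x y
    using that monoid.m_closed[OF group.is_monoid[OF group_sanov], of x y]
    by (cases x; cases y) (auto simp: half_dom_def sanov_simps)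
qed (auto simp: half_dom_def)

lemma virtual_hom_half_conj: "virtual_hom sanov sanov half_dom half_conj"
proof -
  have "finite (rcosets\<^bsub>sanov\<^esub> half_dom)"
  proof (rule group.finite_rcosetsI[OF group_sanov subgroup_half_dom])
    \<comment> \<open>The lower left entry of the quotient is \<open>c * d' - d * c'\<close>. As
      \<open>d\<close> and \<open>d'\<close> are odd, its divisibility by 4 depends only on the
      parities of \<open>c div 2\<close> and \<open>c' div 2\<close>; the index is at most
      two.\<close>
    let ?f = "\<lambda>x :: mat2. even (fst (snd (snd x)) div 2)"
    show "finite (?f ` carrier sanov)"
      by simp
    fix x y assume xy: "x \<in> carrier sanov" "y \<in> carrier sanov" "?f x = ?f y"
    obtain a b c d where x: "x = (a, b, c, d)" by (cases x)
    obtain a' b' c' d' where y: "y = (a', b', c', d')" by (cases y)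
    obtain k k' where k: "c = 2 * k" "c' = 2 * k'"
      using xy by (auto simp: x y sanov_simps elim!: evenE)
    have "d mod 4 = 1" "d' mod 4 = 1"
      using xy by (simp_all add: x y sanov_simps)
    then have "odd d" "odd d'"
      by presburger+
    then have "even (k * d' - d * k')"
      using xy(3) by (simp add: x y k)
    then have "4 dvd 2 * (k * d' - d * k')"
      by presburger
    then have "4 dvd c * d' - d * c'"
      by (simp add: k algebra_simps)
    moreover have "x \<otimes>\<^bsub>sanov\<^esub> inv\<^bsub>sanov\<^esub> y \<in> carrier sanov"
      using xy group.inv_closed[OF group_sanov] monoid.m_closed[OF group.is_monoid[OF group_sanov]]
      by blast
    ultimately show "x \<otimes>\<^bsub>sanov\<^esub> inv\<^bsub>sanov\<^esub> y \<in> half_dom"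
      using xy(2) by (simp add: half_dom_def inv_sanov x y sanov_simps(2) algebra_simps)
  qed
  moreover have "half_conj \<in> hom (sanov\<lparr>carrier := half_dom\<rparr>) sanov"
  proof (rule homI)
    fix x assume "x \<in> carrier (sanov\<lparr>carrier := half_dom\<rparr>)"
    then show "half_conj x \<in> carrier sanov"
      by (cases x) (auto simp: half_dom_def half_conj_def sanov_simps elim!: dvdE)
  next
    fix x y
    assume xy: "x \<in> carrier (sanov\<lparr>carrier := half_dom\<rparr>)" "y \<in> carrier (sanov\<lparr>carrier := half_dom\<rparr>)"
    obtain a b c d where x: "x = (a, b, c, d)" by (cases x)
    obtain a' b' c' d' where y: "y = (a', b', c', d')" by (cases y)
    obtain k k' where k: "c = 2 * k" "c' = 2 * k'"
      using xy by (auto simp: x y half_dom_def sanov_simps elim!: evenE)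
    have "(c * a' + d * c') div 2 = k * a' + d * k'"
      by (simp add: k)
    then show "half_conj (x \<otimes>\<^bsub>sanov\<lparr>carrier := half_dom\<rparr>\<^esub> y) = half_conj x \<otimes>\<^bsub>sanov\<^esub> half_conj y"
      by (simp add: x y half_conj_def sanov_simps(2) k)
  qed
  ultimately show ?thesis
    by (simp add: virtual_hom_def subgroup_half_dom)
qed

lemma eq_zero_if_dvd_powers:
  fixes c k :: int
  assumes "!!i :: nat. k ^ i dvd c" "k \<ge> 2" shows "c = 0"
proof (rule ccontr)
  assume "c \<noteq> 0"
  have *: "int i < k ^ i" for i
    using assms(2)
  proof (induction i)
    case (Suc i)
    then have "int i + 1 \<le> k ^ i" by simp
    also have "k ^ i < k * k ^ i" using Suc.prems by simp
    finally show ?case by simp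
  qed simp
  have "k ^ nat \<bar>c\<bar> \<le> \<bar>c\<bar>"
    using assms(1)[of "nat \<bar>c\<bar>"] \<open>c \<noteq> 0\<close> dvd_imp_le_int[of c "k ^ nat \<bar>c\<bar>"] assms(2) by simp
  then show False
    using *[of "nat \<bar>c\<bar>"] by simp
qed

text \<open>Each application of \<open>half_conj\<close> halves the lower left entry, so on an
  invariant subgroup this entry is divisible by all powers of two and vanishes. Conjugation by
  \<open>(1, 0, 2, 1)\<close> brings a multiple of the upper right entry into the same place, so
  that entry vanishes too.\<close>

lemma sanov_core: "trivial_core sanov {(half_dom, half_conj)}"
  unfolding trivial_core_def
proof (intro allI impI)
  fix K assume K: "K \<lhd> sanov"
    and "\<forall>(L, \<phi>)\<in>{(half_dom, half_conj)}. K \<subseteq> L \<and> \<phi> ` K \<subseteq> K"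
  then have inv: "K \<subseteq> half_dom" "half_conj ` K \<subseteq> K"
    by auto
  have Kc: "K \<subseteq> carrier sanov"
    using inv(1) by (auto simp: half_dom_def)
  have dvd: "2 ^ i dvd c" if "(a, b, c, d) \<in> K" for i :: nat and a b c d
    using that
  proof (induction i arbitrary: a b c d)
    case (Suc i)
    have "4 dvd c"
      using Suc.prems inv(1) by (auto simp: half_dom_def)
    then have "c = 2 * (c div 2)"
      by presburger
    moreover have "(a, 2 * b, c div 2, d) \<in> K"
      using Suc.prems inv(2) by (force simp: half_conj_def)
    ultimately show ?case
      using Suc.IH by (metis dvd_refl mult_dvd_mono power_Suc)
  qed simp
  have c0: "c = 0" if "(a, b, c, d) \<in> K" for a b c d
    using dvd[OF that] eq_zero_if_dvd_powers[of 2 c] by simp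
  have "x = (1, 0, 0, 1)" if x: "x \<in> K" for x
  proof -
    obtain a b c d where abcd: "x = (a, b, c, d)" by (cases x)
    have "c = 0" using c0 x abcd by simp
    moreover have "a * d = 1" "a mod 4 = 1"
      using x Kc \<open>c = 0\<close> by (auto simp: abcd sanov_simps)
    \<comment> \<open>The residue modulo 4 excludes the solution \<open>-1\<close>.\<close>
    then have "a = 1" "d = 1"
      using zmult_eq_1_iff[of a d] by auto
    ultimately have x': "x = (1, b, 0, 1)" by (simp add: abcd)
    have Y: "(1, 0, 2, 1) \<in> carrier sanov"
      by (simp add: sanov_simps)
    have "(1, 0, 2, 1) \<otimes>\<^bsub>sanov\<^esub> x \<otimes>\<^bsub>sanov\<^esub> inv\<^bsub>sanov\<^esub> (1, 0, 2, 1) \<in> K"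
      using normal.inv_op_closed2[OF K Y x] .
    then have "(1 - b * 2, b, - (4 * b), 2 * b + 1) \<in> K"
      using Y by (simp add: inv_sanov sanov_simps(2) x')
    then have "b = 0"
      using c0 by force
    then show ?thesis using x' by simp
  qed
  then have "K \<subseteq> {\<one>\<^bsub>sanov\<^esub>}"
    unfolding sanov_simps(3) by blast
  then show "K = {\<one>\<^bsub>sanov\<^esub>}"
    using subgroup.one_closed[OF normal_imp_subgroup[OF K]] by blast
qed


subsection \<open>Ping-pong\<close>

text \<open>The conjugates of \<open>(1, 0, 2, 1)\<close> by the powers of \<open>(1, 2, 0, 1)\<close>.\<close>

definition sanov_conj :: "nat => mat2" where
  "sanov_conj i = (1 + 4 * int i, - 8 * (int i)^2, 2, 1 - 4 * int i)"

lemma sanov_conj_closed: "sanov_conj i \<in> carrier sanov"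
proof -
  have "(1 + 4 * int i) mod 4 = 1" "(1 - 4 * int i) mod 4 = 1"
    by presburger+
  then show ?thesis
    by (simp add: sanov_conj_def sanov_simps power2_eq_square algebra_simps)
qed

text \<open>Entering a ping-pong region: twice the dominant coordinate, added to the other one,
  makes the latter dominant and gives the product of both the sign of the letter.\<close>

lemma abs_add_two_less:
  fixes u v :: int
  assumes "\<bar>u\<bar> > \<bar>v\<bar>" "e = 1 \<or> e = -1"
  shows "\<bar>v + 2 * e * u\<bar> > \<bar>u\<bar>" "e * u * (v + 2 * e * u) > 0"
proof -
  show "\<bar>v + 2 * e * u\<bar> > \<bar>u\<bar>" using assms by (elim disjE) auto
  have "u \<noteq> 0" using assms by auto
  have "\<bar>u\<bar> * \<bar>v\<bar> \<le> \<bar>u\<bar> * \<bar>u\<bar>"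
    using assms(1) by (intro mult_left_mono) auto
  then have "\<bar>e * u * v\<bar> \<le> u * u"
    using assms(2) by (auto simp: abs_mult)
  moreover have "u * u > 0"
    using \<open>u \<noteq> 0\<close> by (simp add: zero_less_mult_iff) linarith
  moreover have "e * u * (v + 2 * e * u) = e * u * v + 2 * (u * u)"
    using assms(2) by (auto simp: algebra_simps)
  ultimately show "e * u * (v + 2 * e * u) > 0"
    by linarith
qed

text \<open>Staying in a ping-pong region when the same letter is repeated. Dominance alone could be
  lost if the summands had opposite signs, so the sign belongs to the invariant.\<close>

lemma abs_add_two_same_sign:
  fixes u v :: int
  assumes "\<bar>v\<bar> > \<bar>u\<bar>" "e * u * v > 0" "e = 1 \<or> e = -1"
  shows "\<bar>v + 2 * e * u\<bar> > \<bar>u\<bar>" "e * u * (v + 2 * e * u) > 0"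
proof -
  have "e * u * (v + 2 * e * u) = e * u * v + 2 * (u * u)"
    using assms(3) by (auto simp: algebra_simps)
  then show "e * u * (v + 2 * e * u) > 0"
    using assms(2) zero_le_square[of u] by linarith
  have "(u > 0 \<and> v > 0) \<or> (u < 0 \<and> v < 0)" if "e = 1"
    using assms(2) that by (auto simp: zero_less_mult_iff)
  moreover have "(u < 0 \<and> v > 0) \<or> (u > 0 \<and> v < 0)" if "e = -1"
    using assms(2) that by (auto simp: mult_less_0_iff)
  ultimately show "\<bar>v + 2 * e * u\<bar> > \<bar>u\<bar>"
    using assms(1,3) by auto
qed

definition letter_sign :: "bool \<times> 's => int" where
  "letter_sign a = (if fst a then 1 else -1)"

lemma letter_sign_cases: "letter_sign a = 1 \<or> letter_sign a = -1"
  by (simp add: letter_sign_def)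

lemma letter_sign_eq: "snd a = snd b ==> b \<noteq> inv_letter a ==> letter_sign a = letter_sign b"
  by (auto simp: letter_sign_def inv_letter_def prod_eq_iff)

text \<open>The coordinate \<open>u\<close> undoes the conjugation by a power of
  \<open>(1, 2, 0, 1)\<close>. In terms of \<open>u\<close> and \<open>V\<close> the letter acts
  like \<open>(1, 0, 2, 1)\<close> or its inverse: it keeps \<open>u\<close> and changes
  \<open>V\<close> by twice \<open>u\<close>.\<close>

lemma sanov_conj_letter:
  assumes "u = U - 2 * int (snd a) * V" "V' = V + 2 * letter_sign a * u"
  shows "mat2_apply (group.letter_val sanov sanov_conj a) (U, V) = (u + 2 * int (snd a) * V', V')"
proof -
  define i where "i = int (snd a)"
  have "group.letter_val sanov sanov_conj a =
    (if fst a then (1 + 4 * i, - 8 * i^2, 2, 1 - 4 * i) else (1 - 4 * i, 8 * i^2, -2, 1 + 4 * i))"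
    using inv_sanov[OF sanov_conj_closed[of "snd a"]]
    by (simp add: group.letter_val_def[OF group_sanov] sanov_conj_def i_def)
  moreover have "(1 + 4 * i) * U + - 8 * i^2 * V = u + 2 * i * (V + 2 * u)"
    "2 * U + (1 - 4 * i) * V = V + 2 * u"
    "(1 - 4 * i) * U + 8 * i^2 * V = u + 2 * i * (V - 2 * u)"
    "-2 * U + (1 + 4 * i) * V = V - 2 * u"
    unfolding assms(1) i_def[symmetric] power2_eq_square by (simp_all add: algebra_simps)
  ultimately show ?thesis
    unfolding assms(2) i_def[symmetric] by (simp add: letter_sign_def)
qed

text \<open>The region of the generator \<open>i\<close> is where \<open>V\<close> dominates
  \<open>U - 2 * i * V\<close>. Passing from \<open>j\<close> to a different \<open>i\<close>
  changes this coordinate by a nonzero even multiple of \<open>V\<close>, which makes it dominate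
  \<open>V\<close>, so the next letter can enter its own region. The vector \<open>(1, 0)\<close>
  lies outside all regions.\<close>

lemma sanov_conj_ping_pong:
  assumes "reduced w" "w \<noteq> []" "mat2_apply (group.eval_word sanov sanov_conj w) (1, 0) = (U, V)"
  shows "\<bar>V\<bar> > \<bar>U - 2 * int (snd (hd w)) * V\<bar> \<and>
    letter_sign (hd w) * (U - 2 * int (snd (hd w)) * V) * V > 0"
  using assms
proof (induction w arbitrary: U V)
  case (Cons a w)
  interpret group sanov by simp
  obtain U0 V0 where UV0: "mat2_apply (eval_word sanov_conj w) (1, 0) = (U0, V0)"
    by fastforce
  define u where "u = U0 - 2 * int (snd a) * V0"
  have "(U, V) = mat2_apply (letter_val sanov_conj a) (U0, V0)"
    using Cons.prems(3) unfolding eval_word_simps sanov_simps(2) mat2_apply_mult UV0 by simp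
  then have UV: "(U, V) = (u + 2 * int (snd a) * V, V)" "V = V0 + 2 * letter_sign a * u"
    unfolding sanov_conj_letter[OF u_def HOL.refl] by auto
  have "\<bar>V\<bar> > \<bar>u\<bar> \<and> letter_sign a * u * V > 0"
  proof (cases "w \<noteq> [] \<and> snd (hd w) = snd a")
    case True
    then have "letter_sign a = letter_sign (hd w)"
      using Cons.prems(1) by (intro letter_sign_eq) (auto simp: reduced_Cons)
    then have "\<bar>V0\<bar> > \<bar>u\<bar>" "letter_sign a * u * V0 > 0"
      using Cons.IH[OF _ _ UV0] Cons.prems(1) True by (auto simp: u_def reduced_Cons)
    then show ?thesis
      using abs_add_two_same_sign[OF _ _ letter_sign_cases] UV(2) by blast
  next
    case False
    have "\<bar>u\<bar> > \<bar>V0\<bar>"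
    proof (cases "w = []")
      case True
      then show ?thesis using UV0 by (auto simp: u_def sanov_simps)
    next
      case w: False
      define j where "j = snd (hd w)"
      have "\<bar>V0\<bar> > \<bar>U0 - 2 * int j * V0\<bar>"
        using Cons.IH[OF _ w UV0] Cons.prems(1) by (auto simp: reduced_Cons j_def)
      moreover have "u = (U0 - 2 * int j * V0) + 2 * ((int j - int (snd a)) * V0)"
        by (simp add: u_def algebra_simps)
      moreover have "\<bar>(int j - int (snd a)) * V0\<bar> \<ge> \<bar>V0\<bar>"
        using False w mult_right_mono[of 1 "\<bar>int j - int (snd a)\<bar>" "\<bar>V0\<bar>"]
        by (auto simp: j_def abs_mult)
      ultimately show ?thesis by linarith
    qed
    then show ?thesis
      using abs_add_two_less[OF _ letter_sign_cases] UV(2) by blast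
  qed
  moreover have "U - 2 * int (snd a) * V = u"
    using UV(1) by simp
  ultimately show ?case by simp
qed simp

lemma sanov_conj_inj:
  assumes "w \<in> carrier (free_group S)" "group.eval_word sanov sanov_conj w = \<one>\<^bsub>sanov\<^esub>"
  shows "w = []"
  using sanov_conj_ping_pong[of w 1 0] assms by (auto simp: free_group_simps sanov_simps)

definition sanov_gen :: "nat => mat2" where
  "sanov_gen s = (if s = 0 then (1, 2, 0, 1) else (1, 0, 2, 1))"

lemma sanov_gen_simps: "sanov_gen 0 = (1, 2, 0, 1)" "sanov_gen 1 = (1, 0, 2, 1)"
  by (simp_all add: sanov_gen_def)

lemma sanov_gen_closed: "sanov_gen s \<in> carrier sanov"
  by (simp add: sanov_gen_def sanov_simps)

text \<open>Each of the two standard basis vectors is fixed by one of the generators. The starting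
  vector therefore depends on the last letter, which acts first, and is the one that this letter
  moves.\<close>

lemma sanov_gen_ping_pong:
  assumes "reduced w" "w \<noteq> []" "snd ` set w \<subseteq> {..<2}"
    "mat2_apply (group.eval_word sanov sanov_gen w) (if snd (last w) = 0 then (0, 1) else (1, 0)) = (U, V)"
  shows "letter_sign (hd w) * U * V > 0 \<and> (if snd (hd w) = 0 then \<bar>U\<bar> > \<bar>V\<bar> else \<bar>V\<bar> > \<bar>U\<bar>)"
  using assms
proof (induction w arbitrary: U V)
  case (Cons a w)
  interpret group sanov by simp
  let ?z = "if snd (last (a # w)) = 0 then (0, 1) else (1, 0) :: int \<times> int"
  obtain U0 V0 where UV0: "mat2_apply (eval_word sanov_gen w) ?z = (U0, V0)"
    by fastforce
  have UV: "(U, V) = (if snd a = 0 then (U0 + 2 * letter_sign a * V0, V0)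
      else (U0, V0 + 2 * letter_sign a * U0))"
  proof -
    have "(U, V) = mat2_apply (letter_val sanov_gen a) (U0, V0)"
      using Cons.prems(4) unfolding eval_word_simps sanov_simps(2) mat2_apply_mult UV0 by simp
    then show ?thesis
      using sanov_gen_closed[of "snd a"]
      by (auto simp: letter_val_def inv_sanov sanov_gen_def letter_sign_def)
  qed
  show ?case
  proof (cases "w = []")
    case True
    then have "(U0, V0) = (if snd a = 0 then (0, 1) else (1, 0))"
      using UV0 by (auto simp: sanov_simps split: if_splits)
    then show ?thesis
      using UV letter_sign_cases[of a] by (auto split: if_splits)
  next
    case False
    have IH: "letter_sign (hd w) * U0 * V0 > 0 \<and> (if snd (hd w) = 0 then \<bar>U0\<bar> > \<bar>V0\<bar> else \<bar>V0\<bar> > \<bar>U0\<bar>)"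
      using Cons.IH[of U0 V0] Cons.prems False UV0 by (auto simp: reduced_Cons)
    have cases: "snd a < 2" "snd (hd w) < 2"
      using Cons.prems(3) False by (auto simp: hd_in_set image_subset_iff)
    show ?thesis
    proof (cases "snd (hd w) = snd a")
      case True
      then have "letter_sign a = letter_sign (hd w)"
        using Cons.prems(1) False by (intro letter_sign_eq) (auto simp: reduced_Cons)
      then show ?thesis
        using IH UV True abs_add_two_same_sign[of U0 V0 "letter_sign a"]
          abs_add_two_same_sign[of V0 U0 "letter_sign a"] letter_sign_cases[of a]
        by (auto split: if_splits simp: mult.commute mult.left_commute)
    next
      case neq: False
      then show ?thesis
        using IH UV cases abs_add_two_less[of U0 V0 "letter_sign a"]
          abs_add_two_less[of V0 U0 "letter_sign a"] letter_sign_cases[of a]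
        by (auto split: if_splits simp: mult.commute mult.left_commute)
    qed
  qed
qed simp

lemma sanov_gen_inj:
  assumes "w \<in> carrier (free_group {..<2})" "group.eval_word sanov sanov_gen w = \<one>\<^bsub>sanov\<^esub>"
  shows "w = []"
proof (rule ccontr)
  assume "w \<noteq> []"
  moreover have "mat2_apply (group.eval_word sanov sanov_gen w)
      (if snd (last w) = 0 then (0, 1) else (1, 0)) = (if snd (last w) = 0 then (0, 1) else (1, 0))"
    using assms(2) by (simp add: sanov_simps)
  ultimately show False
    using sanov_gen_ping_pong[of w "if snd (last w) = 0 then 0 else 1" "if snd (last w) = 0 then 1 else 0"]
      assms(1) by (auto simp: free_group_simps words_iff split: if_splits)
qed

text \<open>Euclid's algorithm on the first column: since \<open>a\<close> is odd and \<open>c\<close> even, one of the four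
  elementary steps lowers \<open>\<bar>a\<bar> + \<bar>c\<bar>\<close> as long as \<open>c \<noteq> 0\<close>.\<close>

lemma sanov_gen_surj:
  assumes "x \<in> carrier sanov"
  shows "\<exists>w\<in>carrier (free_group {..<2}). group.eval_word sanov sanov_gen w = x"
proof -
  interpret group sanov by simp
  note [simp del] = eval_word_simps
  let ?F = "free_group {..<2 :: nat}"
  interpret F: group ?F by simp
  interpret ev: group_hom ?F sanov "eval_word sanov_gen"
    using eval_word_hom[of sanov_gen "{..<2}"] sanov_gen_closed
    by (auto simp: group_hom_def group_hom_axioms_def)
  have gen: "free_gen s \<in> carrier ?F" "eval_word sanov_gen (free_gen s) = sanov_gen s"
    if "s < 2" for s
    using that eval_free_gen[of sanov_gen s] sanov_gen_closed by (auto simp: free_group_simps)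
  have imgI: "\<exists>w\<in>carrier ?F. eval_word sanov_gen w = x"
    if "g \<otimes>\<^bsub>sanov\<^esub> x = eval_word sanov_gen w" "w \<in> carrier ?F" "g = eval_word sanov_gen v"
      "v \<in> carrier ?F" "x \<in> carrier sanov" for g x v w
  proof (intro bexI)
    have "eval_word sanov_gen (inv\<^bsub>?F\<^esub> v \<otimes>\<^bsub>?F\<^esub> w)
      = inv\<^bsub>sanov\<^esub> (eval_word sanov_gen v) \<otimes>\<^bsub>sanov\<^esub> eval_word sanov_gen w"
      using that(2,4) by simp
    also have "eval_word sanov_gen w = eval_word sanov_gen v \<otimes>\<^bsub>sanov\<^esub> x"
      using that(1,3) by simp
    finally show "eval_word sanov_gen (inv\<^bsub>?F\<^esub> v \<otimes>\<^bsub>?F\<^esub> w) = x"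
      using that(4,5) by simp
  qed (use that in simp)
  have powX: "\<exists>w\<in>carrier ?F. eval_word sanov_gen w = (1, 2 * k, 0, 1)" for k :: int
  proof (induction k rule: int_induct[of _ 0])
    case base
    show ?case
      by (intro bexI[of _ "[]"]) (auto simp: sanov_simps free_group_simps eval_word_simps)
  next
    case (step1 k)
    then obtain w where w: "w \<in> carrier ?F" "eval_word sanov_gen w = (1, 2 * k, 0, 1)" by blast
    then have "eval_word sanov_gen (free_gen 0 \<otimes>\<^bsub>?F\<^esub> w) = (1, 2 * (k + 1), 0, 1)"
      using gen[of 0] by (simp add: sanov_simps sanov_gen_simps)
    then show ?case
      using F.m_closed[OF gen(1)[of 0] w(1)] by auto
  next
    case (step2 k)
    then obtain w where w: "w \<in> carrier ?F" "eval_word sanov_gen w = (1, 2 * k, 0, 1)" by blast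
    then have "eval_word sanov_gen (inv\<^bsub>?F\<^esub> (free_gen 0) \<otimes>\<^bsub>?F\<^esub> w) = (1, 2 * (k - 1), 0, 1)"
      using gen[of 0] sanov_gen_closed[of 0] by (simp add: sanov_simps sanov_gen_simps inv_sanov)
    then show ?case
      using F.m_closed[OF F.inv_closed[OF gen(1)[of 0]] w(1)] by auto
  qed
  show ?thesis
    using assms
  proof (induction "nat (\<bar>fst x\<bar> + \<bar>fst (snd (snd x))\<bar>)" arbitrary: x rule: less_induct)
    case (less x)
    obtain a b c d where x: "x = (a, b, c, d)" by (cases x)
    have S: "a * d - b * c = 1" "a mod 4 = 1" "d mod 4 = 1" "even b" "even c"
      using less.prems by (auto simp: x sanov_simps)
    have "odd a" using S(2) by presburger
    have step: ?case if v: "v \<in> carrier ?F"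
      and lt: "\<bar>fst (eval_word sanov_gen v \<otimes>\<^bsub>sanov\<^esub> x)\<bar> +
        \<bar>fst (snd (snd (eval_word sanov_gen v \<otimes>\<^bsub>sanov\<^esub> x)))\<bar> < \<bar>a\<bar> + \<bar>c\<bar>" for v
    proof -
      have "eval_word sanov_gen v \<otimes>\<^bsub>sanov\<^esub> x \<in> carrier sanov"
        using v less.prems by simp
      moreover have "nat (\<bar>fst (eval_word sanov_gen v \<otimes>\<^bsub>sanov\<^esub> x)\<bar> +
          \<bar>fst (snd (snd (eval_word sanov_gen v \<otimes>\<^bsub>sanov\<^esub> x)))\<bar>) < nat (\<bar>fst x\<bar> + \<bar>fst (snd (snd x))\<bar>)"
        using lt by (simp add: x)
      ultimately obtain w where "w \<in> carrier ?F"
        "eval_word sanov_gen w = eval_word sanov_gen v \<otimes>\<^bsub>sanov\<^esub> x"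
        using less.hyps by blast
      then show ?case
        using imgI[OF HOL.sym _ HOL.refl v less.prems] by blast
    qed
    have g: "free_gen s \<in> carrier ?F" "inv\<^bsub>?F\<^esub> free_gen s \<in> carrier ?F"
      "eval_word sanov_gen (inv\<^bsub>?F\<^esub> free_gen s) = mat2_adj (sanov_gen s)" if "s < 2" for s
      using gen[OF that] ev.hom_inv[OF gen(1)[OF that]] inv_sanov[OF sanov_gen_closed[of s]] by auto
    consider "c = 0" | "c \<noteq> 0" "\<bar>a\<bar> > \<bar>c\<bar>" | "\<bar>c\<bar> > \<bar>a\<bar>"
    proof -
      have "\<bar>a\<bar> \<noteq> \<bar>c\<bar>"
      proof
        assume "\<bar>a\<bar> = \<bar>c\<bar>"
        moreover have "even \<bar>c\<bar>" using S(5) by simp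
        ultimately show False using \<open>odd a\<close> by (metis dvd_abs_iff)
      qed
      then show ?thesis using that by linarith
    qed
    then show ?case
    proof cases
      case 1
      then have "a = 1" "d = 1"
        using S zmult_eq_1_iff[of a d] by auto
      then show ?thesis
        using powX[of "b div 2"] S(4) 1 by (simp add: x)
    next
      case 2
      show ?thesis
      proof (cases "(a > 0) = (c > 0)")
        case True
        then show ?thesis
          using 2 g(2)[of 0] g(3)[of 0]
          by (intro step[of "inv\<^bsub>?F\<^esub> free_gen 0"]) (auto simp: x sanov_simps(2) sanov_gen_def)
      next
        case False
        then show ?thesis
          using 2 gen[of 0]
          by (intro step[of "free_gen 0"]) (auto simp: x sanov_simps(2) sanov_gen_def)
      qed
    next
      case 3
      have "a \<noteq> 0" using \<open>odd a\<close> by auto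
      show ?thesis
      proof (cases "(a > 0) = (c > 0)")
        case True
        then show ?thesis
          using 3 \<open>a \<noteq> 0\<close> g(2)[of 1] g(3)[of 1]
          by (intro step[of "inv\<^bsub>?F\<^esub> free_gen 1"]) (auto simp: x sanov_simps(2) sanov_gen_def)
      next
        case False
        then show ?thesis
          using 3 \<open>a \<noteq> 0\<close> gen[of 1]
          by (intro step[of "free_gen 1"]) (auto simp: x sanov_simps(2) sanov_gen_def)
      qed
    qed
  qed
qed


lemma (in group) virtual_hom_post:
  assumes "virtual_hom G Q L \<phi>" "h \<in> hom Q R"
  shows "virtual_hom G R L (h \<circ> \<phi>)"
  using assms by (auto simp: virtual_hom_def hom_def)

lemma normal_hom_image:
  assumes "group_hom G H h" "h ` carrier G = carrier H" "K \<lhd> G"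
  shows "h ` K \<lhd> H"
proof -
  interpret h: group_hom G H h by fact
  have K: "subgroup K G" using assms(3) by (rule normal_imp_subgroup)
  show ?thesis
  proof (rule h.H.normal_invI)
    show "subgroup (h ` K) H" using K by (rule h.subgroup_img_is_subgroup)
    fix x y assume "x \<in> carrier H" "y \<in> h ` K"
    then obtain g k where gk: "x = h g" "y = h k" "g \<in> carrier G" "k \<in> K"
      using assms(2) by blast
    have "k \<in> carrier G" using subgroup.mem_carrier[OF K gk(4)] .
    then have "x \<otimes>\<^bsub>H\<^esub> y \<otimes>\<^bsub>H\<^esub> inv\<^bsub>H\<^esub> x = h (g \<otimes>\<^bsub>G\<^esub> k \<otimes>\<^bsub>G\<^esub> inv\<^bsub>G\<^esub> g)"
      using gk by simp
    then show "x \<otimes>\<^bsub>H\<^esub> y \<otimes>\<^bsub>H\<^esub> inv\<^bsub>H\<^esub> x \<in> h ` K"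
      using normal.inv_op_closed2[OF assms(3) gk(3,4)] by simp
  qed
qed

subsection \<open>Free groups of finite rank have virtual endomorphisms with trivial core\<close>

text \<open>A nonabelian free group maps into Sanov's group injectively by \<open>\<iota>\<close>, contains a copy of it and
  retracts onto this copy by \<open>\<pi>\<close>. An invariant normal subgroup dies under \<open>\<pi>\<close> because of the core
  property of Sanov's group, and hence under \<open>\<iota>\<close>.\<close>

lemma free_group_trivial_core_ge2:
  assumes r: "r \<ge> 2"
  obtains L1 f1 L2 f2 where
    "virtual_hom (free_group {..<r}) (free_group {..<r}) L1 f1"
    "virtual_hom (free_group {..<r}) (free_group {..<r}) L2 f2"
    "trivial_core (free_group {..<r :: nat}) {(L1, f1), (L2, f2)}"
proof -
  let ?F = "free_group {..<r}" and ?F2 = "free_group {..<2 :: nat}"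
  interpret S: group sanov by simp
  interpret F: group ?F by simp
  define \<iota> where "\<iota> = S.eval_word sanov_conj"
  define \<mu> where "\<mu> = S.eval_word sanov_gen"
  \<comment> \<open>On the first two generators this is the isomorphism onto Sanov's group; the
    other generators are killed.\<close>
  define \<pi> where "\<pi> = S.eval_word (\<lambda>s. if s < 2 then sanov_gen s else \<one>\<^bsub>sanov\<^esub>)"
  have \<iota>: "\<iota> \<in> hom ?F sanov"
    unfolding \<iota>_def using sanov_conj_closed by (intro S.eval_word_hom) auto
  have \<mu>: "\<mu> \<in> hom ?F2 sanov"
    unfolding \<mu>_def using sanov_gen_closed by (intro S.eval_word_hom) auto
  have \<pi>: "\<pi> \<in> hom ?F sanov"
    unfolding \<pi>_def using sanov_gen_closed S.one_closed by (intro S.eval_word_hom) auto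
  interpret \<iota>: group_hom ?F sanov \<iota>
    using \<iota> by (simp add: group_hom_def group_hom_axioms_def)
  interpret \<mu>: group_hom ?F2 sanov \<mu>
    using \<mu> by (simp add: group_hom_def group_hom_axioms_def)
  interpret \<pi>: group_hom ?F sanov \<pi>
    using \<pi> by (simp add: group_hom_def group_hom_axioms_def)
  have \<mu>_inj: "inj_on \<mu> (carrier ?F2)"
    unfolding \<mu>.inj_on_one_iff
  proof (intro allI impI)
    show "w = \<one>\<^bsub>?F2\<^esub>" if "w \<in> carrier ?F2" "\<mu> w = \<one>\<^bsub>sanov\<^esub>" for w
      using sanov_gen_inj that by (simp add: \<mu>_def one_free_group)
  qed
  have \<mu>_bij: "\<exists>w. w \<in> carrier ?F2 \<and> \<mu> w = x" if "x \<in> carrier sanov" for x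
    using sanov_gen_surj[OF that] unfolding \<mu>_def by blast
  define j where "j x = (SOME w. w \<in> carrier ?F2 \<and> \<mu> w = x)" for x
  have j: "j x \<in> carrier ?F2" "\<mu> (j x) = x" if "x \<in> carrier sanov" for x
    using someI_ex[OF \<mu>_bij[OF that]] unfolding j_def by auto
  have F2F: "w \<in> carrier ?F" if "w \<in> carrier ?F2" for w
    using that r by (auto simp: free_group_simps words_iff)
  have j_hom: "j \<in> hom sanov ?F"
  proof (rule homI)
    show "j x \<in> carrier ?F" if "x \<in> carrier sanov" for x
      using j(1)[OF that] F2F by simp
    show "j (x \<otimes>\<^bsub>sanov\<^esub> y) = j x \<otimes>\<^bsub>?F\<^esub> j y" if "x \<in> carrier sanov" "y \<in> carrier sanov" for x y
    proof -
      have "\<mu> (j (x \<otimes>\<^bsub>sanov\<^esub> y)) = \<mu> (j x \<otimes>\<^bsub>?F2\<^esub> j y)"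
        using that j by simp
      then have "j (x \<otimes>\<^bsub>sanov\<^esub> y) = j x \<otimes>\<^bsub>?F2\<^esub> j y"
        using that by (intro inj_onD[OF \<mu>_inj]) (simp_all add: j)
      then show ?thesis by (simp add: mult_free_group)
    qed
  qed
  have \<pi>j: "\<pi> (j x) = x" if "x \<in> carrier sanov" for x
  proof -
    have "\<pi> (j x) = \<mu> (j x)"
      unfolding \<pi>_def \<mu>_def using j(1)[OF that]
      by (intro S.eval_word_cong[of "{..<2}"]) (auto simp: free_group_simps)
    then show ?thesis using j(2)[OF that] by simp
  qed
  have \<pi>_onto: "\<pi> ` carrier ?F = carrier sanov"
    using \<pi>j j(1) F2F \<pi>.hom_closed by (metis (no_types, lifting) image_eqI image_subsetI subsetI subset_antisym)
  \<comment> \<open>Both maps conjugate in Sanov's group and return to the free group by the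
    embedding \<open>j\<close>, which \<open>\<pi>\<close> inverts. They differ in the way into
    Sanov's group.\<close>
  define L1 f1 L2 f2 where
    "L1 = {x \<in> carrier ?F. \<iota> x \<in> half_dom}" and "f1 = j \<circ> (half_conj \<circ> \<iota>)" and
    "L2 = {x \<in> carrier ?F. \<pi> x \<in> half_dom}" and "f2 = j \<circ> (half_conj \<circ> \<pi>)"
  have v: "virtual_hom ?F ?F L1 f1" "virtual_hom ?F ?F L2 f2"
    unfolding L1_def f1_def L2_def f2_def
    using F.virtual_hom_post[OF F.virtual_hom_comp[OF F.virtual_hom_of_hom[OF \<iota>]
          virtual_hom_half_conj group_sanov] j_hom]
      F.virtual_hom_post[OF F.virtual_hom_comp[OF F.virtual_hom_of_hom[OF \<pi>]
          virtual_hom_half_conj group_sanov] j_hom] by auto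
  have hc: "half_conj x \<in> carrier sanov" if "x \<in> half_dom" for x
    using virtual_hom_half_conj that by (auto simp: virtual_hom_def hom_def)
  have "trivial_core ?F {(L1, f1), (L2, f2)}"
    unfolding trivial_core_def
  proof (intro allI impI)
    fix K assume K: "K \<lhd> ?F" and "\<forall>(L, \<phi>)\<in>{(L1, f1), (L2, f2)}. K \<subseteq> L \<and> \<phi> ` K \<subseteq> K"
    then have inv: "K \<subseteq> L1" "f1 ` K \<subseteq> K" "K \<subseteq> L2" "f2 ` K \<subseteq> K"
      by auto
    have "\<pi> ` K \<lhd> sanov"
      by (rule normal_hom_image[OF \<pi>.group_hom_axioms \<pi>_onto K])
    moreover have "\<pi> ` K \<subseteq> half_dom"
      using inv(3) by (auto simp: L2_def)
    moreover have "half_conj (\<pi> k) \<in> \<pi> ` K" if "k \<in> K" for k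
    proof -
      have "\<pi> (f2 k) = half_conj (\<pi> k)"
        unfolding f2_def comp_def using that inv(3) by (intro \<pi>j hc) (auto simp: L2_def)
      then show ?thesis
        using that inv(4) by (metis image_eqI image_subset_iff)
    qed
    ultimately have \<pi>K: "\<pi> ` K = {\<one>\<^bsub>sanov\<^esub>}"
      using sanov_core unfolding trivial_core_def by blast
    have "k = \<one>\<^bsub>?F\<^esub>" if k: "k \<in> K" for k
    proof -
      have kF: "k \<in> carrier ?F" and \<iota>k: "\<iota> k \<in> half_dom"
        using k inv(1) by (auto simp: L1_def)
      \<comment> \<open>As \<open>f1 k\<close> lies in \<open>K\<close>, it dies under
        \<open>\<pi>\<close>. Since \<open>half_conj\<close> is injective on its domain,
        \<open>\<iota> k\<close> is already trivial.\<close>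
      have "half_conj (\<iota> k) = \<pi> (f1 k)"
        using \<iota>k hc \<pi>j by (simp add: f1_def)
      also have "\<dots> = \<one>\<^bsub>sanov\<^esub>"
        using k inv(2) \<pi>K by blast
      finally have "\<iota> k = \<one>\<^bsub>sanov\<^esub>"
        using \<iota>k by (cases "\<iota> k") (auto simp: half_conj_def half_dom_def sanov_simps)
      then show ?thesis
        using sanov_conj_inj[OF kF] by (simp add: \<iota>_def one_free_group)
    qed
    then show "K = {\<one>\<^bsub>?F\<^esub>}"
      using subgroup.one_closed[OF normal_imp_subgroup[OF K]] by blast
  qed
  then show thesis
    using that v by blast
qed

lemma reduced_single_letter:
  assumes "reduced w" "snd ` set w \<subseteq> {s}" shows "w = replicate (length w) (hd w)"
  using assms
proof (induction w)
  case (Cons a w)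
  show ?case
  proof (cases "w = []")
    case False
    then have "hd w = a"
      using Cons.prems by (cases w; cases a; cases "hd w") (auto simp: inv_letter_def)
    then show ?thesis
      using Cons by (auto simp: reduced_Cons)
  qed simp
qed simp

text \<open>In rank one Sanov's group does not embed. Halving of even exponents takes the place of
  \<open>half_conj\<close>.\<close>

lemma free_group_trivial_core_1:
  assumes r: "r = (1 :: nat)"
  obtains L f where "virtual_hom (free_group {..<r}) (free_group {..<r}) L f"
    "trivial_core (free_group {..<r}) {(L, f)}"
proof -
  let ?F = "free_group {..<r}"
  interpret F: group ?F by simp
  interpret Z: group integer_group by simp
  define e where "e = Z.eval_word (\<lambda>_ :: nat. 1)"
  have e: "e \<in> hom ?F integer_group"
    unfolding e_def by (intro Z.eval_word_hom) auto
  interpret e: group_hom ?F integer_group e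
    using e by (simp add: group_hom_def group_hom_axioms_def)
  have e_mult: "e (u \<otimes>\<^bsub>?F\<^esub> w) = e u + e w" if "u \<in> carrier ?F" "w \<in> carrier ?F" for u w
    using e.hom_mult[OF that] by simp
  have e_inv: "e (inv\<^bsub>?F\<^esub> w) = - e w" if "w \<in> carrier ?F" for w
    using e.hom_inv[OF that] by simp
  have e_replicate: "e (replicate k a) = (if fst a then int k else - int k)" for k a
    by (induction k) (auto simp: e_def Z.letter_val_def)
  have e_inj: "w = []" if "w \<in> carrier ?F" "e w = 0" for w
  proof -
    have "w = replicate (length w) (hd w)"
      using reduced_single_letter[of w 0] that(1) r by (fastforce simp: free_group_simps words_iff)
    then have "e w = (if fst (hd w) then int (length w) else - int (length w))"
      using e_replicate[of "length w" "hd w"] by metis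
    then show ?thesis
      using that(2) by (auto split: if_splits)
  qed
  have g: "free_gen 0 \<in> carrier ?F"
    using r by (simp add: free_gen_closed)
  have e_pow: "e (free_gen 0 [^]\<^bsub>?F\<^esub> k) = k" for k :: int
  proof -
    have "e (free_gen 0) = 1"
      using e_replicate[of 1 "(True, 0)"] by simp
    then show ?thesis
      using e.hom_int_pow[OF g, of k] by simp
  qed
  define L f where "L = {w \<in> carrier ?F. even (e w)}"
    and "f w = free_gen 0 [^]\<^bsub>?F\<^esub> (e w div 2)" for w
  have L: "subgroup L ?F"
  proof (rule F.subgroupI)
    show "L \<noteq> {}" using e.hom_one F.one_closed by (force simp: L_def)
  qed (auto simp: L_def e_mult e_inv)
  have "virtual_hom ?F ?F L f"
    unfolding virtual_hom_def
  proof (intro conjI L homI)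
    show "finite (rcosets\<^bsub>?F\<^esub> L)"
      by (rule F.finite_rcosetsI[OF L, of "\<lambda>w. even (e w)"]) (auto simp: L_def e_mult e_inv)
    show "f (x \<otimes>\<^bsub>?F\<lparr>carrier := L\<rparr>\<^esub> y) = f x \<otimes>\<^bsub>?F\<^esub> f y"
      if "x \<in> carrier (?F\<lparr>carrier := L\<rparr>)" "y \<in> carrier (?F\<lparr>carrier := L\<rparr>)" for x y
      using that g by (simp add: L_def f_def e_mult F.int_pow_mult)
  qed (simp add: f_def g)
  moreover have "trivial_core ?F {(L, f)}"
    unfolding trivial_core_def
  proof (intro allI impI)
    fix K assume K: "K \<lhd> ?F" and "\<forall>(L, \<phi>)\<in>{(L, f)}. K \<subseteq> L \<and> \<phi> ` K \<subseteq> K"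
    then have inv: "K \<subseteq> L" "f ` K \<subseteq> K"
      by auto
    have dvd: "2 ^ i dvd e k" if "k \<in> K" for i k
      using that
    proof (induction i arbitrary: k)
      case (Suc i)
      have "e k = 2 * (e k div 2)"
        using Suc.prems inv(1) by (auto simp: L_def)
      moreover have "2 ^ i dvd e (f k)"
        using Suc.IH Suc.prems inv(2) by blast
      ultimately show ?case
        by (metis dvd_refl e_pow f_def mult_dvd_mono power_Suc)
    qed simp
    have "k = \<one>\<^bsub>?F\<^esub>" if "k \<in> K" for k
      using eq_zero_if_dvd_powers[of 2 "e k"] dvd[OF that] e_inj[of k] that inv(1)
      by (auto simp: L_def one_free_group)
    then show "K = {\<one>\<^bsub>?F\<^esub>}"
      using subgroup.one_closed[OF normal_imp_subgroup[OF K]] by blast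
  qed
  ultimately show thesis
    using that by blast
qed

lemma free_group_trivial_core:
  obtains F where "finite F"
    "!!L f. (L, f) \<in> F ==> virtual_hom (free_group {..<r}) (free_group {..<r}) L f"
    "trivial_core (free_group {..<r :: nat}) F"
proof -
  consider "r = 0" | "r = 1" | "r \<ge> 2" by linarith
  then show thesis
  proof cases
    case 1
    have "trivial_core (free_group {..<r}) {}"
      unfolding trivial_core_def
    proof (intro allI impI)
      fix K assume K: "K \<lhd> free_group {..<r}"
      have "carrier (free_group {..<r}) = {\<one>\<^bsub>free_group {..<r}\<^esub>}"
        using 1 by (auto simp: free_group_simps words_iff)
      then show "K = {\<one>\<^bsub>free_group {..<r}\<^esub>}"
        using normal_imp_subgroup[OF K] subgroup.subset subgroup.one_closed by fastforce
    qed
    then show ?thesis using that[of "{}"] by simp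
  next
    case 2
    then show ?thesis
    proof -
      obtain L f where "virtual_hom (free_group {..<r}) (free_group {..<r}) L f"
        "trivial_core (free_group {..<r}) {(L, f)}"
        by (rule free_group_trivial_core_1[OF 2])
      then show ?thesis
        by (intro that[of "{(L, f)}"]) auto
    qed
  next
    case 3
    obtain L1 f1 L2 f2 where
      "virtual_hom (free_group {..<r}) (free_group {..<r}) L1 f1"
      "virtual_hom (free_group {..<r}) (free_group {..<r}) L2 f2"
      "trivial_core (free_group {..<r}) {(L1, f1), (L2, f2)}"
      by (rule free_group_trivial_core_ge2[OF 3])
    then show ?thesis
      by (intro that[of "{(L1, f1), (L2, f2)}"]) auto
  qed
qed

section \<open>Linear groups over the rationals\<close>

lemma carrier_GL_rat:
  "M \<in> carrier (GL_rat k) \<longleftrightarrow>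
    M \<in> carrier_mat k k \<and> (\<exists>N\<in>carrier_mat k k. M * N = 1\<^sub>m k \<and> N * M = 1\<^sub>m k)"
  by (auto simp: GL_rat_def units_of_def Units_def ring_mat_simps)

lemma mult_GL_rat: "M \<otimes>\<^bsub>GL_rat k\<^esub> N = M * N"
  by (simp add: GL_rat_def units_of_def ring_mat_simps)

lemma one_GL_rat: "\<one>\<^bsub>GL_rat k\<^esub> = 1\<^sub>m k"
  by (simp add: GL_rat_def units_of_def ring_mat_simps)

lemmas GL_rat_simps = mult_GL_rat one_GL_rat

lemma GL_rat_carrier_mat: "M \<in> carrier (GL_rat k) ==> M \<in> carrier_mat k k"
  by (simp add: carrier_GL_rat)

lemma group_GL_rat [simp]: "group (GL_rat k)"
proof -
  interpret ring "ring_mat TYPE(rat) k ()" by (rule ring_mat)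
  show ?thesis unfolding GL_rat_def by (rule units_group)
qed

lemma hom_GL_ratI:
  assumes G: "group G"
    and car: "!!g. g \<in> carrier G ==> \<rho> g \<in> carrier_mat k k"
    and mult: "!!g h. g \<in> carrier G ==> h \<in> carrier G ==> \<rho> (g \<otimes>\<^bsub>G\<^esub> h) = \<rho> g * \<rho> h"
    and one: "\<rho> \<one>\<^bsub>G\<^esub> = 1\<^sub>m k"
  shows "\<rho> \<in> hom G (GL_rat k)"
proof (rule homI)
  interpret group G by fact
  fix g assume g: "g \<in> carrier G"
  then show "\<rho> g \<in> carrier (GL_rat k)"
    unfolding carrier_GL_rat
    using car[OF g] car[of "inv\<^bsub>G\<^esub> g"] mult[of g "inv\<^bsub>G\<^esub> g"] mult[of "inv\<^bsub>G\<^esub> g" g] one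
    by (metis inv_closed l_inv r_inv)
qed (simp add: mult GL_rat_simps)


subsection \<open>Localisations of the integers\<close>

definition int_loc :: "int => rat set" where
  "int_loc m = {of_int a / of_int b | a b. b \<noteq> 0 \<and> coprime b m}"

definition loc_ideal :: "int => rat set" where
  "loc_ideal m = (\<lambda>x. of_int m * x) ` int_loc m"

lemma int_locI: "b \<noteq> 0 ==> coprime b m ==> of_int a / of_int b \<in> int_loc m"
  by (auto simp: int_loc_def)

lemma int_loc_of_int [simp]: "of_int a \<in> int_loc m" "0 \<in> int_loc m" "1 \<in> int_loc m"
  using int_locI[of 1 m a] int_locI[of 1 m 0] int_locI[of 1 m 1] by auto

lemma int_loc_closed:
  assumes "x \<in> int_loc m" "y \<in> int_loc m"
  shows "x + y \<in> int_loc m" "x * y \<in> int_loc m" "x - y \<in> int_loc m"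
proof -
  obtain a b c d where x: "x = of_int a / of_int b" "b \<noteq> 0" "coprime b m"
    and y: "y = of_int c / of_int d" "d \<noteq> 0" "coprime d m"
    using assms by (auto simp: int_loc_def)
  have eq: "x + y = of_int (a * d + c * b) / of_int (b * d)" "x * y = of_int (a * c) / of_int (b * d)"
    "x - y = of_int (a * d - c * b) / of_int (b * d)"
    using x y by (simp_all add: add_frac_eq diff_frac_eq)
  show "x + y \<in> int_loc m" "x * y \<in> int_loc m" "x - y \<in> int_loc m"
    unfolding eq by (rule int_locI; use x y in simp)+
qed

lemma int_loc_sum: "(!!i. i \<in> I ==> f i \<in> int_loc m) ==> sum f I \<in> int_loc m"
  by (induction I rule: infinite_finite_induct) (auto intro: int_loc_closed)

lemma loc_ideal_closed:
  "0 \<in> loc_ideal m" "x \<in> loc_ideal m ==> y \<in> loc_ideal m ==> x + y \<in> loc_ideal m"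
  "x \<in> loc_ideal m ==> y \<in> loc_ideal m ==> x - y \<in> loc_ideal m"
  "x \<in> loc_ideal m ==> y \<in> int_loc m ==> x * y \<in> loc_ideal m"
  "x \<in> loc_ideal m ==> y \<in> int_loc m ==> y * x \<in> loc_ideal m"
proof -
  show "0 \<in> loc_ideal m"
    unfolding loc_ideal_def by (rule image_eqI[of _ _ 0]) auto
  show "x + y \<in> loc_ideal m" "x - y \<in> loc_ideal m" if "x \<in> loc_ideal m" "y \<in> loc_ideal m"
    using that by (auto simp: loc_ideal_def simp flip: distrib_left right_diff_distrib intro: int_loc_closed)
  show *: "x * y \<in> loc_ideal m" if "x \<in> loc_ideal m" "y \<in> int_loc m"
    using that by (auto simp: loc_ideal_def mult.assoc intro: int_loc_closed)
  show "y * x \<in> loc_ideal m" if "x \<in> loc_ideal m" "y \<in> int_loc m"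
    using *[OF that] by (simp add: mult.commute)
qed

lemma loc_ideal_sum: "(!!i. i \<in> I ==> f i \<in> loc_ideal m) ==> sum f I \<in> loc_ideal m"
  by (induction I rule: infinite_finite_induct) (auto intro: loc_ideal_closed)

text \<open>Modulo the ideal, the localisation becomes the ring of integers modulo \<open>m\<close>:
  with \<open>u\<close> inverse to the denominator \<open>b\<close> modulo \<open>m\<close>, the
  residue of \<open>a / b\<close> is that of \<open>a * u\<close>.\<close>

lemma loc_ideal_residue:
  assumes x: "x \<in> int_loc m" and m: "m > 0"
  obtains r where "0 \<le> r" "r < m" "x - of_int r \<in> loc_ideal m"
proof -
  obtain a b where ab: "x = of_int a / of_int b" "b \<noteq> 0" "coprime b m"
    using x by (auto simp: int_loc_def)
  obtain u v where uv: "u * b + v * m = 1"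
    using bezout_int[of b m] ab(3) by auto
  define r where "r = a * u mod m"
  have "a - r * b = a * (1 - u * b) + (a * u - r) * b"
    by (simp add: algebra_simps)
  also have "\<dots> = m * (a * v + (a * u div m) * b)"
    using uv by (simp add: r_def minus_mod_eq_mult_div algebra_simps flip: uv)
  finally obtain c where c: "a - r * b = m * c" by blast
  have "x - of_int r = of_int (a - r * b) / of_int b"
    using ab(2) by (simp add: ab(1) field_simps)
  also have "\<dots> = of_int m * (of_int c / of_int b)"
    by (simp add: c)
  finally have "x - of_int r \<in> loc_ideal m"
    unfolding loc_ideal_def using int_locI[OF ab(2,3)] by blast
  moreover have "0 \<le> r" "r < m"
    using m by (auto simp: r_def)
  ultimately show thesis using that by blast
qed

lemma of_int_div_loc_ideal:
  assumes "of_int a / of_int b \<in> loc_ideal m" "b \<noteq> 0" shows "\<exists>d. coprime d m \<and> m dvd a * d"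
proof -
  obtain c d where cd: "of_int a / of_int b = (of_int m * (of_int c / of_int d) :: rat)" "d \<noteq> 0" "coprime d m"
    using assms(1) by (auto simp: loc_ideal_def int_loc_def)
  then have "(of_int (a * d) :: rat) = of_int (m * c * b)"
    using assms(2) by (simp add: field_simps)
  then have "a * d = m * c * b"
    by (simp only: of_int_eq_iff)
  then show ?thesis
    using cd(3) by (metis dvd_triv_left mult.assoc)
qed

text \<open>Denominators are prime to \<open>m\<close> and cannot absorb its powers, so all of these
  divide the numerator of \<open>x\<close>.\<close>

lemma int_loc_divisible_eq_0:
  fixes x :: rat
  assumes m: "m \<ge> 2" and x: "x \<in> int_loc m"
    and div: "!!i :: nat. \<exists>y\<in>int_loc m. x = of_int m ^ i * y"
  shows "x = 0"
proof -
  obtain a b where ab: "x = of_int a / of_int b" "b \<noteq> 0" "coprime b m"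
    using x by (auto simp: int_loc_def)
  have "m ^ i dvd a" for i :: nat
  proof -
    obtain c d where cd: "x = (of_int m ^ i * (of_int c / of_int d) :: rat)" "d \<noteq> 0" "coprime d m"
      using div[of i] by (auto simp: int_loc_def)
    then have "(of_int (a * d) :: rat) = of_int (m ^ i * c * b)"
      using ab by (simp add: field_simps)
    then have "a * d = m ^ i * c * b"
      by (simp only: of_int_eq_iff)
    then have "m ^ i dvd a * d"
      by (metis dvd_triv_left mult.assoc)
    moreover have "coprime (m ^ i) d"
      using cd(3) by (simp add: coprime_commute)
    ultimately show ?thesis
      using coprime_dvd_mult_left_iff by blast
  qed
  then have "a = 0"
    using eq_zero_if_dvd_powers m by blast
  then show ?thesis by (simp add: ab)
qed


subsection \<open>Finitely generated rational linear groups\<close>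

definition loc_mat :: "int => nat => rat mat set" where
  "loc_mat m k = {M \<in> carrier_mat k k. \<forall>i<k. \<forall>j<k. M $$ (i, j) \<in> int_loc m}"

lemma mult_mat_entry:
  assumes "M \<in> carrier_mat k k" "N \<in> carrier_mat k k" "i < k" "j < k"
  shows "(M * N) $$ (i, j) = (\<Sum>l<k. M $$ (i, l) * N $$ (l, j))"
  using assms by (simp add: scalar_prod_def lessThan_atLeast0)

lemma loc_mat_mult: "M \<in> loc_mat m k ==> N \<in> loc_mat m k ==> M * N \<in> loc_mat m k"
  by (auto simp: loc_mat_def mult_mat_entry simp del: index_mult_mat intro!: int_loc_sum int_loc_closed)

lemma loc_mat_one: "1\<^sub>m k \<in> loc_mat m k"
  by (auto simp: loc_mat_def)

lemma coprime_factor: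
  fixes d D m :: int
  assumes "coprime D m" "d dvd D" shows "coprime d m"
  using coprime_divisors[OF assms(2) dvd_refl assms(1)] .

lemma loc_mat_exists:
  assumes "M \<in> carrier_mat k k"
  obtains d where "d > 0" "!!m. coprime d m ==> M \<in> loc_mat m k"
proof -
  have "\<exists>d>0. \<forall>m. coprime d m \<longrightarrow> M $$ p \<in> int_loc m" for p
  proof -
    obtain a b where "M $$ p = of_int a / of_int b" "b > 0"
      by (metis quotient_of_denom_pos quotient_of_div surj_pair)
    then show ?thesis
      by (intro exI[of _ b]) (auto intro: int_locI)
  qed
  then obtain d where d: "!!p. d p > 0" "!!p m. coprime (d p) m ==> M $$ p \<in> int_loc m"
    by metis
  show thesis
  proof (rule that[of "prod d ({..<k} \<times> {..<k})"])
    show "prod d ({..<k} \<times> {..<k}) > 0"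
      by (rule prod_pos) (use d(1) in auto)
    fix m assume "coprime (prod d ({..<k} \<times> {..<k})) m"
    then have "coprime (d (i, j)) m" if "i < k" "j < k" for i j
      by (rule coprime_factor) (use that in \<open>intro dvd_prodI; simp\<close>)
    then show "M \<in> loc_mat m k"
      using assms d(2) by (simp add: loc_mat_def)
  qed
qed

text \<open>Only the finitely many denominators in the generators and their inverses occur. The
  modulus \<open>m\<close> is quantified after \<open>d\<close>, because it is chosen later under
  further conditions.\<close>

lemma finitely_generated_loc_mat:
  assumes G: "group G" and X: "finite X" "X \<subseteq> carrier G" "generate G X = carrier G"
    and \<rho>: "\<rho> \<in> hom G (GL_rat k)"
  obtains d where "d > 0" "!!m g. coprime d m ==> g \<in> carrier G ==> \<rho> g \<in> loc_mat m k"
proof -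
  interpret \<rho>: group_hom G "GL_rat k" \<rho>
    using G \<rho> by (simp add: group_hom_def group_hom_axioms_def)
  have "\<exists>d>0. \<forall>m. coprime d m \<longrightarrow> \<rho> g \<in> loc_mat m k" if "g \<in> carrier G" for g
    using loc_mat_exists[of "\<rho> g" k] GL_rat_carrier_mat \<rho>.hom_closed[OF that] by metis
  then obtain d where d: "!!g. g \<in> carrier G ==> d g > 0"
    "!!g m. g \<in> carrier G ==> coprime (d g) m ==> \<rho> g \<in> loc_mat m k"
    by metis
  define D where "D = (\<Prod>x\<in>X. d x * d (inv\<^bsub>G\<^esub> x))"
  have "\<rho> g \<in> loc_mat m k" if m: "coprime D m" and g: "g \<in> generate G X" for m g
    using g
  proof (induction rule: generate.induct)
    case one
    then show ?case by (simp add: \<rho>.hom_one one_GL_rat loc_mat_one)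
  next
    case (incl h)
    have "d h dvd D"
      unfolding D_def by (rule dvd_mult_left[OF dvd_prodI[OF X(1) incl]])
    then have "coprime (d h) m"
      by (rule coprime_factor[OF m])
    then show ?case using d(2) incl X(2) by blast
  next
    case (inv h)
    have "d (inv\<^bsub>G\<^esub> h) dvd D"
      unfolding D_def by (rule dvd_mult_right[OF dvd_prodI[OF X(1) inv]])
    then have "coprime (d (inv\<^bsub>G\<^esub> h)) m"
      by (rule coprime_factor[OF m])
    then show ?case using d(2) inv X(2) by blast
  next
    case (eng g h)
    then have "g \<in> carrier G" "h \<in> carrier G"
      using X(3) by auto
    then show ?case
      using eng by (simp add: mult_GL_rat loc_mat_mult)
  qed
  moreover have "D > 0"
    unfolding D_def using X d(1) by (intro prod_pos) (auto intro!: mult_pos_pos)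
  ultimately show thesis
    using that X(3) by blast
qed

text \<open>Mal'cev's theorem, by reduction modulo some \<open>m\<close> prime to the denominators of the group and to
  the numerator of an entry distinguishing the given element from the identity.\<close>

lemma linear_residually_finite:
  assumes G: "group G" and X: "finite X" "X \<subseteq> carrier G" "generate G X = carrier G"
    and lin: "linear_over_rat G"
  shows "residually_finite G"
  unfolding residually_finite_def
proof (intro ballI impI)
  interpret group G by fact
  fix g assume g: "g \<in> carrier G" "g \<noteq> \<one>\<^bsub>G\<^esub>"
  obtain k \<rho> where \<rho>: "\<rho> \<in> hom G (GL_rat k)" and inj: "inj_on \<rho> (carrier G)"
    using lin by (auto simp: linear_over_rat_def)
  interpret \<rho>: group_hom G "GL_rat k" \<rho>
    using G \<rho> by (simp add: group_hom_def group_hom_axioms_def)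
  have car: "\<rho> h \<in> carrier_mat k k" if "h \<in> carrier G" for h
    using \<rho>.hom_closed[OF that] by (rule GL_rat_carrier_mat)
  have one: "\<rho> \<one>\<^bsub>G\<^esub> = 1\<^sub>m k"
    using \<rho>.hom_one by (simp add: one_GL_rat)
  have mult: "\<rho> (x \<otimes>\<^bsub>G\<^esub> y) = \<rho> x * \<rho> y" if "x \<in> carrier G" "y \<in> carrier G" for x y
    using \<rho>.hom_mult[OF that] by (simp add: mult_GL_rat)
  obtain d where d: "d > 0" "!!m g. coprime d m ==> g \<in> carrier G ==> \<rho> g \<in> loc_mat m k"
    using finitely_generated_loc_mat[OF G X \<rho>] by metis
  have "\<rho> g \<noteq> 1\<^sub>m k"
    using inj_onD[OF inj, of g "\<one>\<^bsub>G\<^esub>"] g one by auto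
  then obtain i j where ij: "i < k" "j < k" "\<rho> g $$ (i, j) - 1\<^sub>m k $$ (i, j) \<noteq> 0"
    using car[OF g(1)] eq_matI[of "1\<^sub>m k" "\<rho> g"] by auto
  obtain a b where ab: "\<rho> g $$ (i, j) - 1\<^sub>m k $$ (i, j) = of_int a / of_int b" "b > 0"
    by (metis quotient_of_denom_pos quotient_of_div surj_pair)
  have "a \<noteq> 0" using ij(3) ab by auto
  \<comment> \<open>One more than a common multiple of \<open>d\<close> and \<open>a\<close> is
    prime to both.\<close>
  define m where "m = d * \<bar>a\<bar> + 1"
  have m: "m \<ge> 2" "coprime d m" "coprime a m"
  proof -
    have "d * \<bar>a\<bar> > 0" using d(1) \<open>a \<noteq> 0\<close> by simp
    then show "m \<ge> 2" by (simp add: m_def)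
    have "coprime (d * \<bar>a\<bar>) m"
      unfolding m_def by (rule coprime_add_one_right)
    then show "coprime d m" "coprime a m" by simp_all
  qed
  \<comment> \<open>Congruence of matrices modulo the ideal generated by \<open>m\<close>; the
    congruence subgroup \<open>N\<close> is the class of the identity.\<close>
  define cg where "cg M N \<longleftrightarrow> (\<forall>i<k. \<forall>j<k. M $$ (i, j) - N $$ (i, j) \<in> loc_ideal m)"
    for M N :: "rat mat"
  have cg_refl: "cg M M" for M
    by (simp add: cg_def loc_ideal_closed)
  have cg_trans: "cg M L" if "cg M N" "cg N L" for M N L
    unfolding cg_def
  proof (intro allI impI)
    fix i j assume "i < k" "j < k"
    then show "M $$ (i, j) - L $$ (i, j) \<in> loc_ideal m"
      using loc_ideal_closed(2)[of "M $$ (i, j) - N $$ (i, j)" m "N $$ (i, j) - L $$ (i, j)"] that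
      by (simp add: cg_def)
  qed
  have cg_sym: "cg N M" if "cg M N" for M N
    unfolding cg_def
  proof (intro allI impI)
    fix i j assume "i < k" "j < k"
    then show "N $$ (i, j) - M $$ (i, j) \<in> loc_ideal m"
      using loc_ideal_closed(3)[OF loc_ideal_closed(1), of "M $$ (i, j) - N $$ (i, j)" m] that
      by (simp add: cg_def)
  qed
  have cg_mult: "cg (M * L) (N * L) \<and> cg (L * M) (L * N)"
    if "cg M N" "M \<in> carrier_mat k k" "N \<in> carrier_mat k k" "L \<in> loc_mat m k" for M N L
  proof -
    have L: "L \<in> carrier_mat k k" "!!i j. i < k ==> j < k ==> L $$ (i, j) \<in> int_loc m"
      using that(4) by (auto simp: loc_mat_def)
    have "(M * L) $$ (i, j) - (N * L) $$ (i, j) \<in> loc_ideal m" if ij: "i < k" "j < k" for i j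
    proof -
      have "(M * L) $$ (i, j) - (N * L) $$ (i, j) = (\<Sum>l<k. (M $$ (i, l) - N $$ (i, l)) * L $$ (l, j))"
        using ij \<open>M \<in> _\<close> \<open>N \<in> _\<close> L(1)
        by (simp add: mult_mat_entry left_diff_distrib sum_subtractf del: index_mult_mat)
      also have "\<dots> \<in> loc_ideal m"
        using that(1) ij L(2) \<open>cg M N\<close> by (intro loc_ideal_sum loc_ideal_closed(4)) (auto simp: cg_def)
      finally show ?thesis .
    qed
    moreover have "(L * M) $$ (i, j) - (L * N) $$ (i, j) \<in> loc_ideal m" if ij: "i < k" "j < k" for i j
    proof -
      have "(L * M) $$ (i, j) - (L * N) $$ (i, j) = (\<Sum>l<k. L $$ (i, l) * (M $$ (l, j) - N $$ (l, j)))"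
        using ij \<open>M \<in> _\<close> \<open>N \<in> _\<close> L(1)
        by (simp add: mult_mat_entry right_diff_distrib sum_subtractf del: index_mult_mat)
      also have "\<dots> \<in> loc_ideal m"
        using that(1) ij L(2) \<open>cg M N\<close> by (intro loc_ideal_sum loc_ideal_closed(5)) (auto simp: cg_def)
      finally show ?thesis .
    qed
    ultimately show ?thesis
      by (simp add: cg_def del: index_mult_mat)
  qed
  note loc = d(2)[OF m(2)]
  define N where "N = {h \<in> carrier G. cg (\<rho> h) (1\<^sub>m k)}"
  have cg_div: "cg (\<rho> (x \<otimes>\<^bsub>G\<^esub> inv\<^bsub>G\<^esub> y)) (1\<^sub>m k)"
    if "x \<in> carrier G" "y \<in> carrier G" "cg (\<rho> x) (\<rho> y)" for x y
    using cg_mult[OF that(3) car[OF that(1)] car[OF that(2)] loc[of "inv\<^bsub>G\<^esub> y"]] that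
      mult[of x "inv\<^bsub>G\<^esub> y"] mult[of y "inv\<^bsub>G\<^esub> y"] one by auto
  have N: "subgroup N G"
  proof (rule subgroupI)
    show "N \<noteq> {}" using cg_refl one by (auto simp: N_def intro!: exI[of _ "\<one>\<^bsub>G\<^esub>"])
    fix x assume x: "x \<in> N"
    then show "inv\<^bsub>G\<^esub> x \<in> N"
      using cg_div[of "\<one>\<^bsub>G\<^esub>" x] cg_sym[of "\<rho> x" "1\<^sub>m k"] one by (auto simp: N_def)
    fix y assume y: "y \<in> N"
    have "cg (\<rho> x * \<rho> y) (1\<^sub>m k * \<rho> y)"
      using x y cg_mult[of "\<rho> x" "1\<^sub>m k" "\<rho> y"] car loc by (auto simp: N_def)
    moreover have "1\<^sub>m k * \<rho> y = \<rho> y"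
      using y car[of y] by (simp add: N_def)
    ultimately have "cg (\<rho> x * \<rho> y) (\<rho> y)"
      by simp
    moreover have "cg (\<rho> y) (1\<^sub>m k)"
      using y by (simp add: N_def)
    ultimately have "cg (\<rho> x * \<rho> y) (1\<^sub>m k)"
      by (rule cg_trans)
    then show "x \<otimes>\<^bsub>G\<^esub> y \<in> N"
      using x y mult[of x y] by (simp add: N_def mult_GL_rat)
  qed (auto simp: N_def)
  have "N \<lhd> G"
  proof (rule normal_invI[OF N])
    fix x h assume xh: "x \<in> carrier G" "h \<in> N"
    then have h: "h \<in> carrier G" "cg (\<rho> h) (1\<^sub>m k)" by (auto simp: N_def)
    have "cg (\<rho> x * \<rho> h) (\<rho> x * 1\<^sub>m k)"
      using cg_mult[OF h(2) car[OF h(1)] _ loc[OF xh(1)]] by simp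
    then have "cg (\<rho> (x \<otimes>\<^bsub>G\<^esub> h)) (\<rho> x)"
      using xh h car[OF xh(1)] by (simp add: mult_GL_rat)
    then show "x \<otimes>\<^bsub>G\<^esub> h \<otimes>\<^bsub>G\<^esub> inv\<^bsub>G\<^esub> x \<in> N"
      using cg_div[of "x \<otimes>\<^bsub>G\<^esub> h" x] xh h by (simp add: N_def)
  qed
  moreover have "finite (rcosets\<^bsub>G\<^esub> N)"
  proof -
    have "\<exists>r. \<forall>x\<in>int_loc m. 0 \<le> r x \<and> r x < m \<and> x - of_int (r x) \<in> loc_ideal m"
    proof (rule bchoice, rule ballI)
      fix x assume "x \<in> int_loc m"
      then obtain r where "0 \<le> r" "r < m" "x - of_int r \<in> loc_ideal m"
        using m(1) by (rule_tac loc_ideal_residue[of x m]) auto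
      then show "\<exists>r. 0 \<le> r \<and> r < m \<and> x - of_int r \<in> loc_ideal m" by blast
    qed
    then obtain r where r: "0 \<le> r x \<and> r x < m \<and> x - of_int (r x) \<in> loc_ideal m"
      if "x \<in> int_loc m" for x
      by blast
    \<comment> \<open>The matrix of residues modulo \<open>m\<close> has finitely many values and
      determines the coset.\<close>
    define f where "f h = (\<lambda>p\<in>{..<k} \<times> {..<k}. r (\<rho> h $$ p))" for h
    show ?thesis
    proof (rule finite_rcosetsI[OF N, of f])
      have "f ` carrier G \<subseteq> ({..<k} \<times> {..<k}) \<rightarrow>\<^sub>E {0..<m}"
      proof (rule image_subsetI)
        fix h assume h: "h \<in> carrier G"
        have "r (\<rho> h $$ p) \<in> {0..<m}" if "p \<in> {..<k} \<times> {..<k}" for p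
          using r[of "\<rho> h $$ p"] loc[OF h] that by (cases p) (simp add: loc_mat_def)
        then show "f h \<in> ({..<k} \<times> {..<k}) \<rightarrow>\<^sub>E {0..<m}"
          unfolding f_def by (intro restrict_PiE_iff[THEN iffD2] ballI)
      qed
      then show "finite (f ` carrier G)"
        by (rule finite_subset) (auto intro: finite_PiE)
      fix x y assume xy: "x \<in> carrier G" "y \<in> carrier G" "f x = f y"
      have "\<rho> x $$ (i, j) - \<rho> y $$ (i, j) \<in> loc_ideal m" if "i < k" "j < k" for i j
      proof -
        have "r (\<rho> x $$ (i, j)) = r (\<rho> y $$ (i, j))"
          using fun_cong[OF xy(3), of "(i, j)"] that by (simp add: f_def)
        moreover have "\<rho> x $$ (i, j) \<in> int_loc m" "\<rho> y $$ (i, j) \<in> int_loc m"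
          using loc xy that by (auto simp: loc_mat_def)
        ultimately show ?thesis
          using r[of "\<rho> x $$ (i, j)"] r[of "\<rho> y $$ (i, j)"]
            loc_ideal_closed(3)[of "\<rho> x $$ (i, j) - of_int (r (\<rho> x $$ (i, j)))" m
              "\<rho> y $$ (i, j) - of_int (r (\<rho> y $$ (i, j)))"] by simp
      qed
      then show "x \<otimes>\<^bsub>G\<^esub> inv\<^bsub>G\<^esub> y \<in> N"
        using cg_div[OF xy(1,2)] xy by (simp add: N_def cg_def)
    qed
  qed
  moreover have "g \<notin> N"
  proof
    assume "g \<in> N"
    then have "\<rho> g $$ (i, j) - 1\<^sub>m k $$ (i, j) \<in> loc_ideal m"
      using ij by (simp add: N_def cg_def)
    then have "of_int a / of_int b \<in> loc_ideal m"
      unfolding ab(1) .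
    then obtain c where "coprime c m" "m dvd a * c"
      using of_int_div_loc_ideal ab(2) by blast
    then have "coprime (a * c) m" "m dvd a * c"
      using m(3) by simp_all
    then have "m dvd 1"
      by (metis coprime_common_divisor dvd_refl)
    then show False using m(1) by auto
  qed
  ultimately show "\<exists>N. N \<lhd> G \<and> finite (rcosets\<^bsub>G\<^esub> N) \<and> g \<notin> N"
    by blast
qed

subsection \<open>Induced representations\<close>

lemma sum_div_mod:
  fixes f :: "nat => 'a :: comm_monoid_add"
  shows "(\<Sum>r<m * k. f r) = (\<Sum>y<m. \<Sum>l<k. f (y * k + l))"
proof -
  have "(\<Sum>l<k. f (y * k + l)) = sum f {y * k..<y * k + k}" for y
    using sum.shift_bounds_nat_ivl[of f 0 "y * k" k] by (simp add: atLeast0LessThan add.commute)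
  then show ?thesis
    by (simp add: sum.nat_group)
qed

text \<open>The induced representation. The matrix of \<open>g\<close> consists of blocks of size
  \<open>k\<close>, with \<open>\<tau> g x\<close> in row \<open>\<sigma> g x\<close> and column
  \<open>x\<close>. It is faithful because an element acting as the identity fixes the trivial
  coset, hence lies in \<open>L\<close>, and the block there is its value under
  \<open>\<rho>\<close>.\<close>

lemma linear_of_finite_index:
  assumes G: "group G" and L: "virtual_hom G (GL_rat k) L \<rho>" and inj: "inj_on \<rho> L" and k: "k \<ge> 1"
  shows "linear_over_rat G"
proof -
  interpret group G by fact
  obtain X :: "'a set" and \<sigma> \<tau> where X: "finite X" "\<one>\<^bsub>G\<^esub> \<in> X"
    and \<sigma>: "!!g x. g \<in> carrier G ==> x \<in> X ==> \<sigma> g x \<in> X"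
    and \<tau>: "!!g x. g \<in> carrier G ==> x \<in> X ==> \<tau> g x \<in> carrier (GL_rat k)"
    and \<sigma>_one: "!!x. x \<in> X ==> \<sigma> \<one>\<^bsub>G\<^esub> x = x"
    and \<sigma>_mult: "!!g h x. g \<in> carrier G ==> h \<in> carrier G ==> x \<in> X ==>
      \<sigma> (g \<otimes>\<^bsub>G\<^esub> h) x = \<sigma> g (\<sigma> h x)"
    and \<tau>_mult: "!!g h x. g \<in> carrier G ==> h \<in> carrier G ==> x \<in> X ==>
      \<tau> (g \<otimes>\<^bsub>G\<^esub> h) x = \<tau> g (\<sigma> h x) \<otimes>\<^bsub>GL_rat k\<^esub> \<tau> h x"
    and fix_one: "!!g. g \<in> carrier G ==> \<sigma> g \<one>\<^bsub>G\<^esub> = \<one>\<^bsub>G\<^esub> ==> g \<in> L"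
      "!!g. g \<in> carrier G ==> \<sigma> g \<one>\<^bsub>G\<^esub> = \<one>\<^bsub>G\<^esub> ==> \<tau> g \<one>\<^bsub>G\<^esub> = \<rho> g"
    using virtual_hom_recursion[OF L group_GL_rat] by blast
  interpret GL: group "GL_rat k" by simp
  define m where "m = card X"
  obtain b where b: "bij_betw b X {..<m}"
    using ex_bij_betw_finite_nat[OF X(1)] by (auto simp: atLeast0LessThan m_def)
  define c where "c = inv_into X b"
  have c: "c i \<in> X" "b (c i) = i" if "i < m" for i
    using b that by (auto simp: c_def bij_betw_def f_inv_into_f inv_into_into)
  have bX: "c (b x) = x" "b x < m" if "x \<in> X" for x
    using b that by (auto simp: c_def bij_betw_def)
  define s where "s g i = b (\<sigma> g (c i))" for g i
  have s: "s g i < m" "c (s g i) = \<sigma> g (c i)" if "g \<in> carrier G" "i < m" for g i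
    using that c \<sigma> bX by (auto simp: s_def)
  define R where "R g = mat (m * k) (m * k) (\<lambda>(p, q).
    if p div k = s g (q div k) then \<tau> g (c (q div k)) $$ (p mod k, q mod k) else 0)" for g
  have \<tau>_car: "\<tau> g (c i) \<in> carrier_mat k k" if "g \<in> carrier G" "i < m" for g i
    using that \<tau> c GL_rat_carrier_mat by blast
  have pk: "p div k < m" "p mod k < k" if "p < m * k" for p
    using that k by (auto simp: less_mult_imp_div_less)
  have "R (g \<otimes>\<^bsub>G\<^esub> h) = R g * R h" if g: "g \<in> carrier G" and h: "h \<in> carrier G" for g h
  proof (rule eq_matI)
    fix p q assume "p < dim_row (R g * R h)" "q < dim_col (R g * R h)"
    then have pq: "p < m * k" "q < m * k" by (simp_all add: R_def)
    define x y where "x = q div k" and "y = s h x"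
    have x: "x < m" "y < m" using pk(1)[OF pq(2)] s(1)[OF h] by (auto simp: x_def y_def)
    have "(R g * R h) $$ (p, q) = (\<Sum>r<m * k. R g $$ (p, r) * R h $$ (r, q))"
      by (rule mult_mat_entry) (use pq in \<open>auto simp: R_def\<close>)
    also have "\<dots> = (\<Sum>z<m. \<Sum>l<k. R g $$ (p, z * k + l) * R h $$ (z * k + l, q))"
      by (rule sum_div_mod)
    also have "\<dots> = (\<Sum>z<m. if z = y then (\<Sum>l<k. (if p div k = s g y then
        \<tau> g (c y) $$ (p mod k, l) else 0) * \<tau> h (c x) $$ (l, q mod k)) else 0)"
    proof (rule sum.cong[OF HOL.refl])
      fix z assume z: "z \<in> {..<m}"
      have "R g $$ (p, z * k + l) * R h $$ (z * k + l, q) = (if z = y then (if p div k = s g y then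
        \<tau> g (c y) $$ (p mod k, l) else 0) * \<tau> h (c x) $$ (l, q mod k) else 0)" if l: "l < k" for l
      proof -
        have "z * k + l < (z + 1) * k" using l by simp
        also have "\<dots> \<le> m * k" using z by (intro mult_right_mono) auto
        finally have "z * k + l < m * k" .
        then show ?thesis
          using pq l by (simp add: R_def x_def y_def)
      qed
      then show "(\<Sum>l<k. R g $$ (p, z * k + l) * R h $$ (z * k + l, q)) =
        (if z = y then (\<Sum>l<k. (if p div k = s g y then
        \<tau> g (c y) $$ (p mod k, l) else 0) * \<tau> h (c x) $$ (l, q mod k)) else 0)"
        by (cases "z = y") (simp_all add: sum.neutral)
    qed
    also have "\<dots> = (\<Sum>l<k. (if p div k = s g y then
        \<tau> g (c y) $$ (p mod k, l) else 0) * \<tau> h (c x) $$ (l, q mod k))"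
      using x by simp
    also have "\<dots> = (if p div k = s g y then (\<tau> g (c y) * \<tau> h (c x)) $$ (p mod k, q mod k) else 0)"
      using mult_mat_entry[OF \<tau>_car[OF g x(2)] \<tau>_car[OF h x(1)] pk(2)[OF pq(1)] pk(2)[OF pq(2)]]
      by simp
    also have "\<dots> = R (g \<otimes>\<^bsub>G\<^esub> h) $$ (p, q)"
    proof -
      have "s (g \<otimes>\<^bsub>G\<^esub> h) x = s g y"
        using x c(1)[OF x(1)] s(2)[OF h x(1)] g h by (simp add: s_def y_def \<sigma>_mult bX \<sigma>)
      moreover have "\<tau> (g \<otimes>\<^bsub>G\<^esub> h) (c x) = \<tau> g (c y) * \<tau> h (c x)"
        using c(1)[OF x(1)] s(2)[OF h x(1)] g h by (simp add: y_def \<tau>_mult mult_GL_rat)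
      ultimately show ?thesis
        using pq by (simp add: R_def x_def)
    qed
    finally show "R (g \<otimes>\<^bsub>G\<^esub> h) $$ (p, q) = (R g * R h) $$ (p, q)" by simp
  qed (auto simp: R_def)
  moreover have "R \<one>\<^bsub>G\<^esub> = 1\<^sub>m (m * k)"
  proof (rule eq_matI)
    have \<tau>1: "\<tau> \<one>\<^bsub>G\<^esub> x = 1\<^sub>m k" if x: "x \<in> X" for x
      using \<tau>_mult[of "\<one>\<^bsub>G\<^esub>" "\<one>\<^bsub>G\<^esub>" x] \<sigma>_one[OF x] \<tau>[OF _ x, of "\<one>\<^bsub>G\<^esub>"] x
        GL.r_cancel_one[of "\<tau> \<one>\<^bsub>G\<^esub> x" "\<tau> \<one>\<^bsub>G\<^esub> x"] by (simp add: one_GL_rat)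
    fix p q assume "p < dim_row (1\<^sub>m (m * k) :: rat mat)" "q < dim_col (1\<^sub>m (m * k) :: rat mat)"
    then have pq: "p < m * k" "q < m * k" by simp_all
    have s1: "s \<one>\<^bsub>G\<^esub> (q div k) = q div k"
      using c pk(1)[OF pq(2)] by (simp add: s_def \<sigma>_one)
    have "(p div k = q div k \<and> p mod k = q mod k) = (p = q)"
      by (metis div_mult_mod_eq)
    then show "R \<one>\<^bsub>G\<^esub> $$ (p, q) = 1\<^sub>m (m * k) $$ (p, q)"
      using pq pk[OF pq(1)] pk[OF pq(2)] c(1) s1 by (auto simp: R_def \<tau>1)
  qed (auto simp: R_def)
  ultimately have R: "R \<in> hom G (GL_rat (m * k))"
    by (intro hom_GL_ratI[OF G]) (auto simp: R_def)
  interpret R: group_hom G "GL_rat (m * k)" R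
    using G R by (simp add: group_hom_def group_hom_axioms_def)
  have "g = \<one>\<^bsub>G\<^esub>" if g: "g \<in> carrier G" and Rg: "R g = 1\<^sub>m (m * k)" for g
  proof -
    define x where "x = b \<one>\<^bsub>G\<^esub>"
    have x: "x < m" "c x = \<one>\<^bsub>G\<^esub>" using bX[OF X(2)] by (auto simp: x_def)
    have xk: "x * k + l < m * k" if "l < k" for l
    proof -
      have "x * k + l < (x + 1) * k" using that by simp
      also have "\<dots> \<le> m * k" using x by (intro mult_right_mono) auto
      finally show ?thesis .
    qed
    have entry: "(if x = s g x then \<tau> g \<one>\<^bsub>G\<^esub> $$ (i, j) else 0) = (if i = j then 1 else 0)"
      if "i < k" "j < k" for i j
    proof -
      have "R g $$ (x * k + i, x * k + j) = (if x = s g x then \<tau> g \<one>\<^bsub>G\<^esub> $$ (i, j) else 0)"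
        using that xk[of i] xk[of j] x by (simp add: R_def)
      then show ?thesis
        using Rg that xk[of i] xk[of j] by simp
    qed
    \<comment> \<open>Otherwise the diagonal block would be zero. As \<open>k \<ge> 1\<close>, it
      has an entry \<open>(0, 0)\<close>, which equals 1.\<close>
    have "s g x = x"
      using entry[of 0 0] k by (auto split: if_splits)
    then have \<sigma>g: "\<sigma> g \<one>\<^bsub>G\<^esub> = \<one>\<^bsub>G\<^esub>"
      using s(2)[OF g x(1)] x(2) by simp
    have "\<rho> g = 1\<^sub>m k"
      using entry \<tau>_car[OF g x(1)] x(2) \<open>s g x = x\<close> fix_one(2)[OF g \<sigma>g]
      by (intro eq_matI) (auto simp: one_mat_def)
    moreover have "\<rho> \<one>\<^bsub>G\<^esub> = 1\<^sub>m k" "\<one>\<^bsub>G\<^esub> \<in> L"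
      using L subgroup.one_closed group_hom.hom_one[of "G\<lparr>carrier := L\<rparr>" "GL_rat k" \<rho>]
        subgroup_imp_group[of L]
      by (auto simp: virtual_hom_def group_hom_def group_hom_axioms_def one_GL_rat)
    ultimately show ?thesis
      using inj_onD[OF inj, of g "\<one>\<^bsub>G\<^esub>"] fix_one(1)[OF g \<sigma>g] by simp
  qed
  then have "inj_on R (carrier G)"
    unfolding R.inj_on_one_iff by (simp add: one_GL_rat)
  then show ?thesis
    using R unfolding linear_over_rat_def by blast
qed

definition block_sum :: "nat => nat => rat mat => rat mat => rat mat" where
  "block_sum k l M N = four_block_mat M (0\<^sub>m k l) (0\<^sub>m l k) N"

lemma block_sum_mult:
  assumes "M \<in> carrier_mat k k" "M' \<in> carrier_mat k k" "N \<in> carrier_mat l l" "N' \<in> carrier_mat l l"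
  shows "block_sum k l (M * M') (N * N') = block_sum k l M N * block_sum k l M' N'"
  unfolding block_sum_def using assms
  by (subst mult_four_block_mat[of M k k _ l _ l N M' k _ l _ N']) auto

lemma block_sum_eq_one:
  assumes M: "M \<in> carrier_mat k k" and N: "N \<in> carrier_mat l l"
    and eq: "block_sum k l M N = 1\<^sub>m (k + l)"
  shows "M = 1\<^sub>m k" "N = 1\<^sub>m l"
proof -
  have e: "block_sum k l M N $$ (i, j) = 1\<^sub>m (k + l) $$ (i, j)" for i j
    by (simp add: eq)
  show "M = 1\<^sub>m k"
  proof (rule eq_matI)
    show "M $$ (i, j) = 1\<^sub>m k $$ (i, j)" if "i < dim_row (1\<^sub>m k :: rat mat)" "j < dim_col (1\<^sub>m k :: rat mat)" for i j
      using e[of i j] M N that by (simp add: block_sum_def)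
  qed (use M in auto)
  show "N = 1\<^sub>m l"
  proof (rule eq_matI)
    show "N $$ (i, j) = 1\<^sub>m l $$ (i, j)" if "i < dim_row (1\<^sub>m l :: rat mat)" "j < dim_col (1\<^sub>m l :: rat mat)" for i j
      using e[of "k + i" "k + j"] M N that by (simp add: block_sum_def)
  qed (use N in auto)
qed

lemma block_sum_hom:
  assumes G: "group G" and \<rho>: "\<rho> \<in> hom G (GL_rat k)" and \<mu>: "\<mu> \<in> hom G (GL_rat l)"
  shows "(\<lambda>g. block_sum k l (\<rho> g) (\<mu> g)) \<in> hom G (GL_rat (k + l))"
proof -
  interpret \<rho>: group_hom G "GL_rat k" \<rho>
    using G \<rho> by (simp add: group_hom_def group_hom_axioms_def)
  interpret \<mu>: group_hom G "GL_rat l" \<mu>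
    using G \<mu> by (simp add: group_hom_def group_hom_axioms_def)
  have car: "\<rho> g \<in> carrier_mat k k" "\<mu> g \<in> carrier_mat l l" if "g \<in> carrier G" for g
    using that GL_rat_carrier_mat \<rho>.hom_closed \<mu>.hom_closed by blast+
  show ?thesis
  proof (rule hom_GL_ratI[OF G])
    show "block_sum k l (\<rho> g) (\<mu> g) \<in> carrier_mat (k + l) (k + l)" if "g \<in> carrier G" for g
      using car[OF that] by (simp add: block_sum_def)
    show "block_sum k l (\<rho> (g \<otimes>\<^bsub>G\<^esub> h)) (\<mu> (g \<otimes>\<^bsub>G\<^esub> h)) =
      block_sum k l (\<rho> g) (\<mu> g) * block_sum k l (\<rho> h) (\<mu> h)"
      if "g \<in> carrier G" "h \<in> carrier G" for g h
      using block_sum_mult that car by (simp add: mult_GL_rat)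
    show "block_sum k l (\<rho> \<one>\<^bsub>G\<^esub>) (\<mu> \<one>\<^bsub>G\<^esub>) = 1\<^sub>m (k + l)"
      by (simp add: \<rho>.hom_one \<mu>.hom_one one_GL_rat block_sum_def)
  qed
qed

definition sanov_rep :: "mat2 => rat mat" where
  "sanov_rep = (\<lambda>(a, b, c, d). mat 2 2 (\<lambda>(i, j).
    if i = 0 then (if j = 0 then of_int a else of_int b) else (if j = 0 then of_int c else of_int d)))"

lemma sanov_rep_hom: "sanov_rep \<in> hom sanov (GL_rat 2)"
proof (rule hom_GL_ratI)
  show "sanov_rep g \<in> carrier_mat 2 2" for g
    by (cases g) (simp add: sanov_rep_def)
  show "sanov_rep (g \<otimes>\<^bsub>sanov\<^esub> h) = sanov_rep g * sanov_rep h" for g h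
  proof (rule eq_matI)
    fix i j assume "i < dim_row (sanov_rep g * sanov_rep h)" "j < dim_col (sanov_rep g * sanov_rep h)"
    then have "i < 2" "j < 2" by (cases g; cases h; simp add: sanov_rep_def)+
    then have "i = 0 \<or> i = 1" "j = 0 \<or> j = 1" by auto
    then show "sanov_rep (g \<otimes>\<^bsub>sanov\<^esub> h) $$ (i, j) = (sanov_rep g * sanov_rep h) $$ (i, j)"
      by (cases g; cases h) (auto simp: sanov_rep_def sanov_simps scalar_prod_def numeral_2_eq_2)
  qed (cases g; cases h; simp add: sanov_rep_def sanov_simps)+
  show "sanov_rep \<one>\<^bsub>sanov\<^esub> = 1\<^sub>m 2"
    by (rule eq_matI) (auto simp: sanov_rep_def sanov_simps)
qed simp

lemma sanov_rep_eq_one: "sanov_rep x = 1\<^sub>m 2 ==> x = \<one>\<^bsub>sanov\<^esub>"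
proof -
  assume "sanov_rep x = 1\<^sub>m 2"
  then have "sanov_rep x $$ (i, j) = 1\<^sub>m 2 $$ (i, j)" for i j by simp
  from this[of 0 0] this[of 0 1] this[of 1 0] this[of 1 1] show ?thesis
    by (cases x) (simp add: sanov_rep_def sanov_simps)
qed

section \<open>Presented groups\<close>

lemma pres_rel_eval:
  assumes Q: "group Q" and f: "f ` S \<subseteq> carrier Q"
    and R: "!!u w. (u, w) \<in> R ==> u \<in> words S ==> w \<in> words S ==>
      group.eval_word Q f u = group.eval_word Q f w"
    and uw: "(u, w) \<in> pres_rel S R"
  shows "group.eval_word Q f u = group.eval_word Q f w"
proof -
  interpret group Q by fact
  show ?thesis
    using uw
  proof (induction rule: pres_rel.induct)
    case (cong u w x y)
    then show ?case
      using pres_rel_words[of u w S R] by (simp add: eval_word_append[OF f])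
  next
    case (cancel s b)
    then have "f s \<in> carrier Q" using f by auto
    then show ?case by (auto simp: letter_val_def)
  qed (use R in auto)
qed

text \<open>Von Dyck's theorem. The homomorphism evaluates an arbitrary member of a class of words,
  which is legitimate by \<open>pres_rel_eval\<close>.\<close>

lemma presented_group_hom:
  assumes Q: "group Q" and f: "f ` S \<subseteq> carrier Q"
    and R: "!!u w. (u, w) \<in> R ==> u \<in> words S ==> w \<in> words S ==>
      group.eval_word Q f u = group.eval_word Q f w"
  obtains h where "h \<in> hom (presented_group S R) Q"
    "!!w. w \<in> words S ==> h (pres_rel S R `` {w}) = group.eval_word Q f w"
proof -
  interpret group Q by fact
  define h where "h c = eval_word f (SOME w. w \<in> c)" for c
  have h: "h (pres_rel S R `` {w}) = eval_word f w" if "w \<in> words S" for w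
  proof -
    have "(SOME u. u \<in> pres_rel S R `` {w}) \<in> pres_rel S R `` {w}"
      by (rule someI[of _ w]) (simp add: pres_rel.refl that)
    then show ?thesis
      unfolding h_def using pres_rel_eval[OF Q f R] by auto
  qed
  have car: "carrier (presented_group S R) = (\<lambda>w. pres_rel S R `` {w}) ` words S"
    by (auto simp: presented_group_def quotient_def)
  have "h \<in> hom (presented_group S R) Q"
  proof (rule homI)
    show "h c \<in> carrier Q" if "c \<in> carrier (presented_group S R)" for c
      using that h eval_word_closed[OF f] unfolding car by auto
    fix c d assume "c \<in> carrier (presented_group S R)" "d \<in> carrier (presented_group S R)"
    then obtain u w where uw: "u \<in> words S" "w \<in> words S"
      and c: "c = pres_rel S R `` {u}" and d: "d = pres_rel S R `` {w}"
      unfolding car by blast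
    have "h (c \<otimes>\<^bsub>presented_group S R\<^esub> d) = eval_word f (u @ w)"
      using uw h[of "u @ w"] by (simp add: c d pres_rel_mult)
    then show "h (c \<otimes>\<^bsub>presented_group S R\<^esub> d) = h c \<otimes>\<^bsub>Q\<^esub> h d"
      using uw h[OF uw(1)] h[OF uw(2)] by (simp add: c d eval_word_append[OF f])
  qed
  then show thesis using that h by blast
qed


section \<open>Graphs\<close>

subsection \<open>Potentials\<close>

text \<open>Connectedness by edges of \<open>F\<close> in either direction. The end maps are
  parameters because this serves both for the given graph and for a finite quotient graph whose
  edges are letters of a free group.\<close>

definition link :: "('e => 'v) => ('e => 'v) => 'e set => ('v \<times> 'v) set" where
  "link src tgt F = (\<Union>e\<in>F. {(src e, tgt e), (tgt e, src e)})\<^sup>*"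

lemma link_refl [simp]: "(v, v) \<in> link src tgt F"
  by (simp add: link_def)

lemma link_trans: "(u, v) \<in> link src tgt F ==> (v, w) \<in> link src tgt F ==> (u, w) \<in> link src tgt F"
  unfolding link_def by (rule rtrancl_trans)

lemma link_edge: "e \<in> F ==> (src e, tgt e) \<in> link src tgt F" "e \<in> F ==> (tgt e, src e) \<in> link src tgt F"
  by (auto simp: link_def intro!: r_into_rtrancl)

lemma link_step:
  "(u, v) \<in> link src tgt F ==> e \<in> F ==> (u, src e) \<in> link src tgt F \<longleftrightarrow> (u, tgt e) \<in> link src tgt F"
  using link_trans link_edge by meson

lemma link_induct [consumes 1, case_names refl forward backward]:
  assumes "(u, v) \<in> link src tgt F" "P u"
    "!!e. e \<in> F ==> (u, src e) \<in> link src tgt F ==> P (src e) ==> P (tgt e)"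
    "!!e. e \<in> F ==> (u, tgt e) \<in> link src tgt F ==> P (tgt e) ==> P (src e)"
  shows "P v"
  using assms(1) unfolding link_def
proof (induction rule: rtrancl_induct)
  case (step y z)
  then show ?case
    using assms(3,4) unfolding link_def by blast
qed (rule assms(2))

text \<open>An edge joining different components does not obstruct a potential: translate it on one of them.\<close>

lemma (in group) potential_insert:
  assumes q: "!!v. q v \<in> carrier G" and l: "!!f. f \<in> insert e F ==> l f \<in> carrier G"
    and F: "!!f. f \<in> F ==> q (src f) \<otimes> l f = q (tgt f)"
    and e: "(src e, tgt e) \<notin> link src tgt F"
  obtains q' where "!!v. q' v \<in> carrier G"
    "!!f. f \<in> insert e F ==> q' (src f) \<otimes> l f = q' (tgt f)"
proof -
  \<comment> \<open>Chosen such that \<open>c \<otimes> q (src e) \<otimes> l e = q (tgt e)\<close>.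
    Left translation of a whole component preserves the equations of its edges.\<close>
  define c where "c = q (tgt e) \<otimes> inv (q (src e) \<otimes> l e)"
  define q' where "q' v = (if (src e, v) \<in> link src tgt F then c \<otimes> q v else q v)" for v
  have c: "c \<in> carrier G" using q l by (simp add: c_def)
  show thesis
  proof (rule that[of q'])
    show "q' v \<in> carrier G" for v
      using q c by (simp add: q'_def)
    fix f assume "f \<in> insert e F"
    then consider "f = e" | "f \<in> F" by blast
    then show "q' (src f) \<otimes> l f = q' (tgt f)"
    proof cases
      case 1
      then show ?thesis
        using e q l by (simp add: q'_def c_def word_simps)
    next
      case 2
      have "((src e, src f) \<in> link src tgt F) = ((src e, tgt f) \<in> link src tgt F)"
        using link_step[OF link_refl 2] .
      then show ?thesis
        using F[OF 2] q l[of f] 2 c by (simp add: q'_def m_assoc)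
    qed
  qed
qed

subsection \<open>Undirected walks\<close>

fun uwalk :: "('v, 'e) pre_digraph => 'v => ('e \<times> bool) list => 'v => bool" where
  "uwalk D u [] v \<longleftrightarrow> u = v"
| "uwalk D u (s # p) v \<longleftrightarrow> step_src D s = u \<and> uwalk D (step_tgt D s) p v"

definition usimple :: "('v, 'e) pre_digraph => 'v => ('e \<times> bool) list => bool" where
  "usimple D u p \<longleftrightarrow> distinct (u # map (step_tgt D) p)"

lemma uwalk_append: "uwalk D u (p @ q) w \<longleftrightarrow> (\<exists>v. uwalk D u p v \<and> uwalk D v q w)"
  by (induction p arbitrary: u) auto

lemma uwalk_vertices: "uwalk D u p v ==> map (step_src D) p @ [v] = u # map (step_tgt D) p"
  by (induction p arbitrary: u) auto

lemma uwalk_hd_last: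
  "uwalk D u p v ==> p \<noteq> [] ==> step_src D (hd p) = u \<and> step_tgt D (last p) = v"
  by (induction p arbitrary: u) auto

lemma uwalk_nth:
  "uwalk D u p v ==> Suc i < length p ==> step_tgt D (p ! i) = step_src D (p ! Suc i)"
proof (induction p arbitrary: u i)
  case (Cons s p)
  then have w: "uwalk D (step_tgt D s) p v" by simp
  show ?case
  proof (cases i)
    case 0
    then have "p \<noteq> []" using Cons.prems(2) by auto
    then show ?thesis using uwalk_hd_last[OF w] 0 by (simp add: hd_conv_nth)
  next
    case (Suc k)
    then show ?thesis using Cons.IH[OF w, of k] Cons.prems(2) by simp
  qed
qed simp

lemma uwalk_suffix:
  assumes "uwalk D u p v" "usimple D u p" "x \<in> set (u # map (step_tgt D) p)"
  shows "\<exists>q. uwalk D x q v \<and> usimple D x q \<and> set q \<subseteq> set p"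
  using assms
proof (induction p arbitrary: u)
  case (Cons s p)
  show ?case
  proof (cases "x = u")
    case True
    then show ?thesis using Cons.prems by blast
  next
    case False
    then have "\<exists>q. uwalk D x q v \<and> usimple D x q \<and> set q \<subseteq> set p"
      using Cons.prems by (intro Cons.IH[of "step_tgt D s"]) (auto simp: usimple_def)
    then show ?thesis by auto
  qed
qed (auto simp: usimple_def)

text \<open>Edges are put in front one at a time. If the new vertex already lies on the walk, the
  part of the walk from there on is taken instead.\<close>

lemma link_usimple_walk:
  assumes "(u, v) \<in> link (head D) (tail D) F"
  shows "\<exists>p. uwalk D u p v \<and> usimple D u p \<and> fst ` set p \<subseteq> F"
proof -
  have ext: "\<exists>p. uwalk D x p v \<and> usimple D x p \<and> fst ` set p \<subseteq> F"
    if p: "uwalk D y p v" "usimple D y p" "fst ` set p \<subseteq> F"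
      and s: "step_src D s = x" "step_tgt D s = y" "fst s \<in> F" for x y p s
  proof (cases "x \<in> set (y # map (step_tgt D) p)")
    case True
    then show ?thesis using uwalk_suffix[OF p(1,2)] p(3) by blast
  next
    case False
    then show ?thesis
      using p s by (intro exI[of _ "s # p"]) (auto simp: usimple_def)
  qed
  show ?thesis
    using assms unfolding link_def
  proof (induction rule: converse_rtrancl_induct)
    case base
    show ?case by (intro exI[of _ "[]"]) (simp add: usimple_def)
  next
    case (step y z)
    then obtain e where "e \<in> F" "(y, z) = (head D e, tail D e) \<or> (y, z) = (tail D e, head D e)"
      by auto
    then show ?case
      using step.IH ext[of z _ "(e, False)" y] ext[of z _ "(e, True)" y]
      by (auto simp: step_src_def step_tgt_def)
  qed
qed

text \<open>A second passage through the first arc would visit the starting vertex again, whatever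
  the direction.\<close>

lemma usimple_distinct_arcs:
  "uwalk D u p v ==> usimple D u p ==> distinct (map fst p)"
proof (induction p arbitrary: u)
  case (Cons s p)
  have w: "uwalk D (step_tgt D s) p v" "step_src D s = u"
    using Cons.prems(1) by auto
  have u: "u \<notin> set (step_tgt D s # map (step_tgt D) p)"
    using Cons.prems(2) by (simp add: usimple_def)
  have "fst s \<notin> fst ` set p"
  proof
    assume "fst s \<in> fst ` set p"
    then obtain s' where s': "s' \<in> set p" "fst s' = fst s" by auto
    then have "u = step_src D s' \<or> u = step_tgt D s'"
      using w(2) by (auto simp: step_src_def step_tgt_def)
    moreover have "step_src D s' \<in> set (step_tgt D s # map (step_tgt D) p)"
      using s'(1) unfolding uwalk_vertices[OF w(1), symmetric] by simp
    ultimately show False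
      using u s'(1) by auto
  qed
  then show ?case
    using Cons.IH[OF w(1)] Cons.prems(2) by (simp add: usimple_def)
qed simp

text \<open>A simple walk between the ends of \<open>e\<close> is closed by \<open>e\<close> to a
  circuit. Contrapositively, an edge of a tree always joins different components of a set of other
  edges, as \<open>potential_insert\<close> demands.\<close>

lemma circuit_of_link:
  assumes e: "e \<in> arcs D" "e \<notin> F" "F \<subseteq> arcs D" and link: "(head D e, tail D e) \<in> link (head D) (tail D) F"
  shows "\<exists>p. circuit D p"
proof -
  obtain q where q: "uwalk D (head D e) q (tail D e)" "usimple D (head D e) q" "fst ` set q \<subseteq> F"
    using link_usimple_walk[OF link] by blast
  let ?p = "q @ [(e, True)]"
  have w: "uwalk D (head D e) ?p (head D e)"
    using q(1) by (auto simp: uwalk_append step_src_def step_tgt_def)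
  have "map (step_src D) ?p = head D e # map (step_tgt D) q"
    using uwalk_vertices[OF q(1)] by (simp add: step_src_def)
  then have "distinct (map (step_src D) ?p)"
    using q(2) by (simp only: usimple_def)
  moreover have "distinct (map fst ?p)"
    using usimple_distinct_arcs[OF q(1,2)] q(3) e(2) by auto
  ultimately have "circuit D ?p"
    using uwalk_nth[OF w] uwalk_hd_last[OF w] q(3) e unfolding circuit_def by auto
  then show ?thesis ..
qed


subsection \<open>Maximal subtrees\<close>

lemma connected_iff_link:
  assumes "wf_digraph D"
  shows "connected D \<longleftrightarrow> verts D \<noteq> {} \<and> (\<forall>u\<in>verts D. \<forall>v\<in>verts D. (u, v) \<in> link (head D) (tail D) (arcs D))"
proof -
  interpret wf_digraph D by fact
  have ends: "arcs_ends (with_proj (mk_symmetric D)) = (\<Union>e\<in>arcs D. {(head D e, tail D e), (tail D e, head D e)})"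
    by (auto simp: arcs_ends_conv mk_symmetric_def)
  have V: "verts (with_proj (mk_symmetric D)) = verts D"
    by (simp add: mk_symmetric_def)
  have "(u, v) \<in> rtrancl_on (verts D) (\<Union>e\<in>arcs D. {(head D e, tail D e), (tail D e, head D e)})
    \<longleftrightarrow> (u, v) \<in> link (head D) (tail D) (arcs D)" if u: "u \<in> verts D" for u v
  proof
    assume "(u, v) \<in> link (head D) (tail D) (arcs D)"
    then show "(u, v) \<in> rtrancl_on (verts D) (\<Union>e\<in>arcs D. {(head D e, tail D e), (tail D e, head D e)})"
      unfolding link_def
    proof (induction rule: rtrancl_induct)
      case (step y z)
      then show ?case
        by (intro rtrancl_on_into_rtrancl_on[OF step.IH]) auto
    qed (use u in auto)
  qed (unfold link_def, rule rtrancl_on_rtranclI)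
  then show ?thesis
    unfolding connected_def strongly_connected_def reachable_def ends V by blast
qed

locale maximal_subtree_of =
  fixes D T :: "('v, 'e) pre_digraph"
  assumes D: "fin_digraph D" "connected D" and T: "maximal_subtree D T"
begin

sublocale D: fin_digraph D by (rule D(1))

lemma T_sub: "verts T \<subseteq> verts D" "arcs T \<subseteq> arcs D" "wf_digraph T" "tail T = tail D" "head T = head D"
  using T by (auto simp: maximal_subtree_def D.max_subgraph_def subgraph_def compatible_def)

lemma T_tree: "undirected_tree T"
  using T by (auto simp: maximal_subtree_def D.max_subgraph_def)

lemma T_max: "subgraph T H ==> subgraph H D ==> undirected_tree H ==> H = T"
  using T unfolding maximal_subtree_def D.max_subgraph_def by blast

lemma circuit_next:
  assumes p: "circuit H p" and s: "s \<in> set p"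
  obtains s' where "s' \<in> set p" "step_src H s' = step_tgt H s"
proof -
  obtain i where i: "i < length p" "p ! i = s"
    using s by (auto simp: in_set_conv_nth)
  show thesis
  proof (cases "Suc i < length p")
    case True
    then show ?thesis using p i that[of "p ! Suc i"] by (auto simp: circuit_def)
  next
    case False
    then have "last p = s"
    proof -
      have "p \<noteq> []" "i = length p - 1" using i False by auto
      then show ?thesis using i(2) by (simp add: last_conv_nth)
    qed
    then show ?thesis
      using p that[of "hd p"] by (auto simp: circuit_def)
  qed
qed

lemma circuit_prev:
  assumes p: "circuit H p" and s: "s \<in> set p"
  obtains s' where "s' \<in> set p" "step_tgt H s' = step_src H s"
proof -
  obtain i where i: "i < length p" "p ! i = s"
    using s by (auto simp: in_set_conv_nth)
  show thesis
  proof (cases i)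
    case 0
    then have "hd p = s" using i by (cases p) auto
    then show ?thesis
      using p that[of "last p"] by (auto simp: circuit_def)
  next
    case (Suc j)
    then show ?thesis using p i that[of "p ! j"] by (auto simp: circuit_def)
  qed
qed

lemma circuit_arc_unique: "circuit H p ==> s \<in> set p ==> s' \<in> set p ==> fst s = fst s' ==> s = s'"
  unfolding circuit_def distinct_map by (auto dest: inj_onD)

text \<open>Otherwise connectedness yields an edge with exactly one end in \<open>T\<close>. Adding
  it makes the other end a leaf, through which no circuit passes, so \<open>T\<close> was not
  maximal.\<close>

lemma verts_T: "verts T = verts D"
proof (rule ccontr)
  assume "verts T \<noteq> verts D"
  then obtain y where y: "y \<in> verts D" "y \<notin> verts T"
    using T_sub(1) by auto
  have conT: "verts T \<noteq> {}" "!!u v. u \<in> verts T ==> v \<in> verts T ==> (u, v) \<in> link (head D) (tail D) (arcs T)"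
    using T_tree connected_iff_link[OF T_sub(3)] T_sub(4,5) by (auto simp: undirected_tree_def)
  obtain u where u: "u \<in> verts T" using conT(1) by blast
  have "(u, y) \<in> link (head D) (tail D) (arcs D)"
    using D(2) connected_iff_link[OF D.wf_digraph_axioms] u y T_sub(1) by blast
  have "\<exists>e\<in>arcs D. \<exists>x z. {head D e, tail D e} = {x, z} \<and> x \<notin> verts T \<and> z \<in> verts T"
  proof (rule ccontr)
    assume no: "\<not> ?thesis"
    have "y \<in> verts T"
      using \<open>(u, y) \<in> _\<close>
    proof (induction rule: link_induct)
      case (forward e)
      then show ?case using no by blast
    next
      case (backward e)
      then show ?case using no by blast
    qed (rule u)
    then show False using y by simp
  qed
  then obtain e x z where e: "e \<in> arcs D" "{head D e, tail D e} = {x, z}" "x \<notin> verts T" "z \<in> verts T"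
    by blast
  define H where "H = T\<lparr>verts := insert x (verts T), arcs := insert e (arcs T)\<rparr>"
  have H: "verts H = insert x (verts T)" "arcs H = insert e (arcs T)" "tail H = tail D" "head H = head D"
    by (simp_all add: H_def T_sub)
  have ends: "head D e \<in> {x, z}" "tail D e \<in> {x, z}" using e(2) by auto
  have wfT: "tail D f \<in> verts T" "head D f \<in> verts T" if "f \<in> arcs T" for f
    using wf_digraph.tail_in_verts[OF T_sub(3) that] wf_digraph.head_in_verts[OF T_sub(3) that] T_sub
    by auto
  have wfH: "wf_digraph H"
    using wfT ends e(4) by unfold_locales (auto simp: H)
  have "x \<in> verts D" using e(1,2) D.head_in_verts D.tail_in_verts by (auto simp: doubleton_eq_iff)
  then have sub: "subgraph T H" "subgraph H D"
    using T_sub wfH D.wf_digraph_axioms e(1) by (auto simp: subgraph_def H compatible_def)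
  have mono: "link (head D) (tail D) (arcs T) \<subseteq> link (head D) (tail D) (arcs H)"
    unfolding link_def H(2) by (intro rtrancl_mono) auto
  have xz: "(x, z) \<in> link (head D) (tail D) (arcs H)" "(z, x) \<in> link (head D) (tail D) (arcs H)"
    using link_edge(1)[of e "arcs H" "head D" "tail D"] link_edge(2)[of e "arcs H" "tail D" "head D"] e(2)
    unfolding H(2) by (auto simp: doubleton_eq_iff)
  have "(v, z) \<in> link (head D) (tail D) (arcs H)" "(z, v) \<in> link (head D) (tail D) (arcs H)"
    if "v \<in> verts H" for v
    using that conT(2)[OF _ e(4)] conT(2)[OF e(4)] mono xz unfolding H(1) by auto
  then have "connected H"
    unfolding connected_iff_link[OF wfH] using H link_trans by (metis empty_iff insertI1)
  moreover have "\<not> circuit H p" for p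
  proof
    assume p: "circuit H p"
    have st: "step_src H = step_src T" "step_tgt H = step_tgt T"
      by (auto simp: fun_eq_iff step_src_def step_tgt_def H T_sub)
    \<comment> \<open>\<open>e\<close> is the only arc at the new vertex \<open>x\<close>, while a
      circuit enters and leaves \<open>x\<close> through different arcs.\<close>
    have x_e: "fst s = e" if "s \<in> set p" "step_src H s = x \<or> step_tgt H s = x" for s
    proof -
      have "fst s \<in> arcs H" using p that(1) by (auto simp: circuit_def)
      then show ?thesis
        using that(2) wfT e(3) by (auto simp: H step_src_def step_tgt_def split: if_splits)
    qed
    show False
    proof (cases "e \<in> fst ` set p")
      case True
      then obtain s where s: "s \<in> set p" "fst s = e" by auto
      have xz_ne: "x \<noteq> z" using e by auto
      have s_ends: "{step_src H s, step_tgt H s} = {x, z}"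
        using s(2) e(2) by (auto simp: step_src_def step_tgt_def H)
      then consider "step_tgt H s = x" | "step_src H s = x" by (auto simp: doubleton_eq_iff)
      then show ?thesis
      proof cases
        case 1
        obtain s' where "s' \<in> set p" "step_src H s' = x" using circuit_next[OF p s(1)] 1 by metis
        then have "s' = s" using x_e circuit_arc_unique[OF p] s by metis
        then show ?thesis using \<open>step_src H s' = x\<close> 1 s_ends xz_ne by auto
      next
        case 2
        obtain s' where "s' \<in> set p" "step_tgt H s' = x" using circuit_prev[OF p s(1)] 2 by metis
        then have "s' = s" using x_e circuit_arc_unique[OF p] s by metis
        then show ?thesis using \<open>step_tgt H s' = x\<close> 2 s_ends xz_ne by auto
      qed
    next
      case False
      then have "circuit T p"
        using p unfolding circuit_def st H(2) by auto
      then show ?thesis using T_tree by (auto simp: undirected_tree_def)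
    qed
  qed
  ultimately have "H = T"
    using T_max[OF sub] by (simp add: undirected_tree_def)
  then show False using H(1) e(3) by auto
qed

lemma link_T: "u \<in> verts D ==> v \<in> verts D ==> (u, v) \<in> link (head D) (tail D) (arcs T)"
  using T_tree connected_iff_link[OF T_sub(3)] T_sub(4,5) verts_T by (auto simp: undirected_tree_def)

lemma tree_induct [consumes 2, case_names root edge]:
  assumes "u \<in> verts D" "v \<in> verts D" "P u"
    and "!!e. e \<in> arcs T ==> P (tail D e) \<longleftrightarrow> P (head D e)"
  shows "P v"
  using link_T[OF assms(1,2)] by (induction rule: link_induct) (use assms(3,4) in auto)

text \<open>The edges of \<open>T\<close> are inserted one by one. Each of them joins different
  components of the previous ones, since \<open>T\<close> has no circuit.\<close>

lemma tree_potential: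
  assumes Q: "group Q" and l: "!!e. e \<in> arcs T ==> l e \<in> carrier Q"
  obtains q where "!!v. q v \<in> carrier Q" "!!e. e \<in> arcs T ==> q (head D e) \<otimes>\<^bsub>Q\<^esub> l e = q (tail D e)"
proof -
  interpret Q: group Q by fact
  have fin: "finite (arcs T)"
    by (rule finite_subset[OF T_sub(2)]) simp
  have "\<exists>q. (\<forall>v. q v \<in> carrier Q) \<and> (\<forall>e\<in>F. q (head D e) \<otimes>\<^bsub>Q\<^esub> l e = q (tail D e))"
    if "F \<subseteq> arcs T" for F
    using finite_subset[OF that fin] that
  proof (induction F rule: finite_induct)
    case empty
    show ?case by (intro exI[of _ "\<lambda>_. \<one>\<^bsub>Q\<^esub>"]) simp
  next
    case (insert e F)
    then obtain q where q: "!!v. q v \<in> carrier Q" "!!e. e \<in> F ==> q (head D e) \<otimes>\<^bsub>Q\<^esub> l e = q (tail D e)"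
      by auto
    have "(head D e, tail D e) \<notin> link (head D) (tail D) F"
      using circuit_of_link[of e T F] insert.hyps insert.prems T_tree T_sub(4,5)
      by (auto simp: undirected_tree_def)
    then obtain q' where "!!v. q' v \<in> carrier Q"
      "!!f. f \<in> insert e F ==> q' (head D f) \<otimes>\<^bsub>Q\<^esub> l f = q' (tail D f)"
      using Q.potential_insert[of q e F l "head D" "tail D"] q l insert.prems by blast
    then show ?case
      by (intro exI[of _ q']) blast
  qed
  from this[OF subset_refl] obtain q where "\<forall>v. q v \<in> carrier Q"
    "\<forall>e\<in>arcs T. q (head D e) \<otimes>\<^bsub>Q\<^esub> l e = q (tail D e)"
    by blast
  then show thesis
    by (intro that[of q]) auto
qed

end

section \<open>Semidirect products of free groups\<close>

definition map_letter :: "('s => 't) => bool \<times> 's => bool \<times> 't" where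
  "map_letter f a = (fst a, f (snd a))"

definition map_word :: "('s => 't) => 's word => 't word" where
  "map_word f w = map (map_letter f) w"

lemma map_letter_simps [simp]: "map_letter f (b, s) = (b, f s)" "snd (map_letter f a) = f (snd a)"
  by (simp_all add: map_letter_def)

lemma map_word_simps [simp]:
  "map_word f [] = []" "map_word f (a # w) = map_letter f a # map_word f w"
  "map_word f (u @ w) = map_word f u @ map_word f w" "length (map_word f w) = length w"
  "map_word f w = [] \<longleftrightarrow> w = []" "tl (map_word f w) = map_word f (tl w)"
  by (simp_all add: map_word_def map_tl)

lemma hd_map_word: "w \<noteq> [] ==> hd (map_word f w) = map_letter f (hd w)"
  by (simp add: map_word_def hd_map)

lemma map_letter_inv_letter: "map_letter f (inv_letter a) = inv_letter (map_letter f a)"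
  by (cases a) simp

lemma map_letter_eq_iff:
  assumes "inj_on f S" "snd a \<in> S" "snd b \<in> S"
  shows "map_letter f a = map_letter f b \<longleftrightarrow> a = b"
  using assms by (cases a; cases b) (auto dest: inj_onD)

lemma map_word_reduced:
  assumes "inj_on f S" "w \<in> words S"
  shows "reduced (map_word f w) \<longleftrightarrow> reduced w"
  using assms(2)
proof (induction w)
  case (Cons a w)
  then have w: "w \<in> words S" "snd a \<in> S" by (auto simp: words_iff)
  have "hd (map_word f w) = inv_letter (map_letter f a) \<longleftrightarrow> hd w = inv_letter a" if "w \<noteq> []"
    using that w map_letter_eq_iff[OF assms(1), of "hd w" "inv_letter a"]
    by (cases w) (auto simp: words_iff map_letter_inv_letter)
  then show ?case
    using Cons.IH[OF w(1)] by (auto simp: reduced_Cons)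
qed simp

lemma map_word_rcons:
  assumes "inj_on f S" "w \<in> words S" "snd a \<in> S"
  shows "map_word f (rcons a w) = rcons (map_letter f a) (map_word f w)"
proof (cases "w = []")
  case False
  then have "hd (map_word f w) = inv_letter (map_letter f a) \<longleftrightarrow> hd w = inv_letter a"
    using assms map_letter_eq_iff[OF assms(1), of "hd w" "inv_letter a"]
    by (cases w) (auto simp: words_iff map_letter_inv_letter)
  then show ?thesis using False by (auto simp: rcons_def)
qed (simp add: rcons_def)

lemma map_word_foldr_rcons:
  assumes "inj_on f S" "u \<in> words S" "w \<in> words S"
  shows "map_word f (foldr rcons u w) = foldr rcons (map_word f u) (map_word f w)"
  using assms(2)
proof (induction u)
  case (Cons a u)
  then have "u \<in> words S" "snd a \<in> S" by (auto simp: words_iff)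
  then show ?case
    using Cons.IH map_word_rcons[OF assms(1) foldr_rcons_words[OF _ assms(3)]] by simp
qed simp

text \<open>The first components are the vertices of the Cayley tree of the free group. The group
  acts on this tree, \<open>P\<close> being the stabiliser of the empty word and permuting the
  letters.\<close>

definition free_semidirect ::
  "'s set => ('p, 'q) monoid_scheme => ('p => 's => 's) => ('s word \<times> 'p) monoid" where
  "free_semidirect S P act = \<lparr>carrier = carrier (free_group S) \<times> carrier P,
    monoid.mult = (\<lambda>x y. (foldr rcons (fst x) (map_word (act (snd x)) (fst y)), snd x \<otimes>\<^bsub>P\<^esub> snd y)),
    one = ([], \<one>\<^bsub>P\<^esub>)\<rparr>"

locale letter_action = P: group P for P (structure) +
  fixes S :: "'s set" and act :: "'a => 's => 's"
  assumes act_closed: "p \<in> carrier P ==> s \<in> S ==> act p s \<in> S"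
    and act_one: "s \<in> S ==> act \<one> s = s"
    and act_mult: "p \<in> carrier P ==> q \<in> carrier P ==> s \<in> S ==> act (p \<otimes> q) s = act p (act q s)"
begin

abbreviation X :: "('s word \<times> 'a) monoid" where
  "X \<equiv> free_semidirect S P act"

lemma X_simps:
  "x \<in> carrier X \<longleftrightarrow> fst x \<in> words S \<and> reduced (fst x) \<and> snd x \<in> carrier P"
  "x \<otimes>\<^bsub>X\<^esub> y = (foldr rcons (fst x) (map_word (act (snd x)) (fst y)), snd x \<otimes> snd y)"
  "\<one>\<^bsub>X\<^esub> = ([], \<one>)"
  by (cases x) (auto simp: free_semidirect_def free_group_simps)

lemma act_inj: "p \<in> carrier P ==> inj_on (act p) S"
  by (rule inj_on_inverseI[where g = "act (inv p)"]) (simp add: act_mult[symmetric] act_one)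

lemma map_word_closed: "p \<in> carrier P ==> w \<in> words S ==> map_word (act p) w \<in> words S"
  by (auto simp: words_iff act_closed map_word_def)

lemma map_word_one: "w \<in> words S ==> map_word (act \<one>) w = w"
  unfolding map_word_def by (rule map_idI) (auto simp: words_iff act_one prod_eq_iff map_letter_def)

lemma map_word_mult:
  "p \<in> carrier P ==> q \<in> carrier P ==> w \<in> words S ==>
    map_word (act (p \<otimes> q)) w = map_word (act p) (map_word (act q) w)"
  by (auto simp: words_iff act_mult map_word_def map_letter_def)

lemma group_X: "group X"
proof (rule groupI)
  fix x y assume xy: "x \<in> carrier X" "y \<in> carrier X"
  then show "x \<otimes>\<^bsub>X\<^esub> y \<in> carrier X"
    by (simp add: X_simps foldr_rcons_words map_word_closed reduced_foldr_rcons
        map_word_reduced[OF act_inj])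
  fix z assume z: "z \<in> carrier X"
  have "foldr rcons (foldr rcons (fst x) (map_word (act (snd x)) (fst y)))
      (map_word (act (snd x \<otimes> snd y)) (fst z)) =
    foldr rcons (fst x) (map_word (act (snd x)) (foldr rcons (fst y) (map_word (act (snd y)) (fst z))))"
    using xy z
    by (subst map_word_foldr_rcons[OF act_inj])
      (simp_all add: X_simps map_word_closed map_word_mult foldr_rcons_assoc
        map_word_reduced[OF act_inj])
  then show "x \<otimes>\<^bsub>X\<^esub> y \<otimes>\<^bsub>X\<^esub> z = x \<otimes>\<^bsub>X\<^esub> (y \<otimes>\<^bsub>X\<^esub> z)"
    using xy z by (simp add: X_simps P.m_assoc)
next
  fix x assume x: "x \<in> carrier X"
  then show "\<one>\<^bsub>X\<^esub> \<otimes>\<^bsub>X\<^esub> x = x"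
    by (cases x) (simp add: X_simps map_word_one)
  let ?y = "(map_word (act (inv (snd x))) (inv_word (fst x)), inv (snd x))"
  have "inv_word (fst x) \<in> words S"
    using x by (simp add: X_simps words_iff)
  then have "?y \<in> carrier X"
    using x by (simp add: X_simps map_word_closed map_word_reduced[OF act_inj])
  moreover have "?y \<otimes>\<^bsub>X\<^esub> x = \<one>\<^bsub>X\<^esub>"
    using x \<open>inv_word (fst x) \<in> words S\<close>
    by (simp add: X_simps map_word_foldr_rcons[OF act_inj, symmetric] inv_word_mult)
  ultimately show "\<exists>y\<in>carrier X. y \<otimes>\<^bsub>X\<^esub> x = \<one>\<^bsub>X\<^esub>" ..
qed (simp add: X_simps)

sublocale X: group X by (rule group_X)

lemma inv_X:
  assumes x: "x \<in> carrier X"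
  shows "inv\<^bsub>X\<^esub> x = (map_word (act (inv (snd x))) (inv_word (fst x)), inv (snd x))" (is "_ = ?y")
proof (rule X.inv_equality[OF _ x])
  have w: "inv_word (fst x) \<in> words S"
    using x by (simp add: X_simps words_iff)
  then show "?y \<in> carrier X"
    using x by (simp add: X_simps map_word_closed map_word_reduced[OF act_inj])
  show "?y \<otimes>\<^bsub>X\<^esub> x = \<one>\<^bsub>X\<^esub>"
    using x w
    by (simp add: X_simps map_word_foldr_rcons[OF act_inj, symmetric] inv_word_mult)
qed

lemma fst_inv_mult:
  assumes "x \<in> carrier X" "y \<in> carrier X"
  shows "fst (inv\<^bsub>X\<^esub> x \<otimes>\<^bsub>X\<^esub> y) =
    map_word (act (inv (snd x))) (foldr rcons (inv_word (fst x)) (fst y))"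
proof -
  have "inv_word (fst x) \<in> words S"
    using assms by (simp add: X_simps words_iff)
  then show ?thesis
    using assms by (simp add: inv_X X_simps map_word_foldr_rcons[OF act_inj])
qed

text \<open>Two elements lie in the same left coset of the stabiliser \<open>P\<close> of the empty
  word precisely when they carry the empty word to the same vertex.\<close>

lemma fst_inv_mult_Nil:
  assumes "x \<in> carrier X" "y \<in> carrier X"
  shows "fst (inv\<^bsub>X\<^esub> x \<otimes>\<^bsub>X\<^esub> y) = [] \<longleftrightarrow> fst x = fst y"
proof
  assume "fst (inv\<^bsub>X\<^esub> x \<otimes>\<^bsub>X\<^esub> y) = []"
  then have "foldr rcons (inv_word (fst x)) (fst y) = []"
    by (simp add: fst_inv_mult assms)
  then have "foldr rcons (fst x) [] = fst y"
    using foldr_rcons_inv_word[of "fst y" "inv_word (fst x)"] assms by (simp add: X_simps)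
  then show "fst x = fst y"
    using foldr_rcons_reduced[of "fst x" "[]"] assms by (simp add: X_simps)
next
  assume "fst x = fst y"
  then show "fst (inv\<^bsub>X\<^esub> x \<otimes>\<^bsub>X\<^esub> y) = []"
    using assms by (simp add: fst_inv_mult inv_word_mult X_simps(1))
qed

lemma snd_hom: "snd \<in> hom X P"
  by (auto simp: hom_def X_simps)

end


section \<open>The fundamental group of a graph of groups\<close>

text \<open>The isomorphism \<open>\<Phi>\<close> moves the presentation into an abstract group.
  After \<open>gen_induct\<close> and \<open>universal\<close> the words of the presentation
  disappear, and only \<open>\<epsilon>\<close>, \<open>t\<close> and their relations
  remain.\<close>

locale gog_group = group G for G :: "('g, 'b) monoid_scheme" (structure) +
  fixes \<Gamma> :: "('v, 'e, 'a) gog" and T :: "('v, 'e) pre_digraph"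
    and \<Phi> :: "('v, 'e, 'a) fg_gen word set => 'g"
  assumes gog: "finite_connected_graph_of_groups \<Gamma>"
    and maxT: "maximal_subtree (base \<Gamma>) T"
    and \<Phi>: "\<Phi> \<in> iso (fundamental_group \<Gamma> T) G"
begin

abbreviation "V \<equiv> verts (base \<Gamma>)"
abbreviation "E \<equiv> arcs (base \<Gamma>)"
abbreviation "org \<equiv> tail (base \<Gamma>)"
abbreviation "ter \<equiv> head (base \<Gamma>)"
abbreviation "A \<equiv> vgrp \<Gamma>"

sublocale T: maximal_subtree_of "base \<Gamma>" T
  using gog maxT by unfold_locales (auto simp: finite_connected_graph_of_groups_def fin_digraph_def
      fin_digraph_axioms_def wf_digraph_def)

lemma A_group: "v \<in> V ==> group (A v)"
  using gog by (simp add: finite_connected_graph_of_groups_def)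

lemma esub_subgroup: "e \<in> E ==> subgroup (esub \<Gamma> e) (A (org e))"
  using gog by (simp add: finite_connected_graph_of_groups_def)

lemma emap_subgroup: "e \<in> E ==> subgroup (emap \<Gamma> e ` esub \<Gamma> e) (A (ter e))"
  using gog by (simp add: finite_connected_graph_of_groups_def)

lemma emap_hom: "e \<in> E ==> emap \<Gamma> e \<in> hom (egrp \<Gamma> e) (A (ter e))"
  using gog subgroup.subset[OF emap_subgroup]
  by (fastforce simp: finite_connected_graph_of_groups_def iso_def hom_def egrp_def)

lemma emap_inj: "e \<in> E ==> inj_on (emap \<Gamma> e) (esub \<Gamma> e)"
  using gog by (simp add: finite_connected_graph_of_groups_def iso_def bij_betw_def egrp_def)

lemma esub_closed: "e \<in> E ==> g \<in> esub \<Gamma> e ==> g \<in> carrier (A (org e))"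
  using subgroup.mem_carrier[OF esub_subgroup] .

lemma emap_closed: "e \<in> E ==> g \<in> esub \<Gamma> e ==> emap \<Gamma> e g \<in> carrier (A (ter e))"
  using subgroup.mem_carrier[OF emap_subgroup] by blast

definition \<theta> :: "('v, 'e, 'a) fg_gen word => 'g" where
  "\<theta> w = \<Phi> (pres_rel (fg_gens \<Gamma>) (fg_rels \<Gamma> T) `` {w})"

definition \<epsilon> :: "'v => 'a => 'g" where "\<epsilon> v g = \<theta> [(True, Elt v g)]"
definition t :: "'e => 'g" where "t e = \<theta> [(True, Stable e)]"

lemma gens: "Elt v g \<in> fg_gens \<Gamma> \<longleftrightarrow> v \<in> V \<and> g \<in> carrier (A v)" "Stable e \<in> fg_gens \<Gamma> \<longleftrightarrow> e \<in> E"
  by (auto simp: fg_gens_def)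

lemma carrier_fg: "carrier (fundamental_group \<Gamma> T) =
    (\<lambda>w. pres_rel (fg_gens \<Gamma>) (fg_rels \<Gamma> T) `` {w}) ` words (fg_gens \<Gamma>)"
  by (auto simp: fundamental_group_def presented_group_def quotient_def)

lemma \<theta>_closed: "w \<in> words (fg_gens \<Gamma>) ==> \<theta> w \<in> carrier G"
  using \<Phi> by (auto simp: \<theta>_def iso_def hom_def carrier_fg)

lemma \<theta>_append:
  assumes "u \<in> words (fg_gens \<Gamma>)" "w \<in> words (fg_gens \<Gamma>)"
  shows "\<theta> (u @ w) = \<theta> u \<otimes> \<theta> w"
  using \<Phi> assms pres_rel_mult[OF assms, of "fg_rels \<Gamma> T"]
  by (fastforce simp: \<theta>_def iso_def hom_def carrier_fg fundamental_group_def[symmetric])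

lemma \<theta>_eq: "(u, w) \<in> pres_rel (fg_gens \<Gamma>) (fg_rels \<Gamma> T) ==> \<theta> u = \<theta> w"
  unfolding \<theta>_def using equiv_class_eq[OF equiv_pres_rel] by metis

lemma \<theta>_surj: "g \<in> carrier G ==> \<exists>w\<in>words (fg_gens \<Gamma>). g = \<theta> w"
  using \<Phi> by (auto simp: \<theta>_def iso_def bij_betw_def carrier_fg image_iff)

lemma \<theta>_Nil: "\<theta> [] = \<one>"
  using \<theta>_append[of "[]" "[]"] \<theta>_closed[of "[]"] by simp

lemma \<theta>_inv: "s \<in> fg_gens \<Gamma> ==> \<theta> [(False, s)] = inv (\<theta> [(True, s)])"
proof -
  assume s: "s \<in> fg_gens \<Gamma>"
  have "\<theta> [(False, s), (True, s)] = \<one>"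
    using \<theta>_eq[OF pres_rel.cancel[OF s, of False]] \<theta>_Nil by simp
  then show ?thesis
    using \<theta>_append[of "[(False, s)]" "[(True, s)]"] s \<theta>_closed[of "[(False, s)]"]
      \<theta>_closed[of "[(True, s)]"] by (simp add: inv_equality)
qed

lemma \<epsilon>_closed [simp]: "v \<in> V ==> g \<in> carrier (A v) ==> \<epsilon> v g \<in> carrier G"
  by (simp add: \<epsilon>_def \<theta>_closed gens)

lemma t_closed [simp]: "e \<in> E ==> t e \<in> carrier G"
  by (simp add: t_def \<theta>_closed gens)

lemma \<theta>_relation: "(u, w) \<in> fg_rels \<Gamma> T ==> u \<in> words (fg_gens \<Gamma>) ==> w \<in> words (fg_gens \<Gamma>) ==> \<theta> u = \<theta> w"
  by (intro \<theta>_eq pres_rel.relation)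

lemma \<epsilon>_mult:
  assumes "v \<in> V" "g \<in> carrier (A v)" "h \<in> carrier (A v)"
  shows "\<epsilon> v (g \<otimes>\<^bsub>A v\<^esub> h) = \<epsilon> v g \<otimes> \<epsilon> v h"
proof -
  have gh: "g \<otimes>\<^bsub>A v\<^esub> h \<in> carrier (A v)"
    using assms A_group by (simp add: group.is_monoid monoid.m_closed)
  have "\<theta> [(True, Elt v g), (True, Elt v h)] = \<theta> [(True, Elt v (g \<otimes>\<^bsub>A v\<^esub> h))]"
    by (rule \<theta>_relation) (use assms gh in \<open>auto simp: fg_rels_def gens\<close>)
  then show ?thesis
    using \<theta>_append[of "[(True, Elt v g)]" "[(True, Elt v h)]"] assms by (simp add: \<epsilon>_def gens)
qed

lemma \<epsilon>_hom: "v \<in> V ==> group_hom (A v) G (\<epsilon> v)"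
  using A_group group_axioms
  by (auto simp: group_hom_def group_hom_axioms_def hom_def \<epsilon>_mult)

lemma t_tree: "e \<in> arcs T ==> t e = \<one>"
proof -
  assume "e \<in> arcs T"
  then have e: "e \<in> E" "e \<in> arcs T" using T.T_sub(2) by auto
  have "\<theta> [(True, Stable e)] = \<theta> []"
    by (rule \<theta>_relation) (use e in \<open>auto simp: fg_rels_def gens\<close>)
  then show ?thesis by (simp add: t_def \<theta>_Nil)
qed

lemma t_conj:
  assumes "e \<in> E" "g \<in> esub \<Gamma> e"
  shows "t e \<otimes> \<epsilon> (org e) g \<otimes> inv (t e) = \<epsilon> (ter e) (emap \<Gamma> e g)"
proof -
  have g: "org e \<in> V" "ter e \<in> V" "g \<in> carrier (A (org e))" "emap \<Gamma> e g \<in> carrier (A (ter e))"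
    using assms esub_closed emap_closed by auto
  have "\<theta> [(True, Stable e), (True, Elt (org e) g), (False, Stable e)] =
      \<theta> [(True, Elt (ter e) (emap \<Gamma> e g))]"
    by (rule \<theta>_relation) (use assms g in \<open>auto simp: fg_rels_def gens\<close>)
  moreover have "\<theta> [(True, Stable e), (True, Elt (org e) g), (False, Stable e)] =
      t e \<otimes> \<epsilon> (org e) g \<otimes> inv (t e)"
    using \<theta>_append[of "[(True, Stable e)]" "[(True, Elt (org e) g), (False, Stable e)]"]
      \<theta>_append[of "[(True, Elt (org e) g)]" "[(False, Stable e)]"] \<theta>_inv[of "Stable e"] assms g
    by (simp add: t_def \<epsilon>_def gens m_assoc \<theta>_closed)
  ultimately show ?thesis by (simp add: \<epsilon>_def)
qed

text \<open>Generators are multiplied from the right, the end at which reduced paths grow. Inverses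
  of vertex elements need no case, being vertex elements.\<close>

lemma gen_induct [consumes 1, case_names one vertex stable stable_inv]:
  assumes "\<gamma> \<in> carrier G" "P \<one>"
    "!!\<gamma> v g. \<gamma> \<in> carrier G ==> P \<gamma> ==> v \<in> V ==> g \<in> carrier (A v) ==> P (\<gamma> \<otimes> \<epsilon> v g)"
    "!!\<gamma> e. \<gamma> \<in> carrier G ==> P \<gamma> ==> e \<in> E ==> P (\<gamma> \<otimes> t e)"
    "!!\<gamma> e. \<gamma> \<in> carrier G ==> P \<gamma> ==> e \<in> E ==> P (\<gamma> \<otimes> inv (t e))"
  shows "P \<gamma>"
proof -
  obtain w where w: "w \<in> words (fg_gens \<Gamma>)" "\<gamma> = \<theta> w"
    using \<theta>_surj[OF assms(1)] by blast
  have "P (\<theta> w)"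
    using w(1)
  proof (induction w rule: rev_induct)
    case Nil
    then show ?case by (simp add: \<theta>_Nil assms(2))
  next
    case (snoc a w)
    obtain b s where a: "a = (b, s)" by (cases a)
    have w: "w \<in> words (fg_gens \<Gamma>)" "s \<in> fg_gens \<Gamma>" using snoc.prems a by auto
    have eq: "\<theta> (w @ [a]) = \<theta> w \<otimes> \<theta> [(b, s)]"
      using w by (simp add: a \<theta>_append)
    show ?case
    proof (cases s)
      case (Elt v g)
      then have g: "v \<in> V" "g \<in> carrier (A v)" using w(2) by (auto simp: gens)
      have "inv (\<epsilon> v g) = \<epsilon> v (inv\<^bsub>A v\<^esub> g)"
        using group_hom.hom_inv[OF \<epsilon>_hom[OF g(1)] g(2)] by simp
      then have "\<theta> [(b, s)] = \<epsilon> v (if b then g else inv\<^bsub>A v\<^esub> g)"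
        using \<theta>_inv[OF w(2)] Elt by (cases b) (auto simp: \<epsilon>_def)
      moreover have "(if b then g else inv\<^bsub>A v\<^esub> g) \<in> carrier (A v)"
        using g group.inv_closed[OF A_group] by auto
      ultimately show ?thesis
        using assms(3)[OF \<theta>_closed[OF w(1)] snoc.IH[OF w(1)] g(1)] eq by simp
    next
      case (Stable e)
      then have e: "e \<in> E" using w(2) by (auto simp: gens)
      show ?thesis
        using assms(4,5)[OF \<theta>_closed[OF w(1)] snoc.IH[OF w(1)] e] eq \<theta>_inv[OF w(2)] Stable
        by (cases b) (auto simp: t_def)
    qed
  qed
  then show ?thesis using w by simp
qed

lemma universal:
  assumes Q: "group Q" and a: "!!v. v \<in> V ==> a v \<in> hom (A v) Q"
    and s: "!!e. e \<in> E ==> s e \<in> carrier Q"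
    and rel: "!!e g. e \<in> E ==> g \<in> esub \<Gamma> e ==>
      s e \<otimes>\<^bsub>Q\<^esub> a (org e) g \<otimes>\<^bsub>Q\<^esub> inv\<^bsub>Q\<^esub> (s e) = a (ter e) (emap \<Gamma> e g)"
    and tree: "!!e. e \<in> arcs T ==> s e = \<one>\<^bsub>Q\<^esub>"
  obtains h where "group_hom G Q h" "!!v g. v \<in> V ==> g \<in> carrier (A v) ==> h (\<epsilon> v g) = a v g"
    "!!e. e \<in> E ==> h (t e) = s e"
proof -
  interpret Q: group Q by fact
  define f where "f x = (case x of Elt v g => a v g | Stable e => s e)" for x
  have a_closed: "a v g \<in> carrier Q" if "v \<in> V" "g \<in> carrier (A v)" for v g
    using a that by (auto simp: hom_def)
  have f: "f ` fg_gens \<Gamma> \<subseteq> carrier Q"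
    using a_closed s by (auto simp: f_def fg_gens_def)
  have "Q.eval_word f u = Q.eval_word f w" if "(u, w) \<in> fg_rels \<Gamma> T" for u w
    using that unfolding fg_rels_def
  proof (elim UnE CollectE exE conjE)
    fix v g h assume "(u, w) = ([(True, Elt v g), (True, Elt v h)], [(True, Elt v (g \<otimes>\<^bsub>A v\<^esub> h))])"
      "v \<in> V" "g \<in> carrier (A v)" "h \<in> carrier (A v)"
    then show ?thesis
      using a[of v] a_closed group.is_monoid[OF A_group[of v]]
      by (auto simp: Q.letter_val_def f_def hom_def monoid.m_closed)
  next
    fix e g assume e: "(u, w) = ([(True, Stable e), (True, Elt (org e) g), (False, Stable e)],
        [(True, Elt (ter e) (emap \<Gamma> e g))])" "e \<in> E" "g \<in> esub \<Gamma> e"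
    have "a (org e) g \<in> carrier Q" "a (ter e) (emap \<Gamma> e g) \<in> carrier Q"
      using a_closed esub_closed[OF e(2,3)] emap_closed[OF e(2,3)] e(2) by auto
    then show ?thesis
      using e(1) rel[OF e(2,3)] s[OF e(2)] by (auto simp: Q.letter_val_def f_def Q.m_assoc)
  next
    fix e assume "(u, w) = ([(True, Stable e)], [])" "e \<in> E \<inter> arcs T"
    then show ?thesis
      using tree by (auto simp: Q.letter_val_def f_def)
  qed
  then obtain h0 where h0: "h0 \<in> hom (fundamental_group \<Gamma> T) Q"
    "!!w. w \<in> words (fg_gens \<Gamma>) ==> h0 (pres_rel (fg_gens \<Gamma>) (fg_rels \<Gamma> T) `` {w}) = Q.eval_word f w"
    unfolding fundamental_group_def
    by (rule_tac presented_group_hom[OF Q f, of "fg_rels \<Gamma> T"]) auto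
  define h where "h = h0 \<circ> inv_into (carrier (fundamental_group \<Gamma> T)) \<Phi>"
  have "inv_into (carrier (fundamental_group \<Gamma> T)) \<Phi> \<in> iso G (fundamental_group \<Gamma> T)"
    using \<Phi> group_presented_group by (intro group.iso_set_sym) (simp add: fundamental_group_def)
  then have "h \<in> hom G Q"
    using h0(1) unfolding h_def by (auto simp: iso_def hom_def Pi_iff)
  moreover have h\<theta>: "h (\<theta> w) = Q.eval_word f w" if "w \<in> words (fg_gens \<Gamma>)" for w
  proof -
    have "inj_on \<Phi> (carrier (fundamental_group \<Gamma> T))"
      using \<Phi> by (simp add: iso_def bij_betw_def)
    then show ?thesis
      using that h0(2) by (simp add: h_def \<theta>_def carrier_fg inv_into_f_f)
  qed
  have "h (\<epsilon> v g) = a v g" if "v \<in> V" "g \<in> carrier (A v)" for v g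
    using that a_closed h\<theta>[of "[(True, Elt v g)]"] by (simp add: \<epsilon>_def gens f_def Q.letter_val_def)
  moreover have "h (t e) = s e" if "e \<in> E" for e
    using that s h\<theta>[of "[(True, Stable e)]"] by (simp add: t_def gens f_def Q.letter_val_def)
  ultimately show thesis
    using Q group_axioms by (intro that[of h]) (auto simp: group_hom_def group_hom_axioms_def)
qed

text \<open>The stabiliser of a vertex of the Bass-Serre tree, namely of the coset of the vertex
  group at \<open>v\<close> represented by \<open>\<gamma>\<close>. That tree is not constructed;
  pairs \<open>(\<gamma>, v)\<close> stand for its vertices.\<close>

definition vgroup :: "'g => 'v => 'g set" where
  "vgroup \<gamma> v = (\<lambda>g. \<gamma> \<otimes> \<epsilon> v g \<otimes> inv \<gamma>) ` carrier (A v)"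

lemma vgroup_closed: "\<gamma> \<in> carrier G ==> v \<in> V ==> vgroup \<gamma> v \<subseteq> carrier G"
  by (auto simp: vgroup_def)

text \<open>Conjugation by \<open>z\<close> fixes \<open>H\<close> pointwise and carries the
  stabiliser of \<open>(\<gamma>, v)\<close> to that of
  \<open>(z \<otimes> \<gamma>, v)\<close>.\<close>

lemma vgroup_commuting:
  assumes "\<gamma> \<in> carrier G" "v \<in> V" "z \<in> carrier G" "H \<subseteq> vgroup \<gamma> v" "!!h. h \<in> H ==> z \<otimes> h = h \<otimes> z"
  shows "H \<subseteq> vgroup (z \<otimes> \<gamma>) v"
proof
  fix h assume h: "h \<in> H"
  then have hG: "h \<in> carrier G" using assms(4) vgroup_closed[OF assms(1,2)] by blast
  obtain g where g: "g \<in> carrier (A v)" "h = \<gamma> \<otimes> \<epsilon> v g \<otimes> inv \<gamma>"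
    using h assms(4) by (auto simp: vgroup_def)
  have "h = z \<otimes> h \<otimes> inv z"
    using assms(5)[OF h] hG assms(3) by (simp add: m_assoc)
  also have "\<dots> = z \<otimes> \<gamma> \<otimes> \<epsilon> v g \<otimes> inv (z \<otimes> \<gamma>)"
    using g assms by (simp add: word_simps)
  finally show "h \<in> vgroup (z \<otimes> \<gamma>) v"
    using g(1) by (auto simp: vgroup_def)
qed

end


section \<open>Normal forms\<close>

text \<open>The vertex groups and the stable letters are represented in an auxiliary group \<open>P\<close>. Then \<open>G\<close>
  acts on the Cayley tree of the free group on the pairs of an edge \<open>e\<close> and a coset of the image
  \<open>Q e\<close> of its edge group, by the twisted representation \<open>\<Theta>\<close>; the stable letter of \<open>e\<close> contributes
  the letter \<open>(e, Q e)\<close>. Reduced expressions in the sense of Bass and Serre yield reduced words.\<close>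

locale gog_rep = gog_group G \<Gamma> T \<Phi> + P: group P
  for G :: "('g, 'b) monoid_scheme" (structure)
    and \<Gamma> :: "('v, 'e, 'a) gog" and T and \<Phi> and P :: "('p, 'q) monoid_scheme" +
  fixes a :: "'v => 'a => 'p" and s :: "'e => 'p"
  assumes a_hom: "v \<in> V ==> a v \<in> hom (A v) P"
    and s_closed [simp]: "e \<in> E ==> s e \<in> carrier P"
    and s_conj: "e \<in> E ==> g \<in> esub \<Gamma> e ==> s e \<otimes>\<^bsub>P\<^esub> a (org e) g = a (ter e) (emap \<Gamma> e g) \<otimes>\<^bsub>P\<^esub> s e"
    and pinch_ter: "e \<in> E ==> g \<in> carrier (A (ter e)) ==>
      a (ter e) g \<in> a (ter e) ` emap \<Gamma> e ` esub \<Gamma> e ==> g \<in> emap \<Gamma> e ` esub \<Gamma> e"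
    and pinch_org: "e \<in> E ==> g \<in> carrier (A (org e)) ==>
      a (org e) g \<in> a (org e) ` esub \<Gamma> e ==> g \<in> esub \<Gamma> e"
begin

abbreviation mult_P (infixl "\<cdot>" 70) where "x \<cdot> y \<equiv> x \<otimes>\<^bsub>P\<^esub> y"
abbreviation inv_P ("inv\<^sub>P _" [81] 80) where "inv\<^sub>P x \<equiv> inv\<^bsub>P\<^esub> x"

text \<open>By the pinch assumptions a vertex element whose image lies in that of the edge group
  belongs to the edge group. They take the place of injectivity of \<open>a\<close>, which fails
  when \<open>P\<close> is a finite quotient of \<open>G\<close>.\<close>

definition Q :: "'e => 'p set" where "Q e = a (ter e) ` emap \<Gamma> e ` esub \<Gamma> e"

definition S :: "('e \<times> 'p set) set" where "S = E \<times> Pow (carrier P)"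

definition act :: "'p => 'e \<times> 'p set => 'e \<times> 'p set" where
  "act p x = (fst x, p <#\<^bsub>P\<^esub> snd x)"

sublocale letter_action P S act
proof unfold_locales
  show "act p x \<in> S" if "p \<in> carrier P" "x \<in> S" for p x
    using P.l_coset_subset_G[of "snd x" p] that by (auto simp: S_def act_def)
  show "act \<one>\<^bsub>P\<^esub> x = x" if "x \<in> S" for x
    using that by (auto simp: S_def act_def P.lcos_mult_one)
  show "act (p \<cdot> q) x = act p (act q x)" if "p \<in> carrier P" "q \<in> carrier P" "x \<in> S" for p q x
    using that by (auto simp: S_def act_def P.lcos_m_assoc)
qed

abbreviation mult_X (infixl "\<star>" 70) where "x \<star> y \<equiv> x \<otimes>\<^bsub>X\<^esub> y"
abbreviation inv_X ("inv\<^sub>X _" [81] 80) where "inv\<^sub>X x \<equiv> inv\<^bsub>X\<^esub> x"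

lemma a_closed [simp]: "v \<in> V ==> g \<in> carrier (A v) ==> a v g \<in> carrier P"
  using a_hom by (auto simp: hom_def)

lemma a_group_hom: "v \<in> V ==> group_hom (A v) P (a v)"
  using a_hom A_group P.is_group by (auto simp: group_hom_def group_hom_axioms_def)

lemma Q_subgroup: "e \<in> E ==> subgroup (Q e) P"
  unfolding Q_def using group_hom.subgroup_img_is_subgroup[OF a_group_hom emap_subgroup] by simp

lemma Q_sub: "e \<in> E ==> Q e \<subseteq> carrier P"
  using subgroup.subset[OF Q_subgroup] .

lemma coset_eqD:
  assumes "e \<in> E" "p \<in> carrier P" "p' \<in> carrier P" "p <#\<^bsub>P\<^esub> Q e = p' <#\<^bsub>P\<^esub> Q e"
  shows "inv\<^sub>P p \<cdot> p' \<in> Q e"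
proof -
  have "p' \<cdot> \<one>\<^bsub>P\<^esub> \<in> p' <#\<^bsub>P\<^esub> Q e"
    unfolding l_coset_def using subgroup.one_closed[OF Q_subgroup[OF assms(1)]] by blast
  then have "p' \<in> p <#\<^bsub>P\<^esub> Q e"
    using assms(3,4) by simp
  then obtain q where "q \<in> Q e" "p' = p \<cdot> q" unfolding l_coset_def by blast
  then show ?thesis
    using Q_sub[OF assms(1)] assms(2) by (auto simp: subset_iff)
qed

lemma coset_absorb:
  assumes "e \<in> E" "x \<in> Q e" shows "x <#\<^bsub>P\<^esub> Q e = Q e"
proof -
  interpret Q: subgroup "Q e" P by (rule Q_subgroup[OF assms(1)])
  show ?thesis
  proof
    show "x <#\<^bsub>P\<^esub> Q e \<subseteq> Q e"
      using assms(2) by (auto simp: l_coset_def)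
    show "Q e \<subseteq> x <#\<^bsub>P\<^esub> Q e"
    proof
      fix y assume y: "y \<in> Q e"
      have "y = x \<cdot> (inv\<^sub>P x \<cdot> y)"
        using assms(2) y by simp
      moreover have "inv\<^sub>P x \<cdot> y \<in> Q e"
        using assms(2) y by simp
      ultimately show "y \<in> x <#\<^bsub>P\<^esub> Q e"
        unfolding l_coset_def by blast
    qed
  qed
qed

definition edge_elt :: "'e => ('e \<times> 'p set) word \<times> 'p" where
  "edge_elt e = ([(True, (e, Q e))], s e)"

lemma letter_in_S: "(e, c) \<in> S \<longleftrightarrow> e \<in> E \<and> c \<subseteq> carrier P"
  by (auto simp: S_def)

lemma edge_elt_closed [simp]: "e \<in> E ==> edge_elt e \<in> carrier X"
  using letter_in_S[of e "Q e"] Q_sub by (simp add: X_simps edge_elt_def)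

lemma P_closed [simp]: "p \<in> carrier P ==> ([], p) \<in> carrier X"
  by (simp add: X_simps)

text \<open>Elements of \<open>Q e\<close> fix the coset \<open>Q e\<close> and hence the letter of
  the edge, so the relation of the stable letter holds in \<open>X\<close>.\<close>

lemma edge_elt_conj:
  assumes e: "e \<in> E" "g \<in> esub \<Gamma> e"
  shows "edge_elt e \<star> ([], a (org e) g) = ([], a (ter e) (emap \<Gamma> e g)) \<star> edge_elt e"
proof -
  have "a (ter e) (emap \<Gamma> e g) <#\<^bsub>P\<^esub> Q e = Q e"
    using coset_absorb[OF e(1)] e(2) by (simp add: Q_def)
  then show ?thesis
    by (simp add: X_simps edge_elt_def s_conj[OF e] act_def rcons_def)
qed

text \<open>Stable letters of edges of \<open>T\<close> are trivial in \<open>G\<close>, but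
  \<open>edge_elt\<close> never is, since it contains a letter. Conjugating the data at the vertex
  \<open>v\<close> by \<open>q v\<close> compensates for this.\<close>

definition potential :: "('v => ('e \<times> 'p set) word \<times> 'p) => bool" where
  "potential q \<longleftrightarrow> (\<forall>v. q v \<in> carrier X) \<and> (\<forall>e\<in>arcs T. q (ter e) \<star> edge_elt e = q (org e))"

definition twisted :: "('v => ('e \<times> 'p set) word \<times> 'p) => ('g => ('e \<times> 'p set) word \<times> 'p) => bool" where
  "twisted q \<Theta> \<longleftrightarrow> group_hom G X \<Theta> \<and>
    (\<forall>v\<in>V. \<forall>g\<in>carrier (A v). \<Theta> (\<epsilon> v g) = q v \<star> ([], a v g) \<star> inv\<^sub>X q v) \<and>
    (\<forall>e\<in>E. \<Theta> (t e) = q (ter e) \<star> edge_elt e \<star> inv\<^sub>X q (org e))"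

lemma potential_exists: obtains q where "potential q"
proof -
  have cl: "edge_elt e \<in> carrier X" if "e \<in> arcs T" for e
    using that T.T_sub(2) by auto
  show thesis
  proof (rule T.tree_potential[OF group_X cl])
    fix q assume "!!v. q v \<in> carrier X"
      "!!e. e \<in> arcs T ==> q (ter e) \<star> edge_elt e = q (org e)"
    then show thesis
      by (intro that[of q]) (simp add: potential_def)
  qed
qed

lemma twisted_exists:
  assumes "potential q"
  obtains \<Theta> where "twisted q \<Theta>"
proof -
  have q [simp]: "q v \<in> carrier X" for v
    using assms by (simp add: potential_def)
  obtain \<Theta> where "group_hom G X \<Theta>"
    "!!v g. v \<in> V ==> g \<in> carrier (A v) ==> \<Theta> (\<epsilon> v g) = q v \<star> ([], a v g) \<star> inv\<^sub>X q v"
    "!!e. e \<in> E ==> \<Theta> (t e) = q (ter e) \<star> edge_elt e \<star> inv\<^sub>X q (org e)"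
  proof (rule universal[OF group_X, of "\<lambda>v g. q v \<star> ([], a v g) \<star> inv\<^sub>X q v"
        "\<lambda>e. q (ter e) \<star> edge_elt e \<star> inv\<^sub>X q (org e)"])
    fix v assume v: "v \<in> V"
    interpret a: group_hom "A v" P "a v" by (rule a_group_hom[OF v])
    show "(\<lambda>g. q v \<star> ([], a v g) \<star> inv\<^sub>X q v) \<in> hom (A v) X"
    proof (rule homI)
      fix g h assume gh: "g \<in> carrier (A v)" "h \<in> carrier (A v)"
      have "([], a v g \<cdot> a v h) = ([], a v g) \<star> ([], a v h)"
        by (simp add: X_simps)
      then show "q v \<star> ([], a v (g \<otimes>\<^bsub>A v\<^esub> h)) \<star> inv\<^sub>X q v =
        q v \<star> ([], a v g) \<star> inv\<^sub>X q v \<star> (q v \<star> ([], a v h) \<star> inv\<^sub>X q v)"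
        using gh v by (simp add: X.m_assoc)
    qed (use v in simp)
  next
    fix e g assume e: "e \<in> E" "g \<in> esub \<Gamma> e"
    have g: "g \<in> carrier (A (org e))" "emap \<Gamma> e g \<in> carrier (A (ter e))"
      using esub_closed[OF e] emap_closed[OF e] by auto
    let ?a = "([], a (org e) g) :: ('e \<times> 'p set) word \<times> 'p" and ?b = "([], a (ter e) (emap \<Gamma> e g)) :: ('e \<times> 'p set) word \<times> 'p"
    have ab: "?a \<in> carrier X" "?b \<in> carrier X" using g e(1) by simp_all
    have "edge_elt e \<star> (?a \<star> x) = ?b \<star> (edge_elt e \<star> x)" if "x \<in> carrier X" for x
      using edge_elt_conj[OF e] ab e(1) that by (simp flip: X.m_assoc)
    then show "q (ter e) \<star> edge_elt e \<star> inv\<^sub>X q (org e) \<star>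
        (q (org e) \<star> ?a \<star> inv\<^sub>X q (org e)) \<star>
        inv\<^sub>X (q (ter e) \<star> edge_elt e \<star> inv\<^sub>X q (org e)) =
      q (ter e) \<star> ?b \<star> inv\<^sub>X q (ter e)"
      using ab e(1) by (simp add: X.word_simps)
  next
    fix e assume e: "e \<in> arcs T"
    then have "e \<in> E" "q (ter e) \<star> edge_elt e = q (org e)"
      using assms T.T_sub(2) by (auto simp: potential_def)
    then show "q (ter e) \<star> edge_elt e \<star> inv\<^sub>X q (org e) = \<one>\<^bsub>X\<^esub>"
      by simp
  qed auto
  then show thesis
    by (intro that[of \<Theta>]) (simp add: twisted_def)
qed

end

lemma eq_inv_letter_iff: "(c, s) = inv_letter b \<longleftrightarrow> b = (\<not> c, s)"
  by (cases b) auto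

lemma snoc_letter:
  assumes "reduced w"
  shows "foldr rcons w [l] = (if w \<noteq> [] \<and> last w = inv_letter l then butlast w else w @ [l])"
proof (cases "w \<noteq> [] \<and> last w = inv_letter l")
  case True
  then obtain u where u: "w = u @ [inv_letter l]" by (metis append_butlast_last_id)
  then show ?thesis
    using assms foldr_rcons_reduced[of u "[]"] by (simp add: rcons_def reduced_append)
next
  case False
  then have "w = [] \<or> l \<noteq> inv_letter (last w)"
    by (metis inv_letter_simps(1))
  then have "reduced (w @ [l])"
    using assms by (auto simp: reduced_append)
  then show ?thesis using False by (simp only: foldr_rcons_reduced if_False)
qed

locale gog_twisted = gog_rep G \<Gamma> T \<Phi> P a s
  for G :: "('g, 'b) monoid_scheme" (structure)
    and \<Gamma> :: "('v, 'e, 'a) gog" and T and \<Phi> and P :: "('p, 'q) monoid_scheme" and a s +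
  fixes q :: "'v => ('e \<times> 'p set) word \<times> 'p" and \<Theta> :: "'g => ('e \<times> 'p set) word \<times> 'p"
  assumes q: "potential q" and \<Theta>: "twisted q \<Theta>"
begin

sublocale \<Theta>: group_hom G X \<Theta>
  using \<Theta> by (simp add: twisted_def)

lemma q_closed [simp]: "q v \<in> carrier X"
  using q by (simp add: potential_def)

lemma \<Theta>_\<epsilon>: "v \<in> V ==> g \<in> carrier (A v) ==> \<Theta> (\<epsilon> v g) = q v \<star> ([], a v g) \<star> inv\<^sub>X q v"
  using \<Theta> by (simp add: twisted_def)

lemma \<Theta>_t: "e \<in> E ==> \<Theta> (t e) = q (ter e) \<star> edge_elt e \<star> inv\<^sub>X q (org e)"
  using \<Theta> by (simp add: twisted_def)

text \<open>The first component of \<open>y \<gamma> v\<close> is the image, in the Cayley tree, of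
  the vertex \<open>(\<gamma>, v)\<close> of the Bass-Serre tree.\<close>

definition y :: "'g => 'v => ('e \<times> 'p set) word \<times> 'p" where
  "y \<gamma> v = \<Theta> \<gamma> \<star> q v"

lemma y_closed [simp]: "\<gamma> \<in> carrier G ==> y \<gamma> v \<in> carrier X"
  by (simp add: y_def)

lemma y_mult: "z \<in> carrier G ==> \<gamma> \<in> carrier G ==> y (z \<otimes> \<gamma>) v = \<Theta> z \<star> y \<gamma> v"
  by (simp add: y_def X.m_assoc)

lemma y_\<epsilon>: "\<gamma> \<in> carrier G ==> v \<in> V ==> g \<in> carrier (A v) ==>
    y (\<gamma> \<otimes> \<epsilon> v g) v = y \<gamma> v \<star> ([], a v g)"
  by (simp add: y_def \<Theta>_\<epsilon> X.m_assoc)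

lemma y_t: "\<gamma> \<in> carrier G ==> e \<in> E ==> y (\<gamma> \<otimes> t e) (org e) = y \<gamma> (ter e) \<star> edge_elt e"
  by (simp add: y_def \<Theta>_t X.m_assoc)

lemma y_t_inv: "\<gamma> \<in> carrier G ==> e \<in> E ==>
    y (\<gamma> \<otimes> inv (t e)) (ter e) = y \<gamma> (org e) \<star> inv\<^sub>X edge_elt e"
  by (simp add: y_def \<Theta>_t X.word_simps)

subsection \<open>Reduced paths\<close>

text \<open>A reduced Bass-Serre expression of \<open>\<gamma>\<close> leading from
  \<open>v0\<close> to \<open>v\<close>, with its value \<open>p\<close> in \<open>P\<close> and the
  word \<open>w\<close> of edges passed, each marked by the coset in which it is passed. Being
  reduced is a condition on letters only: a new one must not cancel the last one.\<close>

inductive reduced_path :: "'v => 'v => ('e \<times> 'p set) word => 'p => 'g => bool" for v0 where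
  base: "g \<in> carrier (A v0) ==> reduced_path v0 v0 [] (a v0 g) (\<epsilon> v0 g)"
| forward: "reduced_path v0 (ter e) w p \<gamma> ==> e \<in> E ==> g \<in> carrier (A (org e)) ==>
    w = [] \<or> last w \<noteq> (False, (e, p <#\<^bsub>P\<^esub> Q e)) ==>
    reduced_path v0 (org e) (w @ [(True, (e, p <#\<^bsub>P\<^esub> Q e))]) (p \<cdot> s e \<cdot> a (org e) g)
      (\<gamma> \<otimes> t e \<otimes> \<epsilon> (org e) g)"
| backward: "reduced_path v0 (org e) w p \<gamma> ==> e \<in> E ==> g \<in> carrier (A (ter e)) ==>
    w = [] \<or> last w \<noteq> (True, (e, p \<cdot> inv\<^sub>P s e <#\<^bsub>P\<^esub> Q e)) ==>
    reduced_path v0 (ter e) (w @ [(False, (e, p \<cdot> inv\<^sub>P s e <#\<^bsub>P\<^esub> Q e))])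
      (p \<cdot> inv\<^sub>P s e \<cdot> a (ter e) g) (\<gamma> \<otimes> inv (t e) \<otimes> \<epsilon> (ter e) g)"

lemma coset_in_S: "e \<in> E ==> p \<in> carrier P ==> (e, p <#\<^bsub>P\<^esub> Q e) \<in> S"
  using P.l_coset_subset_G[OF Q_sub] by (simp add: letter_in_S)

lemma reduced_path_closed:
  assumes "reduced_path v0 v w p \<gamma>" "v0 \<in> V"
  shows "v \<in> V" "w \<in> words S" "reduced w" "p \<in> carrier P" "\<gamma> \<in> carrier G"
  using assms
  by (induction rule: reduced_path.induct)
    (auto simp: coset_in_S reduced_append \<epsilon>_closed eq_inv_letter_iff)

lemma mult_edge_elt: "x \<star> edge_elt e =
    (foldr rcons (fst x) [(True, (e, snd x <#\<^bsub>P\<^esub> Q e))], snd x \<cdot> s e)"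
  by (simp add: X_simps edge_elt_def act_def)

lemma mult_inv_edge_elt:
  assumes "e \<in> E" "snd x \<in> carrier P"
  shows "x \<star> inv\<^sub>X edge_elt e =
    (foldr rcons (fst x) [(False, (e, snd x \<cdot> inv\<^sub>P s e <#\<^bsub>P\<^esub> Q e))], snd x \<cdot> inv\<^sub>P s e)"
  using assms Q_sub[OF assms(1)] inv_X[OF edge_elt_closed[OF assms(1)]]
  by (simp add: X_simps(2) edge_elt_def act_def inv_word_def P.lcos_m_assoc)

lemma reduced_path_vertex:
  assumes "reduced_path v0 v w p \<gamma>" "v0 \<in> V" "g \<in> carrier (A v)"
  shows "reduced_path v0 v w (p \<cdot> a v g) (\<gamma> \<otimes> \<epsilon> v g)"
  using assms(1)
proof cases
  case (base h)
  have "reduced_path v0 v0 [] (a v0 (h \<otimes>\<^bsub>A v0\<^esub> g)) (\<epsilon> v0 (h \<otimes>\<^bsub>A v0\<^esub> g))"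
    using base assms A_group by (intro reduced_path.base) (simp add: group.is_monoid monoid.m_closed)
  then show ?thesis
    using base assms \<epsilon>_mult[of v0 h g] group_hom.hom_mult[OF a_group_hom, of v0 h g] by simp
next
  case (forward e w' p' \<gamma>' h)
  note c = reduced_path_closed[OF forward(5) assms(2)]
  have o: "org e \<in> V" using forward(6) by simp
  have gh: "h \<otimes>\<^bsub>A v\<^esub> g \<in> carrier (A v)"
    using forward assms A_group[OF o] by (simp add: group.is_monoid monoid.m_closed)
  show ?thesis
    using reduced_path.forward[OF forward(5,6) _ forward(8), of "h \<otimes>\<^bsub>A v\<^esub> g"] gh forward assms(3) o c
      \<epsilon>_mult[of v h g] group_hom.hom_mult[OF a_group_hom, of v h g]
    by (simp add: m_assoc P.m_assoc)
next
  case (backward e w' p' \<gamma>' h)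
  note c = reduced_path_closed[OF backward(5) assms(2)]
  have o: "ter e \<in> V" using backward(6) by simp
  have gh: "h \<otimes>\<^bsub>A v\<^esub> g \<in> carrier (A v)"
    using backward assms A_group[OF o] by (simp add: group.is_monoid monoid.m_closed)
  show ?thesis
    using reduced_path.backward[OF backward(5,6) _ backward(8), of "h \<otimes>\<^bsub>A v\<^esub> g"] gh backward assms(3) o c
      \<epsilon>_mult[of v h g] group_hom.hom_mult[OF a_group_hom, of v h g]
    by (simp add: m_assoc P.m_assoc)
qed

lemma a_\<epsilon>_one: "v \<in> V ==> a v \<one>\<^bsub>A v\<^esub> = \<one>\<^bsub>P\<^esub>" "v \<in> V ==> \<epsilon> v \<one>\<^bsub>A v\<^esub> = \<one>"
  "v \<in> V ==> \<one>\<^bsub>A v\<^esub> \<in> carrier (A v)"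
  using group_hom.hom_one[OF a_group_hom] group_hom.hom_one[OF \<epsilon>_hom] A_group
  by (auto simp: group.is_monoid monoid.one_closed)

text \<open>If the new letter cancels, the last vertex element lies in the edge group, so that it can be
  moved through the stable letter.\<close>

lemma reduced_path_forward:
  assumes rp: "reduced_path v0 (ter e) w p \<gamma>" and v0: "v0 \<in> V" and e: "e \<in> E"
  shows "reduced_path v0 (org e) (foldr rcons w [(True, (e, p <#\<^bsub>P\<^esub> Q e))]) (p \<cdot> s e) (\<gamma> \<otimes> t e)"
proof (cases "w \<noteq> [] \<and> last w = (False, (e, p <#\<^bsub>P\<^esub> Q e))")
  case False
  note c = reduced_path_closed[OF rp v0]
  have o: "org e \<in> V" using e by simp
  show ?thesis
    using reduced_path.forward[OF rp e a_\<epsilon>_one(3)[OF o]] False c o e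
    by (auto simp: snoc_letter a_\<epsilon>_one)
next
  case True
  note c = reduced_path_closed[OF rp v0]
  show ?thesis
    using rp
  proof cases
    case (backward e' w' p' \<gamma>' g)
    note c' = reduced_path_closed[OF backward(5) v0]
    have ee: "e' = e" "p' \<cdot> inv\<^sub>P s e <#\<^bsub>P\<^esub> Q e = p <#\<^bsub>P\<^esub> Q e"
      using True backward(2) by auto
    have g: "g \<in> carrier (A (ter e))" and ter: "ter e \<in> V" "org e \<in> V"
      using backward(7) e ee by auto
    have p: "p = p' \<cdot> inv\<^sub>P s e \<cdot> a (ter e) g" "\<gamma> = \<gamma>' \<otimes> inv (t e) \<otimes> \<epsilon> (ter e) g"
      using backward ee by auto
    have "inv\<^sub>P (p' \<cdot> inv\<^sub>P s e) \<cdot> p \<in> Q e"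
      using coset_eqD[OF e _ c(4) ee(2)] c'(4) e by simp
    then have "a (ter e) g \<in> Q e"
      using c'(4) e g ter by (simp add: p P.word_simps)
    then obtain g' where g': "g' \<in> esub \<Gamma> e" "g = emap \<Gamma> e g'"
      using pinch_ter[OF e g] unfolding Q_def by blast
    have g'c: "g' \<in> carrier (A (org e))" using esub_closed[OF e g'(1)] .
    have "p \<cdot> s e = p' \<cdot> inv\<^sub>P s e \<cdot> (s e \<cdot> a (org e) g')"
      using s_conj[OF e g'(1)] p(1) g' g e c'(4) ter by (simp add: P.m_assoc)
    then have 1: "p \<cdot> s e = p' \<cdot> a (org e) g'"
      using c'(4) e g'c ter by (simp add: P.m_assoc)
    have "\<gamma> \<otimes> t e = \<gamma>' \<otimes> inv (t e) \<otimes> (t e \<otimes> \<epsilon> (org e) g' \<otimes> inv (t e)) \<otimes> t e"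
      using t_conj[OF e g'(1)] p(2) g'(2) by simp
    then have 2: "\<gamma> \<otimes> t e = \<gamma>' \<otimes> \<epsilon> (org e) g'"
      using c'(5) e g'c ter by (simp add: m_assoc)
    have "butlast w = w'" using backward(2) by simp
    then have "foldr rcons w [(True, (e, p <#\<^bsub>P\<^esub> Q e))] = w'"
      using snoc_letter[OF c(3), of "(True, (e, p <#\<^bsub>P\<^esub> Q e))"] True \<open>butlast w = w'\<close> by simp
    then show ?thesis
      using reduced_path_vertex[OF backward(5) v0] g'c ee 1 2 by simp
  qed (use True in auto)
qed

text \<open>As for the forward step, except that the last vertex element is at the origin of the
  edge: its image is carried across by \<open>s e\<close> and back before \<open>pinch_org\<close>
  applies.\<close>

lemma reduced_path_backward:
  assumes rp: "reduced_path v0 (org e) w p \<gamma>" and v0: "v0 \<in> V" and e: "e \<in> E"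
  shows "reduced_path v0 (ter e) (foldr rcons w [(False, (e, p \<cdot> inv\<^sub>P s e <#\<^bsub>P\<^esub> Q e))])
    (p \<cdot> inv\<^sub>P s e) (\<gamma> \<otimes> inv (t e))"
proof (cases "w \<noteq> [] \<and> last w = (True, (e, p \<cdot> inv\<^sub>P s e <#\<^bsub>P\<^esub> Q e))")
  case False
  note c = reduced_path_closed[OF rp v0]
  have o: "ter e \<in> V" using e by simp
  show ?thesis
    using reduced_path.backward[OF rp e a_\<epsilon>_one(3)[OF o]] False c o e
    by (auto simp: snoc_letter a_\<epsilon>_one)
next
  case True
  note c = reduced_path_closed[OF rp v0]
  show ?thesis
    using rp
  proof cases
    case (forward e' w' p' \<gamma>' g)
    note c' = reduced_path_closed[OF forward(5) v0]
    have ee: "e' = e" "p' <#\<^bsub>P\<^esub> Q e = p \<cdot> inv\<^sub>P s e <#\<^bsub>P\<^esub> Q e"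
      using True forward(2) by auto
    have g: "g \<in> carrier (A (org e))" and ter: "ter e \<in> V" "org e \<in> V"
      using forward(7) e ee by auto
    have p: "p = p' \<cdot> s e \<cdot> a (org e) g" "\<gamma> = \<gamma>' \<otimes> t e \<otimes> \<epsilon> (org e) g"
      using forward ee by auto
    have "inv\<^sub>P p' \<cdot> (p \<cdot> inv\<^sub>P s e) \<in> Q e"
      using coset_eqD[OF e c'(4) _ ee(2)] c(4) e by simp
    then have "s e \<cdot> a (org e) g \<cdot> inv\<^sub>P s e \<in> Q e"
      using c'(4) e g ter by (simp add: p P.m_assoc)
    then obtain g' where g': "g' \<in> esub \<Gamma> e"
      "s e \<cdot> a (org e) g \<cdot> inv\<^sub>P s e = a (ter e) (emap \<Gamma> e g')"
      unfolding Q_def by blast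
    have g'c: "g' \<in> carrier (A (org e))" "emap \<Gamma> e g' \<in> carrier (A (ter e))"
      using esub_closed[OF e g'(1)] emap_closed[OF e g'(1)] .
    have "s e \<cdot> a (org e) g \<cdot> inv\<^sub>P s e \<cdot> s e = a (ter e) (emap \<Gamma> e g') \<cdot> s e"
      using g'(2) by simp
    then have "s e \<cdot> a (org e) g = s e \<cdot> a (org e) g'"
      using s_conj[OF e g'(1)] g e ter by (simp add: P.m_assoc)
    then have ag: "a (org e) g = a (org e) g'"
      using g g'c e ter by simp
    then have gs: "g \<in> esub \<Gamma> e"
      using pinch_org[OF e g] g'(1) by blast
    have gc: "emap \<Gamma> e g \<in> carrier (A (ter e))" using emap_closed[OF e gs] .
    have "p \<cdot> inv\<^sub>P s e = p' \<cdot> (a (ter e) (emap \<Gamma> e g) \<cdot> s e) \<cdot> inv\<^sub>P s e"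
      using s_conj[OF e gs] p(1) g e c'(4) ter by (simp add: P.m_assoc)
    then have 1: "p \<cdot> inv\<^sub>P s e = p' \<cdot> a (ter e) (emap \<Gamma> e g)"
      using c'(4) e gc ter by (simp add: P.m_assoc)
    have "\<gamma> \<otimes> inv (t e) = \<gamma>' \<otimes> (t e \<otimes> \<epsilon> (org e) g \<otimes> inv (t e))"
      using p(2) g e c'(5) ter by (simp add: m_assoc)
    then have 2: "\<gamma> \<otimes> inv (t e) = \<gamma>' \<otimes> \<epsilon> (ter e) (emap \<Gamma> e g)"
      using t_conj[OF e gs] by simp
    have "butlast w = w'" using forward(2) by simp
    then have "foldr rcons w [(False, (e, p \<cdot> inv\<^sub>P s e <#\<^bsub>P\<^esub> Q e))] = w'"
      using snoc_letter[OF c(3), of "(False, (e, p \<cdot> inv\<^sub>P s e <#\<^bsub>P\<^esub> Q e))"] True \<open>butlast w = w'\<close> by simp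
    then show ?thesis
      using reduced_path_vertex[OF forward(5) v0] gc ee 1 2 by simp
  qed (use True in auto)
qed

text \<open>The position of \<open>(\<gamma>, v)\<close> as seen from the base vertex, where
  \<open>y \<one> v0 = q v0\<close>.\<close>

definition x :: "'v => 'g => 'v => ('e \<times> 'p set) word \<times> 'p" where
  "x v0 \<gamma> v = inv\<^sub>X q v0 \<star> y \<gamma> v"

lemma x_closed [simp]: "\<gamma> \<in> carrier G ==> x v0 \<gamma> v \<in> carrier X"
  by (simp add: x_def)

lemma reduced_path_x_t:
  assumes "reduced_path v0 (ter e) (fst (x v0 \<gamma> (ter e))) (snd (x v0 \<gamma> (ter e))) \<gamma>"
    "v0 \<in> V" "e \<in> E" "\<gamma> \<in> carrier G"
  shows "reduced_path v0 (org e) (fst (x v0 (\<gamma> \<otimes> t e) (org e))) (snd (x v0 (\<gamma> \<otimes> t e) (org e))) (\<gamma> \<otimes> t e)"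
proof -
  have "x v0 (\<gamma> \<otimes> t e) (org e) = x v0 \<gamma> (ter e) \<star> edge_elt e"
    using assms by (simp add: x_def y_t X.m_assoc)
  then show ?thesis
    using reduced_path_forward[OF assms(1-3)] by (simp add: mult_edge_elt)
qed

lemma reduced_path_x_t_inv:
  assumes "reduced_path v0 (org e) (fst (x v0 \<gamma> (org e))) (snd (x v0 \<gamma> (org e))) \<gamma>"
    "v0 \<in> V" "e \<in> E" "\<gamma> \<in> carrier G"
  shows "reduced_path v0 (ter e) (fst (x v0 (\<gamma> \<otimes> inv (t e)) (ter e)))
    (snd (x v0 (\<gamma> \<otimes> inv (t e)) (ter e))) (\<gamma> \<otimes> inv (t e))"
proof -
  have "x v0 (\<gamma> \<otimes> inv (t e)) (ter e) = x v0 \<gamma> (org e) \<star> inv\<^sub>X edge_elt e"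
    using assms by (simp add: x_def y_t_inv X.m_assoc)
  moreover have "snd (x v0 \<gamma> (org e)) \<in> carrier P"
    using reduced_path_closed(4)[OF assms(1,2)] .
  ultimately show ?thesis
    using reduced_path_backward[OF assms(1-3)] assms(3) by (simp add: mult_inv_edge_elt)
qed

text \<open>Along edges of \<open>T\<close> the end vertex changes while \<open>\<gamma>\<close>
  does not, since their stable letters are trivial.\<close>

lemma reduced_path_tree:
  assumes "reduced_path v0 u (fst (x v0 \<gamma> u)) (snd (x v0 \<gamma> u)) \<gamma>"
    "v0 \<in> V" "u \<in> V" "v \<in> V" "\<gamma> \<in> carrier G"
  shows "reduced_path v0 v (fst (x v0 \<gamma> v)) (snd (x v0 \<gamma> v)) \<gamma>"
  using assms(3,4,1)
proof (induction rule: T.tree_induct)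
  case (edge e)
  then have e: "e \<in> E" "t e = \<one>" using T.T_sub(2) t_tree by auto
  show ?case
    using reduced_path_x_t[of v0 e \<gamma>] reduced_path_x_t_inv[of v0 e \<gamma>] e assms by auto
qed

lemma reduced_path_x:
  assumes v0: "v0 \<in> V" and \<gamma>: "\<gamma> \<in> carrier G" and v: "v \<in> V"
  shows "reduced_path v0 v (fst (x v0 \<gamma> v)) (snd (x v0 \<gamma> v)) \<gamma>"
proof -
  have "\<forall>v\<in>V. reduced_path v0 v (fst (x v0 \<gamma> v)) (snd (x v0 \<gamma> v)) \<gamma>"
    using \<gamma>
  proof (induction rule: gen_induct)
    case one
    have "x v0 \<one> v0 = \<one>\<^bsub>X\<^esub>"
      by (simp add: x_def y_def)
    then have "reduced_path v0 v0 (fst (x v0 \<one> v0)) (snd (x v0 \<one> v0)) \<one>"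
      using reduced_path.base[OF a_\<epsilon>_one(3)[OF v0]] v0 by (simp add: a_\<epsilon>_one X_simps)
    then show ?case
      using reduced_path_tree[OF _ v0 v0] by blast
  next
    case (vertex \<gamma> u g)
    have "x v0 (\<gamma> \<otimes> \<epsilon> u g) u = x v0 \<gamma> u \<star> ([], a u g)"
      using vertex by (simp add: x_def y_\<epsilon> X.m_assoc)
    moreover have "reduced_path v0 u (fst (x v0 \<gamma> u)) (snd (x v0 \<gamma> u) \<cdot> a u g) (\<gamma> \<otimes> \<epsilon> u g)"
      using vertex v0 by (intro reduced_path_vertex) auto
    ultimately have "reduced_path v0 u (fst (x v0 (\<gamma> \<otimes> \<epsilon> u g) u)) (snd (x v0 (\<gamma> \<otimes> \<epsilon> u g) u)) (\<gamma> \<otimes> \<epsilon> u g)"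
      using foldr_rcons_reduced[of "fst (x v0 \<gamma> u)" "[]"] x_closed[OF vertex(1), of v0 u]
      by (simp add: X_simps)
    then show ?case
      using reduced_path_tree[OF _ v0] vertex by simp
  next
    case (stable \<gamma> e)
    then have "reduced_path v0 (org e) (fst (x v0 (\<gamma> \<otimes> t e) (org e))) (snd (x v0 (\<gamma> \<otimes> t e) (org e))) (\<gamma> \<otimes> t e)"
      using v0 by (intro reduced_path_x_t) auto
    then show ?case
      using reduced_path_tree[OF _ v0] stable by simp
  next
    case (stable_inv \<gamma> e)
    then have "reduced_path v0 (ter e) (fst (x v0 (\<gamma> \<otimes> inv (t e)) (ter e)))
        (snd (x v0 (\<gamma> \<otimes> inv (t e)) (ter e))) (\<gamma> \<otimes> inv (t e))"
      using v0 by (intro reduced_path_x_t_inv) auto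
    then show ?case
      using reduced_path_tree[OF _ v0] stable_inv by simp
  qed
  then show ?thesis using v by blast
qed

text \<open>Uniqueness of the reduced expression: no letter cancels along it, so computing in
  \<open>X\<close> returns its word unchanged.\<close>

lemma reduced_path_eq_x:
  assumes "reduced_path v0 v w p \<gamma>" "v0 \<in> V"
  shows "x v0 \<gamma> v = (w, p)"
  using assms
proof (induction rule: reduced_path.induct)
  case (base g)
  then show ?case
    by (simp add: x_def y_def \<Theta>_\<epsilon> X.m_assoc)
next
  case (forward e w p \<gamma> g)
  note c = reduced_path_closed[OF forward(1) forward.prems]
  have o: "org e \<in> V" using forward by simp
  have 1: "x v0 (\<gamma> \<otimes> t e \<otimes> \<epsilon> (org e) g) (org e) = x v0 \<gamma> (ter e) \<star> edge_elt e \<star> ([], a (org e) g)"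
    using c(5) forward(2,3) o by (simp add: x_def y_\<epsilon> y_t X.m_assoc)
  have "reduced (w @ [(True, (e, p <#\<^bsub>P\<^esub> Q e))])"
    using reduced_path_closed(3)[OF reduced_path.forward[OF forward(1,2,3,4)] forward.prems] .
  then show ?case
    unfolding 1 forward.IH[OF forward.prems] mult_edge_elt
    using foldr_rcons_reduced[of "w @ [(True, (e, p <#\<^bsub>P\<^esub> Q e))]" "[]"]
      foldr_rcons_reduced[of w "[(True, (e, p <#\<^bsub>P\<^esub> Q e))]"]
    by (simp add: X_simps(2) del: foldr_append)
next
  case (backward e w p \<gamma> g)
  note c = reduced_path_closed[OF backward(1) backward.prems]
  have o: "ter e \<in> V" using backward by simp
  have 1: "x v0 (\<gamma> \<otimes> inv (t e) \<otimes> \<epsilon> (ter e) g) (ter e) =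
      x v0 \<gamma> (org e) \<star> inv\<^sub>X edge_elt e \<star> ([], a (ter e) g)"
    using c(5) backward(2,3) o by (simp add: x_def y_\<epsilon> y_t_inv X.m_assoc)
  let ?l = "(False, (e, p \<cdot> inv\<^sub>P s e <#\<^bsub>P\<^esub> Q e))"
  have "reduced (w @ [?l])"
    using reduced_path_closed(3)[OF reduced_path.backward[OF backward(1,2,3,4)] backward.prems] .
  moreover have "(w, p) \<star> inv\<^sub>X edge_elt e = (foldr rcons w [?l], p \<cdot> inv\<^sub>P s e)"
    using mult_inv_edge_elt[of e "(w, p)"] backward(2) c by simp
  ultimately show ?case
    unfolding 1 backward.IH[OF backward.prems]
    using foldr_rcons_reduced[of "w @ [?l]" "[]"] foldr_rcons_reduced[of w "[?l]"]
    by (simp add: X_simps(2) del: foldr_append)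
qed

lemma reduced_path_prefix:
  assumes "reduced_path v0 v w p \<gamma>" "w = u @ u'"
  shows "\<exists>v' p' \<gamma>'. reduced_path v0 v' u p' \<gamma>'"
  using assms
proof (induction arbitrary: u' rule: reduced_path.induct)
  case (base g)
  then show ?case using reduced_path.base[OF base(1)] by auto
next
  case (forward e w p \<gamma> g)
  show ?case
  proof (cases u' rule: rev_cases)
    case Nil
    then show ?thesis using reduced_path.forward[OF forward(1,2,3,4)] forward.prems by auto
  next
    case (snoc u'' l)
    then show ?thesis using forward.IH[of u''] forward.prems by auto
  qed
next
  case (backward e w p \<gamma> g)
  show ?case
  proof (cases u' rule: rev_cases)
    case Nil
    then show ?thesis using reduced_path.backward[OF backward(1,2,3,4)] backward.prems by auto
  next
    case (snoc u'' l)
    then show ?thesis using backward.IH[of u''] backward.prems by auto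
  qed
qed


subsection \<open>Stabilisers\<close>

text \<open>The normal form theorem in the form needed: a reduced path with empty word can only come
  from the rule \<open>base\<close>.\<close>

lemma fst_x_Nil:
  assumes "v0 \<in> V" "\<gamma> \<in> carrier G" "v \<in> V" "fst (x v0 \<gamma> v) = []"
  shows "v = v0" "\<gamma> \<in> \<epsilon> v0 ` carrier (A v0)"
  using reduced_path_x[OF assms(1-3)] unfolding assms(4) by (auto elim: reduced_path.cases)

text \<open>The map to the Cayley tree creates no new stabilisers. After translation by the inverse
  of \<open>\<gamma>\<close> an element fixing the image has a reduced path with empty word, so it
  is a vertex element.\<close>

lemma fst_y_eq_iff:
  assumes \<gamma>: "\<gamma> \<in> carrier G" and v: "v \<in> V" and z: "z \<in> carrier G"
  shows "fst (\<Theta> z \<star> y \<gamma> v) = fst (y \<gamma> v) \<longleftrightarrow> z \<in> vgroup \<gamma> v"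
proof
  assume eq: "fst (\<Theta> z \<star> y \<gamma> v) = fst (y \<gamma> v)"
  have "x v (inv \<gamma> \<otimes> z \<otimes> \<gamma>) v = inv\<^sub>X (y \<gamma> v) \<star> (\<Theta> z \<star> y \<gamma> v)"
    using \<gamma> z by (simp add: x_def y_def X.word_simps)
  then have "fst (x v (inv \<gamma> \<otimes> z \<otimes> \<gamma>) v) = []"
    using fst_inv_mult_Nil[of "y \<gamma> v" "\<Theta> z \<star> y \<gamma> v"] \<gamma> z eq by simp
  then obtain g where g: "g \<in> carrier (A v)" "inv \<gamma> \<otimes> z \<otimes> \<gamma> = \<epsilon> v g"
    using fst_x_Nil(2)[OF v _ v, of "inv \<gamma> \<otimes> z \<otimes> \<gamma>"] \<gamma> z by auto
  have "\<gamma> \<otimes> (inv \<gamma> \<otimes> z \<otimes> \<gamma>) \<otimes> inv \<gamma> = z"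
    using \<gamma> z by (simp add: m_assoc)
  then show "z \<in> vgroup \<gamma> v"
    unfolding vgroup_def g(2) using g(1) by blast
next
  assume "z \<in> vgroup \<gamma> v"
  then obtain g where g: "g \<in> carrier (A v)" "z = \<gamma> \<otimes> \<epsilon> v g \<otimes> inv \<gamma>"
    by (auto simp: vgroup_def)
  have "\<Theta> z \<star> y \<gamma> v = y \<gamma> v \<star> ([], a v g)"
    using g \<gamma> v by (simp add: y_def \<Theta>_\<epsilon> X.word_simps)
  then show "fst (\<Theta> z \<star> y \<gamma> v) = fst (y \<gamma> v)"
    using foldr_rcons_reduced[of "fst (y \<gamma> v)" "[]"] y_closed[OF \<gamma>, of v] by (simp add: X_simps)
qed

definition dist :: "'g => 'v => 'g => 'v => nat" where
  "dist \<gamma> v \<gamma>' v' = length (fst (inv\<^sub>X (y \<gamma> v) \<star> y \<gamma>' v'))"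

lemma dist_sym:
  assumes "\<gamma> \<in> carrier G" "\<gamma>' \<in> carrier G"
  shows "dist \<gamma> v \<gamma>' v' = dist \<gamma>' v' \<gamma> v"
proof -
  let ?m = "inv\<^sub>X (y \<gamma> v) \<star> y \<gamma>' v'"
  have "inv\<^sub>X (y \<gamma>' v') \<star> y \<gamma> v = inv\<^sub>X ?m"
    using assms by (simp add: X.inv_mult_group)
  moreover have "length (fst (inv\<^sub>X ?m)) = length (fst ?m)"
    using inv_X[of ?m] assms by simp
  ultimately show ?thesis
    by (simp add: dist_def)
qed

text \<open>The first vertex on the way from \<open>(\<gamma>, v)\<close> to \<open>(\<gamma>', v')\<close> is fixed by every subgroup that fixes
  \<open>(\<gamma>, v)\<close> and some point \<open>(z \<gamma>, v)\<close> lying in the same direction.\<close>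

lemma closer_vertex:
  assumes \<gamma>: "\<gamma> \<in> carrier G" "\<gamma>' \<in> carrier G" "z \<in> carrier G" and v: "v \<in> V" "v' \<in> V"
    and H: "H \<subseteq> vgroup \<gamma> v" "H \<subseteq> vgroup (z \<otimes> \<gamma>) v"
    and m: "m = fst (inv\<^sub>X (y \<gamma> v) \<star> y \<gamma>' v')" "m \<noteq> []"
    and b: "b = fst (inv\<^sub>X (y \<gamma> v) \<star> y (z \<otimes> \<gamma>) v)" "b \<noteq> []" "hd b = hd m"
  shows "\<exists>\<gamma>0\<in>carrier G. \<exists>v0\<in>V. H \<subseteq> vgroup \<gamma>0 v0 \<and> dist \<gamma>0 v0 \<gamma>' v' < dist \<gamma> v \<gamma>' v'"
proof -
  let ?Y = "y \<gamma> v" and ?Y' = "y \<gamma>' v'" and ?Z = "y (z \<otimes> \<gamma>) v"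
  have Y: "?Y \<in> carrier X" "?Y' \<in> carrier X" "?Z \<in> carrier X"
    using \<gamma> by simp_all
  define l where "l = hd m"
  have xv: "x v (inv \<gamma> \<otimes> \<gamma>') v' = inv\<^sub>X ?Y \<star> ?Y'"
    using \<gamma> by (simp add: x_def y_def X.word_simps)
  have "m = [l] @ tl m" using m(2) by (simp add: l_def)
  then have "fst (x v (inv \<gamma> \<otimes> \<gamma>') v') = [l] @ tl m"
    using m(1) by (simp add: xv)
  then obtain v0 p0 \<delta> where rp: "reduced_path v v0 [l] p0 \<delta>"
    using reduced_path_prefix[OF reduced_path_x[OF v(1) _ v(2), of "inv \<gamma> \<otimes> \<gamma>'"], of "[l]" "tl m"]
      \<gamma> by auto
  note c = reduced_path_closed[OF rp v(1)]
  have x\<delta>: "x v \<delta> v0 = ([l], p0)" by (rule reduced_path_eq_x[OF rp v(1)])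
  have lX: "([l], p0) \<in> carrier X" using c by (simp add: X_simps)
  have y\<delta>: "y (\<gamma> \<otimes> \<delta>) v0 = ?Y \<star> ([l], p0)"
    using \<gamma> c by (simp add: x\<delta>[symmetric] x_def y_def X.m_assoc)
  have "H \<subseteq> vgroup (\<gamma> \<otimes> \<delta>) v0"
  proof
    fix h assume h: "h \<in> H"
    have hG: "h \<in> carrier G" using h H(1) vgroup_closed[OF \<gamma>(1) v(1)] by blast
    define r where "r = snd (inv\<^sub>X ?Y \<star> (\<Theta> h \<star> ?Y))"
    define r' where "r' = snd (inv\<^sub>X ?Z \<star> (\<Theta> h \<star> ?Z))"
    have rY: "inv\<^sub>X ?Y \<star> (\<Theta> h \<star> ?Y) = ([], r)"
      using fst_inv_mult_Nil[of ?Y "\<Theta> h \<star> ?Y"] fst_y_eq_iff[OF \<gamma>(1) v(1) hG] h H(1) Y hG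
      by (auto simp: r_def prod_eq_iff)
    have rZ: "inv\<^sub>X ?Z \<star> (\<Theta> h \<star> ?Z) = ([], r')"
      using fst_inv_mult_Nil[of ?Z "\<Theta> h \<star> ?Z"] fst_y_eq_iff[OF _ v(1) hG, of "z \<otimes> \<gamma>"] h H(2) Y hG \<gamma>
      by (auto simp: r'_def prod_eq_iff)
    have rX: "([], r) \<in> carrier X" "([], r') \<in> carrier X"
      unfolding rY[symmetric] rZ[symmetric] using Y hG by simp_all
    then have rP: "r \<in> carrier P" "r' \<in> carrier P" by (simp_all add: X_simps)
    have hY: "\<Theta> h \<star> ?Y = ?Y \<star> ([], r)"
      using Y hG by (simp flip: rY)
    \<comment> \<open>\<open>h\<close> fixes both points, so its action \<open>r\<close> on the
      letters fixes the whole word \<open>b\<close> between them, in particular the first letter,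
      which \<open>b\<close> shares with \<open>m\<close>.\<close>
    have "([], r) \<star> (inv\<^sub>X ?Y \<star> ?Z) = (inv\<^sub>X ?Y \<star> ?Z) \<star> ([], r')"
      unfolding rY[symmetric] rZ[symmetric] using Y hG by (simp add: X.m_assoc)
    then have "map_word (act r) b = b"
      using foldr_rcons_reduced[of b "[]"] X.m_closed[OF X.inv_closed[OF Y(1)] Y(3)]
      by (simp add: X_simps b(1))
    then have "map_letter (act r) l = l"
      using b(2,3) hd_map_word[OF b(2), of "act r"] by (simp add: l_def)
    then have rl: "([], r) \<star> ([l], p0) = ([l], r \<cdot> p0)"
      by (simp add: X_simps)
    have "\<Theta> h \<star> y (\<gamma> \<otimes> \<delta>) v0 = ?Y \<star> ([l], r \<cdot> p0)"
      unfolding y\<delta> rl[symmetric] using hY Y hG rX lX by (simp flip: X.m_assoc)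
    then have "fst (\<Theta> h \<star> y (\<gamma> \<otimes> \<delta>) v0) = fst (y (\<gamma> \<otimes> \<delta>) v0)"
      unfolding y\<delta> by (simp add: X_simps)
    then show "h \<in> vgroup (\<gamma> \<otimes> \<delta>) v0"
      using fst_y_eq_iff[of "\<gamma> \<otimes> \<delta>" v0 h] \<gamma> c hG by simp
  qed
  moreover have "dist (\<gamma> \<otimes> \<delta>) v0 \<gamma>' v' < dist \<gamma> v \<gamma>' v'"
  proof -
    have M: "inv\<^sub>X ?Y \<star> ?Y' \<in> carrier X" using Y by simp
    have "inv\<^sub>X (y (\<gamma> \<otimes> \<delta>) v0) \<star> ?Y' = inv\<^sub>X ([l], p0) \<star> (inv\<^sub>X ?Y \<star> ?Y')"
      unfolding y\<delta> using Y lX by (simp add: X.word_simps)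
    then have "fst (inv\<^sub>X (y (\<gamma> \<otimes> \<delta>) v0) \<star> ?Y') =
        map_word (act (inv\<^sub>P p0)) (foldr rcons (inv_word [l]) m)"
      using fst_inv_mult[OF lX M] m(1) by simp
    moreover have "foldr rcons (inv_word [l]) m = tl m"
      using m(2) by (simp add: inv_word_def rcons_def l_def)
    ultimately show ?thesis
      using m by (simp add: dist_def)
  qed
  ultimately show ?thesis
    using \<gamma> c by blast
qed

text \<open>If two conjugates of vertex groups have no common fixed vertex, then the bridge between their
  fixed subtrees is fixed by everything commuting with both.\<close>

lemma common_vgroup_or_bridge:
  assumes \<gamma>: "\<gamma>1 \<in> carrier G" "\<gamma>2 \<in> carrier G" and v: "v1 \<in> V" "v2 \<in> V"
  obtains (common) \<gamma> v where "\<gamma> \<in> carrier G" "v \<in> V" "vgroup \<gamma>1 v1 \<union> vgroup \<gamma>2 v2 \<subseteq> vgroup \<gamma> v"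
  | (bridge) \<gamma> v where "\<gamma> \<in> carrier G" "v \<in> V"
    "!!z. z \<in> carrier G ==> (!!h. h \<in> vgroup \<gamma>1 v1 \<union> vgroup \<gamma>2 v2 ==> z \<otimes> h = h \<otimes> z) ==> z \<in> vgroup \<gamma> v"
proof -
  let ?H1 = "vgroup \<gamma>1 v1" and ?H2 = "vgroup \<gamma>2 v2"
  \<comment> \<open>A closest pair of vertices fixed by the two subgroups: the ends of the bridge,
    or one and the same point.\<close>
  define Pr where "Pr d \<longleftrightarrow> (\<exists>\<gamma>\<in>carrier G. \<exists>v\<in>V. \<exists>\<gamma>'\<in>carrier G. \<exists>v'\<in>V.
    ?H1 \<subseteq> vgroup \<gamma> v \<and> ?H2 \<subseteq> vgroup \<gamma>' v' \<and> d = dist \<gamma> v \<gamma>' v')" for d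
  have "Pr (dist \<gamma>1 v1 \<gamma>2 v2)" using \<gamma> v unfolding Pr_def by blast
  then have "Pr (LEAST d. Pr d)" by (rule LeastI)
  then obtain \<gamma> u \<gamma>' u' where b: "\<gamma> \<in> carrier G" "u \<in> V" "\<gamma>' \<in> carrier G" "u' \<in> V"
    "?H1 \<subseteq> vgroup \<gamma> u" "?H2 \<subseteq> vgroup \<gamma>' u'" "dist \<gamma> u \<gamma>' u' = (LEAST d. Pr d)"
    unfolding Pr_def by metis
  have min: "dist \<gamma> u \<gamma>' u' \<le> dist \<delta> w \<delta>' w'" if "\<delta> \<in> carrier G" "w \<in> V" "\<delta>' \<in> carrier G" "w' \<in> V"
    "?H1 \<subseteq> vgroup \<delta> w" "?H2 \<subseteq> vgroup \<delta>' w'" for \<delta> w \<delta>' w'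
    unfolding b(7) by (rule Least_le) (use that in \<open>auto simp: Pr_def\<close>)
  let ?Y = "y \<gamma> u" and ?Y' = "y \<gamma>' u'"
  have Y: "?Y \<in> carrier X" "?Y' \<in> carrier X" using b by simp_all
  define M where "M = inv\<^sub>X ?Y \<star> ?Y'"
  have M: "M \<in> carrier X" using Y by (simp add: M_def)
  show thesis
  proof (cases "fst M = []")
    case True
    then have "fst ?Y = fst ?Y'"
      using fst_inv_mult_Nil[OF Y] by (simp add: M_def)
    have "vgroup \<gamma>' u' \<subseteq> vgroup \<gamma> u"
    proof
      fix h assume h: "h \<in> vgroup \<gamma>' u'"
      then have hG: "h \<in> carrier G" using vgroup_closed[OF b(3,4)] by blast
      have "fst (\<Theta> h \<star> ?Y) = fst (\<Theta> h \<star> ?Y')"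
        using \<open>fst ?Y = fst ?Y'\<close> by (simp add: X_simps)
      then show "h \<in> vgroup \<gamma> u"
        using fst_y_eq_iff[OF b(1,2) hG] fst_y_eq_iff[OF b(3,4) hG] h \<open>fst ?Y = fst ?Y'\<close> by simp
    qed
    then show ?thesis
      by (intro common[OF b(1,2)]) (use b in blast)
  next
    case False
    show ?thesis
    proof (rule bridge[OF b(1,2)])
      fix z assume z: "z \<in> carrier G" and comm: "!!h. h \<in> ?H1 \<union> ?H2 ==> z \<otimes> h = h \<otimes> z"
      let ?Z = "y (z \<otimes> \<gamma>) u" and ?Z' = "y (z \<otimes> \<gamma>') u'"
      have Z: "?Z \<in> carrier X" "?Z' \<in> carrier X" using b z by simp_all
      have H1: "?H1 \<subseteq> vgroup (z \<otimes> \<gamma>) u" and H2: "?H2 \<subseteq> vgroup (z \<otimes> \<gamma>') u'"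
        using vgroup_commuting[OF b(1,2) z b(5)] vgroup_commuting[OF b(3,4) z b(6)] comm by auto
      define Ka where "Ka = inv\<^sub>X ?Y \<star> ?Z"
      define Kb where "Kb = inv\<^sub>X ?Y' \<star> ?Z'"
      have K: "Ka \<in> carrier X" "Kb \<in> carrier X" using Y Z by (simp_all add: Ka_def Kb_def)
      \<comment> \<open>If \<open>z\<close> moved the end of the bridge in the direction of the
        other end, \<open>closer_vertex\<close> would yield a closer pair.\<close>
      have c1: "fst Ka = [] \<or> hd (fst Ka) \<noteq> hd (fst M)"
      proof (rule ccontr)
        assume "\<not> ?thesis"
        then have "\<exists>\<gamma>0\<in>carrier G. \<exists>v0\<in>V. ?H1 \<subseteq> vgroup \<gamma>0 v0 \<and> dist \<gamma>0 v0 \<gamma>' u' < dist \<gamma> u \<gamma>' u'"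
          using b z H1 False by (intro closer_vertex[of _ _ z, where m = "fst M" and b = "fst Ka"]) (auto simp: M_def Ka_def)
        then show False using min b by (meson not_less)
      qed
      have invM: "inv\<^sub>X M = inv\<^sub>X ?Y' \<star> ?Y"
        using Y by (simp add: M_def X.inv_mult_group)
      have "fst (inv\<^sub>X M) \<noteq> []" using False M by (simp add: inv_X)
      have c2: "fst Kb = [] \<or> hd (fst Kb) \<noteq> hd (fst (inv\<^sub>X M))"
      proof (rule ccontr)
        assume "\<not> ?thesis"
        then have "\<exists>\<gamma>0\<in>carrier G. \<exists>v0\<in>V. ?H2 \<subseteq> vgroup \<gamma>0 v0 \<and> dist \<gamma>0 v0 \<gamma> u < dist \<gamma>' u' \<gamma> u"
          using b z H2 \<open>fst (inv\<^sub>X M) \<noteq> []\<close>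
          by (intro closer_vertex[of _ _ z, where m = "fst (inv\<^sub>X M)" and b = "fst Kb"])
            (auto simp: invM Kb_def)
        then show False using min b dist_sym by (metis not_less)
      qed
      \<comment> \<open>\<open>z\<close> preserves the length of the bridge. But the path between
        the translated ends runs through the bridge without cancellation, so it is longer unless the
        ends are fixed.\<close>
      have "inv\<^sub>X ?Z \<star> ?Z' = M"
        using b z by (simp add: M_def y_mult X.word_simps)
      moreover have "inv\<^sub>X ?Z \<star> ?Z' = inv\<^sub>X Ka \<star> (M \<star> Kb)"
        using Y Z by (simp add: Ka_def Kb_def M_def X.word_simps)
      ultimately have "length (fst M) = length (fst (inv\<^sub>X Ka \<star> (M \<star> Kb)))"
        by simp
      also have "\<dots> = length (foldr rcons (inv_word (fst Ka)) (foldr rcons (fst M) (map_word (act (snd M)) (fst Kb))))"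
        using K M by (simp add: fst_inv_mult) (simp add: X_simps)
      also have "\<dots> = length (fst Ka) + length (fst M) + length (map_word (act (snd M)) (fst Kb))"
      proof (rule length_mult_reduced)
        have M': "fst M \<in> words S" "reduced (fst M)" "snd M \<in> carrier P" using M by (simp_all add: X_simps)
        have K': "fst Kb \<in> words S" "reduced (fst Kb)" "reduced (fst Ka)" using K by (simp_all add: X_simps)
        show "reduced (map_word (act (snd M)) (fst Kb))"
          using M' K' map_word_reduced[OF act_inj] by simp
        show "map_word (act (snd M)) (fst Kb) = [] \<or> hd (map_word (act (snd M)) (fst Kb)) \<noteq> inv_letter (last (fst M))"
        proof (cases "fst Kb = []")
          case kb: False
          have "map_word (act (snd M)) (fst (inv\<^sub>X M)) = inv_word (fst M)"
          proof -
            have "inv_word (fst M) \<in> words S" using M' by (simp add: words_iff)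
            then show ?thesis
              using M M' by (simp add: inv_X map_word_mult[symmetric] map_word_one)
          qed
          then have "map_letter (act (snd M)) (hd (fst (inv\<^sub>X M))) = inv_letter (last (fst M))"
            using hd_map_word[OF \<open>fst (inv\<^sub>X M) \<noteq> []\<close>, of "act (snd M)"] hd_inv_word[OF False] by simp
          moreover have "map_letter (act (snd M)) (hd (fst Kb)) \<noteq> map_letter (act (snd M)) (hd (fst (inv\<^sub>X M)))"
          proof -
            have "snd (hd (fst Kb)) \<in> S" using K'(1) kb by (cases "fst Kb") (auto simp: words_iff)
            moreover have "fst (inv\<^sub>X M) \<in> words S" using X.inv_closed[OF M] by (simp add: X_simps)
            then have "snd (hd (fst (inv\<^sub>X M))) \<in> S"
              using \<open>fst (inv\<^sub>X M) \<noteq> []\<close> by (cases "fst (inv\<^sub>X M)") (auto simp: words_iff)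
            ultimately show ?thesis
              using map_letter_eq_iff[OF act_inj[OF M'(3)]] c2 kb by simp
          qed
          ultimately show ?thesis
            using hd_map_word[OF kb, of "act (snd M)"] by simp
        qed simp
      qed (use M K c1 False in \<open>simp_all add: X_simps\<close>)
      finally have "fst Ka = []" by simp
      then have "fst ?Y = fst ?Z"
        using fst_inv_mult_Nil[OF Y(1) Z(1)] by (simp add: Ka_def)
      then show "z \<in> vgroup \<gamma> u"
        using fst_y_eq_iff[OF b(1,2) z] b z by (simp add: y_mult)
    qed
  qed
qed

end

section \<open>Lattices\<close>

text \<open>Coordinates of a free abelian group of rank \<open>n\<close>. Only the indices below
  \<open>n\<close> count; \<open>c g\<close> is arbitrary beyond.\<close>

locale Zn_coords = group A for A :: "('a, 'b) monoid_scheme" (structure) +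
  fixes n :: nat and c :: "'a => nat => int"
  assumes c_mult: "g \<in> carrier A ==> h \<in> carrier A ==> i < n ==> c (g \<otimes> h) i = c g i + c h i"
    and c_inj: "g \<in> carrier A ==> h \<in> carrier A ==> (!!i. i < n ==> c g i = c h i) ==> g = h"
    and c_surj: "\<exists>g\<in>carrier A. \<forall>i<n. c g i = z i"
begin

lemma c_one: "i < n ==> c \<one> i = 0"
  using c_mult[of \<one> \<one> i] by simp

lemma c_inv: "g \<in> carrier A ==> i < n ==> c (inv g) i = - c g i"
  using c_mult[of g "inv g" i] by (simp add: c_one)

lemma c_pow: "g \<in> carrier A ==> i < n ==> c (g [^] (k :: nat)) i = int k * c g i"
  by (induction k) (auto simp: c_one c_mult algebra_simps)

lemma commute: "g \<in> carrier A ==> h \<in> carrier A ==> g \<otimes> h = h \<otimes> g"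
  by (rule c_inj) (auto simp: c_mult)

lemma comm_group: "comm_group A"
  by (rule group_comm_groupI) (rule commute)

lemma normal: "subgroup H A ==> H \<lhd> A"
  using comm_group.normal_iff_subgroup[OF comm_group] by simp

definition elt :: "(nat => int) => 'a" where
  "elt z = (SOME g. g \<in> carrier A \<and> (\<forall>i<n. c g i = z i))"

lemma elt: "elt z \<in> carrier A" "i < n ==> c (elt z) i = z i"
  using someI_ex[of "\<lambda>g. g \<in> carrier A \<and> (\<forall>i<n. c g i = z i)"] c_surj[of z]
  unfolding elt_def by blast+

lemma root:
  assumes "g \<in> carrier A" "!!i. i < n ==> int k dvd c g i"
  obtains h where "h \<in> carrier A" "h [^] k = g"
proof
  have "elt (\<lambda>i. c g i div int k) [^] k = g"
    by (rule c_inj) (use assms elt in \<open>auto simp: c_pow\<close>)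
  then show "elt (\<lambda>i. c g i div int k) [^] k = g" .
qed (rule elt)

lemma pow_eq_one:
  assumes "g \<in> carrier A" "g [^] k = \<one>" "k \<ge> (1 :: nat)" shows "g = \<one>"
proof (rule c_inj)
  fix i assume "i < n"
  then show "c g i = c \<one> i"
    using c_pow[OF assms(1), of i k] assms by (simp add: c_one)
qed (use assms in auto)

lemma pow_inj:
  assumes "g \<in> carrier A" "h \<in> carrier A" "g [^] k = h [^] k" "k \<ge> (1 :: nat)" shows "g = h"
proof (rule c_inj)
  fix i assume "i < n"
  then show "c g i = c h i"
    using c_pow[OF assms(1), of i k] c_pow[OF assms(2), of i k] assms by simp
qed (use assms in auto)

lemma pow_mult: "g \<in> carrier A ==> h \<in> carrier A ==> (g \<otimes> h) [^] (k :: nat) = g [^] k \<otimes> h [^] k"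
  using comm_group.axioms(1)[OF comm_group] by (intro comm_monoid.nat_pow_distrib) auto

definition residues :: "nat => 'a => nat => int" where
  "residues k g = (\<lambda>i\<in>{..<n}. c g i mod int k)"

lemma finite_residues:
  assumes "k \<ge> 1" shows "finite (range (residues k))"
proof (rule finite_subset)
  show "range (residues k) \<subseteq> {..<n} \<rightarrow>\<^sub>E {0..<int k}"
    using assms by (auto simp: residues_def split: if_splits)
qed (auto intro: finite_PiE)

lemma residues_eq:
  assumes "g \<in> carrier A" "h \<in> carrier A" "residues k g = residues k h"
  obtains x where "x \<in> carrier A" "g \<otimes> inv h = x [^] k"
proof -
  have dv: "int k dvd c (g \<otimes> inv h) i" if "i < n" for i
    using fun_cong[OF assms(3), of i] that assms(1,2)
    by (simp add: residues_def c_mult c_inv mod_eq_dvd_iff)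
  have gh: "g \<otimes> inv h \<in> carrier A" using assms by simp
  obtain x where "x \<in> carrier A" "x [^] k = g \<otimes> inv h" by (rule root[OF gh dv])
  then show thesis by (intro that[of x]) auto
qed

definition basis :: "nat => 'a" where
  "basis j = elt (\<lambda>i. if i = j then 1 else 0)"

lemma basis_closed [simp]: "basis j \<in> carrier A"
  by (simp add: basis_def elt)

lemma c_basis: "i < n ==> c (basis j) i = (if i = j then 1 else 0)"
  by (simp add: basis_def elt)

lemma c_int_pow: "g \<in> carrier A ==> i < n ==> c (g [^] (k :: int)) i = k * c g i"
  using c_pow[of g i "nat k"] c_pow[of g i "nat (- k)"] c_inv[of "g [^] nat (- k)" i]
  unfolding int_pow_def2 by auto

text \<open>Induction on a bound for the nonzero coordinates: subtracting a multiple of a basis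
  element clears the last one.\<close>

lemma subgroup_of_basis:
  assumes K: "subgroup K A" and b: "!!j. j < n ==> basis j \<in> K"
  shows "K = carrier A"
proof -
  have "g \<in> K" if "g \<in> carrier A" "m \<le> n" "!!i. m \<le> i ==> i < n ==> c g i = 0" for m g
    using that
  proof (induction m arbitrary: g)
    case 0
    have "g = \<one>"
      by (rule c_inj) (use 0 in \<open>auto simp: c_one\<close>)
    then show ?case using subgroup.one_closed[OF K] by simp
  next
    case (Suc m)
    let ?b = "basis m [^] (c g m)"
    have b_in: "?b \<in> K" "?b \<in> carrier A"
      using subgroup_int_pow_closed[OF K b] Suc.prems(2) by auto
    have "g \<otimes> inv ?b \<in> K"
    proof (rule Suc.IH)
      show "c (g \<otimes> inv ?b) i = 0" if "m \<le> i" "i < n" for i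
      proof -
        have "c (g \<otimes> inv ?b) i = c g i - c g m * c (basis m) i"
          using that Suc.prems(1) b_in by (simp add: c_mult c_inv c_int_pow)
        then show ?thesis
          using Suc.prems(3)[of i] that by (cases "i = m") (auto simp: c_basis)
      qed
    qed (use Suc.prems b_in in auto)
    then have "g \<otimes> inv ?b \<otimes> ?b \<in> K"
      using subgroup.m_closed[OF K] b_in by blast
    then show ?case using Suc.prems(1) b_in by (simp add: m_assoc)
  qed
  from this[of _ n] have "carrier A \<subseteq> K" by auto
  then show ?thesis using subgroup.subset[OF K] by blast
qed

lemma additive_expand:
  fixes f :: "'a => rat"
  assumes f: "!!g h. g \<in> carrier A ==> h \<in> carrier A ==> f (g \<otimes> h) = f g + f h" and g: "g \<in> carrier A"
  shows "f g = (\<Sum>j<n. of_int (c g j) * f (basis j))"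
proof -
  let ?d = "\<lambda>g. f g - (\<Sum>j<n. of_int (c g j) * f (basis j))"
  have d: "?d (g \<otimes> h) = ?d g + ?d h" if "g \<in> carrier A" "h \<in> carrier A" for g h
    using that by (simp add: f c_mult sum.distrib algebra_simps)
  have d1: "?d \<one> = 0" using d[of \<one> \<one>] by simp
  have dinv: "?d (inv g) = - ?d g" if "g \<in> carrier A" for g
    using d[of g "inv g"] that d1 by simp
  define K where "K = {g \<in> carrier A. ?d g = 0}"
  have "subgroup K A"
  proof (rule subgroupI)
    show "K \<noteq> {}" using d1 by (auto simp: K_def)
    show "inv a \<in> K" if "a \<in> K" for a using that dinv[of a] by (simp add: K_def)
    show "a \<otimes> b \<in> K" if "a \<in> K" "b \<in> K" for a b using that d[of a b] by (simp add: K_def)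
  qed (auto simp: K_def)
  moreover have "basis j \<in> K" if "j < n" for j
  proof -
    have "(\<Sum>i<n. of_int (c (basis j) i) * f (basis i)) = (\<Sum>i<n. if i = j then f (basis i) else 0)"
      by (rule sum.cong) (auto simp: c_basis)
    then show ?thesis using that by (simp add: K_def)
  qed
  ultimately have "K = carrier A" by (rule subgroup_of_basis)
  then have "g \<in> K" using g by simp
  then show ?thesis by (simp add: K_def)
qed

definition col :: "'a => rat mat" where
  "col g = mat n 1 (\<lambda>(i, j). of_int (c g i))"

lemma col_closed [simp]: "col g \<in> carrier_mat n 1"
  by (simp add: col_def)

lemma col_mult: "g \<in> carrier A ==> h \<in> carrier A ==> col (g \<otimes> h) = col g + col h"
  by (rule eq_matI) (auto simp: col_def c_mult)

lemma col_one: "col \<one> = 0\<^sub>m n 1"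
  by (rule eq_matI) (auto simp: col_def c_one)

lemma col_inj:
  assumes "g \<in> carrier A" "h \<in> carrier A" "col g = col h" shows "g = h"
proof (rule c_inj[OF assms(1,2)])
  fix i assume "i < n"
  then have "col g $$ (i, 0) = of_int (c g i)" "col h $$ (i, 0) = of_int (c h i)"
    by (simp_all add: col_def)
  then show "c g i = c h i" using assms(3) by simp
qed

text \<open>Finite index puts the \<open>k\<close>-th power of each basis element into
  \<open>C\<close>. Its image, divided by \<open>k\<close>, is a column of the rational
  matrix.\<close>

lemma extend_hom:
  assumes B: "Zn_coords B n d" and C: "subgroup C A" and k: "k \<ge> (1 :: nat)" "!!g. g \<in> carrier A ==> g [^] k \<in> C"
    and f: "f \<in> hom (A\<lparr>carrier := C\<rparr>) B"
  obtains M where "M \<in> carrier_mat n n" "!!g. g \<in> C ==> M * col g = Zn_coords.col n d (f g)"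
proof -
  interpret B: Zn_coords B n d by fact
  have fB: "f g \<in> carrier B" if "g \<in> C" for g
    using f that by (auto simp: hom_def)
  have fm: "f (g \<otimes> h) = f g \<otimes>\<^bsub>B\<^esub> f h" if "g \<in> C" "h \<in> C" for g h
    using f that by (auto simp: hom_def)
  define M where "M = mat n n (\<lambda>(i, j). of_int (d (f (basis j [^] k)) i) / of_nat k :: rat)"
  show thesis
  proof (rule that[of M])
    show "M \<in> carrier_mat n n" by (simp add: M_def)
    fix g assume g: "g \<in> C"
    then have gA: "g \<in> carrier A" using subgroup.mem_carrier[OF C] by blast
    have fpow: "f (g [^] m) = f g [^]\<^bsub>B\<^esub> m" for m :: nat
    proof (induction m)
      case 0
      have "f \<one> \<otimes>\<^bsub>B\<^esub> f \<one> = f \<one>" using fm[of \<one> \<one>] subgroup.one_closed[OF C] by simp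
      then show ?case using fB[OF subgroup.one_closed[OF C]] by simp
    next
      case (Suc m)
      have "g [^] m \<in> C" using g C by (induction m) (auto simp: subgroup.one_closed subgroup.m_closed)
      then show ?case using fm[OF _ g, of "g [^] m"] Suc by simp
    qed
    show "M * col g = B.col (f g)"
    proof (rule eq_matI)
      fix i j assume "i < dim_row (B.col (f g))" "j < dim_col (B.col (f g))"
      then have ij: "i < n" "j = 0" by (auto simp: B.col_def)
      define F where "F x = (of_int (d (f (x [^] k)) i) :: rat)" for x
      have "F (x \<otimes> y) = F x + F y" if "x \<in> carrier A" "y \<in> carrier A" for x y
        using that ij fm[OF k(2)[OF that(1)] k(2)[OF that(2)]] fB[OF k(2)[OF that(1)]] fB[OF k(2)[OF that(2)]]
        by (simp add: F_def pow_mult B.c_mult)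
      then have "F g = (\<Sum>j<n. of_int (c g j) * F (basis j))"
        using gA by (rule additive_expand)
      moreover have "F g = of_nat k * of_int (d (f g) i)"
        using ij fB[OF g] by (simp add: F_def fpow B.c_pow)
      ultimately have "of_int (d (f g) i) = (\<Sum>j<n. of_int (c g j) * F (basis j)) / of_nat k"
        using k(1) by (simp add: field_simps)
      also have "\<dots> = (\<Sum>j<n. F (basis j) / of_nat k * of_int (c g j))"
        by (simp add: sum_divide_distrib mult.commute)
      finally show "(M * col g) $$ (i, j) = B.col (f g) $$ (i, j)"
        using ij by (simp add: M_def B.col_def col_def scalar_prod_def F_def atLeast0LessThan)
    qed (auto simp: M_def col_def B.col_def)
  qed
qed

text \<open>\<open>C\<close> contains a nonzero multiple of every basis vector. The lemma shows that
  matrices extending mutually inverse maps between subgroups of finite index are inverse to each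
  other.\<close>

lemma mat_one_if_fixes:
  assumes M: "M \<in> carrier_mat n n" and k: "k \<ge> (1 :: nat)" "!!g. g \<in> carrier A ==> g [^] k \<in> C"
    and fixed: "!!g. g \<in> C ==> M * col g = col g"
  shows "M = 1\<^sub>m n"
proof (rule eq_matI)
  fix i j assume "i < dim_row (1\<^sub>m n :: rat mat)" "j < dim_col (1\<^sub>m n :: rat mat)"
  then have ij: "i < n" "j < n" by auto
  have "of_int (c (basis j [^] k) i) = (M * col (basis j [^] k)) $$ (i, 0)"
    using fixed[OF k(2)[OF basis_closed]] ij by (simp add: col_def)
  also have "\<dots> = (\<Sum>l<n. M $$ (i, l) * of_int (c (basis j [^] k) l))"
    using M ij by (simp add: col_def scalar_prod_def atLeast0LessThan)
  also have "\<dots> = (\<Sum>l<n. if l = j then M $$ (i, l) * of_nat k else 0)"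
    by (rule sum.cong) (auto simp: c_pow c_basis)
  also have "\<dots> = M $$ (i, j) * of_nat k" using ij by simp
  finally show "M $$ (i, j) = 1\<^sub>m n $$ (i, j)"
    using k(1) ij by (auto simp: c_pow c_basis split: if_splits)
qed (use M in auto)

end

subsection \<open>Affine matrices\<close>

definition trans_mat :: "nat => rat mat => rat mat" where
  "trans_mat n x = four_block_mat (1\<^sub>m n) x (0\<^sub>m 1 n) (1\<^sub>m 1)"

definition lin_mat :: "nat => rat mat => rat mat" where
  "lin_mat n M = four_block_mat M (0\<^sub>m n 1) (0\<^sub>m 1 n) (1\<^sub>m 1)"

lemma trans_mat_closed [simp]: "x \<in> carrier_mat n 1 ==> trans_mat n x \<in> carrier_mat (n + 1) (n + 1)"
  unfolding trans_mat_def by (rule four_block_carrier_mat) auto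

lemma lin_mat_closed [simp]: "M \<in> carrier_mat n n ==> lin_mat n M \<in> carrier_mat (n + 1) (n + 1)"
  unfolding lin_mat_def by (rule four_block_carrier_mat) auto

lemma trans_mat_mult:
  assumes "x \<in> carrier_mat n 1" "z \<in> carrier_mat n 1"
  shows "trans_mat n x * trans_mat n z = trans_mat n (x + z)"
  unfolding trans_mat_def using assms
  by (subst mult_four_block_mat[of _ n n _ 1 _ 1 _ _ n _ 1]) (auto simp: comm_add_mat[of x n 1 z])

lemma lin_mat_mult:
  assumes "M \<in> carrier_mat n n" "N \<in> carrier_mat n n"
  shows "lin_mat n M * lin_mat n N = lin_mat n (M * N)"
  unfolding lin_mat_def using assms
  by (subst mult_four_block_mat[of _ n n _ 1 _ 1 _ _ n _ 1]) auto

text \<open>A linear map conjugates a translation to the translation by the image vector. This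
  becomes the relation of a stable letter.\<close>

lemma lin_trans_mat:
  assumes "M \<in> carrier_mat n n" "x \<in> carrier_mat n 1"
  shows "lin_mat n M * trans_mat n x = trans_mat n (M * x) * lin_mat n M"
  unfolding lin_mat_def trans_mat_def using assms
  by (subst (1 2) mult_four_block_mat[of _ n n _ 1 _ 1 _ _ n _ 1]) auto

lemma trans_mat_zero: "trans_mat n (0\<^sub>m n 1) = 1\<^sub>m (n + 1)"
  by (rule eq_matI) (auto simp: trans_mat_def)

lemma lin_mat_one: "lin_mat n (1\<^sub>m n) = 1\<^sub>m (n + 1)"
  by (simp add: lin_mat_def)

lemma trans_mat_inj:
  assumes "x \<in> carrier_mat n 1" "z \<in> carrier_mat n 1" "trans_mat n x = trans_mat n z"
  shows "x = z"
proof (rule eq_matI)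
  fix i j assume "i < dim_row z" "j < dim_col z"
  then have ij: "i < n" "j = 0" using assms(2) by auto
  have "trans_mat n x $$ (i, n) = trans_mat n z $$ (i, n)" by (simp add: assms(3))
  then show "x $$ (i, j) = z $$ (i, j)"
    using ij assms(1,2) by (simp add: trans_mat_def)
qed (use assms in auto)

lemma trans_mat_GL:
  assumes "x \<in> carrier_mat n 1" shows "trans_mat n x \<in> carrier (GL_rat (n + 1))"
proof -
  have "x + (- x) = 0\<^sub>m n 1" "- x + x = 0\<^sub>m n 1" "- x \<in> carrier_mat n 1"
    using assms by (auto intro!: eq_matI)
  then show ?thesis
    unfolding carrier_GL_rat
    using trans_mat_closed[OF assms] trans_mat_closed[of "- x" n] assms
    by (auto intro!: bexI[of _ "trans_mat n (- x)"] simp: trans_mat_mult trans_mat_zero[simplified] simp del: trans_mat_closed)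
qed

lemma lin_mat_GL:
  assumes "M \<in> carrier_mat n n" "N \<in> carrier_mat n n" "M * N = 1\<^sub>m n" "N * M = 1\<^sub>m n"
  shows "lin_mat n M \<in> carrier (GL_rat (n + 1))"
  unfolding carrier_GL_rat
  using lin_mat_closed[OF assms(1)] lin_mat_closed[OF assms(2)] assms
  by (auto intro!: bexI[of _ "lin_mat n N"] simp: lin_mat_mult lin_mat_one simp del: lin_mat_closed)

section \<open>Generalized Baumslag--Solitar groups\<close>

lemma Zn_coords_of_iso:
  assumes A: "group A" and iso: "A \<cong> Zn n"
  obtains c where "Zn_coords A n c"
proof -
  obtain f where f: "f \<in> iso A (Zn n)" using iso by (auto simp: is_iso_def)
  have mult: "f (g \<otimes>\<^bsub>A\<^esub> h) = f g \<otimes>\<^bsub>Zn n\<^esub> f h" if "g \<in> carrier A" "h \<in> carrier A" for g h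
    using f that by (auto simp: iso_def hom_def)
  have bij: "bij_betw f (carrier A) (carrier (Zn n))" using f by (simp add: iso_def)
  have carr: "carrier (Zn n) = {..<n} \<rightarrow>\<^sub>E UNIV"
    by (auto simp: Zn_def PiE_iff integer_group_def)
  interpret group A by fact
  show thesis
  proof (rule that[of f], unfold_locales)
    show "f (g \<otimes>\<^bsub>A\<^esub> h) i = f g i + f h i" if "g \<in> carrier A" "h \<in> carrier A" "i < n" for g h i
      using that mult[OF that(1,2)] by (simp add: Zn_def)
    show "g = h" if "g \<in> carrier A" "h \<in> carrier A" "!!i. i < n ==> f g i = f h i" for g h
    proof -
      have "f g \<in> {..<n} \<rightarrow>\<^sub>E UNIV" "f h \<in> {..<n} \<rightarrow>\<^sub>E UNIV"
        using bij that(1,2) carr by (auto simp: bij_betw_def)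
      then have "f g = f h" using that(3) by (intro PiE_ext[of "f g" "{..<n}" "\<lambda>_. UNIV"]) auto
      then show ?thesis using bij that(1,2) by (auto simp: bij_betw_def inj_on_def)
    qed
    show "\<exists>g\<in>carrier A. \<forall>i<n. f g i = z i" for z
    proof -
      have "restrict z {..<n} \<in> f ` carrier A" using bij carr by (auto simp: bij_betw_def)
      then obtain g where "g \<in> carrier A" "f g = restrict z {..<n}" by force
      then show ?thesis by (intro bexI[of _ g]) auto
    qed
  qed
qed

lemma (in Zn_coords) finite_index_pow_mem:
  assumes "subgroup H A" "finite (rcosets H)"
  obtains k :: nat where "k \<ge> 1" "!!g. g \<in> carrier A ==> g [^] k \<in> H"
  using normal_pow_mem[OF normal[OF assms(1)] assms(2)] by blast

text \<open>The projection of the twisted representation to \<open>P\<close>. The stable letters of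
  \<open>T\<close> may have nontrivial values \<open>s e\<close>, so on vertex groups it agrees with
  \<open>a\<close> only up to the conjugation that stems from the potential.\<close>

lemma (in gog_rep) conj_rep:
  obtains \<alpha> where "\<alpha> \<in> hom G P"
    "!!\<gamma> v. \<gamma> \<in> carrier G ==> v \<in> V ==> \<exists>b\<in>carrier P. \<forall>g\<in>carrier (A v).
      \<alpha> (\<gamma> \<otimes> \<epsilon> v g \<otimes> inv \<gamma>) = b \<cdot> a v g \<cdot> inv\<^sub>P b"
proof -
  obtain q where q: "potential q" by (rule potential_exists)
  obtain \<Theta> where \<Theta>: "twisted q \<Theta>" by (rule twisted_exists[OF q])
  interpret gog_twisted G \<Gamma> T \<Phi> P a s q \<Theta>
    by unfold_locales (rule q \<Theta>)+
  interpret sh: group_hom X P snd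
    using snd_hom by unfold_locales
  show thesis
  proof (rule that[of "\<lambda>g. snd (\<Theta> g)"])
    show "(\<lambda>g. snd (\<Theta> g)) \<in> hom G P" by (rule homI) auto
    fix \<gamma> v assume \<gamma>: "\<gamma> \<in> carrier G" and v: "v \<in> V"
    show "\<exists>b\<in>carrier P. \<forall>g\<in>carrier (A v).
      snd (\<Theta> (\<gamma> \<otimes> \<epsilon> v g \<otimes> inv \<gamma>)) = b \<cdot> a v g \<cdot> inv\<^sub>P b"
    proof (intro bexI[of _ "snd (\<Theta> \<gamma> \<star> q v)"] ballI)
      fix g assume g: "g \<in> carrier (A v)"
      then have "\<Theta> (\<gamma> \<otimes> \<epsilon> v g \<otimes> inv \<gamma>) =
          (\<Theta> \<gamma> \<star> q v) \<star> ([], a v g) \<star> inv\<^sub>X (\<Theta> \<gamma> \<star> q v)"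
        using \<gamma> v by (simp add: \<Theta>_\<epsilon> X.word_simps)
      moreover have "snd (y \<star> ([], a v g) \<star> inv\<^sub>X y) = snd y \<cdot> a v g \<cdot> inv\<^sub>P snd y"
        if "y \<in> carrier X" for y
        using that g v by simp
      ultimately show "snd (\<Theta> (\<gamma> \<otimes> \<epsilon> v g \<otimes> inv \<gamma>)) =
          snd (\<Theta> \<gamma> \<star> q v) \<cdot> a v g \<cdot> inv\<^sub>P snd (\<Theta> \<gamma> \<star> q v)"
        using \<gamma> by simp
    qed (use \<gamma> in \<open>simp\<close>)
  qed
qed

locale gbs = gog_group G \<Gamma> T \<Phi>
  for G :: "('g, 'b) monoid_scheme" (structure)
    and \<Gamma> :: "('v, 'e, 'a) gog" and T and \<Phi> +
  fixes n :: nat and c :: "'v => 'a => nat => int" and r :: nat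
  assumes coords: "v \<in> V ==> Zn_coords (A v) n (c v)"
    and r: "r \<ge> 1"
    and esub_pow: "e \<in> E ==> g \<in> carrier (A (org e)) ==> g [^]\<^bsub>A (org e)\<^esub> r \<in> esub \<Gamma> e"
    and emap_pow: "e \<in> E ==> g \<in> carrier (A (ter e)) ==> g [^]\<^bsub>A (ter e)\<^esub> r \<in> emap \<Gamma> e ` esub \<Gamma> e"

lemma (in gog_group) gbs_exists:
  assumes "GBS_graph_of_groups n \<Gamma>"
  obtains c r where "gbs G \<Gamma> T \<Phi> n c r"
proof -
  have "\<exists>c. Zn_coords (A v) n c" if "v \<in> V" for v
    using Zn_coords_of_iso[OF A_group[OF that], of n] assms that unfolding GBS_graph_of_groups_def by metis
  then obtain c where c: "!!v. v \<in> V ==> Zn_coords (A v) n (c v)" by metis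
  have "\<exists>k\<ge>1::nat. (\<forall>g\<in>carrier (A (org e)). g [^]\<^bsub>A (org e)\<^esub> k \<in> esub \<Gamma> e) \<and>
      (\<forall>g\<in>carrier (A (ter e)). g [^]\<^bsub>A (ter e)\<^esub> k \<in> emap \<Gamma> e ` esub \<Gamma> e)" if e: "e \<in> E" for e
  proof -
    have V: "org e \<in> V" "ter e \<in> V" using e by auto
    interpret o: Zn_coords "A (org e)" n "c (org e)" by (rule c[OF V(1)])
    interpret t: Zn_coords "A (ter e)" n "c (ter e)" by (rule c[OF V(2)])
    have fin: "finite (rcosets\<^bsub>A (org e)\<^esub> esub \<Gamma> e)" "finite (rcosets\<^bsub>A (ter e)\<^esub> (emap \<Gamma> e ` esub \<Gamma> e))"
      using assms e by (auto simp: GBS_graph_of_groups_def)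
    obtain k :: nat where k: "k \<ge> 1" "!!g. g \<in> carrier (A (org e)) ==> g [^]\<^bsub>A (org e)\<^esub> k \<in> esub \<Gamma> e"
      by (rule o.finite_index_pow_mem[OF esub_subgroup[OF e] fin(1)]) (rule that; blast)
    obtain l :: nat where l: "l \<ge> 1" "!!g. g \<in> carrier (A (ter e)) ==> g [^]\<^bsub>A (ter e)\<^esub> l \<in> emap \<Gamma> e ` esub \<Gamma> e"
      by (rule t.finite_index_pow_mem[OF emap_subgroup[OF e] fin(2)]) (rule that; blast)
    have "g [^]\<^bsub>A (org e)\<^esub> (k * l) \<in> esub \<Gamma> e" if "g \<in> carrier (A (org e))" for g
      using k(2)[of "g [^]\<^bsub>A (org e)\<^esub> l"] that by (simp add: o.nat_pow_pow mult.commute)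
    moreover have "g [^]\<^bsub>A (ter e)\<^esub> (k * l) \<in> emap \<Gamma> e ` esub \<Gamma> e" if "g \<in> carrier (A (ter e))" for g
      using l(2)[of "g [^]\<^bsub>A (ter e)\<^esub> k"] that by (simp add: t.nat_pow_pow)
    ultimately show ?thesis using k(1) l(1) by (intro exI[of _ "k * l"]) auto
  qed
  then obtain k :: "'e => nat" where k: "!!e. e \<in> E ==> k e \<ge> 1"
    "!!e g. e \<in> E ==> g \<in> carrier (A (org e)) ==> g [^]\<^bsub>A (org e)\<^esub> k e \<in> esub \<Gamma> e"
    "!!e g. e \<in> E ==> g \<in> carrier (A (ter e)) ==> g [^]\<^bsub>A (ter e)\<^esub> k e \<in> emap \<Gamma> e ` esub \<Gamma> e"
    by metis
  \<comment> \<open>The product over all edges is one exponent that serves every edge group at both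
    of its ends.\<close>
  define r where "r = prod k E"
  have "\<exists>l. r = l * k e" if "e \<in> E" for e
    using prod.remove[OF T.D.finite_arcs that, of k] by (auto simp: r_def mult.commute)
  then obtain l where l: "!!e. e \<in> E ==> r = l e * k e" by metis
  show thesis
  proof (rule that[of c r], intro gbs.intro gbs_axioms.intro gog_group_axioms)
    have "0 < prod k E" by (rule prod_pos) (use k(1) in force)
    then show "r \<ge> 1" unfolding r_def by linarith
    fix e g assume e: "e \<in> E"
    have V: "org e \<in> V" "ter e \<in> V" using e by auto
    interpret o: Zn_coords "A (org e)" n "c (org e)" by (rule c[OF V(1)])
    interpret t: Zn_coords "A (ter e)" n "c (ter e)" by (rule c[OF V(2)])
    show "g [^]\<^bsub>A (org e)\<^esub> r \<in> esub \<Gamma> e" if "g \<in> carrier (A (org e))"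
      using k(2)[OF e, of "g [^]\<^bsub>A (org e)\<^esub> l e"] that l[OF e] by (simp add: o.nat_pow_pow)
    show "g [^]\<^bsub>A (ter e)\<^esub> r \<in> emap \<Gamma> e ` esub \<Gamma> e" if "g \<in> carrier (A (ter e))"
      using k(3)[OF e, of "g [^]\<^bsub>A (ter e)\<^esub> l e"] that l[OF e] by (simp add: t.nat_pow_pow)
  qed (rule c)
qed

section \<open>The affine representation of a generalized Baumslag-Solitar group\<close>

context gbs begin

abbreviation "cvec v \<equiv> Zn_coords.col n (c v)"
abbreviation "tvec v g \<equiv> trans_mat n (cvec v g)"
abbreviation "GL \<equiv> GL_rat (n + 1)"

text \<open>The edge group has finite index at both ends, so the edge map and its inverse both
  extend to rational matrices. These are inverse to each other because their products fix a subgroup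
  of finite index.\<close>

lemma edge_matrix:
  assumes e: "e \<in> E"
  obtains M where "M \<in> carrier_mat n n" "lin_mat n M \<in> carrier GL"
    "!!g. g \<in> esub \<Gamma> e ==> M * cvec (org e) g = cvec (ter e) (emap \<Gamma> e g)"
proof -
  have V: "org e \<in> V" "ter e \<in> V" using e by auto
  interpret o: Zn_coords "A (org e)" n "c (org e)" by (rule coords[OF V(1)])
  interpret t: Zn_coords "A (ter e)" n "c (ter e)" by (rule coords[OF V(2)])
  let ?C = "esub \<Gamma> e" and ?D = "emap \<Gamma> e ` esub \<Gamma> e"
  have f: "emap \<Gamma> e \<in> hom (A (org e)\<lparr>carrier := ?C\<rparr>) (A (ter e))"
    using emap_hom[OF e] by (simp add: egrp_def)
  have inv: "inv_into ?C (emap \<Gamma> e) (emap \<Gamma> e g) = g" if "g \<in> ?C" for g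
    using emap_inj[OF e] that by (rule inv_into_f_f)
  have f': "inv_into ?C (emap \<Gamma> e) \<in> hom (A (ter e)\<lparr>carrier := ?D\<rparr>) (A (org e))"
  proof (rule homI)
    fix x y assume xy: "x \<in> carrier (A (ter e)\<lparr>carrier := ?D\<rparr>)" "y \<in> carrier (A (ter e)\<lparr>carrier := ?D\<rparr>)"
    then obtain g h where g: "g \<in> ?C" "x = emap \<Gamma> e g" and h: "h \<in> ?C" "y = emap \<Gamma> e h" by auto
    have "emap \<Gamma> e (g \<otimes>\<^bsub>A (org e)\<^esub> h) = x \<otimes>\<^bsub>A (ter e)\<^esub> y"
      using f g h by (auto simp: hom_def)
    then show "inv_into ?C (emap \<Gamma> e) (x \<otimes>\<^bsub>A (ter e)\<lparr>carrier := ?D\<rparr>\<^esub> y) =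
        inv_into ?C (emap \<Gamma> e) x \<otimes>\<^bsub>A (org e)\<^esub> inv_into ?C (emap \<Gamma> e) y"
      using g h inv[of "g \<otimes>\<^bsub>A (org e)\<^esub> h"] subgroup.m_closed[OF esub_subgroup[OF e] g(1) h(1)]
      by (simp add: inv)
  qed (use inv esub_closed[OF e] in auto)
  obtain M where M: "M \<in> carrier_mat n n" "!!g. g \<in> ?C ==> M * cvec (org e) g = cvec (ter e) (emap \<Gamma> e g)"
    by (rule o.extend_hom[OF coords[OF V(2)] esub_subgroup[OF e] r esub_pow[OF e] f]) (assumption, rule that, assumption, blast)
  obtain N where N: "N \<in> carrier_mat n n"
    "!!g. g \<in> ?D ==> N * cvec (ter e) g = cvec (org e) (inv_into ?C (emap \<Gamma> e) g)"
    by (rule t.extend_hom[OF coords[OF V(1)] emap_subgroup[OF e] r emap_pow[OF e] f']) (assumption, rule that, assumption, blast)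
  have "N * M = 1\<^sub>m n"
  proof (rule o.mat_one_if_fixes[OF _ r esub_pow[OF e]])
    show "N * M * cvec (org e) g = cvec (org e) g" if "g \<in> ?C" for g
      using assoc_mult_mat[OF N(1) M(1) o.col_closed[of g]] that by (simp add: M N inv)
  qed (use M N in auto)
  moreover have "M * N = 1\<^sub>m n"
  proof (rule t.mat_one_if_fixes[OF _ r emap_pow[OF e]])
    show "M * N * cvec (ter e) g = cvec (ter e) g" if "g \<in> ?D" for g
      using assoc_mult_mat[OF M(1) N(1) t.col_closed[of g]] that by (auto simp: M N inv)
  qed (use M N in auto)
  ultimately have "lin_mat n M \<in> carrier GL"
    using lin_mat_GL[OF M(1) N(1)] by simp
  then show thesis using M by (intro that[of M]) auto
qed

text \<open>Keeps the dimension in the form \<open>n + 1\<close>, which simplification would turn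
  into \<open>Suc n\<close>.\<close>

context notes One_nat_def [simp del] begin

text \<open>Vertex elements act as translations and stable letters as the linear maps extending the
  edge isomorphisms. Different vertex elements give different translations, which settles the pinch
  conditions.\<close>

lemma affine_gog_rep:
  obtains M where "gog_rep G \<Gamma> T \<Phi> GL tvec (\<lambda>e. lin_mat n (M e))"
proof -
  have "\<exists>M. M \<in> carrier_mat n n \<and> lin_mat n M \<in> carrier GL \<and>
    (\<forall>g\<in>esub \<Gamma> e. M * cvec (org e) g = cvec (ter e) (emap \<Gamma> e g))" if "e \<in> E" for e
    by (rule edge_matrix[OF that]) blast
  then obtain M where M: "!!e. e \<in> E ==> M e \<in> carrier_mat n n"
    "!!e. e \<in> E ==> lin_mat n (M e) \<in> carrier GL"
    "!!e g. e \<in> E ==> g \<in> esub \<Gamma> e ==> M e * cvec (org e) g = cvec (ter e) (emap \<Gamma> e g)"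
    by metis
  have inj: "g = h" if "v \<in> V" "g \<in> carrier (A v)" "h \<in> carrier (A v)"
    "tvec v g = tvec v h" for v g h
  proof -
    interpret v: Zn_coords "A v" n "c v" by (rule coords[OF that(1)])
    show ?thesis by (rule v.col_inj[OF that(2,3) trans_mat_inj[OF v.col_closed v.col_closed that(4)]])
  qed
  have "gog_rep G \<Gamma> T \<Phi> GL tvec (\<lambda>e. lin_mat n (M e))"
  proof (intro gog_rep.intro gog_rep_axioms.intro group_GL_rat)
    show "gog_group G \<Gamma> T \<Phi>" by unfold_locales
  next
    fix v assume v: "v \<in> V"
    interpret v: Zn_coords "A v" n "c v" by (rule coords[OF v])
    show "(\<lambda>g. tvec v g) \<in> hom (A v) GL"
      by (rule homI) (auto simp: trans_mat_GL v.col_mult mult_GL_rat trans_mat_mult)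
  next
    fix e assume e: "e \<in> E"
    then have V: "org e \<in> V" "ter e \<in> V" by auto
    interpret o: Zn_coords "A (org e)" n "c (org e)" by (rule coords[OF V(1)])
    interpret t: Zn_coords "A (ter e)" n "c (ter e)" by (rule coords[OF V(2)])
    show "lin_mat n (M e) \<in> carrier GL" by (rule M(2)[OF e])
    show "lin_mat n (M e) \<otimes>\<^bsub>GL\<^esub> trans_mat n (cvec (org e) g) =
      trans_mat n (cvec (ter e) (emap \<Gamma> e g)) \<otimes>\<^bsub>GL\<^esub> lin_mat n (M e)" if "g \<in> esub \<Gamma> e" for g
      using lin_trans_mat[OF M(1)[OF e] o.col_closed] M(3)[OF e that] by (simp add: mult_GL_rat)
    show "g \<in> emap \<Gamma> e ` esub \<Gamma> e" if "g \<in> carrier (A (ter e))"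
      "trans_mat n (cvec (ter e) g) \<in> (\<lambda>g. trans_mat n (cvec (ter e) g)) ` emap \<Gamma> e ` esub \<Gamma> e" for g
      using that inj[OF V(2) that(1)] emap_closed[OF e] by auto
    show "g \<in> esub \<Gamma> e" if "g \<in> carrier (A (org e))"
      "trans_mat n (cvec (org e) g) \<in> (\<lambda>g. trans_mat n (cvec (org e) g)) ` esub \<Gamma> e" for g
      using that inj[OF V(1) that(1)] esub_closed[OF e] by auto
  qed
  then show thesis by (rule that)
qed

lemma common_vgroup_or_bridge:
  assumes "\<gamma>1 \<in> carrier G" "\<gamma>2 \<in> carrier G" "v1 \<in> V" "v2 \<in> V"
  obtains (common) \<gamma> v where "\<gamma> \<in> carrier G" "v \<in> V" "vgroup \<gamma>1 v1 \<union> vgroup \<gamma>2 v2 \<subseteq> vgroup \<gamma> v"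
  | (bridge) \<gamma> v where "\<gamma> \<in> carrier G" "v \<in> V"
    "!!z. z \<in> carrier G ==> (!!h. h \<in> vgroup \<gamma>1 v1 \<union> vgroup \<gamma>2 v2 ==> z \<otimes> h = h \<otimes> z) ==> z \<in> vgroup \<gamma> v"
proof -
  obtain M where "gog_rep G \<Gamma> T \<Phi> GL tvec (\<lambda>e. lin_mat n (M e))"
    by (rule affine_gog_rep)
  then interpret gog_rep G \<Gamma> T \<Phi> GL tvec "\<lambda>e. lin_mat n (M e)" .
  obtain q where q: "potential q" by (rule potential_exists)
  obtain \<Theta> where \<Theta>: "twisted q \<Theta>" by (rule twisted_exists[OF q])
  interpret gog_twisted G \<Gamma> T \<Phi> GL tvec "\<lambda>e. lin_mat n (M e)" q \<Theta>
    by unfold_locales (rule q \<Theta>)+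
  show thesis by (rule common_vgroup_or_bridge[OF assms]) (fact common, fact bridge)
qed

text \<open>A translation \<open>\<tau>\<close> satisfies
  \<open>\<tau>^m - 1 = m (\<tau> - 1)\<close>, and conjugation preserves this. The last clause thus
  turns the existence of roots into divisibility of matrix entries.\<close>

lemma affine_rep:
  obtains \<alpha> where "\<alpha> \<in> hom G GL"
    "!!\<gamma> v g. \<gamma> \<in> carrier G ==> v \<in> V ==> g \<in> carrier (A v) ==>
      \<alpha> (\<gamma> \<otimes> \<epsilon> v g \<otimes> inv \<gamma>) = 1\<^sub>m (n + 1) ==> g = \<one>\<^bsub>A v\<^esub>"
    "!!\<gamma> v h m. \<gamma> \<in> carrier G ==> v \<in> V ==> h \<in> vgroup \<gamma> v ==>
      \<alpha> (h [^] (m :: nat)) = 1\<^sub>m (n + 1) + of_nat m \<cdot>\<^sub>m (\<alpha> h - 1\<^sub>m (n + 1))"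
proof -
  obtain M where "gog_rep G \<Gamma> T \<Phi> GL tvec (\<lambda>e. lin_mat n (M e))"
    by (rule affine_gog_rep)
  then interpret gog_rep G \<Gamma> T \<Phi> GL tvec "\<lambda>e. lin_mat n (M e)" .
  obtain \<alpha> where \<alpha>_hom: "\<alpha> \<in> hom G GL" and conj:
    "!!\<gamma> v. \<gamma> \<in> carrier G ==> v \<in> V ==> \<exists>b\<in>carrier GL. \<forall>g\<in>carrier (A v).
      \<alpha> (\<gamma> \<otimes> \<epsilon> v g \<otimes> inv \<gamma>) = b \<otimes>\<^bsub>GL\<^esub> tvec v g \<otimes>\<^bsub>GL\<^esub> inv\<^bsub>GL\<^esub> b"
    by (rule conj_rep) blast
  show thesis
  proof (rule that[OF \<alpha>_hom])
    fix \<gamma> v g assume \<gamma>: "\<gamma> \<in> carrier G" and v: "v \<in> V" and g: "g \<in> carrier (A v)"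
      and one: "\<alpha> (\<gamma> \<otimes> \<epsilon> v g \<otimes> inv \<gamma>) = 1\<^sub>m (n + 1)"
    interpret v: Zn_coords "A v" n "c v" by (rule coords[OF v])
    obtain b where b: "b \<in> carrier GL"
      "b \<otimes>\<^bsub>GL\<^esub> tvec v g \<otimes>\<^bsub>GL\<^esub> inv\<^bsub>GL\<^esub> b = \<one>\<^bsub>GL\<^esub>"
      using conj[OF \<gamma> v] g one by (auto simp: one_GL_rat)
    then have "b \<otimes>\<^bsub>GL\<^esub> tvec v g = b"
      using a_closed[OF v g] P.m_closed[OF b(1) a_closed[OF v g]] P.inv_equality[OF b(2)]
      by (metis P.inv_closed P.inv_inv P.inv_solve_right' P.l_one P.one_closed)
    then have "tvec v g = \<one>\<^bsub>GL\<^esub>"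
      using b(1) a_closed[OF v g] P.r_cancel_one by simp
    then have "tvec v g = trans_mat n (cvec v \<one>\<^bsub>A v\<^esub>)"
      by (simp add: v.col_one trans_mat_zero one_GL_rat)
    then show "g = \<one>\<^bsub>A v\<^esub>"
      by (rule v.col_inj[OF g v.one_closed trans_mat_inj[OF v.col_closed v.col_closed]])
  next
    fix \<gamma> v h and m :: nat assume \<gamma>: "\<gamma> \<in> carrier G" and v: "v \<in> V" and "h \<in> vgroup \<gamma> v"
    interpret v: Zn_coords "A v" n "c v" by (rule coords[OF v])
    obtain g where g: "g \<in> carrier (A v)" "h = \<gamma> \<otimes> \<epsilon> v g \<otimes> inv \<gamma>"
      using \<open>h \<in> vgroup \<gamma> v\<close> by (auto simp: vgroup_def)
    obtain B where B: "B \<in> carrier GL" and \<alpha>: "!!g. g \<in> carrier (A v) ==>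
        \<alpha> (\<gamma> \<otimes> \<epsilon> v g \<otimes> inv \<gamma>) = B * tvec v g * inv\<^bsub>GL\<^esub> B"
      using conj[OF \<gamma> v] unfolding mult_GL_rat by blast
    define B' where "B' = inv\<^bsub>GL\<^esub> B"
    have BB: "B * B' = 1\<^sub>m (n + 1)" "B \<in> carrier_mat (n + 1) (n + 1)" "B' \<in> carrier_mat (n + 1) (n + 1)"
      using P.r_inv[OF B] GL_rat_carrier_mat[OF B] GL_rat_carrier_mat[OF P.inv_closed[OF B]]
      by (simp_all add: B'_def mult_GL_rat one_GL_rat)
    let ?t = "\<lambda>g. tvec v g" and ?I = "1\<^sub>m (n + 1) :: rat mat"
    have t: "?t g \<in> carrier_mat (n + 1) (n + 1)" for g by (rule trans_mat_closed) simp
    interpret \<epsilon>: group_hom "A v" G "\<epsilon> v" by (rule \<epsilon>_hom[OF v])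
    have "h [^] m = \<gamma> \<otimes> \<epsilon> v (g [^]\<^bsub>A v\<^esub> m) \<otimes> inv \<gamma>"
    proof (induction m)
      case (Suc m)
      then show ?case using \<gamma> g by (simp add: m_assoc)
    qed (use \<gamma> in simp)
    then have "\<alpha> (h [^] m) = B * ?t (g [^]\<^bsub>A v\<^esub> m) * B'" using \<alpha> g by (simp add: B'_def)
    also have "?t (g [^]\<^bsub>A v\<^esub> m) = ?I + of_nat m \<cdot>\<^sub>m (?t g - ?I)"
      using g(1) by (intro eq_matI) (auto simp: trans_mat_def v.col_def v.c_pow)
    also have "B * (?I + of_nat m \<cdot>\<^sub>m (?t g - ?I)) * B' = ?I + of_nat m \<cdot>\<^sub>m (B * ?t g * B' - ?I)"
    proof -
      have d: "?t g - ?I \<in> carrier_mat (n + 1) (n + 1)" by (rule minus_carrier_mat) simp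
      have "B * (?I + of_nat m \<cdot>\<^sub>m (?t g - ?I)) = B * ?I + of_nat m \<cdot>\<^sub>m (B * (?t g - ?I))"
        using mult_add_distrib_mat[OF BB(2) one_carrier_mat smult_carrier_mat[OF d]]
          mult_smult_distrib[OF BB(2) d] by simp
      also have "B * (?t g - ?I) = B * ?t g - B * ?I"
        by (rule mult_minus_distrib_mat[OF BB(2) t one_carrier_mat])
      also have "B * ?I = B" using BB(2) by simp
      finally have 1: "B * (?I + of_nat m \<cdot>\<^sub>m (?t g - ?I)) = B + of_nat m \<cdot>\<^sub>m (B * ?t g - B)" .
      have d: "B * ?t g \<in> carrier_mat (n + 1) (n + 1)" "B * ?t g - B \<in> carrier_mat (n + 1) (n + 1)"
        using t[of g] BB(2) by (auto intro: mult_carrier_mat minus_carrier_mat)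
      have "(B + of_nat m \<cdot>\<^sub>m (B * ?t g - B)) * B' = B * B' + of_nat m \<cdot>\<^sub>m ((B * ?t g - B) * B')"
        using add_mult_distrib_mat[OF BB(2) smult_carrier_mat[OF d(2)] BB(3)]
          mult_smult_assoc_mat[OF d(2) BB(3)] by simp
      also have "(B * ?t g - B) * B' = B * ?t g * B' - B * B'"
        by (rule minus_mult_distrib_mat[OF d(1) BB(2,3)])
      finally show ?thesis by (simp only: 1 BB(1))
    qed
    finally show "\<alpha> (h [^] m) = ?I + of_nat m \<cdot>\<^sub>m (\<alpha> h - ?I)"
      using \<alpha> g by (simp add: B'_def)
  qed
qed

end

text \<open>Vertex groups embed because the affine representation is injective on each of
  them.\<close>

lemma \<epsilon>_inj:
  assumes v: "v \<in> V" shows "inj_on (\<epsilon> v) (carrier (A v))"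
proof -
  interpret \<epsilon>: group_hom "A v" G "\<epsilon> v" by (rule \<epsilon>_hom[OF v])
  obtain \<alpha> where \<alpha>: "\<alpha> \<in> hom G GL"
    "!!\<gamma> v g. \<gamma> \<in> carrier G ==> v \<in> V ==> g \<in> carrier (A v) ==>
      \<alpha> (\<gamma> \<otimes> \<epsilon> v g \<otimes> inv \<gamma>) = 1\<^sub>m (n + 1) ==> g = \<one>\<^bsub>A v\<^esub>"
    by (rule affine_rep) (rule that, assumption, blast)
  have "\<alpha> \<one> = 1\<^sub>m (n + 1)"
    using hom_one[OF \<alpha>(1) group_axioms group_GL_rat] by (simp add: one_GL_rat)
  then have "g = \<one>\<^bsub>A v\<^esub>" if "g \<in> carrier (A v)" "\<epsilon> v g = \<one>" for g
    using \<alpha>(2)[OF one_closed v that(1)] that(2) by simp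
  then show ?thesis by (rule \<epsilon>.inj_on_one_iff[THEN iffD2, rule_format])
qed

end

section \<open>Profinite closures\<close>

context normal begin

lemma coset_mult:
  assumes "H #> x = H #> x'" "H #> y = H #> y'" "x \<in> carrier G" "x' \<in> carrier G" "y \<in> carrier G" "y' \<in> carrier G"
  shows "H #> (x \<otimes> y) = H #> (x' \<otimes> y')"
  using rcos_sum[of x y] rcos_sum[of x' y'] assms by simp

lemma coset_inv:
  assumes "H #> x = H #> x'" "x \<in> carrier G" "x' \<in> carrier G"
  shows "H #> inv x = H #> inv x'"
  using rcos_inv[of x] rcos_inv[of x'] assms by simp

lemma coset_pow:
  assumes "H #> x = H #> x'" "x \<in> carrier G" "x' \<in> carrier G"
  shows "H #> (x [^] (m :: nat)) = H #> (x' [^] m)"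
proof (induction m)
  case (Suc m)
  then show ?case using coset_mult[OF Suc assms(1)] assms(2,3) by simp
qed simp

lemma coset_mem_iff: "x \<in> carrier G ==> x \<in> H \<longleftrightarrow> H #> x = H #> \<one>"
  using rcos_self[of x H] subgroup_axioms coset_join2[of x H] coset_mult_one[OF subset] by fastforce

end

context group begin

definition fin_normal :: "'a set => bool" where
  "fin_normal N \<longleftrightarrow> N \<lhd> G \<and> finite (rcosets N)"

text \<open>The closure in the profinite topology, which is expressed by its basic open sets, the
  cosets of the normal subgroups of finite index.\<close>

definition pcl :: "'a set => 'a set" where
  "pcl H = {g \<in> carrier G. \<forall>N. fin_normal N \<longrightarrow> (\<exists>h\<in>H. N #> g = N #> h)}"

lemma fin_normal_normal: "fin_normal N ==> N \<lhd> G"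
  by (simp add: fin_normal_def)

lemma fin_normal_Inter:
  assumes "finite I" "!!i. i \<in> I ==> fin_normal (N i)"
  shows "\<exists>M. fin_normal M \<and> (\<forall>i\<in>I. M \<subseteq> N i)"
  using assms
proof (induction I rule: finite_induct)
  case empty
  have "rcosets (carrier G) = {carrier G}"
    using coset_join2[OF _ subgroup_self] by (auto simp: RCOSETS_def)
  then have "fin_normal (carrier G)"
    by (simp add: fin_normal_def normal_self)
  then show ?case by blast
next
  case (insert j I)
  then obtain M where M: "fin_normal M" "\<forall>i\<in>I. M \<subseteq> N i" by auto
  have j: "fin_normal (N j)" using insert.prems by simp
  have "fin_normal (M \<inter> N j)"
    using M(1) j finite_rcosets_Int[of M "N j"] normal_imp_subgroup normal_subgroup_intersect
    unfolding fin_normal_def by metis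
  then show ?case using M(2) by blast
qed

lemma pclD: "x \<in> pcl H ==> fin_normal N ==> \<exists>h\<in>H. N #> x = N #> h"
  by (simp add: pcl_def)

lemma pcl_closed: "pcl H \<subseteq> carrier G"
  by (auto simp: pcl_def)

lemma pcl_superset: "H \<subseteq> carrier G ==> H \<subseteq> pcl H"
  by (auto simp: pcl_def)

lemma pcl_mono: "H \<subseteq> K ==> pcl H \<subseteq> pcl K"
  by (fastforce simp: pcl_def)

lemma pcl_mult:
  assumes "subgroup H G" "x \<in> pcl H" "y \<in> pcl H"
  shows "x \<otimes> y \<in> pcl H"
  unfolding pcl_def
proof (intro CollectI conjI allI impI)
  have xy: "x \<in> carrier G" "y \<in> carrier G" using assms pcl_closed by blast+
  then show "x \<otimes> y \<in> carrier G" by simp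
  fix N assume N: "fin_normal N"
  obtain h k where h: "h \<in> H" "N #> x = N #> h" and k: "k \<in> H" "N #> y = N #> k"
    using pclD[OF assms(2) N] pclD[OF assms(3) N] by blast
  have "N #> (x \<otimes> y) = N #> (h \<otimes> k)"
    using normal.coset_mult[OF fin_normal_normal[OF N] h(2) k(2)] xy h(1) k(1) subgroup.mem_carrier[OF assms(1)] by blast
  then show "\<exists>h\<in>H. N #> (x \<otimes> y) = N #> h"
    using subgroup.m_closed[OF assms(1) h(1) k(1)] by blast
qed

lemma pcl_inv:
  assumes "subgroup H G" "x \<in> pcl H" shows "inv x \<in> pcl H"
  unfolding pcl_def
proof (intro CollectI conjI allI impI)
  have x: "x \<in> carrier G" using assms pcl_closed by blast
  then show "inv x \<in> carrier G" by simp
  fix N assume N: "fin_normal N"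
  obtain h where h: "h \<in> H" "N #> x = N #> h"
    using pclD[OF assms(2) N] by blast
  have "N #> inv x = N #> inv h"
    using normal.coset_inv[OF fin_normal_normal[OF N] h(2)] x h(1) subgroup.mem_carrier[OF assms(1)] by blast
  then show "\<exists>h\<in>H. N #> inv x = N #> h"
    using subgroup.m_inv_closed[OF assms(1) h(1)] by blast
qed

lemma pcl_subgroup: "subgroup H G ==> subgroup (pcl H) G"
  using pcl_closed pcl_superset[OF subgroup.subset, of H] subgroup.one_closed[of H G]
  by (intro subgroupI) (auto intro: pcl_mult pcl_inv)

lemma pcl_pow:
  assumes "x \<in> pcl H" "H \<subseteq> carrier G" "!!h. h \<in> H ==> h [^] (m :: nat) \<in> K"
  shows "x [^] m \<in> pcl K"
  unfolding pcl_def
proof (intro CollectI conjI allI impI)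
  have x: "x \<in> carrier G" using assms(1) pcl_closed by blast
  then show "x [^] m \<in> carrier G" by simp
  fix N assume N: "fin_normal N"
  obtain h where h: "h \<in> H" "N #> x = N #> h"
    using pclD[OF assms(1) N] by blast
  have "N #> (x [^] m) = N #> (h [^] m)"
    by (rule normal.coset_pow[OF fin_normal_normal[OF N] h(2) x]) (use h assms(2) in auto)
  then show "\<exists>h\<in>K. N #> (x [^] m) = N #> h"
    using assms(3)[OF h(1)] by blast
qed

lemma pcl_conj:
  assumes "x \<in> pcl H" "H \<subseteq> carrier G" "z \<in> carrier G"
  shows "z \<otimes> x \<otimes> inv z \<in> pcl ((\<lambda>h. z \<otimes> h \<otimes> inv z) ` H)"
  unfolding pcl_def
proof (intro CollectI conjI allI impI)
  have x: "x \<in> carrier G" using assms(1) pcl_closed by blast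
  then show "z \<otimes> x \<otimes> inv z \<in> carrier G" using assms by simp
  fix N assume N: "fin_normal N"
  obtain h where h: "h \<in> H" "N #> x = N #> h"
    using pclD[OF assms(1) N] by blast
  interpret N: normal N G by (rule fin_normal_normal[OF N])
  have "N #> (z \<otimes> x \<otimes> inv z) = N #> (z \<otimes> h \<otimes> inv z)"
    using h x assms(2,3) by (intro N.coset_mult) auto
  then show "\<exists>h\<in>(\<lambda>h. z \<otimes> h \<otimes> inv z) ` H. N #> (z \<otimes> x \<otimes> inv z) = N #> h"
    using h(1) by blast
qed

lemma residually_finite_eqI:
  assumes "residually_finite G" "x \<in> carrier G" "y \<in> carrier G"
    "!!N. fin_normal N ==> N #> x = N #> y"
  shows "x = y"
proof (rule ccontr)
  assume "x \<noteq> y"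
  then have "x \<otimes> inv y \<noteq> \<one>"
    using assms(2,3) by (metis inv_equality inv_inv inv_closed)
  then obtain N where N: "fin_normal N" "x \<otimes> inv y \<notin> N"
    using assms(1-3) unfolding residually_finite_def fin_normal_def by (meson inv_closed m_closed)
  then show False
    using rcoset_eqD[OF normal_imp_subgroup[OF fin_normal_normal[OF N(1)]] assms(2,3) assms(4)[OF N(1)]] by simp
qed

text \<open>In every finite quotient \<open>x\<close> coincides with an element of \<open>H\<close>
  and so commutes with \<open>z\<close>; residual finiteness lifts this to the group.\<close>

lemma pcl_commutes:
  assumes "residually_finite G" "x \<in> pcl H" "H \<subseteq> carrier G" "z \<in> carrier G" "!!h. h \<in> H ==> z \<otimes> h = h \<otimes> z"
  shows "z \<otimes> x = x \<otimes> z"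
proof (rule residually_finite_eqI[OF assms(1)])
  have x: "x \<in> carrier G" using assms(2) pcl_closed by blast
  then show "z \<otimes> x \<in> carrier G" "x \<otimes> z \<in> carrier G" using assms(4) by simp_all
  fix N assume N: "fin_normal N"
  obtain h where h: "h \<in> H" "N #> x = N #> h"
    using pclD[OF assms(2) N] by blast
  interpret N: normal N G by (rule fin_normal_normal[OF N])
  have "N #> (z \<otimes> x) = N #> (z \<otimes> h)" "N #> (x \<otimes> z) = N #> (h \<otimes> z)"
    by (rule N.coset_mult; use h x assms(3,4) in auto)+
  then show "N #> (z \<otimes> x) = N #> (x \<otimes> z)"
    using assms(5)[OF h(1)] by simp
qed

text \<open>A finite union of closed sets is closed: if \<open>b\<close> lay in none of the
  translates of \<open>pcl L\<close>, each of them would be excluded by a finite quotient, and a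
  common refinement of these quotients would separate \<open>b\<close> from
  \<open>H\<close>.\<close>

lemma pcl_cosets:
  assumes L: "L \<subseteq> carrier G" and R: "finite R" "R \<subseteq> carrier G" and H: "H \<subseteq> carrier G"
    "!!x. x \<in> H ==> \<exists>h\<in>R. x \<otimes> inv h \<in> L" and b: "b \<in> pcl H"
  shows "\<exists>h\<in>R. b \<otimes> inv h \<in> pcl L"
proof (rule ccontr)
  have bG: "b \<in> carrier G" using b pcl_closed by blast
  assume no: "\<not> ?thesis"
  have "\<exists>N. fin_normal N \<and> (\<forall>l\<in>L. N #> (b \<otimes> inv h) \<noteq> N #> l)" if "h \<in> R" for h
  proof -
    have "b \<otimes> inv h \<in> carrier G" "b \<otimes> inv h \<notin> pcl L"
      using bG R(2) that no by auto
    then show ?thesis by (auto simp: pcl_def)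
  qed
  then obtain N where N: "!!h. h \<in> R ==> fin_normal (N h)"
    "!!h l. h \<in> R ==> l \<in> L ==> N h #> (b \<otimes> inv h) \<noteq> N h #> l"
    by metis
  obtain M where M: "fin_normal M" "!!h. h \<in> R ==> M \<subseteq> N h"
    using fin_normal_Inter[OF R(1), of N] N(1) by blast
  obtain x where x: "x \<in> H" "M #> b = M #> x" using b M(1) by (auto simp: pcl_def)
  obtain h where h: "h \<in> R" "x \<otimes> inv h \<in> L" using H(2)[OF x(1)] by blast
  have xh: "x \<in> carrier G" "h \<in> carrier G" using x h H(1) R(2) by auto
  interpret Nh: normal "N h" G by (rule fin_normal_normal[OF N(1)[OF h(1)]])
  have "b \<otimes> inv x \<in> N h"
    using rcoset_eqD[OF normal_imp_subgroup[OF fin_normal_normal[OF M(1)]] bG xh(1) x(2)] M(2)[OF h(1)] by blast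
  then have "N h #> b = N h #> x"
    by (rule rcoset_eqI[OF Nh.subgroup_axioms bG xh(1)])
  then have "N h #> (b \<otimes> inv h) = N h #> (x \<otimes> inv h)"
    using bG xh by (intro Nh.coset_mult) auto
  then show False using N(2)[OF h] by simp
qed

text \<open>\<open>pcl L\<close> has finite index in \<open>pcl H\<close> and is therefore open in
  it. \<open>N\<close> is small enough to avoid the cosets of all representatives outside
  \<open>pcl L\<close>.\<close>

lemma pcl_finite_index:
  assumes L: "subgroup L G" and R: "finite R" "R \<subseteq> carrier G" and H: "H \<subseteq> carrier G"
    "!!x. x \<in> H ==> \<exists>h\<in>R. x \<otimes> inv h \<in> L"
  obtains N where "fin_normal N" "N \<inter> pcl H \<subseteq> pcl L"
proof -
  define R' where "R' = {h \<in> R. h \<notin> pcl L}"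
  have "\<forall>h\<in>R'. \<exists>N. fin_normal N \<and> (\<forall>l\<in>L. N #> h \<noteq> N #> l)"
    using R(2) unfolding pcl_def R'_def by blast
  then obtain N where N: "!!h. h \<in> R' ==> fin_normal (N h)"
    "!!h l. h \<in> R' ==> l \<in> L ==> N h #> h \<noteq> N h #> l"
    by metis
  have "finite R'" using R(1) by (simp add: R'_def)
  then obtain M where M: "fin_normal M" "!!h. h \<in> R' ==> M \<subseteq> N h"
    using fin_normal_Inter[of R' N] N(1) by blast
  show thesis
  proof (rule that[OF M(1)], rule subsetI)
    fix b assume b: "b \<in> M \<inter> pcl H"
    then have bG: "b \<in> carrier G" using pcl_closed by blast
    obtain h where h: "h \<in> R" "b \<otimes> inv h \<in> pcl L"
      using pcl_cosets[OF subgroup.subset[OF L] R H] b by blast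
    have hG: "h \<in> carrier G" using h R(2) by blast
    have "h \<in> pcl L"
    proof (rule ccontr)
      assume "h \<notin> pcl L"
      then have h': "h \<in> R'" using h(1) by (simp add: R'_def)
      interpret Nh: normal "N h" G by (rule fin_normal_normal[OF N(1)[OF h']])
      have "N h #> b = N h #> \<one>" using Nh.coset_mem_iff[OF bG] b M(2)[OF h'] by blast
      then have "N h #> (inv (b \<otimes> inv h) \<otimes> b) = N h #> (inv (b \<otimes> inv h) \<otimes> \<one>)"
        using bG hG by (intro Nh.coset_mult) auto
      then have *: "N h #> h = N h #> inv (b \<otimes> inv h)"
        using bG hG by (simp add: inv_mult_group m_assoc)
      have "inv (b \<otimes> inv h) \<in> pcl L" by (rule pcl_inv[OF L h(2)])
      then obtain l where l: "l \<in> L" "N h #> inv (b \<otimes> inv h) = N h #> l"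
        using pclD[OF _ N(1)[OF h']] by blast
      then show False using N(2)[OF h' l(1)] * by simp
    qed
    then have "b \<otimes> inv h \<otimes> h \<in> pcl L" by (rule pcl_mult[OF L h(2)])
    then show "b \<in> pcl L" using bG hG by (simp add: m_assoc)
  qed
qed

lemma conj_pow:
  assumes "z \<in> carrier G" "h \<in> carrier G"
  shows "(z \<otimes> h \<otimes> inv z) [^] (k :: nat) = z \<otimes> h [^] k \<otimes> inv z"
  using assms by (induction k) (simp_all add: m_assoc)

lemma subgroup_pow_closed: "subgroup H G ==> h \<in> H ==> h [^] (k :: nat) \<in> H"
  by (induction k) (auto simp: subgroup.one_closed subgroup.m_closed)

text \<open>For lattices this is one half of commensurability. Stated with a uniform exponent it
  passes to closures by \<open>pcl_pow\<close>, where indices would be awkward.\<close>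

definition pow_into :: "'a set => 'a set => bool" where
  "pow_into H K \<longleftrightarrow> (\<exists>k\<ge>1::nat. \<forall>h\<in>H. h [^] k \<in> K)"

lemma pow_into_trans:
  assumes "pow_into H K" "pow_into K M" "H \<subseteq> carrier G" shows "pow_into H M"
proof -
  obtain k l :: nat where k: "k \<ge> 1" "\<forall>h\<in>H. h [^] k \<in> K" and l: "l \<ge> 1" "\<forall>h\<in>K. h [^] l \<in> M"
    using assms(1,2) by (auto simp: pow_into_def)
  have "h [^] (k * l) \<in> M" if "h \<in> H" for h
  proof -
    have "(h [^] k) [^] l \<in> M" using k(2) l(2) that by blast
    then show ?thesis using nat_pow_pow[of h k l] that assms(3) by auto
  qed
  then show ?thesis unfolding pow_into_def using k(1) l(1) by (intro exI[of _ "k * l"]) auto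
qed

lemma pow_into_conj:
  assumes "pow_into H K" "H \<subseteq> carrier G" "z \<in> carrier G"
  shows "pow_into ((\<lambda>h. z \<otimes> h \<otimes> inv z) ` H) ((\<lambda>h. z \<otimes> h \<otimes> inv z) ` K)"
proof -
  obtain k :: nat where k: "k \<ge> 1" "\<forall>h\<in>H. h [^] k \<in> K"
    using assms(1) by (auto simp: pow_into_def)
  have "(z \<otimes> h \<otimes> inv z) [^] k \<in> (\<lambda>h. z \<otimes> h \<otimes> inv z) ` K" if "h \<in> H" for h
    using k(2) that assms(2,3) conj_pow[of z h k] by blast
  then show ?thesis unfolding pow_into_def using k(1) by blast
qed

lemma pow_into_common:
  assumes fin: "finite I" and into: "!!i. i \<in> I ==> pow_into H (K i)" and H: "H \<subseteq> carrier G"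
    and K: "!!i. i \<in> I ==> subgroup (K i) G"
  obtains k :: nat where "k \<ge> 1" "!!i h. i \<in> I ==> h \<in> H ==> h [^] k \<in> K i"
proof -
  have "\<exists>k\<ge>1::nat. \<forall>h\<in>H. h [^] k \<in> K i" if "i \<in> I" for i
    using into[OF that] by (simp add: pow_into_def)
  then obtain k :: "_ => nat" where k: "!!i. i \<in> I ==> k i \<ge> 1" "!!i h. i \<in> I ==> h \<in> H ==> h [^] k i \<in> K i"
    by metis
  have "0 < prod k I" by (rule prod_pos) (use k(1) in force)
  moreover have "h [^] prod k I \<in> K i" if "i \<in> I" "h \<in> H" for i h
  proof -
    have "prod k I = k i * prod k (I - {i})" by (rule prod.remove[OF fin that(1)])
    moreover have "h \<in> carrier G" using that H by blast
    ultimately have "h [^] prod k I = (h [^] k i) [^] prod k (I - {i})"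
      by (simp add: nat_pow_pow)
    then show ?thesis
      using subgroup_pow_closed[OF K[OF that(1)] k(2)[OF that]] by simp
  qed
  ultimately show thesis by (intro that[of "prod k I"]) auto
qed

end

section \<open>Commensurability of the vertex groups\<close>

context gbs begin

lemma vgroup_subgroup:
  assumes "\<gamma> \<in> carrier G" "v \<in> V" shows "subgroup (vgroup \<gamma> v) G"
proof -
  interpret \<epsilon>: group_hom "A v" G "\<epsilon> v" by (rule \<epsilon>_hom[OF assms(2)])
  have "(\<lambda>g. \<gamma> \<otimes> \<epsilon> v g \<otimes> inv \<gamma>) \<in> hom (A v) G"
    using assms by (intro homI) (auto simp: m_assoc)
  then interpret f: group_hom "A v" G "\<lambda>g. \<gamma> \<otimes> \<epsilon> v g \<otimes> inv \<gamma>"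
    by unfold_locales
  show ?thesis unfolding vgroup_def using f.img_is_subgroup .
qed

lemma vgroup_commute:
  assumes "\<gamma> \<in> carrier G" "v \<in> V" "x \<in> vgroup \<gamma> v" "y \<in> vgroup \<gamma> v" shows "x \<otimes> y = y \<otimes> x"
proof -
  interpret v: Zn_coords "A v" n "c v" by (rule coords[OF assms(2)])
  obtain g h where gh: "g \<in> carrier (A v)" "x = \<gamma> \<otimes> \<epsilon> v g \<otimes> inv \<gamma>" "h \<in> carrier (A v)" "y = \<gamma> \<otimes> \<epsilon> v h \<otimes> inv \<gamma>"
    using assms(3,4) by (auto simp: vgroup_def)
  have "\<epsilon> v g \<otimes> \<epsilon> v h = \<epsilon> v h \<otimes> \<epsilon> v g"
    using v.commute[OF gh(1,3)] \<epsilon>_mult[OF assms(2)] gh by metis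
  then have "\<gamma> \<otimes> (\<epsilon> v g \<otimes> \<epsilon> v h) \<otimes> inv \<gamma> = \<gamma> \<otimes> (\<epsilon> v h \<otimes> \<epsilon> v g) \<otimes> inv \<gamma>" by simp
  then show ?thesis using gh assms by (simp add: m_assoc)
qed

lemma vgroup_mult:
  assumes "z \<in> carrier G" "\<gamma> \<in> carrier G" "v \<in> V"
  shows "vgroup (z \<otimes> \<gamma>) v = (\<lambda>h. z \<otimes> h \<otimes> inv z) ` vgroup \<gamma> v"
  unfolding vgroup_def image_image
  by (rule image_cong) (use assms in \<open>simp_all add: word_simps\<close>)

lemma vgroup_one: "v \<in> V ==> vgroup \<one> v = \<epsilon> v ` carrier (A v)"
  unfolding vgroup_def by (rule image_cong) simp_all

lemma vgroup_absorb:
  assumes "\<gamma> \<in> carrier G" "v \<in> V" "g \<in> carrier (A v)"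
  shows "vgroup (\<gamma> \<otimes> \<epsilon> v g) v = vgroup \<gamma> v"
proof -
  have "vgroup (\<epsilon> v g) v = vgroup \<one> v"
  proof -
    have "\<epsilon> v g \<otimes> h \<otimes> inv \<epsilon> v g = h" if "h \<in> vgroup \<one> v" for h
    proof -
      have h: "h \<in> carrier G" using that vgroup_closed assms(2) by blast
      have "\<epsilon> v g \<in> vgroup \<one> v" using vgroup_one assms by blast
      then have "\<epsilon> v g \<otimes> h = h \<otimes> \<epsilon> v g"
        by (rule vgroup_commute[OF one_closed assms(2) _ that])
      then show ?thesis using h assms by (simp add: m_assoc)
    qed
    then show ?thesis
      using vgroup_mult[of "\<epsilon> v g" \<one> v] assms by simp
  qed
  then show ?thesis
    using vgroup_mult[of \<gamma> "\<epsilon> v g" v] vgroup_mult[of \<gamma> \<one> v] assms by simp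
qed

definition comm :: "'g => 'v => 'g => 'v => bool" where
  "comm \<gamma> v \<gamma>' v' \<longleftrightarrow> pow_into (vgroup \<gamma> v) (vgroup \<gamma>' v') \<and> pow_into (vgroup \<gamma>' v') (vgroup \<gamma> v)"

lemma comm_sym: "comm \<gamma> v \<gamma>' v' ==> comm \<gamma>' v' \<gamma> v"
  by (simp add: comm_def)

lemma comm_refl: "\<gamma> \<in> carrier G ==> v \<in> V ==> comm \<gamma> v \<gamma> v"
  unfolding comm_def pow_into_def using vgroup_closed[of \<gamma> v] by (auto intro!: exI[of _ 1] simp: subset_iff)

lemma comm_trans:
  assumes "comm \<gamma> v \<gamma>' v'" "comm \<gamma>' v' \<gamma>'' v''" "\<gamma> \<in> carrier G" "v \<in> V" "\<gamma>'' \<in> carrier G" "v'' \<in> V"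
  shows "comm \<gamma> v \<gamma>'' v''"
  using assms pow_into_trans[OF _ _ vgroup_closed] unfolding comm_def by meson

lemma comm_mult:
  assumes "comm \<gamma> v \<gamma>' v'" "z \<in> carrier G" "\<gamma> \<in> carrier G" "v \<in> V" "\<gamma>' \<in> carrier G" "v' \<in> V"
  shows "comm (z \<otimes> \<gamma>) v (z \<otimes> \<gamma>') v'"
  using assms pow_into_conj[OF _ vgroup_closed] unfolding comm_def by (simp add: vgroup_mult)

text \<open>Conjugation by the stable letter identifies the two copies of the edge group, and
  \<open>r\<close>-th powers at either end lie in these.\<close>

lemma comm_edge:
  assumes e: "e \<in> E" shows "comm (t e) (org e) \<one> (ter e)"
  unfolding comm_def pow_into_def
proof (intro conjI exI[of _ r] ballI r)
  have V: "org e \<in> V" "ter e \<in> V" using e by auto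
  interpret o: group_hom "A (org e)" G "\<epsilon> (org e)" by (rule \<epsilon>_hom[OF V(1)])
  interpret t: group_hom "A (ter e)" G "\<epsilon> (ter e)" by (rule \<epsilon>_hom[OF V(2)])
  fix h assume "h \<in> vgroup (t e) (org e)"
  then obtain g where g: "g \<in> carrier (A (org e))" "h = t e \<otimes> \<epsilon> (org e) g \<otimes> inv t e"
    by (auto simp: vgroup_def)
  have "h [^] r = t e \<otimes> \<epsilon> (org e) (g [^]\<^bsub>A (org e)\<^esub> r) \<otimes> inv t e"
    using g e V by (simp add: conj_pow o.hom_nat_pow)
  also have "\<dots> = \<epsilon> (ter e) (emap \<Gamma> e (g [^]\<^bsub>A (org e)\<^esub> r))"
    by (rule t_conj[OF e esub_pow[OF e g(1)]])
  finally show "h [^] r \<in> vgroup \<one> (ter e)"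
    using emap_closed[OF e esub_pow[OF e g(1)]] vgroup_one[OF V(2)] by simp
next
  have V: "org e \<in> V" "ter e \<in> V" using e by auto
  interpret t: group_hom "A (ter e)" G "\<epsilon> (ter e)" by (rule \<epsilon>_hom[OF V(2)])
  fix h assume "h \<in> vgroup \<one> (ter e)"
  then obtain g where g: "g \<in> carrier (A (ter e))" "h = \<epsilon> (ter e) g"
    using vgroup_one[OF V(2)] by auto
  obtain x where x: "x \<in> esub \<Gamma> e" "g [^]\<^bsub>A (ter e)\<^esub> r = emap \<Gamma> e x"
    using emap_pow[OF e g(1)] by auto
  have "h [^] r = \<epsilon> (ter e) (g [^]\<^bsub>A (ter e)\<^esub> r)"
    using g by (simp add: t.hom_nat_pow)
  then have "h [^] r = t e \<otimes> \<epsilon> (org e) x \<otimes> inv t e"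
    using x t_conj[OF e x(1)] by simp
  then show "h [^] r \<in> vgroup (t e) (org e)"
    using esub_closed[OF e x(1)] by (auto simp: vgroup_def)
qed

lemma comm_one:
  assumes "v \<in> V" "v' \<in> V" shows "comm \<one> v \<one> v'"
  using assms
proof (induction rule: T.tree_induct)
  case root
  then show ?case using comm_refl assms by simp
next
  case (edge e)
  then have e: "e \<in> E" "comm \<one> (org e) \<one> (ter e)"
    using T.T_sub(2) comm_edge[of e] t_tree[of e] by auto
  then have "org e \<in> V" "ter e \<in> V" by auto
  then show ?case
    using comm_trans[OF _ e(2)] comm_trans[OF _ comm_sym[OF e(2)]] assms one_closed by meson
qed

text \<open>Stabilisers of adjacent vertices are commensurable. The induction over generators is the
  connectedness of the Bass-Serre tree.\<close>

lemma comm_all: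
  assumes "\<gamma> \<in> carrier G" "v \<in> V" "\<gamma>' \<in> carrier G" "v' \<in> V"
  shows "comm \<gamma> v \<gamma>' v'"
proof -
  have base: "\<forall>u\<in>V. \<forall>u'\<in>V. comm \<one> u \<gamma> u'" if "\<gamma> \<in> carrier G" for \<gamma>
    using that
  proof (induction rule: gen_induct)
    case one
    then show ?case using comm_one by blast
  next
    case (vertex \<gamma> w g)
    have "comm \<one> u (\<gamma> \<otimes> \<epsilon> w g) u'" if "u \<in> V" "u' \<in> V" for u u'
    proof (rule comm_trans)
      show "comm \<one> u (\<gamma> \<otimes> \<epsilon> w g) w"
        using vertex that vgroup_absorb unfolding comm_def by metis
      show "comm (\<gamma> \<otimes> \<epsilon> w g) w (\<gamma> \<otimes> \<epsilon> w g) u'"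
        using comm_mult[OF comm_one[OF vertex.hyps(2) that(2)], of "\<gamma> \<otimes> \<epsilon> w g"] vertex that by simp
    qed (use vertex that in auto)
    then show ?case by blast
  next
    case (stable \<gamma> e)
    then have V: "org e \<in> V" "ter e \<in> V" by auto
    have "comm \<one> u (\<gamma> \<otimes> t e) u'" if "u \<in> V" "u' \<in> V" for u u'
    proof (rule comm_trans)
      show "comm \<one> u \<gamma> (ter e)" using stable V that by blast
      show "comm \<gamma> (ter e) (\<gamma> \<otimes> t e) u'"
      proof (rule comm_trans)
        show "comm \<gamma> (ter e) (\<gamma> \<otimes> t e) (org e)"
          using comm_mult[OF comm_sym[OF comm_edge], of e \<gamma>] stable V by simp
        show "comm (\<gamma> \<otimes> t e) (org e) (\<gamma> \<otimes> t e) u'"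
          using comm_mult[OF comm_one[OF V(1) that(2)], of "\<gamma> \<otimes> t e"] stable V that by simp
      qed (use stable V that in auto)
    qed (use stable V that in auto)
    then show ?case by blast
  next
    case (stable_inv \<gamma> e)
    then have V: "org e \<in> V" "ter e \<in> V" by auto
    have "comm \<one> u (\<gamma> \<otimes> inv t e) u'" if "u \<in> V" "u' \<in> V" for u u'
    proof (rule comm_trans)
      show "comm \<one> u \<gamma> (org e)" using stable_inv V that by blast
      show "comm \<gamma> (org e) (\<gamma> \<otimes> inv t e) u'"
      proof (rule comm_trans)
        show "comm \<gamma> (org e) (\<gamma> \<otimes> inv t e) (ter e)"
          using comm_mult[OF comm_edge, of e "\<gamma> \<otimes> inv t e"] stable_inv V by (simp add: m_assoc)
        show "comm (\<gamma> \<otimes> inv t e) (ter e) (\<gamma> \<otimes> inv t e) u'"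
          using comm_mult[OF comm_one[OF V(2) that(2)], of "\<gamma> \<otimes> inv t e"] stable_inv V that by simp
      qed (use stable_inv V that in auto)
    qed (use stable_inv V that in auto)
    then show ?case by blast
  qed
  show ?thesis
    using comm_trans[OF comm_sym] base assms by blast
qed

lemma pow_into_vgroup:
  assumes "\<gamma> \<in> carrier G" "v \<in> V" "\<gamma>' \<in> carrier G" "v' \<in> V"
  obtains k :: nat where "k \<ge> 1" "!!h. h \<in> vgroup \<gamma> v ==> h [^] k \<in> vgroup \<gamma>' v'"
  using comm_all[OF assms] unfolding comm_def pow_into_def by blast

lemma vgroup_finite_reps:
  assumes "\<gamma> \<in> carrier G" "v \<in> V" "k \<ge> (1 :: nat)"
  obtains R where "finite R" "R \<subseteq> vgroup \<gamma> v"
    "!!x. x \<in> vgroup \<gamma> v ==> \<exists>h\<in>R. \<exists>y\<in>vgroup \<gamma> v. x \<otimes> inv h = y [^] k"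
proof -
  interpret v: Zn_coords "A v" n "c v" by (rule coords[OF assms(2)])
  interpret \<epsilon>: group_hom "A v" G "\<epsilon> v" by (rule \<epsilon>_hom[OF assms(2)])
  define f where "f g = \<gamma> \<otimes> \<epsilon> v g \<otimes> inv \<gamma>" for g
  have "f \<in> hom (A v) G"
    using assms unfolding f_def by (intro homI) (auto simp: m_assoc)
  then interpret f: group_hom "A v" G f by unfold_locales
  define p where "p z = (SOME g. g \<in> carrier (A v) \<and> v.residues k g = z)" for z
  have p: "p (v.residues k g) \<in> carrier (A v)" "v.residues k (p (v.residues k g)) = v.residues k g"
    if "g \<in> carrier (A v)" for g
    using someI[of "\<lambda>x. x \<in> carrier (A v) \<and> v.residues k x = v.residues k g" g] that by (auto simp: p_def)
  have fin: "finite (v.residues k ` carrier (A v))"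
    by (rule finite_subset[OF _ v.finite_residues[OF assms(3)]]) auto
  show thesis
  proof (rule that[of "(f \<circ> p) ` v.residues k ` carrier (A v)"])
    show "finite ((f \<circ> p) ` v.residues k ` carrier (A v))" using fin by simp
    show "(f \<circ> p) ` v.residues k ` carrier (A v) \<subseteq> vgroup \<gamma> v"
      using p by (auto simp: vgroup_def f_def)
    fix x assume "x \<in> vgroup \<gamma> v"
    then obtain g where g: "g \<in> carrier (A v)" "x = f g" by (auto simp: vgroup_def f_def)
    obtain y where y: "y \<in> carrier (A v)" "g \<otimes>\<^bsub>A v\<^esub> inv\<^bsub>A v\<^esub> p (v.residues k g) = y [^]\<^bsub>A v\<^esub> k"
      by (rule v.residues_eq[OF g(1) p(1)[OF g(1)] p(2)[OF g(1), symmetric]])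
    have "x \<otimes> inv f (p (v.residues k g)) = f y [^] k"
      using g p(1)[OF g(1)] y by (metis f.hom_inv f.hom_mult f.hom_nat_pow v.inv_closed)
    moreover have "f y \<in> vgroup \<gamma> v" using y(1) by (auto simp: vgroup_def f_def)
    ultimately show "\<exists>h\<in>(f \<circ> p) ` v.residues k ` carrier (A v). \<exists>y\<in>vgroup \<gamma> v. x \<otimes> inv h = y [^] k"
      using g(1) by auto
  qed
qed

lemma finitely_generated:
  obtains X where "finite X" "X \<subseteq> carrier G" "generate G X = carrier G"
proof -
  define X where "X = (\<Union>v\<in>V. \<epsilon> v ` Zn_coords.basis (A v) n (c v) ` {..<n}) \<union> t ` E"
  have X: "X \<subseteq> carrier G"
    using Zn_coords.basis_closed[OF coords] by (auto simp: X_def)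
  interpret K: subgroup "generate G X" G by (rule generate_is_subgroup[OF X])
  have \<epsilon>K: "\<epsilon> v g \<in> generate G X" if v: "v \<in> V" and g: "g \<in> carrier (A v)" for v g
  proof -
    interpret v: Zn_coords "A v" n "c v" by (rule coords[OF v])
    interpret \<epsilon>: group_hom "A v" G "\<epsilon> v" by (rule \<epsilon>_hom[OF v])
    have "subgroup {g \<in> carrier (A v). \<epsilon> v g \<in> generate G X} (A v)"
      by (rule v.subgroupI) auto
    moreover have "v.basis j \<in> {g \<in> carrier (A v). \<epsilon> v g \<in> generate G X}" if "j < n" for j
      using v that by (auto simp: X_def intro: generate.incl)
    ultimately have "{g \<in> carrier (A v). \<epsilon> v g \<in> generate G X} = carrier (A v)"
      by (rule v.subgroup_of_basis)
    then show ?thesis using g by blast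
  qed
  have tK: "t e \<in> generate G X" if "e \<in> E" for e
    using that by (auto simp: X_def intro: generate.incl)
  have "\<gamma> \<in> generate G X" if "\<gamma> \<in> carrier G" for \<gamma>
    using that by (induction rule: gen_induct) (auto intro: \<epsilon>K tK)
  then have "generate G X = carrier G" using K.subset by blast
  moreover have "finite X"
    unfolding X_def using T.D.finite_verts T.D.finite_arcs by auto
  ultimately show thesis using that X by blast
qed

text \<open>For \<open>b\<close> in the closure of the vertex group at \<open>u\<close>, its power
  with exponent \<open>m1 * m2\<close> lies in the closures of both given groups and so commutes
  with them. If there were a bridge, this power would fix it and a further \<open>k\<close>-th power
  would return to the vertex group at \<open>u\<close>, against the assumption
  \<open>no\<close>.\<close>

lemma vgroups_directed:
  assumes rf: "residually_finite G" and u: "u \<in> V"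
    and no: "\<not> (\<exists>k\<ge>1::nat. \<forall>b\<in>pcl (vgroup \<one> u). b [^] k \<in> vgroup \<one> u)"
    and \<gamma>: "\<gamma>1 \<in> carrier G" "\<gamma>2 \<in> carrier G" and v: "v1 \<in> V" "v2 \<in> V"
  shows "\<exists>\<gamma>\<in>carrier G. \<exists>v\<in>V. vgroup \<gamma>1 v1 \<union> vgroup \<gamma>2 v2 \<subseteq> vgroup \<gamma> v"
proof (rule common_vgroup_or_bridge[OF \<gamma> v])
  let ?H = "vgroup \<one> u"
  have H: "?H \<subseteq> carrier G" using vgroup_closed u by simp
  fix \<gamma> v assume \<gamma>v: "\<gamma> \<in> carrier G" "v \<in> V"
    and bridge: "!!z. z \<in> carrier G ==> (!!h. h \<in> vgroup \<gamma>1 v1 \<union> vgroup \<gamma>2 v2 ==> z \<otimes> h = h \<otimes> z) ==> z \<in> vgroup \<gamma> v"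
  obtain m1 :: nat where m1: "m1 \<ge> 1" "!!h. h \<in> ?H ==> h [^] m1 \<in> vgroup \<gamma>1 v1"
    by (rule pow_into_vgroup[OF one_closed u \<gamma>(1) v(1)]) (rule that; blast)
  obtain m2 :: nat where m2: "m2 \<ge> 1" "!!h. h \<in> ?H ==> h [^] m2 \<in> vgroup \<gamma>2 v2"
    by (rule pow_into_vgroup[OF one_closed u \<gamma>(2) v(2)]) (rule that; blast)
  obtain k :: nat where k: "k \<ge> 1" "!!h. h \<in> vgroup \<gamma> v ==> h [^] k \<in> ?H"
    by (rule pow_into_vgroup[OF \<gamma>v one_closed u]) (rule that; blast)
  have comm: "b [^] m \<otimes> h = h \<otimes> b [^] m" if b: "b \<in> pcl ?H" and g: "\<gamma>' \<in> carrier G" "v' \<in> V"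
    and m: "!!h. h \<in> ?H ==> h [^] m \<in> vgroup \<gamma>' v'" and h: "h \<in> vgroup \<gamma>' v'" for b \<gamma>' v' h and m :: nat
  proof -
    have "b [^] m \<in> pcl (vgroup \<gamma>' v')" by (rule pcl_pow[OF b H m])
    then have "h \<otimes> b [^] m = b [^] m \<otimes> h"
    proof (rule pcl_commutes[OF rf])
      show "h \<otimes> h' = h' \<otimes> h" if "h' \<in> vgroup \<gamma>' v'" for h'
        by (rule vgroup_commute[OF g h that])
    qed (use vgroup_closed[OF g] h in auto)
    then show ?thesis by simp
  qed
  have mult: "h [^] (m1 * m2) \<in> vgroup \<gamma>1 v1" "h [^] (m1 * m2) \<in> vgroup \<gamma>2 v2" if "h \<in> ?H" for h
  proof -
    have "h [^] m1 \<in> ?H" "h [^] m2 \<in> ?H" "h \<in> carrier G"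
      using that H subgroup_pow_closed[OF vgroup_subgroup[OF one_closed u]] by auto
    then show "h [^] (m1 * m2) \<in> vgroup \<gamma>1 v1" "h [^] (m1 * m2) \<in> vgroup \<gamma>2 v2"
      using m1(2)[of "h [^] m2"] m2(2)[of "h [^] m1"] by (simp_all add: nat_pow_pow mult.commute)
  qed
  have "b [^] (m1 * m2 * k) \<in> ?H" if b: "b \<in> pcl ?H" for b
  proof -
    have bG: "b \<in> carrier G" using b pcl_closed by blast
    have "b [^] (m1 * m2) \<in> vgroup \<gamma> v"
      using comm[OF b \<gamma>(1) v(1) mult(1)] comm[OF b \<gamma>(2) v(2) mult(2)] bG by (intro bridge) auto
    then show ?thesis using k(2) bG by (metis nat_pow_pow)
  qed
  then have "\<exists>k\<ge>1::nat. \<forall>b\<in>pcl ?H. b [^] k \<in> ?H"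
    using m1(1) m2(1) k(1) by (intro exI[of _ "m1 * m2 * k"]) auto
  then show ?thesis using no by blast
qed blast

end

section \<open>Kernels of homomorphisms to finite groups\<close>

lemma link_sym: "(u, v) \<in> link src tgt F ==> (v, u) \<in> link src tgt F"
  by (induction rule: link_induct) (auto intro: link_trans link_edge)

lemma subgroup_free_group_eq:
  assumes H: "subgroup H (free_group S)" and gen: "!!s. s \<in> S ==> free_gen s \<in> H"
  shows "H = carrier (free_group S)"
proof
  show "H \<subseteq> carrier (free_group S)" by (rule subgroup.subset[OF H])
  have "w \<in> H" if "w \<in> carrier (free_group S)" for w
    using that
  proof (induction w)
    case Nil
    then show ?case using subgroup.one_closed[OF H] by (simp add: one_free_group)
  next
    case (Cons a w)
    obtain b s where a: "a = (b, s)" by (cases a)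
    have w: "s \<in> S" "w \<in> carrier (free_group S)" "reduced (a # w)"
      using Cons.prems a by (auto simp: carrier_free_group reduced_Cons)
    have "[a] \<in> H"
    proof (cases b)
      case False
      have "inv\<^bsub>free_group S\<^esub> (free_gen s) \<in> H"
        using subgroup.m_inv_closed[OF H gen[OF w(1)]] .
      then show ?thesis
        using False w(1) a inv_free_group[of "free_gen s" S] by (simp add: free_gen_closed inv_word_def)
    qed (use gen[OF w(1)] a in simp)
    then have "[a] \<otimes>\<^bsub>free_group S\<^esub> w \<in> H"
      using subgroup.m_closed[OF H] Cons.IH[OF w(2)] by blast
    then show ?case
      using foldr_rcons_reduced[of "[a]" w] w(3) by (simp add: mult_free_group)
  qed
  then show "carrier (free_group S) \<subseteq> H" by blast
qed

text \<open>The kernel of a homomorphism to a finite group \<open>P\<close> acts on the tree with finite quotient graph,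
  whose edges are the letters. Contracting a maximal forest \<open>D\<close> makes the letters outside \<open>D\<close> free
  generators of the image in the free group on all letters.\<close>

locale gog_cover = gog_twisted G \<Gamma> T \<Phi> P a s q \<Theta>
  for G :: "('g, 'b) monoid_scheme" (structure)
    and \<Gamma> :: "('v, 'e, 'a) gog" and T and \<Phi> and P :: "('p, 'q) monoid_scheme" and a s q \<Theta> +
  fixes v0 :: 'v
  assumes finP: "finite (carrier P)" and snd_q: "v \<in> V ==> snd (q v) = \<one>\<^bsub>P\<^esub>"
    and surj: "p \<in> carrier P ==> \<exists>\<gamma>\<in>carrier G. snd (\<Theta> \<gamma>) = p" and v0: "v0 \<in> V"
begin

abbreviation "F \<equiv> free_group S"

sublocale F: group F by simp

definition \<chi> :: "'g => 'p" where "\<chi> \<gamma> = snd (\<Theta> \<gamma>)"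

definition W :: "'g => 'v => ('e \<times> 'p set) word" where "W \<gamma> v = fst (y \<gamma> v)"

lemma \<chi>_closed [simp]: "\<gamma> \<in> carrier G ==> \<chi> \<gamma> \<in> carrier P"
  using \<Theta>.hom_closed[of \<gamma>] unfolding \<chi>_def X_simps(1) by blast

lemma \<chi>_mult: "\<gamma> \<in> carrier G ==> \<delta> \<in> carrier G ==> \<chi> (\<gamma> \<otimes> \<delta>) = \<chi> \<gamma> \<cdot> \<chi> \<delta>"
  by (simp add: \<chi>_def X_simps(2))

sublocale \<chi>: group_hom G P \<chi>
  by unfold_locales (auto intro: homI simp: \<chi>_mult)

lemma snd_y: "\<gamma> \<in> carrier G ==> v \<in> V ==> snd (y \<gamma> v) = \<chi> \<gamma>"
  using \<chi>_closed[of \<gamma>] by (simp add: y_def X_simps(2) snd_q \<chi>_def)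

lemma W_closed [simp]: "\<gamma> \<in> carrier G ==> v \<in> V ==> W \<gamma> v \<in> carrier F"
  using y_closed[of \<gamma> v] unfolding W_def X_simps(1) carrier_free_group by blast

lemma fst_\<Theta>_closed: "\<gamma> \<in> carrier G ==> fst (\<Theta> \<gamma>) \<in> carrier F"
  using \<Theta>.hom_closed[of \<gamma>] unfolding X_simps(1) carrier_free_group by blast

lemma W_\<epsilon>: "\<gamma> \<in> carrier G ==> v \<in> V ==> g \<in> carrier (A v) ==> W (\<gamma> \<otimes> \<epsilon> v g) v = W \<gamma> v"
  using W_closed[of \<gamma> v] F.r_one[of "W \<gamma> v"] y_\<epsilon>[of \<gamma> v g]
  by (simp add: W_def X_simps(2) one_free_group mult_free_group)

lemma \<chi>_\<epsilon>: "v \<in> V ==> g \<in> carrier (A v) ==> \<chi> (\<epsilon> v g) = a v g"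
proof -
  assume v: "v \<in> V" "g \<in> carrier (A v)"
  have "y (\<epsilon> v g) v = q v \<star> ([], a v g)"
    using y_\<epsilon>[of \<one> v g] v by (simp add: y_def)
  then have "snd (y (\<epsilon> v g) v) = snd (q v) \<cdot> a v g" by (simp add: X_simps(2))
  then show ?thesis using snd_y v by (simp add: snd_q)
qed

lemma \<chi>_t: "e \<in> E ==> \<chi> (t e) = s e"
proof -
  assume e: "e \<in> E"
  then have V: "org e \<in> V" "ter e \<in> V" by auto
  have "y (t e) (org e) = q (ter e) \<star> edge_elt e"
    using y_t[of \<one> e] e by (simp add: y_def)
  then have "snd (y (t e) (org e)) = snd (q (ter e)) \<cdot> s e" by (simp add: mult_edge_elt)
  then show ?thesis using snd_y V e by (simp add: snd_q)
qed

text \<open>\<open>lt \<gamma> e\<close> and \<open>vx \<gamma> v\<close> are the edge and the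
  vertex of the finite quotient graph below the edge \<open>e\<close> and the vertex
  \<open>v\<close> translated by \<open>\<gamma>\<close>. They depend on \<open>\<gamma>\<close>
  only through \<open>\<chi>\<close>.\<close>

definition lt :: "'g => 'e => 'e \<times> 'p set" where "lt \<gamma> e = (e, \<chi> \<gamma> <#\<^bsub>P\<^esub> Q e)"

definition vx :: "'g => 'v => 'v \<times> 'p set" where "vx \<gamma> v = (v, \<chi> \<gamma> <#\<^bsub>P\<^esub> a v ` carrier (A v))"

text \<open>The ends of an edge of the quotient graph, read off from the letter alone: the coset of
  the image of the edge group is enlarged to one of the image of a vertex group, for
  \<open>tgt\<close> after shifting by \<open>s\<close>.\<close>

definition src :: "'e \<times> 'p set => 'v \<times> 'p set" where
  "src z = (ter (fst z), snd z <#>\<^bsub>P\<^esub> a (ter (fst z)) ` carrier (A (ter (fst z))))"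

definition tgt :: "'e \<times> 'p set => 'v \<times> 'p set" where
  "tgt z = (org (fst z), (snd z #>\<^bsub>P\<^esub> s (fst z)) <#>\<^bsub>P\<^esub> a (org (fst z)) ` carrier (A (org (fst z))))"

definition S' :: "('e \<times> 'p set) set" where "S' = {lt \<gamma> e | \<gamma> e. \<gamma> \<in> carrier G \<and> e \<in> E}"

lemma S'_sub: "S' \<subseteq> S"
  by (auto simp: S'_def lt_def coset_in_S)

lemma finite_S': "finite S'"
proof (rule finite_subset[OF S'_sub])
  show "finite S" unfolding S_def using finP T.D.finite_arcs by simp
qed

lemma lt_in: "\<gamma> \<in> carrier G ==> e \<in> E ==> lt \<gamma> e \<in> S'"
  by (auto simp: S'_def)

lemma W_t: "\<gamma> \<in> carrier G ==> e \<in> E ==> W (\<gamma> \<otimes> t e) (org e) = W \<gamma> (ter e) \<otimes>\<^bsub>F\<^esub> free_gen (lt \<gamma> e)"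
  using y_t[of \<gamma> e] snd_y[of \<gamma> "ter e"] by (simp add: W_def mult_edge_elt mult_free_group lt_def)

lemma src_lt: "\<gamma> \<in> carrier G ==> e \<in> E ==> src (lt \<gamma> e) = vx \<gamma> (ter e)"
proof -
  assume \<gamma>: "\<gamma> \<in> carrier G" and e: "e \<in> E"
  then have V: "org e \<in> V" "ter e \<in> V" by auto
  let ?R = "a (ter e) ` carrier (A (ter e))" and ?p = "\<chi> \<gamma>"
  have R: "subgroup ?R P" by (rule group_hom.img_is_subgroup[OF a_group_hom[OF V(2)]])
  have QR: "Q e \<subseteq> ?R" using emap_closed[OF e] by (auto simp: Q_def)
  have one: "\<one>\<^bsub>P\<^esub> \<in> Q e" using subgroup.one_closed[OF Q_subgroup[OF e]] .
  have p: "?p \<in> carrier P" using \<gamma> by simp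
  have RP: "?R \<subseteq> carrier P" by (rule subgroup.subset[OF R])
  have "(?p <#\<^bsub>P\<^esub> Q e) <#>\<^bsub>P\<^esub> ?R = ?p <#\<^bsub>P\<^esub> ?R"
  proof
    show "(?p <#\<^bsub>P\<^esub> Q e) <#>\<^bsub>P\<^esub> ?R \<subseteq> ?p <#\<^bsub>P\<^esub> ?R"
    proof
      fix z assume "z \<in> (?p <#\<^bsub>P\<^esub> Q e) <#>\<^bsub>P\<^esub> ?R"
      then obtain x u where x: "x \<in> Q e" "u \<in> ?R" "z = ?p \<cdot> x \<cdot> u"
        unfolding set_mult_def l_coset_def by blast
      have "z = ?p \<cdot> (x \<cdot> u)" using x p QR RP by (auto simp: P.m_assoc subset_iff)
      moreover have "x \<cdot> u \<in> ?R" using x QR subgroup.m_closed[OF R] by blast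
      ultimately show "z \<in> ?p <#\<^bsub>P\<^esub> ?R" unfolding l_coset_def by blast
    qed
    show "?p <#\<^bsub>P\<^esub> ?R \<subseteq> (?p <#\<^bsub>P\<^esub> Q e) <#>\<^bsub>P\<^esub> ?R"
    proof
      fix z assume "z \<in> ?p <#\<^bsub>P\<^esub> ?R"
      then obtain u where u: "u \<in> ?R" "z = ?p \<cdot> u" unfolding l_coset_def by blast
      have "z = ?p \<cdot> \<one>\<^bsub>P\<^esub> \<cdot> u" using u p by simp
      then show "z \<in> (?p <#\<^bsub>P\<^esub> Q e) <#>\<^bsub>P\<^esub> ?R"
        using one u(1) unfolding set_mult_def l_coset_def by blast
    qed
  qed
  then show ?thesis by (simp add: src_def lt_def vx_def)
qed

lemma tgt_lt: "\<gamma> \<in> carrier G ==> e \<in> E ==> tgt (lt \<gamma> e) = vx (\<gamma> \<otimes> t e) (org e)"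
proof -
  assume \<gamma>: "\<gamma> \<in> carrier G" and e: "e \<in> E"
  then have V: "org e \<in> V" "ter e \<in> V" by auto
  let ?R = "a (org e) ` carrier (A (org e))" and ?p = "\<chi> \<gamma>"
  have R: "subgroup ?R P" by (rule group_hom.img_is_subgroup[OF a_group_hom[OF V(1)]])
  have one: "\<one>\<^bsub>P\<^esub> \<in> Q e" using subgroup.one_closed[OF Q_subgroup[OF e]] .
  have p: "?p \<in> carrier P" "s e \<in> carrier P" using \<gamma> e by simp_all
  have RP: "?R \<subseteq> carrier P" by (rule subgroup.subset[OF R])
  have "((?p <#\<^bsub>P\<^esub> Q e) #>\<^bsub>P\<^esub> s e) <#>\<^bsub>P\<^esub> ?R = (?p \<cdot> s e) <#\<^bsub>P\<^esub> ?R"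
  proof
    show "((?p <#\<^bsub>P\<^esub> Q e) #>\<^bsub>P\<^esub> s e) <#>\<^bsub>P\<^esub> ?R \<subseteq> (?p \<cdot> s e) <#\<^bsub>P\<^esub> ?R"
    proof
      fix z assume "z \<in> ((?p <#\<^bsub>P\<^esub> Q e) #>\<^bsub>P\<^esub> s e) <#>\<^bsub>P\<^esub> ?R"
      then obtain x u where x: "x \<in> Q e" "u \<in> ?R" "z = ?p \<cdot> x \<cdot> s e \<cdot> u"
        unfolding set_mult_def l_coset_def r_coset_def by blast
      obtain g where g: "g \<in> esub \<Gamma> e" "x = a (ter e) (emap \<Gamma> e g)" using x(1) by (auto simp: Q_def)
      have gA: "g \<in> carrier (A (org e))" "emap \<Gamma> e g \<in> carrier (A (ter e))"
        using esub_closed[OF e g(1)] emap_closed[OF e g(1)] .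
      have xP: "x \<in> carrier P" "a (org e) g \<in> carrier P" "u \<in> carrier P"
        using g gA V x(2) RP by auto
      have "x \<cdot> s e = s e \<cdot> a (org e) g" using s_conj[OF e g(1)] g(2) by simp
      then have "z = ?p \<cdot> (s e \<cdot> a (org e) g) \<cdot> u"
        using x(3) p xP by (simp add: P.m_assoc)
      then have "z = (?p \<cdot> s e) \<cdot> (a (org e) g \<cdot> u)"
        using p xP by (simp add: P.m_assoc)
      moreover have "a (org e) g \<cdot> u \<in> ?R" using gA(1) subgroup.m_closed[OF R _ x(2)] by blast
      ultimately show "z \<in> (?p \<cdot> s e) <#\<^bsub>P\<^esub> ?R" unfolding l_coset_def by blast
    qed
    show "(?p \<cdot> s e) <#\<^bsub>P\<^esub> ?R \<subseteq> ((?p <#\<^bsub>P\<^esub> Q e) #>\<^bsub>P\<^esub> s e) <#>\<^bsub>P\<^esub> ?R"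
    proof
      fix z assume "z \<in> (?p \<cdot> s e) <#\<^bsub>P\<^esub> ?R"
      then obtain u where u: "u \<in> ?R" "z = ?p \<cdot> s e \<cdot> u" unfolding l_coset_def by blast
      have "z = ?p \<cdot> \<one>\<^bsub>P\<^esub> \<cdot> s e \<cdot> u" using u p by simp
      then show "z \<in> ((?p <#\<^bsub>P\<^esub> Q e) #>\<^bsub>P\<^esub> s e) <#>\<^bsub>P\<^esub> ?R"
        using one u(1) unfolding set_mult_def l_coset_def r_coset_def by blast
    qed
  qed
  then show ?thesis using \<gamma> e by (simp add: tgt_def lt_def vx_def \<chi>_mult \<chi>_t)
qed

lemma vx_eqD:
  assumes "vx \<gamma> v = vx \<delta> u" "v \<in> V" "\<gamma> \<in> carrier G" "\<delta> \<in> carrier G"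
  shows "u = v" "\<exists>g\<in>carrier (A v). \<chi> (\<gamma> \<otimes> \<epsilon> v g) = \<chi> \<delta>"
proof -
  show u: "u = v" using assms(1) by (simp add: vx_def)
  let ?R = "a v ` carrier (A v)"
  have R: "subgroup ?R P" by (rule group_hom.img_is_subgroup[OF a_group_hom[OF assms(2)]])
  have "\<chi> \<delta> = \<chi> \<delta> \<cdot> \<one>\<^bsub>P\<^esub>" using assms(4) by simp
  then have "\<chi> \<delta> \<in> \<chi> \<delta> <#\<^bsub>P\<^esub> ?R"
    unfolding l_coset_def using subgroup.one_closed[OF R] by blast
  then have "\<chi> \<delta> \<in> \<chi> \<gamma> <#\<^bsub>P\<^esub> ?R" using assms(1) u by (simp add: vx_def)
  then obtain g where "g \<in> carrier (A v)" "\<chi> \<delta> = \<chi> \<gamma> \<cdot> a v g" unfolding l_coset_def by blast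
  then show "\<exists>g\<in>carrier (A v). \<chi> (\<gamma> \<otimes> \<epsilon> v g) = \<chi> \<delta>"
    using assms(2,3) by (intro bexI[of _ g]) (simp_all add: \<chi>_mult \<chi>_\<epsilon>)
qed

lemma vx_cong: "\<chi> \<gamma> = \<chi> \<delta> ==> vx \<gamma> v = vx \<delta> v"
  by (simp add: vx_def)

lemma lt_cong: "\<chi> \<gamma> = \<chi> \<delta> ==> lt \<gamma> e = lt \<delta> e"
  by (simp add: lt_def)

lemma vx_\<epsilon>:
  assumes "\<gamma> \<in> carrier G" "v \<in> V" "g \<in> carrier (A v)"
  shows "vx (\<gamma> \<otimes> \<epsilon> v g) v = vx \<gamma> v"
proof -
  let ?R = "a v ` carrier (A v)"
  have R: "subgroup ?R P" by (rule group_hom.img_is_subgroup[OF a_group_hom[OF assms(2)]])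
  have "a v g <#\<^bsub>P\<^esub> ?R = ?R"
    using P.coset_join3[OF _ R, of "a v g"] assms by auto
  moreover have "(\<chi> \<gamma> \<cdot> a v g) <#\<^bsub>P\<^esub> ?R = \<chi> \<gamma> <#\<^bsub>P\<^esub> (a v g <#\<^bsub>P\<^esub> ?R)"
    using P.lcos_m_assoc[OF subgroup.subset[OF R], of "\<chi> \<gamma>" "a v g"] assms by simp
  ultimately show ?thesis using assms by (simp add: vx_def \<chi>_mult \<chi>_\<epsilon>)
qed

text \<open>Connectedness of the Bass-Serre tree as an induction rule. The edge case is an
  equivalence, so it also covers backward steps and moves along \<open>T\<close>.\<close>

lemma walk_induct [consumes 2, case_names base vertex edge]:
  assumes "\<gamma> \<in> carrier G" "v \<in> V" and base: "Pr \<one> v0"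
    and vertex: "!!\<gamma> v g. \<gamma> \<in> carrier G ==> v \<in> V ==> g \<in> carrier (A v) ==> Pr \<gamma> v ==> Pr (\<gamma> \<otimes> \<epsilon> v g) v"
    and edge: "!!\<gamma> e. \<gamma> \<in> carrier G ==> e \<in> E ==> Pr \<gamma> (ter e) \<longleftrightarrow> Pr (\<gamma> \<otimes> t e) (org e)"
  shows "Pr \<gamma> v"
proof -
  have all: "\<forall>u\<in>V. Pr \<gamma> u" if \<gamma>: "\<gamma> \<in> carrier G" and v: "v \<in> V" and "Pr \<gamma> v" for \<gamma> v
  proof
    fix u assume "u \<in> V"
    from v this show "Pr \<gamma> u"
    proof (induction rule: T.tree_induct)
      case (edge e)
      then have "e \<in> E" using T.T_sub(2) by auto
      then show ?case using assms(5)[OF \<gamma>, of e] t_tree[OF edge] \<gamma> by simp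
    qed (rule that(3))
  qed
  from assms(1) have "\<forall>v\<in>V. Pr \<gamma> v"
  proof (induction rule: gen_induct)
    case one
    show ?case by (rule all[OF one_closed v0 base])
  next
    case (vertex \<gamma> v g)
    show ?case
      by (rule all[OF _ vertex.hyps(2) assms(4)]) (use vertex in auto)
  next
    case (stable \<gamma> e)
    then have "org e \<in> V" "Pr (\<gamma> \<otimes> t e) (org e)" using assms(5)[of \<gamma> e] by auto
    then show ?case by (rule_tac all) (use stable in auto)
  next
    case (stable_inv \<gamma> e)
    then have "ter e \<in> V" "Pr (\<gamma> \<otimes> inv t e) (ter e)"
      using assms(5)[of "\<gamma> \<otimes> inv t e" e] by (auto simp: m_assoc)
    then show ?case by (rule_tac all) (use stable_inv in auto)
  qed
  then show ?thesis using assms(2) by blast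
qed

text \<open>A potential in the free group on the letters replaces acyclicity: along a circuit of
  distinct letters the equations would make a nonempty reduced word trivial.\<close>

definition forest :: "('e \<times> 'p set) set => ('v \<times> 'p set => ('e \<times> 'p set) word) => bool" where
  "forest D f \<longleftrightarrow> D \<subseteq> S' \<and> (\<forall>u. f u \<in> carrier F) \<and> (\<forall>x\<in>D. f (src x) \<otimes>\<^bsub>F\<^esub> free_gen x = f (tgt x))"

lemma maximal_forest:
  obtains D f where "forest D f" "!!x. x \<in> S' ==> (src x, tgt x) \<in> link src tgt D"
proof -
  have "forest {} (\<lambda>_. \<one>\<^bsub>F\<^esub>)" by (simp add: forest_def)
  then have "{D. \<exists>f. forest D f} \<noteq> {}" by blast
  moreover have "finite {D. \<exists>f. forest D f}"
    by (rule finite_subset[of _ "Pow S'"]) (auto simp: forest_def finite_S')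
  ultimately obtain D where D: "\<exists>f. forest D f" "!!D'. \<exists>f. forest D' f ==> D \<subseteq> D' ==> D = D'"
    using finite_has_maximal[of "{D. \<exists>f. forest D f}"] by auto
  obtain f where f: "forest D f" using D(1) by blast
  have "(src x, tgt x) \<in> link src tgt D" if x: "x \<in> S'" for x
  proof (rule ccontr)
    assume no: "(src x, tgt x) \<notin> link src tgt D"
    have "\<exists>f'. forest (insert x D) f'"
    proof (rule F.potential_insert[where q = f and l = free_gen and F = D, OF _ _ _ no])
      show "free_gen z \<in> carrier F" if "z \<in> insert x D" for z
        using that f x S'_sub by (auto simp: forest_def free_gen_closed)
      fix f' assume "!!v. f' v \<in> carrier F" "!!z. z \<in> insert x D ==> f' (src z) \<otimes>\<^bsub>F\<^esub> free_gen z = f' (tgt z)"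
      then show ?thesis using f x by (intro exI[of _ f']) (auto simp: forest_def)
    qed (use f in \<open>auto simp: forest_def\<close>)
    then have "D = insert x D" by (rule D(2)) auto
    then show False using link_edge(1)[of x D src tgt] no by blast
  qed
  then show thesis using that f by blast
qed

text \<open>\<open>\<zeta>\<close> deletes the letters of the forest, so that those outside generate
  the fundamental group of the quotient graph; \<open>\<kappa>\<close> sends a remaining letter to
  the loop that runs through the forest to the letter and back. Their composition controls the
  kernel, and lifting paths gives surjectivity.\<close>

lemma cover_hom:
  obtains l and \<omega> where "\<omega> \<in> hom (G\<lparr>carrier := {g \<in> carrier G. \<chi> g = \<one>\<^bsub>P\<^esub>}\<rparr>) (free_group {..<l :: nat})"
    "\<omega> ` {g \<in> carrier G. \<chi> g = \<one>\<^bsub>P\<^esub>} = carrier (free_group {..<l})"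
    "!!g. g \<in> carrier G ==> \<chi> g = \<one>\<^bsub>P\<^esub> ==> \<omega> g = [] ==> g \<in> vgroup \<one> v0"
proof -
  obtain D f where D: "forest D f" and max: "!!x. x \<in> S' ==> (src x, tgt x) \<in> link src tgt D"
    by (rule maximal_forest) (rule that, assumption, blast)
  have f [simp]: "f u \<in> carrier F" for u using D unfolding forest_def by blast
  have fD: "x \<in> D ==> f (src x) \<otimes>\<^bsub>F\<^esub> free_gen x = f (tgt x)" for x using D by (simp add: forest_def)
  have DS: "D \<subseteq> S'" using D by (simp add: forest_def)
  define l where "l = card (S' - D)"
  obtain i where i: "bij_betw i (S' - D) {..<l}"
    using ex_bij_betw_finite_nat[of "S' - D"] finite_S' unfolding l_def atLeast0LessThan by blast
  let ?L = "free_group {..<l}"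
  interpret L: group ?L by simp
  define \<zeta> where "\<zeta> = L.eval_word (\<lambda>x. if x \<in> S' - D then free_gen (i x) else [])"
  have iL: "i x < l" if "x \<in> S' - D" for x using i that by (auto simp: bij_betw_def)
  have \<zeta>_fun: "(\<lambda>x. if x \<in> S' - D then free_gen (i x) else []) ` S \<subseteq> carrier ?L"
    using iL L.one_closed by (auto simp: free_gen_closed one_free_group)
  interpret \<zeta>: group_hom F ?L \<zeta>
    unfolding \<zeta>_def using L.eval_word_hom[OF \<zeta>_fun] by unfold_locales
  have \<zeta>_gen: "\<zeta> (free_gen x) = (if x \<in> S' - D then free_gen (i x) else [])" if "x \<in> S" for x
    unfolding \<zeta>_def by (rule L.eval_free_gen) (use \<zeta>_fun that in blast)
  let ?j = "inv_into (S' - D) i"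
  have j: "?j m \<in> S' - D" if "m < l" for m
    by (rule inv_into_into) (use i that in \<open>auto simp: bij_betw_def\<close>)
  define \<kappa> where "\<kappa> = F.eval_word (\<lambda>m. f (src (?j m)) \<otimes>\<^bsub>F\<^esub> free_gen (?j m) \<otimes>\<^bsub>F\<^esub> inv\<^bsub>F\<^esub> f (tgt (?j m)))"
  have genF: "free_gen x \<in> carrier F" if "x \<in> S'" for x
    using that S'_sub by (auto simp: free_gen_closed)
  have \<kappa>_fun: "(\<lambda>m. f (src (?j m)) \<otimes>\<^bsub>F\<^esub> free_gen (?j m) \<otimes>\<^bsub>F\<^esub> inv\<^bsub>F\<^esub> f (tgt (?j m))) ` {..<l} \<subseteq> carrier F"
    using j genF F.m_closed F.inv_closed f by (intro image_subsetI) (metis DiffD1 lessThan_iff)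
  interpret \<kappa>: group_hom ?L F \<kappa>
    unfolding \<kappa>_def using F.eval_word_hom[OF \<kappa>_fun] by unfold_locales
  have \<kappa>\<zeta>: "\<kappa> (\<zeta> (free_gen x)) = f (src x) \<otimes>\<^bsub>F\<^esub> free_gen x \<otimes>\<^bsub>F\<^esub> inv\<^bsub>F\<^esub> f (tgt x)" if x: "x \<in> S'" for x
  proof (cases "x \<in> D")
    case True
    then show ?thesis
      using \<zeta>_gen[of x] x S'_sub fD[OF True] \<kappa>.hom_one by (auto simp: one_free_group)
  next
    case False
    then have "?j (i x) = x" using i x by (intro inv_into_f_f) (auto simp: bij_betw_def)
    moreover have "\<kappa> (free_gen (i x)) = f (src (?j (i x))) \<otimes>\<^bsub>F\<^esub> free_gen (?j (i x)) \<otimes>\<^bsub>F\<^esub> inv\<^bsub>F\<^esub> f (tgt (?j (i x)))"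
      unfolding \<kappa>_def by (rule F.eval_free_gen) (use \<kappa>_fun iL[of x] x False in blast)
    ultimately show ?thesis using \<zeta>_gen[of x] x S'_sub False by auto
  qed
  \<comment> \<open>\<open>\<kappa> (\<zeta> (W \<gamma> v))\<close> is \<open>W \<gamma> v\<close>
    up to a constant on the left and a factor on the right depending only on
    \<open>vx \<gamma> v\<close>. \<open>K\<close> is the constant that makes this true at the base
    vertex.\<close>
  define K where "K = \<kappa> (\<zeta> (W \<one> v0)) \<otimes>\<^bsub>F\<^esub> f (vx \<one> v0) \<otimes>\<^bsub>F\<^esub> inv\<^bsub>F\<^esub> W \<one> v0"
  have K: "K \<in> carrier F" using v0 by (simp add: K_def)
  have inv: "\<kappa> (\<zeta> (W \<gamma> v)) = K \<otimes>\<^bsub>F\<^esub> W \<gamma> v \<otimes>\<^bsub>F\<^esub> inv\<^bsub>F\<^esub> f (vx \<gamma> v)"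
    if "\<gamma> \<in> carrier G" "v \<in> V" for \<gamma> v
    using that
  proof (induction rule: walk_induct)
    case base
    then show ?case using v0 by (simp add: K_def F.m_assoc)
  next
    case (vertex \<gamma> v g)
    then show ?case by (simp add: W_\<epsilon> vx_\<epsilon>)
  next
    case (edge \<gamma> e)
    then have V: "org e \<in> V" "ter e \<in> V" by auto
    let ?x = "lt \<gamma> e"
    let ?d = "f (src ?x) \<otimes>\<^bsub>F\<^esub> free_gen ?x \<otimes>\<^bsub>F\<^esub> inv\<^bsub>F\<^esub> f (tgt ?x)"
    have x: "?x \<in> S'" "free_gen ?x \<in> carrier F" using lt_in edge genF by auto
    have cl: "W \<gamma> (ter e) \<in> carrier F" using edge V by simp
    have 1: "\<kappa> (\<zeta> (W (\<gamma> \<otimes> t e) (org e))) = \<kappa> (\<zeta> (W \<gamma> (ter e))) \<otimes>\<^bsub>F\<^esub> ?d"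
      using W_t[OF edge] \<kappa>\<zeta>[OF x(1)] x(2) cl by simp
    have 2: "K \<otimes>\<^bsub>F\<^esub> W (\<gamma> \<otimes> t e) (org e) \<otimes>\<^bsub>F\<^esub> inv\<^bsub>F\<^esub> f (vx (\<gamma> \<otimes> t e) (org e)) =
        K \<otimes>\<^bsub>F\<^esub> W \<gamma> (ter e) \<otimes>\<^bsub>F\<^esub> inv\<^bsub>F\<^esub> f (vx \<gamma> (ter e)) \<otimes>\<^bsub>F\<^esub> ?d"
      using W_t[OF edge] src_lt[OF edge] tgt_lt[OF edge] x(2) cl K by (simp add: F.m_assoc)
    show ?case
      unfolding 1 2 using x(2) cl K by (intro F.right_cancel[symmetric]) auto
  qed
  have conn: "(vx \<one> v0, vx \<gamma> v) \<in> link src tgt D" if "\<gamma> \<in> carrier G" "v \<in> V" for \<gamma> v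
    using that
  proof (induction rule: walk_induct)
    case (vertex \<gamma> v g)
    then show ?case by (simp add: vx_\<epsilon>)
  next
    case (edge \<gamma> e)
    have "(vx \<gamma> (ter e), vx (\<gamma> \<otimes> t e) (org e)) \<in> link src tgt D"
      using max[OF lt_in[OF edge]] src_lt[OF edge] tgt_lt[OF edge] by simp
    then show ?case using link_trans link_sym by meson
  qed simp
  let ?z = "\<zeta> (W \<one> v0)"
  have z: "?z \<in> carrier ?L" using v0 by simp
  have \<zeta>_t: "\<zeta> (W (\<gamma> \<otimes> t e) (org e)) = \<zeta> (W \<gamma> (ter e)) \<otimes>\<^bsub>?L\<^esub> (if lt \<gamma> e \<in> D then \<one>\<^bsub>?L\<^esub> else free_gen (i (lt \<gamma> e)))"
    if "\<gamma> \<in> carrier G" "e \<in> E" for \<gamma> e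
    using W_t[OF that] \<zeta>_gen[of "lt \<gamma> e"] genF[OF lt_in[OF that]] that lt_in[OF that] S'_sub
    by (auto simp: one_free_group)
  \<comment> \<open>Two lifts of the same quotient vertex differ, as to \<open>\<chi>\<close>, by a
    vertex element. Multiplication by it changes neither the vertex nor \<open>W\<close>.\<close>
  have adjust: "\<exists>\<gamma>'\<in>carrier G. \<chi> \<gamma>' = \<chi> \<delta> \<and> \<zeta> (W \<gamma>' u) = ?z"
    if ad: "\<gamma> \<in> carrier G" "v \<in> V" "vx \<gamma> v = vx \<delta> u" "\<delta> \<in> carrier G" "\<zeta> (W \<gamma> v) = ?z" for \<gamma> v \<delta> u
  proof -
    obtain g where g: "u = v" "g \<in> carrier (A v)" "\<chi> (\<gamma> \<otimes> \<epsilon> v g) = \<chi> \<delta>"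
      using vx_eqD[OF ad(3,2,1,4)] by blast
    then show ?thesis
      using ad W_\<epsilon>[OF ad(1,2) g(2)] by (intro bexI[of _ "\<gamma> \<otimes> \<epsilon> v g"]) auto
  qed
  \<comment> \<open>Steps within the forest do not change \<open>\<zeta>\<close>, so every quotient
    vertex linked to the base has a lift with the value \<open>?z\<close>.\<close>
  have lift: "\<exists>\<gamma>\<in>carrier G. \<exists>v\<in>V. vx \<gamma> v = u \<and> \<zeta> (W \<gamma> v) = ?z" if "(vx \<one> v0, u) \<in> link src tgt D" for u
    using that
  proof (induction rule: link_induct)
    case refl
    then show ?case using v0 by blast
  next
    case (forward x)
    obtain \<delta> e where x: "x = lt \<delta> e" "\<delta> \<in> carrier G" "e \<in> E"
      using forward(1) DS by (auto simp: S'_def)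
    then have V: "org e \<in> V" "ter e \<in> V" by auto
    obtain \<gamma> where \<gamma>: "\<gamma> \<in> carrier G" "\<chi> \<gamma> = \<chi> \<delta>" "\<zeta> (W \<gamma> (ter e)) = ?z"
      using forward.IH adjust[of _ _ \<delta> "ter e"] src_lt[OF x(2,3)] x by metis
    have "vx (\<gamma> \<otimes> t e) (org e) = tgt x"
      using tgt_lt[OF \<gamma>(1) x(3)] lt_cong[OF \<gamma>(2), of e] x(1) by simp
    moreover have "\<zeta> (W (\<gamma> \<otimes> t e) (org e)) = ?z"
      using \<zeta>_t[OF \<gamma>(1) x(3)] \<gamma>(3) lt_cong[OF \<gamma>(2), of e] x(1) forward(1) z by simp
    ultimately show ?case using \<gamma>(1) x(3) V by (intro bexI[of _ "\<gamma> \<otimes> t e"] bexI[of _ "org e"]) auto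
  next
    case (backward x)
    obtain \<delta> e where x: "x = lt \<delta> e" "\<delta> \<in> carrier G" "e \<in> E"
      using backward(1) DS by (auto simp: S'_def)
    then have V: "org e \<in> V" "ter e \<in> V" by auto
    have \<delta>t: "\<delta> \<otimes> t e \<in> carrier G" using x by simp
    obtain \<gamma> where \<gamma>: "\<gamma> \<in> carrier G" "\<chi> \<gamma> = \<chi> (\<delta> \<otimes> t e)" "\<zeta> (W \<gamma> (org e)) = ?z"
      using backward.IH adjust[OF _ _ _ \<delta>t, of _ _ "org e"] tgt_lt[OF x(2,3)] x(1) by metis
    let ?\<gamma> = "\<gamma> \<otimes> inv t e"
    have \<gamma>': "?\<gamma> \<in> carrier G" "\<chi> ?\<gamma> = \<chi> \<delta>" "?\<gamma> \<otimes> t e = \<gamma>"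
      using \<gamma>(1,2) x by (simp_all add: \<chi>_mult P.m_assoc m_assoc)
    have "vx ?\<gamma> (ter e) = src x"
      using src_lt[OF \<gamma>'(1) x(3)] lt_cong[OF \<gamma>'(2), of e] x(1) by simp
    moreover have "\<zeta> (W ?\<gamma> (ter e)) = ?z"
      using \<zeta>_t[OF \<gamma>'(1) x(3)] \<gamma>(3) \<gamma>'(3) lt_cong[OF \<gamma>'(2), of e] x(1) backward(1) \<gamma>'(1) V by simp
    ultimately show ?case using \<gamma>'(1) V by blast
  qed
  have lift': "\<exists>\<gamma>\<in>carrier G. \<chi> \<gamma> = \<chi> \<delta> \<and> \<zeta> (W \<gamma> u) = ?z" if "\<delta> \<in> carrier G" "u \<in> V" for \<delta> u
    using lift[OF conn[OF that]] adjust[of _ _ \<delta> u] that(1) by metis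
  let ?N = "{g \<in> carrier G. \<chi> g = \<one>\<^bsub>P\<^esub>}"
  have N_mult: "W (g \<otimes> \<gamma>) v = fst (\<Theta> g) \<otimes>\<^bsub>F\<^esub> W \<gamma> v" if "g \<in> ?N" "\<gamma> \<in> carrier G" "v \<in> V" for g \<gamma> v
    using that y_mult[of g \<gamma> v] W_closed[OF that(2,3)] map_word_one[of "W \<gamma> v"]
    by (simp add: W_def \<chi>_def X_simps(2) mult_free_group carrier_free_group)
  define \<omega> where "\<omega> g = \<zeta> (fst (\<Theta> g))" for g
  have \<omega>: "\<omega> \<in> hom (G\<lparr>carrier := ?N\<rparr>) ?L"
  proof (rule homI)
    show "\<omega> g \<in> carrier ?L" if "g \<in> carrier (G\<lparr>carrier := ?N\<rparr>)" for g
      using that fst_\<Theta>_closed[of g] by (simp add: \<omega>_def)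
    fix g h assume gh: "g \<in> carrier (G\<lparr>carrier := ?N\<rparr>)" "h \<in> carrier (G\<lparr>carrier := ?N\<rparr>)"
    have "fst (\<Theta> (g \<otimes> h)) = fst (\<Theta> g) \<otimes>\<^bsub>F\<^esub> fst (\<Theta> h)"
      using gh fst_\<Theta>_closed[of h] map_word_one[of "fst (\<Theta> h)"]
      by (simp add: \<chi>_def X_simps(2) mult_free_group carrier_free_group)
    then show "\<omega> (g \<otimes>\<^bsub>G\<lparr>carrier := ?N\<rparr>\<^esub> h) = \<omega> g \<otimes>\<^bsub>?L\<^esub> \<omega> h"
      using gh fst_\<Theta>_closed by (simp add: \<omega>_def)
  qed
  have N: "subgroup ?N G"
    using \<chi>.subgroup_kernel unfolding kernel_def .
  interpret \<omega>: group_hom "G\<lparr>carrier := ?N\<rparr>" ?L \<omega>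
    using \<omega> subgroup.subgroup_is_group[OF N group_axioms] L.group_axioms
    by (simp add: group_hom_def group_hom_axioms_def)
  have M: "subgroup (\<omega> ` ?N) ?L" using \<omega>.img_is_subgroup by simp
  \<comment> \<open>Lift the edge of the \<open>m\<close>-th letter to start at a vertex with value
    \<open>?z\<close>, and compare its end with a lift of the same quotient vertex of value
    \<open>?z\<close>. The element relating both lies in the kernel and picks up exactly this
    letter.\<close>
  have gen_img: "?z \<otimes>\<^bsub>?L\<^esub> free_gen m \<otimes>\<^bsub>?L\<^esub> inv\<^bsub>?L\<^esub> ?z \<in> \<omega> ` ?N" if m: "m < l" for m
  proof -
    have mL: "free_gen m \<in> carrier ?L" using m by (simp add: free_gen_closed)
    obtain \<delta> e where x: "?j m = lt \<delta> e" "\<delta> \<in> carrier G" "e \<in> E"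
      using j[OF m] by (auto simp: S'_def)
    then have V: "org e \<in> V" "ter e \<in> V" by auto
    obtain \<gamma> where \<gamma>: "\<gamma> \<in> carrier G" "\<chi> \<gamma> = \<chi> \<delta>" "\<zeta> (W \<gamma> (ter e)) = ?z"
      using lift'[OF x(2) V(2)] by blast
    have \<gamma>t: "\<gamma> \<otimes> t e \<in> carrier G" using \<gamma> x by simp
    obtain \<eta> where \<eta>: "\<eta> \<in> carrier G" "\<chi> \<eta> = \<chi> (\<gamma> \<otimes> t e)" "\<zeta> (W \<eta> (org e)) = ?z"
      using lift'[OF \<gamma>t V(1)] by blast
    let ?g = "\<gamma> \<otimes> t e \<otimes> inv \<eta>"
    have g: "?g \<in> ?N" using \<gamma>t \<eta>(1,2) by (simp add: \<chi>.hom_mult[OF \<gamma>t] del: \<chi>.hom_mult)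
    have "?g \<otimes> \<eta> = \<gamma> \<otimes> t e" using \<gamma>t \<eta>(1) by (simp add: m_assoc[OF \<gamma>t])
    then have "W (\<gamma> \<otimes> t e) (org e) = fst (\<Theta> ?g) \<otimes>\<^bsub>F\<^esub> W \<eta> (org e)"
      using N_mult[OF g \<eta>(1) V(1)] by simp
    then have "\<zeta> (W (\<gamma> \<otimes> t e) (org e)) = \<omega> ?g \<otimes>\<^bsub>?L\<^esub> ?z"
      using \<eta> V fst_\<Theta>_closed[of ?g] g by (simp add: \<omega>_def)
    moreover have "\<zeta> (W (\<gamma> \<otimes> t e) (org e)) = ?z \<otimes>\<^bsub>?L\<^esub> free_gen m"
    proof -
      have "lt \<gamma> e = ?j m" using lt_cong[OF \<gamma>(2)] x(1) by simp
      moreover have "i (?j m) = m" using i m by (intro f_inv_into_f) (auto simp: bij_betw_def)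
      ultimately show ?thesis using \<zeta>_t[OF \<gamma>(1) x(3)] \<gamma>(3) j[OF m] by simp
    qed
    ultimately have "\<omega> ?g \<otimes>\<^bsub>?L\<^esub> ?z = ?z \<otimes>\<^bsub>?L\<^esub> free_gen m" by simp
    moreover have "\<omega> ?g \<in> carrier ?L" using \<omega>.hom_closed[of ?g] g by simp
    ultimately have "\<omega> ?g = ?z \<otimes>\<^bsub>?L\<^esub> free_gen m \<otimes>\<^bsub>?L\<^esub> inv\<^bsub>?L\<^esub> ?z"
      by (metis L.inv_closed L.m_assoc L.r_inv L.r_one z)
    moreover have "\<omega> ?g \<in> \<omega> ` ?N" using g by (rule imageI)
    ultimately show ?thesis by simp
  qed
  have "{x \<in> carrier ?L. ?z \<otimes>\<^bsub>?L\<^esub> x \<otimes>\<^bsub>?L\<^esub> inv\<^bsub>?L\<^esub> ?z \<in> \<omega> ` ?N} = carrier ?L"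
  proof (rule subgroup_free_group_eq)
    show "subgroup {x \<in> carrier ?L. ?z \<otimes>\<^bsub>?L\<^esub> x \<otimes>\<^bsub>?L\<^esub> inv\<^bsub>?L\<^esub> ?z \<in> \<omega> ` ?N} ?L"
    proof (rule L.subgroupI)
      have "?z \<otimes>\<^bsub>?L\<^esub> \<one>\<^bsub>?L\<^esub> \<otimes>\<^bsub>?L\<^esub> inv\<^bsub>?L\<^esub> ?z \<in> \<omega> ` ?N"
        using subgroup.one_closed[OF M] z by simp
      then show "{x \<in> carrier ?L. ?z \<otimes>\<^bsub>?L\<^esub> x \<otimes>\<^bsub>?L\<^esub> inv\<^bsub>?L\<^esub> ?z \<in> \<omega> ` ?N} \<noteq> {}" by blast
    next
      fix x assume x: "x \<in> {x \<in> carrier ?L. ?z \<otimes>\<^bsub>?L\<^esub> x \<otimes>\<^bsub>?L\<^esub> inv\<^bsub>?L\<^esub> ?z \<in> \<omega> ` ?N}"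
      then have "inv\<^bsub>?L\<^esub> (?z \<otimes>\<^bsub>?L\<^esub> x \<otimes>\<^bsub>?L\<^esub> inv\<^bsub>?L\<^esub> ?z) \<in> \<omega> ` ?N"
        using subgroup.m_inv_closed[OF M] by blast
      then show "inv\<^bsub>?L\<^esub> x \<in> {x \<in> carrier ?L. ?z \<otimes>\<^bsub>?L\<^esub> x \<otimes>\<^bsub>?L\<^esub> inv\<^bsub>?L\<^esub> ?z \<in> \<omega> ` ?N}"
        using x z by (simp add: L.inv_mult_group L.m_assoc)
      fix x' assume x': "x' \<in> {x \<in> carrier ?L. ?z \<otimes>\<^bsub>?L\<^esub> x \<otimes>\<^bsub>?L\<^esub> inv\<^bsub>?L\<^esub> ?z \<in> \<omega> ` ?N}"
      then have "?z \<otimes>\<^bsub>?L\<^esub> x \<otimes>\<^bsub>?L\<^esub> inv\<^bsub>?L\<^esub> ?z \<otimes>\<^bsub>?L\<^esub> (?z \<otimes>\<^bsub>?L\<^esub> x' \<otimes>\<^bsub>?L\<^esub> inv\<^bsub>?L\<^esub> ?z) \<in> \<omega> ` ?N"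
        using subgroup.m_closed[OF M] x by blast
      then show "x \<otimes>\<^bsub>?L\<^esub> x' \<in> {x \<in> carrier ?L. ?z \<otimes>\<^bsub>?L\<^esub> x \<otimes>\<^bsub>?L\<^esub> inv\<^bsub>?L\<^esub> ?z \<in> \<omega> ` ?N}"
        using x x' z by (simp add: L.m_assoc)
    qed blast
  qed (use gen_img in \<open>auto simp: free_gen_closed\<close>)
  then have conj_img: "?z \<otimes>\<^bsub>?L\<^esub> x \<otimes>\<^bsub>?L\<^esub> inv\<^bsub>?L\<^esub> ?z \<in> \<omega> ` ?N" if "x \<in> carrier ?L" for x
    using that by blast
  have "x \<in> \<omega> ` ?N" if "x \<in> carrier ?L" for x
    using conj_img[of "inv\<^bsub>?L\<^esub> ?z \<otimes>\<^bsub>?L\<^esub> x \<otimes>\<^bsub>?L\<^esub> ?z"] that z by (simp add: L.m_assoc)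
  then have "\<omega> ` ?N = carrier ?L" using subgroup.subset[OF M] by blast
  moreover have "g \<in> vgroup \<one> v0" if g: "g \<in> carrier G" "\<chi> g = \<one>\<^bsub>P\<^esub>" "\<omega> g = []" for g
  proof -
    have gN: "g \<in> ?N" using g by simp
    have W: "W g v0 = fst (\<Theta> g) \<otimes>\<^bsub>F\<^esub> W \<one> v0" using N_mult[OF gN one_closed v0] g(1) by simp
    have Fg: "fst (\<Theta> g) \<in> carrier F" "W \<one> v0 \<in> carrier F" using fst_\<Theta>_closed[OF g(1)] v0 by auto
    have "\<zeta> (W g v0) = \<zeta> (W \<one> v0)"
      using g(3) W Fg z by (simp add: \<omega>_def flip: one_free_group[of "{..<l}"])
    moreover have "vx g v0 = vx \<one> v0" by (rule vx_cong) (use g in simp)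
    ultimately have "K \<otimes>\<^bsub>F\<^esub> W g v0 \<otimes>\<^bsub>F\<^esub> inv\<^bsub>F\<^esub> f (vx \<one> v0) = K \<otimes>\<^bsub>F\<^esub> W \<one> v0 \<otimes>\<^bsub>F\<^esub> inv\<^bsub>F\<^esub> f (vx \<one> v0)"
      using inv[OF g(1) v0] inv[OF one_closed v0] by simp
    then have "W g v0 = W \<one> v0" using K Fg W by (simp add: F.m_assoc)
    then have "fst (\<Theta> g \<star> y \<one> v0) = fst (y \<one> v0)"
      using y_mult[OF g(1) one_closed, of v0] g(1) by (simp add: W_def)
    then show ?thesis using fst_y_eq_iff[OF one_closed v0 g(1)] by simp
  qed
  ultimately show thesis using that \<omega> by blast
qed

end

section \<open>The abelian normal subgroup\<close>

lemma (in gog_group) V_nonempty: obtains v0 where "v0 \<in> V"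
  using T.D(2) connected_iff_link[OF T.D.wf_digraph_axioms] by blast

context gog_rep begin

text \<open>If the tree letters are trivial in \<open>P\<close>, the second components of a
  potential agree at all vertices, as \<open>T\<close> is connected, and a common translation
  removes them. Then \<open>snd\<close> of the twisted representation is the prescribed homomorphism
  itself.\<close>

lemma potential_snd_one:
  assumes s: "!!e. e \<in> arcs T ==> s e = \<one>\<^bsub>P\<^esub>"
  obtains q where "potential q" "!!v. v \<in> V ==> snd (q v) = \<one>\<^bsub>P\<^esub>"
proof -
  obtain q where q: "potential q" by (rule potential_exists)
  have cl [simp]: "q v \<in> carrier X" for v using q by (simp add: potential_def)
  have sq [simp]: "snd (q v) \<in> carrier P" for v using cl[of v] unfolding X_simps(1) by blast
  obtain v0 where v0: "v0 \<in> V" by (rule V_nonempty)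
  have eq: "snd (q v) = snd (q v0)" if "v \<in> V" for v
    using v0 that
  proof (induction rule: T.tree_induct)
    case (edge e)
    have "snd (q (ter e) \<star> edge_elt e) = snd (q (org e))"
      using q edge by (simp add: potential_def)
    then have "snd (q (ter e)) = snd (q (org e))"
      using s[OF edge] by (simp add: X_simps(2) edge_elt_def)
    then show ?case by simp
  qed simp
  define p where "p = (([], snd (q v0)) :: ('e \<times> 'p set) word \<times> 'p)"
  have p: "p \<in> carrier X" by (simp add: p_def)
  have "snd (inv\<^sub>X p \<star> q v) = inv\<^sub>P snd (q v0) \<cdot> snd (q v)" for v
    using inv_X[OF p] by (simp add: X_simps(2) p_def)
  moreover have "potential (\<lambda>v. inv\<^sub>X p \<star> q v)"
    using q p T.T_sub(2) by (auto simp: potential_def X.m_assoc subset_iff)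
  ultimately show thesis using eq by (intro that[of "\<lambda>v. inv\<^sub>X p \<star> q v"]) auto
qed

end

lemma (in gog_twisted) snd_\<Theta>:
  assumes h: "group_hom G P h" "!!v g. v \<in> V ==> g \<in> carrier (A v) ==> h (\<epsilon> v g) = a v g"
    "!!e. e \<in> E ==> h (t e) = s e"
    and snd_q: "!!v. v \<in> V ==> snd (q v) = \<one>\<^bsub>P\<^esub>" and \<gamma>: "\<gamma> \<in> carrier G"
  shows "snd (\<Theta> \<gamma>) = h \<gamma>"
proof -
  interpret h: group_hom G P h by (rule h(1))
  interpret sh: group_hom X P snd using snd_hom by unfold_locales
  have t: "snd (\<Theta> (t e)) = s e" if "e \<in> E" for e
  proof -
    have V: "org e \<in> V" "ter e \<in> V" using that by auto
    have "snd (edge_elt e) = s e" by (simp add: edge_elt_def)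
    then show ?thesis using that snd_q V by (simp add: \<Theta>_t)
  qed
  show ?thesis
    using \<gamma>
  proof (induction rule: gen_induct)
    case one
    then show ?case using sh.hom_one by simp
  next
    case (vertex \<gamma> v g)
    then show ?case using snd_q[of v] h(2)[of v g] by (simp add: \<Theta>_\<epsilon>)
  next
    case (stable \<gamma> e)
    then show ?case using h(3) t by simp
  next
    case (stable_inv \<gamma> e)
    then show ?case using h(3) t by simp
  qed
qed

lemma (in group) normal_pow_image:
  assumes B: "B \<lhd> G" and comm: "!!b b'. b \<in> B ==> b' \<in> B ==> b \<otimes> b' = b' \<otimes> b"
  shows "(\<lambda>b. b [^] (k :: nat)) ` B \<lhd> G"
proof -
  interpret B: normal B G by (rule B)
  let ?Z = "(\<lambda>b. b [^] k) ` B"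
  have "subgroup ?Z G"
  proof (rule subgroupI)
    show "?Z \<subseteq> carrier G" using B.mem_carrier by auto
    show "?Z \<noteq> {}" using B.one_closed by blast
    show "inv z \<in> ?Z" if z: "z \<in> ?Z" for z
    proof -
      obtain b where "b \<in> B" "z = b [^] k" using z by auto
      then have "inv z = (inv b) [^] k" "inv b \<in> B" using nat_pow_inv[of b k] by auto
      then show ?thesis by blast
    qed
    show "z \<otimes> z' \<in> ?Z" if z: "z \<in> ?Z" "z' \<in> ?Z" for z z'
    proof -
      obtain b b' where b: "b \<in> B" "b' \<in> B" "z = b [^] k" "z' = b' [^] k" using z by auto
      then have "z \<otimes> z' = (b \<otimes> b') [^] k" using pow_mult_distrib[OF comm, of b b' k] by auto
      then show ?thesis using b(1,2) by blast
    qed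
  qed
  moreover have "g \<otimes> z \<otimes> inv g \<in> ?Z" if g: "g \<in> carrier G" "z \<in> ?Z" for g z
  proof -
    obtain b where b: "b \<in> B" "z = b [^] k" using g by auto
    then have "g \<otimes> z \<otimes> inv g = (g \<otimes> b \<otimes> inv g) [^] k" using conj_pow[of g b k] g by simp
    then show ?thesis using B.inv_op_closed2[OF g(1) b(1)] by blast
  qed
  ultimately show ?thesis unfolding normal_inv_iff by blast
qed

text \<open>Taking \<open>p\<close>-th powers is a homomorphism on the abelian vertex groups and
  commutes with conjugation by stable letters.\<close>

lemma (in gbs) power_endo:
  obtains \<psi> where "group_hom G G \<psi>"
    "!!v g. v \<in> V ==> g \<in> carrier (A v) ==> \<psi> (\<epsilon> v g) = \<epsilon> v (g [^]\<^bsub>A v\<^esub> (p :: nat))"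
    "!!e. e \<in> E ==> \<psi> (t e) = t e"
proof (rule universal[OF group_axioms, of "\<lambda>v g. \<epsilon> v (g [^]\<^bsub>A v\<^esub> p)" t])
  fix v assume v: "v \<in> V"
  interpret v: Zn_coords "A v" n "c v" by (rule coords[OF v])
  show "(\<lambda>g. \<epsilon> v (g [^]\<^bsub>A v\<^esub> p)) \<in> hom (A v) G"
    using v by (intro homI) (simp_all add: v.pow_mult \<epsilon>_mult)
next
  fix e g assume e: "e \<in> E" "g \<in> esub \<Gamma> e"
  then have V: "org e \<in> V" "ter e \<in> V" by auto
  interpret o: group_hom "A (org e)" G "\<epsilon> (org e)" by (rule \<epsilon>_hom[OF V(1)])
  interpret t: group_hom "A (ter e)" G "\<epsilon> (ter e)" by (rule \<epsilon>_hom[OF V(2)])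
  have g: "g \<in> carrier (A (org e))" "emap \<Gamma> e g \<in> carrier (A (ter e))"
    using esub_closed[OF e] emap_closed[OF e] .
  have "t e \<otimes> \<epsilon> (org e) g [^] p \<otimes> inv t e = (t e \<otimes> \<epsilon> (org e) g \<otimes> inv t e) [^] p"
    by (rule conj_pow[symmetric]) (use e g in auto)
  then show "t e \<otimes> \<epsilon> (org e) (g [^]\<^bsub>A (org e)\<^esub> p) \<otimes> inv t e = \<epsilon> (ter e) (emap \<Gamma> e g [^]\<^bsub>A (ter e)\<^esub> p)"
    using t_conj[OF e] g by (simp add: o.hom_nat_pow t.hom_nat_pow)
qed (use t_tree that in auto)

text \<open>What the two cases share. Only finite subsets of \<open>B\<close> are placed in a
  conjugate of a vertex group, because \<open>B\<close> need not be finitely generated.\<close>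

locale gbs_abelian = gbs +
  fixes B and q :: nat
  assumes B: "B \<lhd> G" and B_vgroup: "finite F ==> F \<subseteq> B ==> \<exists>\<gamma>\<in>carrier G. \<exists>v\<in>V. F \<subseteq> vgroup \<gamma> v"
    and B_central: "b \<in> B ==> v \<in> V ==> g \<in> carrier (A v) ==> b \<otimes> \<epsilon> v g = \<epsilon> v g \<otimes> b"
    and q: "q \<ge> 1" and B_pow: "v \<in> V ==> g \<in> carrier (A v) ==> \<epsilon> v g [^] q \<in> B"
begin

sublocale B: normal B G by (rule B)

lemma B_commute: "b \<in> B ==> b' \<in> B ==> b \<otimes> b' = b' \<otimes> b"
  using B_vgroup[of "{b, b'}"] vgroup_commute by auto

lemma B_vgroup1: "b \<in> B ==> \<exists>\<gamma>\<in>carrier G. \<exists>v\<in>V. b \<in> vgroup \<gamma> v"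
  using B_vgroup[of "{b}"] by auto

text \<open>The exponent is 1 modulo \<open>q\<close> and \<open>q\<close>-th powers of vertex
  elements lie in \<open>B\<close>, so the endomorphism is the identity modulo \<open>B\<close>. For
  a conjugate of a vertex element in \<open>B\<close>, the conjugating element changes only by a
  factor in \<open>B\<close>, which commutes with vertex elements; so \<open>B\<close> itself is
  mapped by the power.\<close>

lemma power_endo_B:
  obtains \<psi> where "group_hom G G \<psi>"
    "!!v g. v \<in> V ==> g \<in> carrier (A v) ==> \<psi> (\<epsilon> v g) = \<epsilon> v g [^] (1 + q * k)"
    "!!g. g \<in> carrier G ==> inv g \<otimes> \<psi> g \<in> B"
    "!!b. b \<in> B ==> \<psi> b = b [^] (1 + q * k)"
proof -
  let ?p = "1 + q * k"
  obtain \<psi> where \<psi>: "group_hom G G \<psi>"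
    "!!v g. v \<in> V ==> g \<in> carrier (A v) ==> \<psi> (\<epsilon> v g) = \<epsilon> v (g [^]\<^bsub>A v\<^esub> ?p)"
    "!!e. e \<in> E ==> \<psi> (t e) = t e"
    by (rule power_endo) (rule that, assumption, blast, blast)
  interpret \<psi>: group_hom G G \<psi> by (rule \<psi>(1))
  have pow: "\<epsilon> v (g [^]\<^bsub>A v\<^esub> ?p) = \<epsilon> v g [^] ?p" if "v \<in> V" "g \<in> carrier (A v)" for v g
  proof -
    interpret \<epsilon>: group_hom "A v" G "\<epsilon> v" by (rule \<epsilon>_hom[OF that(1)])
    show ?thesis by (rule \<epsilon>.hom_nat_pow[OF that(2)])
  qed
  have mod: "inv \<gamma> \<otimes> \<psi> \<gamma> \<in> B" if "\<gamma> \<in> carrier G" for \<gamma>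
    using that
  proof (induction rule: gen_induct)
    case one
    then show ?case by simp
  next
    case (vertex \<gamma> v g)
    let ?h = "\<epsilon> v g"
    have h: "?h \<in> carrier G" using vertex by simp
    have "\<psi> ?h = ?h [^] (1 + q * k)"
      by (simp only: \<psi>(2)[OF vertex.hyps(2,3)] pow[OF vertex.hyps(2,3)])
    also have "\<dots> = ?h [^] (1 :: nat) \<otimes> ?h [^] (q * k)"
      by (rule nat_pow_mult[OF h, symmetric])
    also have "\<dots> = ?h \<otimes> (?h [^] q) [^] k"
      using h by (simp add: nat_pow_pow)
    finally have "inv (\<gamma> \<otimes> ?h) \<otimes> \<psi> (\<gamma> \<otimes> ?h) = (inv ?h \<otimes> (inv \<gamma> \<otimes> \<psi> \<gamma>) \<otimes> ?h) \<otimes> (?h [^] q) [^] k"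
      using vertex h by (simp add: word_simps)
    moreover have "(?h [^] q) [^] k \<in> B"
      using subgroup_pow_closed[OF B.subgroup_axioms B_pow] vertex by blast
    ultimately show ?case
      using B.inv_op_closed1[OF h vertex.IH] by simp
  next
    case (stable \<gamma> e)
    then have "inv (\<gamma> \<otimes> t e) \<otimes> \<psi> (\<gamma> \<otimes> t e) = inv t e \<otimes> (inv \<gamma> \<otimes> \<psi> \<gamma>) \<otimes> t e"
      using \<psi>(3) by (simp add: word_simps)
    then show ?case using B.inv_op_closed1[OF _ stable.IH, of "t e"] stable by simp
  next
    case (stable_inv \<gamma> e)
    then have "inv (\<gamma> \<otimes> inv t e) \<otimes> \<psi> (\<gamma> \<otimes> inv t e) = t e \<otimes> (inv \<gamma> \<otimes> \<psi> \<gamma>) \<otimes> inv t e"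
      using \<psi>(3) by (simp add: word_simps)
    then show ?case using B.inv_op_closed2[OF _ stable_inv.IH, of "t e"] stable_inv by simp
  qed
  have "\<psi> b = b [^] ?p" if bB: "b \<in> B" for b
  proof -
    obtain \<gamma> v g where b: "\<gamma> \<in> carrier G" "v \<in> V" "g \<in> carrier (A v)" "b = \<gamma> \<otimes> \<epsilon> v g \<otimes> inv \<gamma>"
      using B_vgroup1[OF bB] by (auto simp: vgroup_def)
    interpret v: group "A v" by (rule A_group[OF b(2)])
    let ?h = "\<epsilon> v (g [^]\<^bsub>A v\<^esub> ?p)" and ?b = "inv \<gamma> \<otimes> \<psi> \<gamma>"
    have h: "?h \<in> carrier G" "?b \<in> carrier G" using b by auto
    have "\<psi> \<gamma> = \<gamma> \<otimes> ?b" using b(1) by simp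
    then have "\<psi> b = \<gamma> \<otimes> ?b \<otimes> ?h \<otimes> inv (\<gamma> \<otimes> ?b)"
      using b \<psi>(2)[OF b(2,3)] by (simp add: b(4))
    also have "\<dots> = \<gamma> \<otimes> (?b \<otimes> ?h) \<otimes> inv ?b \<otimes> inv \<gamma>"
      using h b(1) by (simp add: word_simps)
    also have "?b \<otimes> ?h = ?h \<otimes> ?b"
      using B_central[OF mod[OF b(1)] b(2), of "g [^]\<^bsub>A v\<^esub> ?p"] b(3) by simp
    also have "\<gamma> \<otimes> (?h \<otimes> ?b) \<otimes> inv ?b \<otimes> inv \<gamma> = \<gamma> \<otimes> ?h \<otimes> inv \<gamma>"
      using h b(1) by (simp add: m_assoc)
    also have "\<dots> = b [^] ?p"
      using conj_pow[OF b(1), of "\<epsilon> v g" ?p] pow[OF b(2,3)] b by simp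
    finally show ?thesis .
  qed
  then show thesis using that[OF \<psi>(1) _ mod] \<psi>(2) pow by simp
qed

end

text \<open>The common outcome of both cases: a subgroup of finite index maps onto a free group of
  finite rank with kernel inside \<open>B\<close>.\<close>

locale gbs_split = gbs_abelian +
  fixes L and l :: nat and \<omega>
  assumes \<omega>: "virtual_hom G (free_group {..<l}) L \<omega>" and \<omega>_surj: "\<omega> ` L = carrier (free_group {..<l})"
    and \<omega>_ker: "g \<in> L ==> \<omega> g = [] ==> g \<in> B"

subsection \<open>Directed vertex groups\<close>

lemma (in gbs) split_of_directed:
  assumes dir: "!!\<gamma>1 v1 \<gamma>2 v2. \<gamma>1 \<in> carrier G ==> v1 \<in> V ==> \<gamma>2 \<in> carrier G ==> v2 \<in> V ==>
    \<exists>\<gamma>\<in>carrier G. \<exists>v\<in>V. vgroup \<gamma>1 v1 \<union> vgroup \<gamma>2 v2 \<subseteq> vgroup \<gamma> v"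
  obtains B l \<omega> where "gbs_split G \<Gamma> T \<Phi> n c r B 1 (carrier G) l \<omega>"
proof -
  obtain v0 where v0: "v0 \<in> V" by (rule V_nonempty)
  define B where "B = (\<Union>\<gamma>\<in>carrier G. \<Union>v\<in>V. vgroup \<gamma> v)"
  have BI: "x \<in> B" if "\<gamma> \<in> carrier G" "v \<in> V" "x \<in> vgroup \<gamma> v" for \<gamma> v x
    using that by (auto simp: B_def)
  have local: "\<exists>\<gamma>\<in>carrier G. \<exists>v\<in>V. F \<subseteq> vgroup \<gamma> v" if "finite F" "F \<subseteq> B" for F
    using that
  proof (induction F rule: finite_induct)
    case empty
    then show ?case using v0 by blast
  next
    case (insert x F)
    then obtain \<gamma>1 v1 where 1: "\<gamma>1 \<in> carrier G" "v1 \<in> V" "F \<subseteq> vgroup \<gamma>1 v1" by auto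
    obtain \<gamma>2 v2 where 2: "\<gamma>2 \<in> carrier G" "v2 \<in> V" "x \<in> vgroup \<gamma>2 v2" using insert.prems by (auto simp: B_def)
    obtain \<gamma> v where "\<gamma> \<in> carrier G" "v \<in> V" "vgroup \<gamma>1 v1 \<union> vgroup \<gamma>2 v2 \<subseteq> vgroup \<gamma> v"
      using dir[OF 1(1,2) 2(1,2)] by blast
    then show ?case using 1(3) 2(3) by blast
  qed
  have B_closed: "B \<subseteq> carrier G" using vgroup_closed by (auto simp: B_def)
  have "subgroup B G"
  proof (rule subgroupI[OF B_closed])
    show "B \<noteq> {}" using BI[OF one_closed v0] subgroup.one_closed[OF vgroup_subgroup[OF one_closed v0]] by blast
    show "inv x \<in> B" if x: "x \<in> B" for x
      using x subgroup.m_inv_closed[OF vgroup_subgroup] unfolding B_def by blast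
    show "x \<otimes> z \<in> B" if xz: "x \<in> B" "z \<in> B" for x z
    proof -
      obtain \<gamma> v where "\<gamma> \<in> carrier G" "v \<in> V" "{x, z} \<subseteq> vgroup \<gamma> v" using local[of "{x, z}"] xz by auto
      then show ?thesis using subgroup.m_closed[OF vgroup_subgroup] BI by (metis insert_subset)
    qed
  qed
  moreover have "z \<otimes> x \<otimes> inv z \<in> B" if zx: "z \<in> carrier G" "x \<in> B" for x z
  proof -
    obtain \<gamma> v where "\<gamma> \<in> carrier G" "v \<in> V" "x \<in> vgroup \<gamma> v" using zx by (auto simp: B_def)
    then show ?thesis using vgroup_mult[OF zx(1)] BI[of "z \<otimes> \<gamma>" v] zx(1) by auto
  qed
  ultimately have B: "B \<lhd> G" unfolding normal_inv_iff by blast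
  interpret B: normal B G by (rule B)
  have \<epsilon>B: "\<epsilon> v g \<in> B" if "v \<in> V" "g \<in> carrier (A v)" for v g
    by (rule BI[OF one_closed that(1)]) (use vgroup_one[OF that(1)] that(2) in blast)
  have abel: "gbs_abelian G \<Gamma> T \<Phi> n c r B 1"
  proof (intro gbs_abelian.intro gbs_abelian_axioms.intro gbs_axioms B local)
    show "b \<otimes> \<epsilon> v g = \<epsilon> v g \<otimes> b" if "b \<in> B" "v \<in> V" "g \<in> carrier (A v)" for b v g
      using local[of "{b, \<epsilon> v g}"] that \<epsilon>B vgroup_commute by auto
  qed (use \<epsilon>B in auto)
  define l where "l = card (E - arcs T)"
  obtain i where i: "bij_betw i (E - arcs T) {..<l}"
    using ex_bij_betw_finite_nat[of "E - arcs T"] T.D.finite_arcs unfolding l_def atLeast0LessThan by blast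
  let ?L = "free_group {..<l}"
  interpret L: group ?L by simp
  have iL: "i e < l" if "e \<in> E - arcs T" for e using i that by (auto simp: bij_betw_def)
  let ?s = "\<lambda>e. if e \<in> arcs T then [] else free_gen (i e)"
  have s: "?s e \<in> carrier ?L" if "e \<in> E" for e
    using iL[of e] that L.one_closed by (auto simp: free_gen_closed one_free_group)
  \<comment> \<open>Killing all vertex groups leaves the free group on the edges outside
    \<open>T\<close>.\<close>
  obtain \<omega> where \<omega>: "group_hom G ?L \<omega>" "!!v g. v \<in> V ==> g \<in> carrier (A v) ==> \<omega> (\<epsilon> v g) = \<one>\<^bsub>?L\<^esub>"
    "!!e. e \<in> E ==> \<omega> (t e) = ?s e"
  proof (rule universal[OF L.group_axioms, of "\<lambda>v g. \<one>\<^bsub>?L\<^esub>" ?s])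
    show "(\<lambda>g. \<one>\<^bsub>?L\<^esub>) \<in> hom (A v) ?L" if "v \<in> V" for v by (rule homI) auto
    show "?s e \<otimes>\<^bsub>?L\<^esub> \<one>\<^bsub>?L\<^esub> \<otimes>\<^bsub>?L\<^esub> inv\<^bsub>?L\<^esub> ?s e = \<one>\<^bsub>?L\<^esub>" if "e \<in> E" for e
      using s[OF that] L.r_one L.r_inv by presburger
  qed (use s in \<open>auto simp: one_free_group\<close>)
  interpret \<omega>: group_hom G ?L \<omega> by (rule \<omega>(1))
  define j where "j = inv_into (E - arcs T) i"
  have j: "j m \<in> E - arcs T" if "m < l" for m
    unfolding j_def by (rule inv_into_into) (use i that in \<open>auto simp: bij_betw_def\<close>)
  have ij: "i (j m) = m" if "m < l" for m
    unfolding j_def by (rule f_inv_into_f) (use i that in \<open>auto simp: bij_betw_def\<close>)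
  have ji: "j (i e) = e" if "e \<in> E - arcs T" for e
    unfolding j_def by (rule inv_into_f_f) (use i that in \<open>auto simp: bij_betw_def\<close>)
  define \<kappa> where "\<kappa> = eval_word (\<lambda>m. t (j m))"
  have tj: "(\<lambda>m. t (j m)) ` {..<l} \<subseteq> carrier G" using j by auto
  interpret \<kappa>: group_hom ?L G \<kappa>
    unfolding \<kappa>_def using eval_word_hom[OF tj] by unfold_locales
  have \<kappa>_gen: "\<kappa> (free_gen m) = t (j m)" if "m < l" for m
    unfolding \<kappa>_def by (rule eval_free_gen) (use tj that in blast)
  have "\<omega> (\<kappa> w) = w" if "w \<in> carrier ?L" for w
  proof (rule free_hom_ext[where h = "\<lambda>w. \<omega> (\<kappa> w)" and k = "\<lambda>w. w" and S = "{..<l}" and G = ?L])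
    show "(\<lambda>w. \<omega> (\<kappa> w)) \<in> hom ?L ?L" "(\<lambda>w. w) \<in> hom ?L ?L" by (auto intro: homI)
    show "\<omega> (\<kappa> (free_gen m)) = free_gen m" if "m \<in> {..<l}" for m
      using that j[of m] \<kappa>_gen[of m] \<omega>(3)[of "j m"] ij[of m] by auto
  qed (use that in auto)
  then have surj: "\<omega> ` carrier G = carrier ?L" using \<kappa>.hom_closed \<omega>.hom_closed by (metis image_eqI subsetI subset_antisym image_subsetI)
  have \<kappa>t: "\<kappa> (\<omega> (t e)) = t e" if "e \<in> E" for e
  proof (cases "e \<in> arcs T")
    case True
    then show ?thesis using \<omega>(3)[OF that] t_tree[OF True] \<kappa>.hom_one by (simp add: one_free_group)
  next
    case False
    then show ?thesis using \<omega>(3)[OF that] ji[of e] \<kappa>_gen[of "i e"] iL[of e] that by simp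
  qed
  \<comment> \<open>Modulo \<open>B\<close> every element equals its image under the retraction onto
    the subgroup generated by the stable letters. Hence the kernel of \<open>\<omega>\<close> lies
    in \<open>B\<close>.\<close>
  have sec: "\<gamma> \<otimes> inv \<kappa> (\<omega> \<gamma>) \<in> B" if "\<gamma> \<in> carrier G" for \<gamma>
    using that
  proof (induction rule: gen_induct)
    case one
    then show ?case by simp
  next
    case (vertex \<gamma> v g)
    have "(\<gamma> \<otimes> \<epsilon> v g) \<otimes> inv \<kappa> (\<omega> (\<gamma> \<otimes> \<epsilon> v g)) = (\<gamma> \<otimes> \<epsilon> v g \<otimes> inv \<gamma>) \<otimes> (\<gamma> \<otimes> inv \<kappa> (\<omega> \<gamma>))"
      using vertex \<omega>(2)[of v g] by (simp add: m_assoc)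
    then show ?case
      using B.inv_op_closed2[OF _ \<epsilon>B, of \<gamma> v g] vertex B.m_closed by simp
  next
    case (stable \<gamma> e)
    then show ?case using \<kappa>t[of e] by (simp add: word_simps)
  next
    case (stable_inv \<gamma> e)
    then show ?case using \<kappa>t[of e] by (simp add: word_simps)
  qed
  have "gbs_split G \<Gamma> T \<Phi> n c r B 1 (carrier G) l \<omega>"
  proof (intro gbs_split.intro gbs_split_axioms.intro abel virtual_hom_of_hom surj)
    show "\<omega> \<in> hom G ?L" by (rule \<omega>.homh)
    show "g \<in> B" if "g \<in> carrier G" "\<omega> g = []" for g
      using sec[OF that(1)] that \<kappa>.hom_one by (simp add: one_free_group)
  qed
  then show thesis by (rule that)
qed

subsection \<open>Vertex groups of finite index in their closures\<close>

text \<open>\<open>B\<close> lies in all vertex and edge groups, so that modulo \<open>B\<close>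
  there remains a graph of finite groups.\<close>

locale gbs_core = gbs_abelian +
  assumes B_sub: "v \<in> V ==> B \<subseteq> \<epsilon> v ` carrier (A v)"
    and B_esub: "e \<in> E ==> B \<subseteq> \<epsilon> (org e) ` esub \<Gamma> e"
    and B_emap: "e \<in> E ==> B \<subseteq> \<epsilon> (ter e) ` emap \<Gamma> e ` esub \<Gamma> e"
begin

text \<open>The kernel of the affine action \<open>x \<mapsto> g x \<psi>(g)\<inverse>\<close> on \<open>B\<close> modulo \<open>q\<close>-th powers.\<close>

lemma affine_kernel:
  obtains N where "fin_normal N" "!!v g. v \<in> V ==> g \<in> carrier (A v) ==> \<epsilon> v g \<in> N ==> \<epsilon> v g \<in> B"
proof -
  obtain v0 where v0: "v0 \<in> V" by (rule V_nonempty)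
  obtain \<psi> where \<psi>: "group_hom G G \<psi>"
    "!!v g. v \<in> V ==> g \<in> carrier (A v) ==> \<psi> (\<epsilon> v g) = \<epsilon> v g [^] (1 + q * 1)"
    "!!g. g \<in> carrier G ==> inv g \<otimes> \<psi> g \<in> B"
    by (rule power_endo_B[of 1]) (rule that, assumption, blast, blast)
  interpret \<psi>: group_hom G G \<psi> by (rule \<psi>(1))
  define Z where "Z = (\<lambda>b. b [^] q) ` B"
  have ZB: "Z \<subseteq> B" using subgroup_pow_closed[OF B.subgroup_axioms] by (auto simp: Z_def)
  have Z: "Z \<lhd> G" unfolding Z_def by (rule normal_pow_image[OF B B_commute])
  interpret Z: normal Z G by (rule Z)
  define dot where "dot g x = g \<otimes> x \<otimes> inv \<psi> g" for g x
  have dotB: "dot g x \<in> B" if "g \<in> carrier G" "x \<in> B" for g x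
  proof -
    have x: "x \<in> carrier G" using that by simp
    have "dot g x = g \<otimes> (x \<otimes> inv (inv g \<otimes> \<psi> g)) \<otimes> inv g"
      using that(1) x by (simp add: dot_def word_simps)
    moreover have "x \<otimes> inv (inv g \<otimes> \<psi> g) \<in> B"
      using \<psi>(3)[OF that(1)] that(2) by blast
    ultimately show ?thesis using B.inv_op_closed2[OF that(1)] by simp
  qed
  have dot_mult: "dot (g \<otimes> h) x = dot g (dot h x)" if "g \<in> carrier G" "h \<in> carrier G" "x \<in> B" for g h x
    using that B.mem_carrier[OF that(3)] by (simp add: dot_def word_simps)
  have dot_one: "dot \<one> x = x" if "x \<in> B" for x
    using that by (simp add: dot_def)
  have dot_cong: "Z #> dot g x = Z #> dot g x'" if "g \<in> carrier G" "x \<in> B" "x' \<in> B" "Z #> x = Z #> x'" for g x x'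
    unfolding dot_def using that by (intro Z.coset_mult) auto
  define N where "N = {g \<in> carrier G. \<forall>x\<in>B. Z #> dot g x = Z #> x}"
  have ND: "Z #> dot g x = Z #> x" if "g \<in> N" "x \<in> B" for g x using that by (simp add: N_def)
  have NG: "N \<subseteq> carrier G" by (auto simp: N_def)
  have N: "subgroup N G"
  proof (rule subgroupI[OF NG])
    show "N \<noteq> {}" using dot_one by (auto simp: N_def)
    show "inv g \<in> N" if g: "g \<in> N" for g
    proof -
      have gG: "g \<in> carrier G" using g NG by blast
      have "Z #> dot (inv g) x = Z #> x" if x: "x \<in> B" for x
      proof -
        have "Z #> dot (inv g) (dot g x) = Z #> dot (inv g) x"
          using dot_cong[of "inv g" "dot g x" x] dotB x g gG by (simp add: ND)
        then show ?thesis using dot_mult[of "inv g" g x] dot_one x gG by simp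
      qed
      then show ?thesis using gG by (simp add: N_def)
    qed
    show "g \<otimes> h \<in> N" if gh: "g \<in> N" "h \<in> N" for g h
    proof -
      have G: "g \<in> carrier G" "h \<in> carrier G" using gh NG by auto
      have "Z #> dot (g \<otimes> h) x = Z #> x" if x: "x \<in> B" for x
        using dot_mult[OF G x] ND[OF gh(1) dotB[OF G(2) x]] ND[OF gh(2) x] by simp
      then show ?thesis using G by (simp add: N_def)
    qed
  qed
  have "g \<otimes> m \<otimes> inv g \<in> N" if g: "g \<in> carrier G" "m \<in> N" for g m
  proof -
    have mG: "m \<in> carrier G" using g NG by auto
    have "Z #> dot (g \<otimes> m \<otimes> inv g) x = Z #> x" if x: "x \<in> B" for x
    proof -
      have 1: "dot (inv g) x \<in> B" "dot m (dot (inv g) x) \<in> B" using dotB g(1) mG x by auto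
      have "dot (g \<otimes> m \<otimes> inv g) x = dot g (dot m (dot (inv g) x))"
        using dot_mult[of "g \<otimes> m" "inv g" x] dot_mult[OF g(1) mG 1(1)] g(1) mG x by simp
      then have "Z #> dot (g \<otimes> m \<otimes> inv g) x = Z #> dot g (dot (inv g) x)"
        using dot_cong[OF g(1) 1(2,1) ND[OF g(2) 1(1)]] by simp
      then show ?thesis using dot_mult[of g "inv g" x] dot_one x g(1) by simp
    qed
    then show ?thesis using g(1) mG by (simp add: N_def)
  qed
  then have normal: "N \<lhd> G" unfolding normal_inv_iff using N by blast
  \<comment> \<open>For a vertex element \<open>y\<close> the power \<open>y [^] q\<close> lies in
    \<open>B\<close>, so \<open>y [^] (q * q)\<close> lies in \<open>Z\<close>. Representatives
    modulo such powers therefore suffice for \<open>B\<close> modulo \<open>Z\<close>.\<close>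
  have qq: "q * q \<ge> 1" using q by simp
  obtain R0 where R0: "finite R0" "R0 \<subseteq> vgroup \<one> v0"
    "!!x. x \<in> vgroup \<one> v0 ==> \<exists>h\<in>R0. \<exists>y\<in>vgroup \<one> v0. x \<otimes> inv h = y [^] (q * q)"
    by (rule vgroup_finite_reps[OF one_closed v0 qq]) (rule that, assumption, assumption, blast)
  define R where "R = R0 \<inter> B"
  have R: "\<exists>h\<in>R. Z #> x = Z #> h" if x: "x \<in> B" for x
  proof -
    have "x \<in> vgroup \<one> v0" using x B_sub[OF v0] vgroup_one[OF v0] by blast
    then obtain h y where h: "h \<in> R0" "y \<in> vgroup \<one> v0" "x \<otimes> inv h = y [^] (q * q)" using R0(3) by blast
    have hy: "h \<in> carrier G" "y \<in> carrier G" using h R0(2) vgroup_closed[OF one_closed v0] by auto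
    obtain g where g: "g \<in> carrier (A v0)" "y = \<epsilon> v0 g" using h(2) vgroup_one[OF v0] by auto
    have "y [^] q \<in> B" using B_pow[OF v0 g(1)] g(2) by simp
    then have "(y [^] q) [^] q \<in> Z" by (auto simp: Z_def)
    then have xh: "x \<otimes> inv h \<in> Z" using h(3) hy by (simp add: nat_pow_pow)
    have "h = inv (x \<otimes> inv h) \<otimes> x" using x hy by (simp add: word_simps)
    moreover have "inv (x \<otimes> inv h) \<otimes> x \<in> B" using xh ZB x by blast
    ultimately have "h \<in> R" using h(1) by (simp add: R_def)
    moreover have "Z #> x = Z #> h" by (rule rcoset_eqI[OF Z.subgroup_axioms _ hy(1) xh]) (use x in simp)
    ultimately show ?thesis by blast
  qed
  have RB: "R \<subseteq> B" by (simp add: R_def)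
  have "finite (rcosets N)"
  proof (rule finite_rcosetsI_left[OF N, where f = "\<lambda>g. \<lambda>x\<in>R. Z #> dot g x"])
    have "(\<lambda>g. \<lambda>x\<in>R. Z #> dot g x) ` carrier G \<subseteq> R \<rightarrow>\<^sub>E (\<lambda>h. Z #> h) ` R"
    proof (intro image_subsetI restrict_PiE_iff[THEN iffD2] ballI)
      fix g x assume "g \<in> carrier G" "x \<in> R"
      then have "dot g x \<in> B" using dotB RB by blast
      then show "Z #> dot g x \<in> (\<lambda>h. Z #> h) ` R" using R by blast
    qed
    moreover have "finite (R \<rightarrow>\<^sub>E (\<lambda>h. Z #> h) ` R)"
      using R0(1) by (intro finite_PiE) (auto simp: R_def)
    ultimately show "finite ((\<lambda>g. \<lambda>x\<in>R. Z #> dot g x) ` carrier G)" by (rule finite_subset)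
    fix g g' assume g: "g \<in> carrier G" "g' \<in> carrier G"
      and eq: "(\<lambda>x\<in>R. Z #> dot g x) = (\<lambda>x\<in>R. Z #> dot g' x)"
    have "Z #> dot (inv g \<otimes> g') x = Z #> x" if x: "x \<in> B" for x
    proof -
      obtain h where h: "h \<in> R" "Z #> x = Z #> h" using R[OF x] by blast
      have hB: "h \<in> B" using h(1) RB by blast
      have "Z #> dot g h = Z #> dot g' h" using fun_cong[OF eq, of h] h(1) by simp
      then have "Z #> dot g' x = Z #> dot g x"
        using dot_cong[OF g(1) x hB h(2)] dot_cong[OF g(2) x hB h(2)] by simp
      then have "Z #> dot (inv g) (dot g' x) = Z #> dot (inv g) (dot g x)"
        by (intro dot_cong) (use dotB g x in auto)
      then show ?thesis using dot_mult[of "inv g" g' x] dot_mult[of "inv g" g x] dot_one g x by simp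
    qed
    then show "inv g \<otimes> g' \<in> N" using g by (simp add: N_def)
  qed
  then have "fin_normal N" using normal by (simp add: fin_normal_def)
  moreover have "\<epsilon> v g \<in> B" if v: "v \<in> V" "g \<in> carrier (A v)" "\<epsilon> v g \<in> N" for v g
  proof -
    interpret v: Zn_coords "A v" n "c v" by (rule coords[OF v(1)])
    interpret \<epsilon>: group_hom "A v" G "\<epsilon> v" by (rule \<epsilon>_hom[OF v(1)])
    let ?h = "\<epsilon> v g"
    have h: "?h \<in> carrier G" using v by simp
    \<comment> \<open>The inverse of \<open>dot ?h \<one>\<close> is the \<open>q\<close>-th power
      of \<open>?h\<close>. If it is the \<open>q\<close>-th power of an element of
      \<open>B\<close>, then \<open>?h\<close> is this element, because roots in vertex groups are
      unique.\<close>
    have "Z #> dot ?h \<one> = Z #> \<one>" using ND[OF v(3)] by simp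
    then have "dot ?h \<one> \<in> Z" using Z.coset_mem_iff[of "dot ?h \<one>"] dotB[OF h, of \<one>] by simp
    then have "inv dot ?h \<one> \<in> Z" by simp
    moreover have "inv dot ?h \<one> = ?h [^] q"
      using \<psi>(2)[OF v(1,2)] h nat_pow_mult[of ?h 1 q] by (simp add: dot_def word_simps)
    ultimately obtain b where b: "b \<in> B" "?h [^] q = b [^] q" by (auto simp: Z_def)
    obtain g' where g': "g' \<in> carrier (A v)" "b = \<epsilon> v g'" using b(1) B_sub[OF v(1)] by auto
    have "\<epsilon> v (g [^]\<^bsub>A v\<^esub> q) = \<epsilon> v (g' [^]\<^bsub>A v\<^esub> q)"
      using b(2) g' v(2) by (simp add: \<epsilon>.hom_nat_pow)
    then have "g [^]\<^bsub>A v\<^esub> q = g' [^]\<^bsub>A v\<^esub> q"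
      by (rule inj_onD[OF \<epsilon>_inj[OF v(1)]]) (use v(2) g'(1) in auto)
    then have "g = g'" by (rule v.pow_inj[OF v(2) g'(1) _ q])
    then show ?thesis using b(1) g'(2) by simp
  qed
  ultimately show thesis by (rule that)
qed

text \<open>The finite quotient by the kernel \<open>N\<close> serves as \<open>P\<close>. Vertex
  elements of \<open>N\<close> lie in \<open>B\<close> and hence in every edge group, which gives
  the pinch conditions, and the stabiliser of the base vertex in \<open>N\<close> lies in
  \<open>B\<close>.\<close>

lemma split:
  obtains L l \<omega> where "gbs_split G \<Gamma> T \<Phi> n c r B q L l \<omega>"
proof -
  obtain v0 where v0: "v0 \<in> V" by (rule V_nonempty)
  obtain N where N: "fin_normal N" "!!v g. v \<in> V ==> g \<in> carrier (A v) ==> \<epsilon> v g \<in> N ==> \<epsilon> v g \<in> B"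
    by (rule affine_kernel) (rule that, assumption, blast)
  interpret N: normal N G by (rule fin_normal_normal[OF N(1)])
  let ?P = "G Mod N" and ?\<pi> = "\<lambda>g. N #> g"
  interpret P: group ?P by (rule N.factorgroup_is_group)
  interpret \<pi>: group_hom G ?P ?\<pi> using N.r_coset_hom_Mod by unfold_locales
  have inN: "\<epsilon> v (g \<otimes>\<^bsub>A v\<^esub> inv\<^bsub>A v\<^esub> x) \<in> B"
    if "v \<in> V" "g \<in> carrier (A v)" "x \<in> carrier (A v)" "?\<pi> (\<epsilon> v g) = ?\<pi> (\<epsilon> v x)" for v g x
  proof -
    interpret \<epsilon>: group_hom "A v" G "\<epsilon> v" by (rule \<epsilon>_hom[OF that(1)])
    have "\<epsilon> v g \<otimes> inv \<epsilon> v x \<in> N"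
      by (rule rcoset_eqD[OF N.subgroup_axioms _ _ that(4)]) (use that in auto)
    then show ?thesis using N(2)[OF that(1), of "g \<otimes>\<^bsub>A v\<^esub> inv\<^bsub>A v\<^esub> x"] that by simp
  qed
  have pinch: "g \<in> D" if v: "v \<in> V" and D: "subgroup D (A v)" "B \<subseteq> \<epsilon> v ` D"
    and g: "g \<in> carrier (A v)" "?\<pi> (\<epsilon> v g) \<in> (\<lambda>g. ?\<pi> (\<epsilon> v g)) ` D" for v D g
  proof -
    interpret v: group "A v" by (rule A_group[OF v])
    obtain x where x: "x \<in> D" "?\<pi> (\<epsilon> v g) = ?\<pi> (\<epsilon> v x)" using g(2) by auto
    have xA: "x \<in> carrier (A v)" using subgroup.mem_carrier[OF D(1) x(1)] .
    obtain d where d: "d \<in> D" "\<epsilon> v (g \<otimes>\<^bsub>A v\<^esub> inv\<^bsub>A v\<^esub> x) = \<epsilon> v d"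
      using inN[OF v g(1) xA x(2)] D(2) by blast
    have dA: "d \<in> carrier (A v)" using subgroup.mem_carrier[OF D(1) d(1)] .
    have "g \<otimes>\<^bsub>A v\<^esub> inv\<^bsub>A v\<^esub> x = d"
      by (rule inj_onD[OF \<epsilon>_inj[OF v] d(2)]) (use g xA dA in auto)
    moreover have "g \<otimes>\<^bsub>A v\<^esub> inv\<^bsub>A v\<^esub> x \<otimes>\<^bsub>A v\<^esub> x = g"
      using g(1) xA by (simp add: v.m_assoc)
    ultimately have "d \<otimes>\<^bsub>A v\<^esub> x = g" by simp
    then show ?thesis using subgroup.m_closed[OF D(1) d(1) x(1)] by simp
  qed
  have rep: "gog_rep G \<Gamma> T \<Phi> ?P (\<lambda>v g. ?\<pi> (\<epsilon> v g)) (\<lambda>e. ?\<pi> (t e))"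
  proof (intro gog_rep.intro gog_rep_axioms.intro P.group_axioms)
    show "gog_group G \<Gamma> T \<Phi>" by unfold_locales
    show "(\<lambda>g. ?\<pi> (\<epsilon> v g)) \<in> hom (A v) ?P" if v: "v \<in> V" for v
    proof -
      interpret \<epsilon>: group_hom "A v" G "\<epsilon> v" by (rule \<epsilon>_hom[OF v])
      show ?thesis by (intro homI) auto
    qed
  next
    fix e assume e: "e \<in> E"
    then have V: "org e \<in> V" "ter e \<in> V" by auto
    show "?\<pi> (t e) \<in> carrier ?P" using e by simp
    show "?\<pi> (t e) \<otimes>\<^bsub>?P\<^esub> ?\<pi> (\<epsilon> (org e) g) = ?\<pi> (\<epsilon> (ter e) (emap \<Gamma> e g)) \<otimes>\<^bsub>?P\<^esub> ?\<pi> (t e)"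
      if g: "g \<in> esub \<Gamma> e" for g
    proof -
      have gA: "g \<in> carrier (A (org e))" "emap \<Gamma> e g \<in> carrier (A (ter e))"
        using esub_closed[OF e g] emap_closed[OF e g] .
      have cl: "t e \<in> carrier G" "\<epsilon> (org e) g \<in> carrier G" "\<epsilon> (ter e) (emap \<Gamma> e g) \<in> carrier G"
        using gA e V by auto
      have "t e \<otimes> \<epsilon> (org e) g \<otimes> inv t e \<otimes> t e = t e \<otimes> \<epsilon> (org e) g"
        using cl by (simp add: m_assoc)
      then have eq: "t e \<otimes> \<epsilon> (org e) g = \<epsilon> (ter e) (emap \<Gamma> e g) \<otimes> t e"
        using t_conj[OF e g] by simp
      show ?thesis
        unfolding \<pi>.hom_mult[OF cl(1,2), symmetric] \<pi>.hom_mult[OF cl(3,1), symmetric] eq ..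
    qed
    show "g \<in> emap \<Gamma> e ` esub \<Gamma> e" if "g \<in> carrier (A (ter e))"
      "?\<pi> (\<epsilon> (ter e) g) \<in> (\<lambda>g. ?\<pi> (\<epsilon> (ter e) g)) ` emap \<Gamma> e ` esub \<Gamma> e" for g
      by (rule pinch[OF V(2) emap_subgroup[OF e] B_emap[OF e] that])
    show "g \<in> esub \<Gamma> e" if "g \<in> carrier (A (org e))"
      "?\<pi> (\<epsilon> (org e) g) \<in> (\<lambda>g. ?\<pi> (\<epsilon> (org e) g)) ` esub \<Gamma> e" for g
      by (rule pinch[OF V(1) esub_subgroup[OF e] B_esub[OF e] that])
  qed
  interpret R: gog_rep G \<Gamma> T \<Phi> ?P "\<lambda>v g. ?\<pi> (\<epsilon> v g)" "\<lambda>e. ?\<pi> (t e)" by (rule rep)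
  have tree: "?\<pi> (t e) = \<one>\<^bsub>?P\<^esub>" if "e \<in> arcs T" for e
    using t_tree[OF that] \<pi>.hom_one by simp
  obtain qq where qq: "R.potential qq" "!!v. v \<in> V ==> snd (qq v) = \<one>\<^bsub>?P\<^esub>"
    by (rule R.potential_snd_one[OF tree]) (assumption, rule that, assumption, blast)
  obtain \<Theta> where \<Theta>: "R.twisted qq \<Theta>" by (rule R.twisted_exists[OF qq(1)])
  have tw: "gog_twisted G \<Gamma> T \<Phi> ?P (\<lambda>v g. ?\<pi> (\<epsilon> v g)) (\<lambda>e. ?\<pi> (t e)) qq \<Theta>"
    by (intro gog_twisted.intro gog_twisted_axioms.intro rep qq(1) \<Theta>)
  have snd\<Theta>: "snd (\<Theta> \<gamma>) = ?\<pi> \<gamma>" if "\<gamma> \<in> carrier G" for \<gamma>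
    by (rule gog_twisted.snd_\<Theta>[OF tw \<pi>.group_hom_axioms _ _ qq(2) that]) auto
  have cover: "gog_cover G \<Gamma> T \<Phi> ?P (\<lambda>v g. ?\<pi> (\<epsilon> v g)) (\<lambda>e. ?\<pi> (t e)) qq \<Theta> v0"
  proof (intro gog_cover.intro gog_cover_axioms.intro tw qq(2) v0)
    show "finite (carrier ?P)" using N(1) by (simp add: fin_normal_def FactGroup_def)
    show "\<exists>\<gamma>\<in>carrier G. snd (\<Theta> \<gamma>) = p" if "p \<in> carrier ?P" for p
      using that snd\<Theta> by (auto simp: FactGroup_def RCOSETS_def)
  qed
  interpret C: gog_cover G \<Gamma> T \<Phi> ?P "\<lambda>v g. ?\<pi> (\<epsilon> v g)" "\<lambda>e. ?\<pi> (t e)" qq \<Theta> v0 by (rule cover)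
  have ker: "{g \<in> carrier G. C.\<chi> g = \<one>\<^bsub>?P\<^esub>} = N"
  proof -
    have "?\<pi> g = \<one>\<^bsub>?P\<^esub> \<longleftrightarrow> g \<in> N" if "g \<in> carrier G" for g
      using N.coset_mem_iff[OF that] \<pi>.hom_one by simp
    then show ?thesis using snd\<Theta> N.subset by (auto simp: C.\<chi>_def)
  qed
  obtain l and \<omega> where \<omega>: "\<omega> \<in> hom (G\<lparr>carrier := N\<rparr>) (free_group {..<l :: nat})"
    "\<omega> ` N = carrier (free_group {..<l})" "!!g. g \<in> N ==> \<omega> g = [] ==> g \<in> vgroup \<one> v0"
  proof (rule C.cover_hom)
    fix \<omega> and l :: nat
    assume "\<omega> \<in> hom (G\<lparr>carrier := {g \<in> carrier G. C.\<chi> g = \<one>\<^bsub>?P\<^esub>}\<rparr>) (free_group {..<l})"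
      "\<omega> ` {g \<in> carrier G. C.\<chi> g = \<one>\<^bsub>?P\<^esub>} = carrier (free_group {..<l})"
      "!!g. g \<in> carrier G ==> C.\<chi> g = \<one>\<^bsub>?P\<^esub> ==> \<omega> g = [] ==> g \<in> vgroup \<one> v0"
    then show thesis
      using ker by (intro that[of \<omega> l]) auto
  qed
  have "gbs_split G \<Gamma> T \<Phi> n c r B q N l \<omega>"
  proof (intro gbs_split.intro gbs_split_axioms.intro gbs_abelian_axioms \<omega>(2))
    show "virtual_hom G (free_group {..<l}) N \<omega>"
      using N(1) \<omega>(1) N.subgroup_axioms by (simp add: virtual_hom_def fin_normal_def)
    show "g \<in> B" if "g \<in> N" "\<omega> g = []" for g
      using \<omega>(3)[OF that] that(1) N(2)[OF v0] vgroup_one[OF v0] by auto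
  qed
  then show thesis by (rule that)
qed

end

section \<open>Obtaining the split from residual finiteness\<close>

context gbs begin

text \<open>Inside a suitable \<open>M\<close> of finite index the closure of a vertex group is
  contained in those of its edge groups, so stable letters carry the parts \<open>C v\<close> into
  each other. Along \<open>T\<close> they coincide, and this common part is a normal subgroup
  centralised by all vertex groups. A power of it lies in the vertex and edge groups
  themselves.\<close>

lemma core_of_closures:
  assumes rf: "residually_finite G" and cls: "!!v. v \<in> V ==> pow_into (pcl (vgroup \<one> v)) (vgroup \<one> v)"
  obtains B q where "gbs_core G \<Gamma> T \<Phi> n c r B q"
proof -
  obtain v0 where v0: "v0 \<in> V" by (rule V_nonempty)
  let ?H = "vgroup \<one>"
  have HG: "?H v \<subseteq> carrier G" "subgroup (?H v) G" if "v \<in> V" for v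
    using vgroup_closed[OF one_closed that] vgroup_subgroup[OF one_closed that] .
  have closed: "\<exists>N. fin_normal N \<and> N \<inter> pcl (?H v) \<subseteq> pcl (\<epsilon> v ` D)"
    if v: "v \<in> V" and D: "subgroup D (A v)" and pow: "!!g. g \<in> carrier (A v) ==> g [^]\<^bsub>A v\<^esub> r \<in> D" for v D
  proof -
    interpret \<epsilon>: group_hom "A v" G "\<epsilon> v" by (rule \<epsilon>_hom[OF v])
    obtain R where R: "finite R" "R \<subseteq> ?H v" "!!x. x \<in> ?H v ==> \<exists>h\<in>R. \<exists>y\<in>?H v. x \<otimes> inv h = y [^] r"
      by (rule vgroup_finite_reps[OF one_closed v r]) (rule that, assumption, assumption, blast)
    have "\<exists>h\<in>R. x \<otimes> inv h \<in> \<epsilon> v ` D" if x: "x \<in> ?H v" for x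
    proof -
      obtain h y where h: "h \<in> R" "y \<in> ?H v" "x \<otimes> inv h = y [^] r" using R(3)[OF x] by blast
      obtain g where g: "g \<in> carrier (A v)" "y = \<epsilon> v g" using h(2) vgroup_one[OF v] by auto
      have "x \<otimes> inv h = \<epsilon> v (g [^]\<^bsub>A v\<^esub> r)" using h(3) g by (simp add: \<epsilon>.hom_nat_pow)
      then show ?thesis using h(1) pow[OF g(1)] by blast
    qed
    then show ?thesis
      using pcl_finite_index[OF \<epsilon>.subgroup_img_is_subgroup[OF D] R(1) subset_trans[OF R(2) HG(1)[OF v]] HG(1)[OF v]]
      by metis
  qed
  have "\<exists>N. fin_normal N \<and> N \<inter> pcl (?H (org e)) \<subseteq> pcl (\<epsilon> (org e) ` esub \<Gamma> e)" if "e \<in> E" for e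
    by (rule closed) (use that esub_subgroup esub_pow in auto)
  then obtain N1 where N1: "!!e. e \<in> E ==> fin_normal (N1 e)"
    "!!e. e \<in> E ==> N1 e \<inter> pcl (?H (org e)) \<subseteq> pcl (\<epsilon> (org e) ` esub \<Gamma> e)" by metis
  have "\<exists>N. fin_normal N \<and> N \<inter> pcl (?H (ter e)) \<subseteq> pcl (\<epsilon> (ter e) ` emap \<Gamma> e ` esub \<Gamma> e)" if "e \<in> E" for e
    by (rule closed) (use that emap_subgroup emap_pow in auto)
  then obtain N2 where N2: "!!e. e \<in> E ==> fin_normal (N2 e)"
    "!!e. e \<in> E ==> N2 e \<inter> pcl (?H (ter e)) \<subseteq> pcl (\<epsilon> (ter e) ` emap \<Gamma> e ` esub \<Gamma> e)" by metis
  \<comment> \<open>The boolean index distinguishes the two ends of an edge.\<close>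
  have "\<exists>M. fin_normal M \<and> (\<forall>x\<in>E \<times> UNIV. M \<subseteq> (if snd x then N1 (fst x) else N2 (fst x)))"
    by (rule fin_normal_Inter) (use N1(1) N2(1) T.D.finite_arcs in auto)
  then obtain M where M0: "fin_normal M"
    "\<forall>x\<in>E \<times> UNIV. M \<subseteq> (if snd x then N1 (fst x) else N2 (fst x))" by blast
  have M: "fin_normal M" "!!e. e \<in> E ==> M \<subseteq> N1 e" "!!e. e \<in> E ==> M \<subseteq> N2 e"
    using M0(1) M0(2)[rule_format, of "(_, True)"] M0(2)[rule_format, of "(_, False)"] by simp_all
  interpret M: normal M G by (rule fin_normal_normal[OF M(1)])
  define C where "C v = M \<inter> pcl (?H v)" for v
  have CG: "C v \<subseteq> carrier G" for v by (auto simp: C_def)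
  have img: "(\<lambda>h. t e \<otimes> h \<otimes> inv t e) ` \<epsilon> (org e) ` esub \<Gamma> e = \<epsilon> (ter e) ` emap \<Gamma> e ` esub \<Gamma> e"
    if "e \<in> E" for e
    unfolding image_image by (rule image_cong) (use t_conj[OF that] in auto)
  have C_t: "t e \<otimes> x \<otimes> inv t e \<in> C (ter e)" if e: "e \<in> E" and x: "x \<in> C (org e)" for e x
  proof -
    have V: "org e \<in> V" "ter e \<in> V" using e by auto
    have "x \<in> pcl (\<epsilon> (org e) ` esub \<Gamma> e)" using x M(2)[OF e] N1(2)[OF e] by (auto simp: C_def)
    then have "t e \<otimes> x \<otimes> inv t e \<in> pcl (\<epsilon> (ter e) ` emap \<Gamma> e ` esub \<Gamma> e)"
      using pcl_conj[of x _ "t e"] esub_closed[OF e] e V img[OF e] by (metis \<epsilon>_closed image_subsetI t_closed)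
    moreover have "\<epsilon> (ter e) ` emap \<Gamma> e ` esub \<Gamma> e \<subseteq> ?H (ter e)"
      using vgroup_one[OF V(2)] emap_closed[OF e] by auto
    ultimately have "t e \<otimes> x \<otimes> inv t e \<in> pcl (?H (ter e))" using pcl_mono by blast
    moreover have "t e \<otimes> x \<otimes> inv t e \<in> M" using M.inv_op_closed2[of "t e" x] e x by (simp add: C_def)
    ultimately show ?thesis by (simp add: C_def)
  qed
  have C_t': "inv t e \<otimes> x \<otimes> t e \<in> C (org e)" if e: "e \<in> E" and x: "x \<in> C (ter e)" for e x
  proof -
    have V: "org e \<in> V" "ter e \<in> V" using e by auto
    have tG: "t e \<in> carrier G" using e by simp
    have x2: "x \<in> pcl (\<epsilon> (ter e) ` emap \<Gamma> e ` esub \<Gamma> e)" using x M(3)[OF e] N2(2)[OF e] by (auto simp: C_def)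
    have sub: "\<epsilon> (ter e) ` emap \<Gamma> e ` esub \<Gamma> e \<subseteq> carrier G" using emap_closed[OF e] V by auto
    have "inv t e \<otimes> \<epsilon> (ter e) (emap \<Gamma> e g) \<otimes> inv (inv t e) = \<epsilon> (org e) g" if g: "g \<in> esub \<Gamma> e" for g
      unfolding t_conj[OF e g, symmetric] using esub_closed[OF e g] tG V by (simp add: m_assoc)
    then have "(\<lambda>h. inv t e \<otimes> h \<otimes> inv (inv t e)) ` \<epsilon> (ter e) ` emap \<Gamma> e ` esub \<Gamma> e = \<epsilon> (org e) ` esub \<Gamma> e"
      unfolding image_image by (intro image_cong) auto
    then have "inv t e \<otimes> x \<otimes> inv (inv t e) \<in> pcl (\<epsilon> (org e) ` esub \<Gamma> e)"
      using pcl_conj[OF x2 sub, of "inv t e"] tG by simp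
    moreover have "\<epsilon> (org e) ` esub \<Gamma> e \<subseteq> ?H (org e)"
      using vgroup_one[OF V(1)] esub_closed[OF e] by auto
    then have "pcl (\<epsilon> (org e) ` esub \<Gamma> e) \<subseteq> pcl (?H (org e))" by (rule pcl_mono)
    ultimately have "inv t e \<otimes> x \<otimes> t e \<in> pcl (?H (org e))" using tG by auto
    moreover have "inv t e \<otimes> x \<otimes> t e \<in> M" using M.inv_op_closed1[of "t e" x] tG x by (simp add: C_def)
    ultimately show ?thesis by (simp add: C_def)
  qed
  have C_eq: "C v = C v0" if "v \<in> V" for v
    using v0 that
  proof (induction rule: T.tree_induct)
    case (edge e)
    then have e: "e \<in> E" using T.T_sub(2) by auto
    have "x \<in> C (ter e)" if x: "x \<in> C (org e)" for x
      using C_t[OF e x] t_tree[OF edge] subsetD[OF CG x] by simp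
    moreover have "x \<in> C (org e)" if x: "x \<in> C (ter e)" for x
      using C_t'[OF e x] t_tree[OF edge] subsetD[OF CG x] by simp
    ultimately show ?case by blast
  qed simp
  let ?C = "C v0"
  have C_pcl: "?C \<subseteq> pcl (?H v)" if "v \<in> V" for v using C_eq[OF that] by (auto simp: C_def)
  have C_comm: "z \<otimes> x = x \<otimes> z" if x: "x \<in> ?C" and v: "v \<in> V" and z: "z \<in> ?H v" for x v z
  proof (rule pcl_commutes[OF rf _ HG(1)[OF v]])
    show "x \<in> pcl (?H v)" using C_pcl[OF v] x by blast
    show "z \<in> carrier G" using HG(1)[OF v] z by blast
    show "z \<otimes> h = h \<otimes> z" if "h \<in> ?H v" for h by (rule vgroup_commute[OF one_closed v z that])
  qed
  have C_abel: "x \<otimes> x' = x' \<otimes> x" if x: "x \<in> ?C" "x' \<in> ?C" for x x'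
  proof (rule pcl_commutes[OF rf _ HG(1)[OF v0]])
    show "x' \<in> pcl (?H v0)" using C_pcl[OF v0] x by blast
    show "x \<in> carrier G" using CG x by blast
    show "x \<otimes> h = h \<otimes> x" if "h \<in> ?H v0" for h using C_comm[OF x(1) v0 that] by simp
  qed
  have conj: "\<forall>x\<in>?C. \<gamma> \<otimes> x \<otimes> inv \<gamma> \<in> ?C" if "\<gamma> \<in> carrier G" for \<gamma>
    using that
  proof (induction rule: gen_induct)
    case one
    show ?case using subsetD[OF CG[of v0]] by simp
  next
    case (vertex \<gamma> v g)
    have "\<gamma> \<otimes> \<epsilon> v g \<otimes> x \<otimes> inv (\<gamma> \<otimes> \<epsilon> v g) = \<gamma> \<otimes> x \<otimes> inv \<gamma>" if x: "x \<in> ?C" for x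
    proof -
      have "\<epsilon> v g \<in> ?H v" using vgroup_one vertex by blast
      then have "\<epsilon> v g \<otimes> x = x \<otimes> \<epsilon> v g" by (rule C_comm[OF x vertex.hyps(2)])
      moreover have "\<gamma> \<otimes> \<epsilon> v g \<otimes> x \<otimes> inv (\<gamma> \<otimes> \<epsilon> v g) = \<gamma> \<otimes> (\<epsilon> v g \<otimes> x) \<otimes> inv \<epsilon> v g \<otimes> inv \<gamma>"
        using vertex x CG by (auto simp: word_simps subset_iff)
      ultimately show ?thesis using vertex x CG by (auto simp: m_assoc subset_iff)
    qed
    then show ?case using vertex by simp
  next
    case (stable \<gamma> e)
    have "\<gamma> \<otimes> t e \<otimes> x \<otimes> inv (\<gamma> \<otimes> t e) = \<gamma> \<otimes> (t e \<otimes> x \<otimes> inv t e) \<otimes> inv \<gamma>" if x: "x \<in> ?C" for x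
      using stable subsetD[OF CG x] by (simp add: word_simps)
    moreover have "t e \<otimes> x \<otimes> inv t e \<in> ?C" if x: "x \<in> ?C" for x
      using C_t[of e x] C_eq[of "org e"] C_eq[of "ter e"] stable x by auto
    ultimately show ?case using stable by simp
  next
    case (stable_inv \<gamma> e)
    have "\<gamma> \<otimes> inv t e \<otimes> x \<otimes> inv (\<gamma> \<otimes> inv t e) = \<gamma> \<otimes> (inv t e \<otimes> x \<otimes> t e) \<otimes> inv \<gamma>" if x: "x \<in> ?C" for x
      using stable_inv subsetD[OF CG x] by (simp add: word_simps)
    moreover have "inv t e \<otimes> x \<otimes> t e \<in> ?C" if x: "x \<in> ?C" for x
      using C_t'[of e x] C_eq[of "org e"] C_eq[of "ter e"] stable_inv x by auto
    ultimately show ?case using stable_inv by simp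
  qed
  have "subgroup ?C G"
    unfolding C_def by (rule subgroups_Inter_pair[OF M.subgroup_axioms pcl_subgroup[OF HG(2)[OF v0]]])
  then have C: "?C \<lhd> G" unfolding normal_inv_iff using conj by blast
  have "pow_into ?C (?H v)" if v: "v \<in> V" for v
    using cls[OF v] C_pcl[OF v] unfolding pow_into_def by blast
  then obtain k0 :: nat where k0: "k0 \<ge> 1" "!!v h. v \<in> V ==> h \<in> ?C ==> h [^] k0 \<in> ?H v"
    using pow_into_common[OF T.D.finite_verts _ CG[of v0], of "\<lambda>v. vgroup \<one> v"] HG(2) by metis
  \<comment> \<open>The exponent \<open>k0\<close> brings elements of the common closure part into
    all vertex groups, and \<open>r\<close> brings these into all edge groups.\<close>
  define B where "B = (\<lambda>x. x [^] (k0 * r)) ` ?C"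
  have B: "B \<lhd> G" unfolding B_def by (rule normal_pow_image[OF C C_abel])
  have B_in: "B \<subseteq> \<epsilon> v ` D" if v: "v \<in> V" and pow: "!!g. g \<in> carrier (A v) ==> g [^]\<^bsub>A v\<^esub> r \<in> D" for v D
  proof
    interpret \<epsilon>: group_hom "A v" G "\<epsilon> v" by (rule \<epsilon>_hom[OF v])
    fix b assume "b \<in> B"
    then obtain x where x: "x \<in> ?C" "b = x [^] (k0 * r)" by (auto simp: B_def)
    obtain g where g: "g \<in> carrier (A v)" "x [^] k0 = \<epsilon> v g" using k0(2)[OF v x(1)] vgroup_one[OF v] by auto
    have "b = (x [^] k0) [^] r" using x subsetD[OF CG x(1)] by (simp add: nat_pow_pow)
    also have "\<dots> = \<epsilon> v (g [^]\<^bsub>A v\<^esub> r)" using g by (simp add: \<epsilon>.hom_nat_pow)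
    finally show "b \<in> \<epsilon> v ` D" using pow[OF g(1)] by blast
  qed
  have B_sub: "B \<subseteq> \<epsilon> v ` carrier (A v)" if "v \<in> V" for v
  proof (rule B_in[OF that])
    interpret v: group "A v" by (rule A_group[OF that])
    show "g [^]\<^bsub>A v\<^esub> r \<in> carrier (A v)" if "g \<in> carrier (A v)" for g using that by simp
  qed
  have B_C: "B \<subseteq> ?C"
    using subgroup_pow_closed[OF normal_imp_subgroup[OF C]] by (auto simp: B_def)
  \<comment> \<open>With exponent \<open>m\<close> vertex elements enter \<open>M\<close>, hence the
    closure part, and \<open>k0 * r\<close> leads on into \<open>B\<close>.\<close>
  obtain m :: nat where m: "m \<ge> 1" "!!x. x \<in> carrier G ==> x [^] m \<in> M"
    using normal_pow_mem[of M] M(1) unfolding fin_normal_def by metis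
  have "gbs_core G \<Gamma> T \<Phi> n c r B (m * (k0 * r))"
  proof (intro gbs_core.intro gbs_abelian.intro gbs_abelian_axioms.intro gbs_core_axioms.intro gbs_axioms B B_sub)
    show "\<exists>\<gamma>\<in>carrier G. \<exists>v\<in>V. F \<subseteq> vgroup \<gamma> v" if "F \<subseteq> B" for F
      using that B_sub[OF v0] vgroup_one[OF v0] v0 by (intro bexI[of _ \<one>] bexI[of _ v0]) auto
    show "b \<otimes> \<epsilon> v g = \<epsilon> v g \<otimes> b" if "b \<in> B" "v \<in> V" "g \<in> carrier (A v)" for b v g
      using C_comm[of b v "\<epsilon> v g"] that B_C vgroup_one by auto
    show "m * (k0 * r) \<ge> 1" using m(1) k0(1) r by simp
    show "\<epsilon> v g [^] (m * (k0 * r)) \<in> B" if "v \<in> V" "g \<in> carrier (A v)" for v g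
    proof -
      have h: "\<epsilon> v g \<in> ?H v" "\<epsilon> v g \<in> carrier G" using that vgroup_one by auto
      then have "\<epsilon> v g [^] m \<in> ?H v" using subgroup_pow_closed[OF HG(2)[OF that(1)]] by blast
      then have "\<epsilon> v g [^] m \<in> C v" using m(2)[OF h(2)] pcl_superset[OF HG(1)[OF that(1)]] by (auto simp: C_def)
      then have "(\<epsilon> v g [^] m) [^] (k0 * r) \<in> B" using C_eq[OF that(1)] by (auto simp: B_def)
      then show ?thesis using h(2) by (simp add: nat_pow_pow)
    qed
    show "B \<subseteq> \<epsilon> (org e) ` esub \<Gamma> e" if "e \<in> E" for e
      by (rule B_in) (use that esub_pow in auto)
    show "B \<subseteq> \<epsilon> (ter e) ` emap \<Gamma> e ` esub \<Gamma> e" if "e \<in> E" for e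
      by (rule B_in) (use that emap_pow in auto)
  qed
  then show thesis by (rule that)
qed

lemma split_exists:
  assumes rf: "residually_finite G"
  obtains B q L l \<omega> where "gbs_split G \<Gamma> T \<Phi> n c r B q L l \<omega>"
proof (cases "\<forall>v\<in>V. pow_into (pcl (vgroup \<one> v)) (vgroup \<one> v)")
  case True
  obtain B q where "gbs_core G \<Gamma> T \<Phi> n c r B q"
    by (rule core_of_closures[OF rf]) (use True in blast)+
  then show thesis by (rule gbs_core.split) (rule that)
next
  case False
  then obtain u where u: "u \<in> V" "\<not> (\<exists>k\<ge>1::nat. \<forall>b\<in>pcl (vgroup \<one> u). b [^] k \<in> vgroup \<one> u)"
    by (auto simp: pow_into_def)
  show thesis
  proof (rule split_of_directed)
    show "\<exists>\<gamma>\<in>carrier G. \<exists>v\<in>V. vgroup \<gamma>1 v1 \<union> vgroup \<gamma>2 v2 \<subseteq> vgroup \<gamma> v"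
      if "\<gamma>1 \<in> carrier G" "v1 \<in> V" "\<gamma>2 \<in> carrier G" "v2 \<in> V" for \<gamma>1 v1 \<gamma>2 v2
      by (rule vgroups_directed[OF rf u that(1,3,2,4)])
  qed (rule that)
qed

lemma vgroup_pow_eq_one:
  assumes "\<gamma> \<in> carrier G" "v \<in> V" "h \<in> vgroup \<gamma> v" "h [^] k = \<one>" "k \<ge> (1 :: nat)"
  shows "h = \<one>"
proof -
  interpret v: Zn_coords "A v" n "c v" by (rule coords[OF assms(2)])
  interpret \<epsilon>: group_hom "A v" G "\<epsilon> v" by (rule \<epsilon>_hom[OF assms(2)])
  obtain g where g: "g \<in> carrier (A v)" "h = \<gamma> \<otimes> \<epsilon> v g \<otimes> inv \<gamma>" using assms(3) by (auto simp: vgroup_def)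
  have "\<gamma> \<otimes> \<epsilon> v (g [^]\<^bsub>A v\<^esub> k) \<otimes> inv \<gamma> = \<one>"
    using conj_pow[OF assms(1), of "\<epsilon> v g" k] g assms(4) by (simp add: \<epsilon>.hom_nat_pow)
  then have "\<gamma> \<otimes> \<epsilon> v (g [^]\<^bsub>A v\<^esub> k) \<otimes> inv \<gamma> \<otimes> \<gamma> = \<gamma>" using assms(1) by simp
  then have "\<gamma> \<otimes> \<epsilon> v (g [^]\<^bsub>A v\<^esub> k) = \<gamma> \<otimes> \<one>"
    using assms(1) g(1) by (simp add: m_assoc)
  then have "\<epsilon> v (g [^]\<^bsub>A v\<^esub> k) = \<epsilon> v \<one>\<^bsub>A v\<^esub>" using assms(1) g(1) by (simp del: r_one)
  then have "g [^]\<^bsub>A v\<^esub> k = \<one>\<^bsub>A v\<^esub>"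
    by (rule inj_onD[OF \<epsilon>_inj[OF assms(2)]]) (use g(1) in auto)
  then have "g = \<one>\<^bsub>A v\<^esub>" by (rule v.pow_eq_one[OF g(1) _ assms(5)])
  then show ?thesis using g(2) assms(1) by simp
qed

end

section \<open>Linearity and self-similarity\<close>

context gbs_split begin

lemma L: "subgroup L G" "finite (rcosets L)" "\<omega> \<in> hom (G\<lparr>carrier := L\<rparr>) (free_group {..<l})"
  using \<omega> by (simp_all add: virtual_hom_def)

lemma affine_rep_B:
  obtains \<alpha> where "\<alpha> \<in> hom G GL" "!!b. b \<in> B ==> \<alpha> b = 1\<^sub>m (n + 1) ==> b = \<one>"
    "!!b m. b \<in> B ==> \<alpha> (b [^] (m :: nat)) = 1\<^sub>m (n + 1) + of_nat m \<cdot>\<^sub>m (\<alpha> b - 1\<^sub>m (n + 1))"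
proof (rule affine_rep)
  fix \<alpha> assume \<alpha>: "\<alpha> \<in> hom G GL"
    "!!\<gamma> v g. \<gamma> \<in> carrier G ==> v \<in> V ==> g \<in> carrier (A v) ==>
      \<alpha> (\<gamma> \<otimes> \<epsilon> v g \<otimes> inv \<gamma>) = 1\<^sub>m (n + 1) ==> g = \<one>\<^bsub>A v\<^esub>"
    "!!\<gamma> v h m. \<gamma> \<in> carrier G ==> v \<in> V ==> h \<in> vgroup \<gamma> v ==>
      \<alpha> (h [^] (m :: nat)) = 1\<^sub>m (n + 1) + of_nat m \<cdot>\<^sub>m (\<alpha> h - 1\<^sub>m (n + 1))"
  show thesis
  proof (rule that[OF \<alpha>(1)])
    show "b = \<one>" if b: "b \<in> B" "\<alpha> b = 1\<^sub>m (n + 1)" for b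
    proof -
      obtain \<gamma> v g where g: "\<gamma> \<in> carrier G" "v \<in> V" "g \<in> carrier (A v)" "b = \<gamma> \<otimes> \<epsilon> v g \<otimes> inv \<gamma>"
        using B_vgroup1[OF b(1)] by (auto simp: vgroup_def)
      interpret \<epsilon>: group_hom "A v" G "\<epsilon> v" by (rule \<epsilon>_hom[OF g(2)])
      have "g = \<one>\<^bsub>A v\<^esub>" using \<alpha>(2)[OF g(1-3)] b(2) g(4) by simp
      then show ?thesis using g by simp
    qed
    show "\<alpha> (b [^] m) = 1\<^sub>m (n + 1) + of_nat m \<cdot>\<^sub>m (\<alpha> b - 1\<^sub>m (n + 1))" if b: "b \<in> B" for b and m :: nat
      using B_vgroup1[OF b] \<alpha>(3) by blast
  qed
qed

text \<open>On \<open>L\<close>, an element killed by the Sanov block has trivial image under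
  \<open>\<omega>\<close>, so it lies in \<open>B\<close>, where the affine block is
  faithful.\<close>

theorem linear: "linear_over_rat G"
proof -
  let ?GL = "G\<lparr>carrier := L\<rparr>" and ?F = "free_group {..<l}"
  interpret L: group ?GL by (rule subgroup.subgroup_is_group[OF L(1) group_axioms])
  interpret S: group sanov by simp
  obtain \<alpha> where \<alpha>: "\<alpha> \<in> hom G GL" "!!b. b \<in> B ==> \<alpha> b = 1\<^sub>m (n + 1) ==> b = \<one>"
    by (rule affine_rep_B) (rule that, assumption, blast)
  have \<alpha>L: "\<alpha> \<in> hom ?GL GL"
    using \<alpha>(1) subgroup.mem_carrier[OF L(1)] by (auto simp: hom_def)
  define \<mu> where "\<mu> g = sanov_rep (S.eval_word sanov_conj (\<omega> g))" for g
  interpret F: group ?F by simp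
  interpret \<iota>: group_hom ?F sanov "S.eval_word sanov_conj"
    using sanov_conj_closed by unfold_locales (auto intro!: S.eval_word_hom)
  interpret sr: group_hom sanov "GL_rat 2" sanov_rep
    using sanov_rep_hom group_GL_rat S.group_axioms by (simp add: group_hom_def group_hom_axioms_def)
  interpret \<omega>: group_hom ?GL ?F \<omega>
    using L(3) by unfold_locales
  have \<mu>: "\<mu> \<in> hom ?GL (GL_rat 2)"
  proof (rule homI)
    show "\<mu> g \<in> carrier (GL_rat 2)" if "g \<in> carrier ?GL" for g
      using \<omega>.hom_closed[OF that] by (simp add: \<mu>_def)
    show "\<mu> (g \<otimes>\<^bsub>?GL\<^esub> h) = \<mu> g \<otimes>\<^bsub>GL_rat 2\<^esub> \<mu> h" if "g \<in> carrier ?GL" "h \<in> carrier ?GL" for g h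
      unfolding \<mu>_def \<omega>.hom_mult[OF that] using \<omega>.hom_closed[OF that(1)] \<omega>.hom_closed[OF that(2)] by simp
  qed
  let ?\<rho> = "\<lambda>g. block_sum (n + 1) 2 (\<alpha> g) (\<mu> g)"
  have \<rho>: "?\<rho> \<in> hom ?GL (GL_rat (n + 1 + 2))"
    by (rule block_sum_hom[OF L.group_axioms \<alpha>L \<mu>])
  interpret \<rho>: group_hom ?GL "GL_rat (n + 1 + 2)" ?\<rho>
    using \<rho> L.group_axioms group_GL_rat by (simp add: group_hom_def group_hom_axioms_def)
  have "g = \<one>" if g: "g \<in> L" "?\<rho> g = \<one>\<^bsub>GL_rat (n + 1 + 2)\<^esub>" for g
  proof -
    have carr: "\<alpha> g \<in> carrier_mat (n + 1) (n + 1)" "\<mu> g \<in> carrier_mat 2 2"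
      by (rule GL_rat_carrier_mat, use \<alpha>L \<mu> g(1) in \<open>auto simp: hom_def\<close>)+
    have eq: "\<alpha> g = 1\<^sub>m (n + 1)" "\<mu> g = 1\<^sub>m 2"
      using block_sum_eq_one[OF carr] g(2) by (auto simp: one_GL_rat)
    have "S.eval_word sanov_conj (\<omega> g) = \<one>\<^bsub>sanov\<^esub>"
      using sanov_rep_eq_one eq(2) by (simp add: \<mu>_def)
    moreover have "\<omega> g \<in> carrier ?F" using L(3) g(1) by (auto simp: hom_def)
    ultimately have "\<omega> g = []" by (rule_tac sanov_conj_inj)
    then have "g \<in> B" by (rule \<omega>_ker[OF g(1)])
    then show ?thesis using \<alpha>(2) eq(1) by blast
  qed
  then have inj: "inj_on ?\<rho> L"
    using \<rho>.inj_on_one_iff by simp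
  show ?thesis
  proof (rule linear_of_finite_index[OF group_axioms _ inj])
    show "virtual_hom G (GL_rat (n + 1 + 2)) L ?\<rho>" using L(1,2) \<rho> by (simp add: virtual_hom_def)
  qed simp
qed

text \<open>The exponent is 1 modulo \<open>q\<close>, and the \<open>q\<close>-th power of
  \<open>x\<close> lies in \<open>B\<close> anyway.\<close>

lemma root_mem_B:
  assumes x: "\<gamma> \<in> carrier G" "v \<in> V" "x \<in> vgroup \<gamma> v" "x [^] (1 + q * k) \<in> B" shows "x \<in> B"
proof -
  have xG: "x \<in> carrier G" using x vgroup_closed by blast
  obtain g where g: "g \<in> carrier (A v)" "x = \<gamma> \<otimes> \<epsilon> v g \<otimes> inv \<gamma>" using x(3) by (auto simp: vgroup_def)
  have "x [^] q \<in> B"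
    using conj_pow[OF x(1), of "\<epsilon> v g" q] g x(2) B.inv_op_closed2[OF x(1) B_pow[OF x(2) g(1)]] by simp
  then have 1: "x [^] (q * k) \<in> B"
    using subgroup_pow_closed[OF B.subgroup_axioms, of "x [^] q" k] xG by (simp add: nat_pow_pow)
  have "x [^] (1 + q * k) = x \<otimes> x [^] (q * k)"
    using nat_pow_mult[OF xG, of 1 "q * k"] xG by simp
  then have "x = x [^] (1 + q * k) \<otimes> inv (x [^] (q * k))"
    using xG by (simp add: m_assoc)
  then show ?thesis using x(4) 1 B.m_closed B.m_inv_closed by metis
qed

text \<open>Pigeonhole, applied to finitely many cosets at a time: their representatives lie in one
  conjugate of a vertex group, where there are at most \<open>p ^ n\<close> residue classes. Two
  representatives in the same class differ by a \<open>p\<close>-th power, whose root lies in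
  \<open>B\<close> by \<open>root_mem_B\<close>.\<close>

lemma finite_pow_cosets:
  fixes k :: nat
  defines "p \<equiv> 1 + q * k"
  shows "finite ((\<lambda>b. (\<lambda>x. x [^] p) ` B #> b) ` B)"
proof (rule ccontr)
  let ?Z = "(\<lambda>x. x [^] p) ` B"
  let ?D = "{..<n} \<rightarrow>\<^sub>E {0..<int p}"
  assume inf: "infinite ((\<lambda>b. ?Z #> b) ` B)"
  obtain \<C> where \<C>: "finite \<C>" "card \<C> = Suc (card ?D)" "\<C> \<subseteq> (\<lambda>b. ?Z #> b) ` B"
    using infinite_arbitrarily_large[OF inf, of "Suc (card ?D)"] by blast
  have "\<exists>f. \<forall>C\<in>\<C>. f C \<in> B \<and> ?Z #> f C = C"
    by (rule bchoice) (use \<C>(3) in auto)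
  then obtain f where f: "!!C. C \<in> \<C> ==> f C \<in> B" "!!C. C \<in> \<C> ==> ?Z #> f C = C"
    by blast
  obtain \<gamma> v where v: "\<gamma> \<in> carrier G" "v \<in> V" "f ` \<C> \<subseteq> vgroup \<gamma> v"
    using B_vgroup[of "f ` \<C>"] \<C>(1) f(1) by auto
  interpret v: Zn_coords "A v" n "c v" by (rule coords[OF v(2)])
  interpret \<epsilon>: group_hom "A v" G "\<epsilon> v" by (rule \<epsilon>_hom[OF v(2)])
  have "\<exists>g. \<forall>C\<in>\<C>. g C \<in> carrier (A v) \<and> f C = \<gamma> \<otimes> \<epsilon> v (g C) \<otimes> inv \<gamma>"
    by (rule bchoice) (use v(3) in \<open>auto simp: vgroup_def\<close>)
  then obtain g where g: "!!C. C \<in> \<C> ==> g C \<in> carrier (A v)" "!!C. C \<in> \<C> ==> f C = \<gamma> \<otimes> \<epsilon> v (g C) \<otimes> inv \<gamma>"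
    by blast
  have "p > 0" by (simp add: p_def)
  then have "v.residues p h \<in> ?D" for h
    by (auto simp: v.residues_def split: if_splits)
  then have "(\<lambda>C. v.residues p (g C)) ` \<C> \<subseteq> ?D" by blast
  moreover have "finite ?D" by (intro finite_PiE) auto
  ultimately have "card ((\<lambda>C. v.residues p (g C)) ` \<C>) < card \<C>"
    using card_mono[of ?D] \<C>(2) by (metis le_imp_less_Suc)
  then have "\<not> inj_on (\<lambda>C. v.residues p (g C)) \<C>"
    by (rule pigeonhole)
  then obtain C C' where C: "C \<in> \<C>" "C' \<in> \<C>" "C \<noteq> C'" "v.residues p (g C) = v.residues p (g C')"
    by (auto simp: inj_on_def)
  obtain x where x: "x \<in> carrier (A v)" "g C \<otimes>\<^bsub>A v\<^esub> inv\<^bsub>A v\<^esub> g C' = x [^]\<^bsub>A v\<^esub> p"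
    by (rule v.residues_eq[OF g(1)[OF C(1)] g(1)[OF C(2)] C(4)])
  let ?x = "\<gamma> \<otimes> \<epsilon> v x \<otimes> inv \<gamma>"
  have "f C \<otimes> inv f C' = \<gamma> \<otimes> \<epsilon> v (g C \<otimes>\<^bsub>A v\<^esub> inv\<^bsub>A v\<^esub> g C') \<otimes> inv \<gamma>"
    using g C(1,2) v(1) by (simp add: word_simps)
  also have "\<dots> = ?x [^] p"
    using conj_pow[OF v(1), of "\<epsilon> v x" p] x by (simp add: \<epsilon>.hom_nat_pow)
  finally have eq: "f C \<otimes> inv f C' = ?x [^] p" .
  have "f C \<otimes> inv f C' \<in> B" using f(1) C(1,2) by blast
  then have "?x [^] (1 + q * k) \<in> B" using eq by (simp only: p_def)
  moreover have "?x \<in> vgroup \<gamma> v" using x(1) by (auto simp: vgroup_def)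
  ultimately have "?x \<in> B" using root_mem_B[OF v(1,2)] by blast
  then have "f C \<otimes> inv f C' \<in> ?Z" using eq by blast
  then have "?Z #> f C = ?Z #> f C'"
    using rcoset_eqI[OF normal_imp_subgroup[OF normal_pow_image[OF B B_commute]], of "f C" "f C'" p] f(1) C(1,2) by simp
  then show False using f(2) C(1-3) by metis
qed

text \<open>An element killed by \<open>\<psi>\<close> lies in \<open>B\<close>, since
  \<open>\<psi>\<close> is the identity modulo \<open>B\<close>, and is trivial because conjugates
  of vertex groups are torsion free. The image of \<open>\<psi>\<close> covers \<open>G\<close>
  modulo \<open>B\<close> and contains the \<open>p\<close>-th powers of \<open>B\<close>, so its
  index is finite.\<close>

lemma power_virtual_hom:
  obtains \<psi> \<phi> where "virtual_hom G G (\<psi> ` carrier G) \<phi>" "!!g. g \<in> carrier G ==> \<phi> (\<psi> g) = g"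
    "!!b. b \<in> B ==> \<psi> b = b [^] (1 + q * k)"
proof -
  let ?p = "1 + q * k"
  obtain \<psi> where \<psi>: "group_hom G G \<psi>" "!!g. g \<in> carrier G ==> inv g \<otimes> \<psi> g \<in> B"
    "!!b. b \<in> B ==> \<psi> b = b [^] ?p"
    by (rule power_endo_B[of k]) (rule that, assumption, blast, blast)
  interpret \<psi>: group_hom G G \<psi> by (rule \<psi>(1))
  have "g = \<one>" if g: "g \<in> carrier G" "\<psi> g = \<one>" for g
  proof -
    have gB: "g \<in> B" using \<psi>(2)[OF g(1)] g B.m_inv_closed[of "inv g"] by simp
    then obtain \<gamma> v where v: "\<gamma> \<in> carrier G" "v \<in> V" "g \<in> vgroup \<gamma> v" using B_vgroup1 by blast
    have "g [^] ?p = \<one>" using \<psi>(3)[OF gB] g(2) by simp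
    then show ?thesis by (rule vgroup_pow_eq_one[OF v]) simp
  qed
  then have inj: "inj_on \<psi> (carrier G)" using \<psi>.inj_on_one_iff by simp
  let ?Z = "(\<lambda>x. x [^] ?p) ` B"
  have Z: "?Z \<lhd> G" by (rule normal_pow_image[OF B B_commute])
  interpret Z: normal ?Z G by (rule Z)
  have sub: "subgroup (\<psi> ` carrier G) G" using \<psi>.img_is_subgroup .
  have bB: "g \<otimes> inv \<psi> g \<in> B" if g: "g \<in> carrier G" for g
  proof -
    have "g \<otimes> inv \<psi> g = g \<otimes> inv (inv g \<otimes> \<psi> g) \<otimes> inv g" using g by (simp add: word_simps)
    then show ?thesis using B.inv_op_closed2[OF g B.m_inv_closed[OF \<psi>(2)[OF g]]] by simp
  qed
  have fin: "finite (rcosets (\<psi> ` carrier G))"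
  proof (rule finite_rcosetsI_left[OF sub, where f = "\<lambda>g. ?Z #> inv (g \<otimes> inv \<psi> g)"])
    have "(\<lambda>g. ?Z #> inv (g \<otimes> inv \<psi> g)) ` carrier G \<subseteq> (\<lambda>b. ?Z #> b) ` B"
      using bB B.m_inv_closed by blast
    then show "finite ((\<lambda>g. ?Z #> inv (g \<otimes> inv \<psi> g)) ` carrier G)"
      using finite_pow_cosets by (rule finite_subset)
    fix x y assume xy: "x \<in> carrier G" "y \<in> carrier G"
      and eq: "?Z #> inv (x \<otimes> inv \<psi> x) = ?Z #> inv (y \<otimes> inv \<psi> y)"
    have "inv (x \<otimes> inv \<psi> x) \<otimes> inv (inv (y \<otimes> inv \<psi> y)) \<in> ?Z"
      by (rule rcoset_eqD[OF Z.subgroup_axioms _ _ eq]) (use xy in auto)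
    then obtain b where b: "b \<in> B" "inv (x \<otimes> inv \<psi> x) \<otimes> (y \<otimes> inv \<psi> y) = \<psi> b"
      using xy \<psi>(3) by auto
    have "inv x \<otimes> y = inv \<psi> x \<otimes> (inv (x \<otimes> inv \<psi> x) \<otimes> (y \<otimes> inv \<psi> y)) \<otimes> \<psi> y"
      using xy by (simp add: word_simps)
    also have "\<dots> = \<psi> (inv x \<otimes> b \<otimes> y)"
      unfolding b(2) using xy b(1) by simp
    finally have "inv x \<otimes> y = \<psi> (inv x \<otimes> b \<otimes> y)" .
    moreover have "inv x \<otimes> b \<otimes> y \<in> carrier G" using xy b(1) by simp
    ultimately show "inv x \<otimes> y \<in> \<psi> ` carrier G" by (rule image_eqI)
  qed
  define \<phi> where "\<phi> = inv_into (carrier G) \<psi>"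
  have \<phi>: "\<phi> (\<psi> g) = g" if "g \<in> carrier G" for g
    unfolding \<phi>_def using inj that by (rule inv_into_f_f)
  have "\<phi> \<in> hom (G\<lparr>carrier := \<psi> ` carrier G\<rparr>) G"
  proof (rule homI)
    show "\<phi> x \<in> carrier G" if "x \<in> carrier (G\<lparr>carrier := \<psi> ` carrier G\<rparr>)" for x using that \<phi> by auto
    fix x y assume "x \<in> carrier (G\<lparr>carrier := \<psi> ` carrier G\<rparr>)" "y \<in> carrier (G\<lparr>carrier := \<psi> ` carrier G\<rparr>)"
    then obtain g h where "g \<in> carrier G" "x = \<psi> g" "h \<in> carrier G" "y = \<psi> h" by auto
    then show "\<phi> (x \<otimes>\<^bsub>G\<lparr>carrier := \<psi> ` carrier G\<rparr>\<^esub> y) = \<phi> x \<otimes> \<phi> y"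
      using \<phi>[of "g \<otimes> h"] by (simp add: \<phi>)
  qed
  then have "virtual_hom G G (\<psi> ` carrier G) \<phi>" using sub fin by (simp add: virtual_hom_def)
  then show thesis using \<phi> \<psi>(3) by (rule that)
qed

lemma \<omega>_section:
  obtains \<kappa> where "\<kappa> \<in> hom (free_group {..<l}) G" "!!w. w \<in> carrier (free_group {..<l}) ==> \<kappa> w \<in> L \<and> \<omega> (\<kappa> w) = w"
proof -
  let ?GL = "G\<lparr>carrier := L\<rparr>" and ?F = "free_group {..<l}"
  interpret L: group ?GL by (rule subgroup.subgroup_is_group[OF L(1) group_axioms])
  interpret F: group ?F by simp
  interpret \<omega>: group_hom ?GL ?F \<omega>
    using L(3) by unfold_locales
  define g where "g i = inv_into L \<omega> (free_gen i)" for i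
  have g: "g i \<in> L" "\<omega> (g i) = free_gen i" if "i < l" for i
  proof -
    have "free_gen i \<in> \<omega> ` L" using \<omega>_surj that by (simp add: free_gen_closed)
    then show "g i \<in> L" "\<omega> (g i) = free_gen i"
      unfolding g_def by (rule inv_into_into, rule f_inv_into_f)
  qed
  define \<kappa> where "\<kappa> = L.eval_word g"
  have gL: "g ` {..<l} \<subseteq> carrier ?GL" using g(1) by auto
  have \<kappa>: "\<kappa> \<in> hom ?F ?GL" unfolding \<kappa>_def by (rule L.eval_word_hom[OF gL])
  interpret \<kappa>: group_hom ?F ?GL \<kappa>
    using \<kappa> by unfold_locales
  have \<kappa>_gen: "\<kappa> (free_gen i) = g i" if "i < l" for i
    unfolding \<kappa>_def by (rule L.eval_free_gen) (use g(1)[OF that] in simp)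
  show thesis
  proof (rule that[of \<kappa>])
    show "\<kappa> \<in> hom ?F G" using \<kappa> subgroup.mem_carrier[OF L(1)] by (auto simp: hom_def)
    fix w assume w: "w \<in> carrier ?F"
    have "\<omega> (\<kappa> w) = w"
    proof (rule free_hom_ext[where h = "\<lambda>w. \<omega> (\<kappa> w)" and k = "\<lambda>w. w" and S = "{..<l}" and G = ?F])
      show "(\<lambda>w. \<omega> (\<kappa> w)) \<in> hom ?F ?F"
      proof (rule homI)
        show "\<omega> (\<kappa> u) \<in> carrier ?F" if "u \<in> carrier ?F" for u
          by (rule \<omega>.hom_closed[OF \<kappa>.hom_closed[OF that]])
        show "\<omega> (\<kappa> (u \<otimes>\<^bsub>?F\<^esub> u')) = \<omega> (\<kappa> u) \<otimes>\<^bsub>?F\<^esub> \<omega> (\<kappa> u')" if "u \<in> carrier ?F" "u' \<in> carrier ?F" for u u'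
          unfolding \<kappa>.hom_mult[OF that] by (rule \<omega>.hom_mult[OF \<kappa>.hom_closed[OF that(1)] \<kappa>.hom_closed[OF that(2)]])
      qed
      show "(\<lambda>w. w) \<in> hom ?F ?F" by (auto intro: homI)
    qed (use w g \<kappa>_gen in auto)
    then show "\<kappa> w \<in> L \<and> \<omega> (\<kappa> w) = w" using \<kappa> w by (auto simp: hom_def)
  qed
qed

theorem self_similar:
  assumes n: "n \<ge> 1" shows "self_similar G"
proof -
  let ?GL = "G\<lparr>carrier := L\<rparr>" and ?F = "free_group {..<l}"
  interpret L: group ?GL by (rule subgroup.subgroup_is_group[OF L(1) group_axioms])
  interpret F: group ?F by simp
  interpret \<omega>: group_hom ?GL ?F \<omega>
    using L(3) by unfold_locales
  obtain \<alpha> where \<alpha>: "\<alpha> \<in> hom G GL" "!!b. b \<in> B ==> \<alpha> b = 1\<^sub>m (n + 1) ==> b = \<one>"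
    "!!b m. b \<in> B ==> \<alpha> (b [^] (m :: nat)) = 1\<^sub>m (n + 1) + of_nat m \<cdot>\<^sub>m (\<alpha> b - 1\<^sub>m (n + 1))"
    by (rule affine_rep_B) (rule that, assumption, blast, blast)
  obtain X where X: "finite X" "X \<subseteq> carrier G" "generate G X = carrier G" by (rule finitely_generated)
  obtain d where d: "d > 0" "!!m g. coprime d m ==> g \<in> carrier G ==> \<alpha> g \<in> loc_mat m (n + 1)"
    by (rule finitely_generated_loc_mat[OF group_axioms X \<alpha>(1)]) (rule that, assumption, blast)
  \<comment> \<open>Makes the exponent one more than a multiple of \<open>d\<close>, hence prime to
    all denominators in the image of \<open>\<alpha>\<close>.\<close>
  define k where "k = nat d"
  let ?p = "1 + q * k"
  have p: "coprime d (int ?p)" "int ?p \<ge> 2"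
  proof -
    have eq: "int ?p = 1 + d * int q" using d(1) by (simp add: k_def)
    have cop: "coprime d (1 + d * int q)"
    proof (rule coprimeI)
      fix b assume "b dvd d" "b dvd 1 + d * int q"
      then show "is_unit b" using dvd_add_left_iff[of b "d * int q" 1] by simp
    qed
    show "coprime d (int ?p)" unfolding eq by (rule cop)
    have "q * k \<ge> 1" using q d(1) by (simp add: k_def)
    then show "int ?p \<ge> 2" by linarith
  qed
  obtain \<psi> \<phi> where \<psi>: "virtual_hom G G (\<psi> ` carrier G) \<phi>" "!!g. g \<in> carrier G ==> \<phi> (\<psi> g) = g"
    "!!b. b \<in> B ==> \<psi> b = b [^] ?p"
    by (rule power_virtual_hom[of k]) (rule that, assumption, blast, blast)
  obtain F0 where F0: "finite F0" "!!L' f. (L', f) \<in> F0 ==> virtual_hom ?F ?F L' f" "trivial_core ?F F0"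
    by (rule free_group_trivial_core[of l]) (rule that, assumption, blast, assumption)
  obtain \<kappa> where \<kappa>: "\<kappa> \<in> hom ?F G" "!!w. w \<in> carrier ?F ==> \<kappa> w \<in> L \<and> \<omega> (\<kappa> w) = w"
    by (rule \<omega>_section) (rule that, assumption, blast)
  \<comment> \<open>Virtual endomorphisms of the free quotient are pulled back by
    \<open>\<omega>\<close> and returned to \<open>G\<close> by its section.\<close>
  define lift where "lift = (\<lambda>(L', f). ({x \<in> L. \<omega> x \<in> L'}, \<kappa> \<circ> (f \<circ> \<omega>)))"
  \<comment> \<open>The identity on \<open>L\<close> confines invariant subgroups to
    \<open>L\<close>, where \<open>\<omega>\<close> is defined. The trivial map is a second pair,
    which ensures at least two letters.\<close>
  define \<F> where "\<F> = {(\<psi> ` carrier G, \<phi>), (L, \<lambda>x. x), (L, \<lambda>x. \<one>)} \<union> lift ` F0"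
  have v: "virtual_hom G G L' f" if "(L', f) \<in> \<F>" for L' f
  proof -
    have "virtual_hom G G L (\<lambda>x. x)" "virtual_hom G G L (\<lambda>x. \<one>)"
      using L(1,2) subgroup.mem_carrier[OF L(1)] by (auto simp: virtual_hom_def hom_def)
    moreover have "virtual_hom G G {x \<in> L. \<omega> x \<in> L'} (\<kappa> \<circ> (f \<circ> \<omega>))" if "(L', f) \<in> F0" for L' f
      by (rule virtual_hom_post[OF virtual_hom_comp[OF \<omega> F0(2)[OF that] F.group_axioms] \<kappa>(1)])
    ultimately show ?thesis using that \<psi>(1) by (auto simp: \<F>_def lift_def)
  qed
  \<comment> \<open>Distinguishes the identity from the trivial map; this is where
    \<open>n \<ge> 1\<close> enters.\<close>
  have "\<exists>x\<in>carrier G. x \<noteq> \<one>"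
  proof -
    obtain v0 where v0: "v0 \<in> V" by (rule V_nonempty)
    interpret v: Zn_coords "A v0" n "c v0" by (rule coords[OF v0])
    interpret \<epsilon>: group_hom "A v0" G "\<epsilon> v0" by (rule \<epsilon>_hom[OF v0])
    have "v.basis 0 \<noteq> \<one>\<^bsub>A v0\<^esub>" using v.c_basis[of 0 0] v.c_one[of 0] n by auto
    then have "\<epsilon> v0 (v.basis 0) \<noteq> \<epsilon> v0 \<one>\<^bsub>A v0\<^esub>"
      using inj_onD[OF \<epsilon>_inj[OF v0], of "v.basis 0" "\<one>\<^bsub>A v0\<^esub>"] by auto
    then show ?thesis using v0 by (intro bexI[of _ "\<epsilon> v0 (v.basis 0)"]) auto
  qed
  then have ne: "(L, \<lambda>x. x) \<noteq> (L, \<lambda>x. \<one>)" by (auto dest: fun_cong)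
  have fin: "finite \<F>" using F0(1) by (simp add: \<F>_def)
  have "card {(L, \<lambda>x. x), (L, \<lambda>x. \<one>)} \<le> card \<F>"
    by (rule card_mono[OF fin]) (auto simp: \<F>_def)
  then have card: "card \<F> \<ge> 2" using ne by simp
  have core: "trivial_core G \<F>"
    unfolding trivial_core_def
  proof (intro allI impI)
    fix K assume K: "K \<lhd> G" and inv: "\<forall>(L', f)\<in>\<F>. K \<subseteq> L' \<and> f ` K \<subseteq> K"
    interpret K: normal K G by (rule K)
    have KL: "K \<subseteq> L" and K\<psi>: "K \<subseteq> \<psi> ` carrier G" "\<phi> ` K \<subseteq> K" using inv by (auto simp: \<F>_def)
    have "K \<lhd> ?GL"
      using normal_restrict_supergroup[OF L(1) K KL] .
    then have \<omega>K: "\<omega> ` K \<lhd> ?F"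
      using normal_hom_image[OF \<omega>.group_hom_axioms] \<omega>_surj by simp
    have "\<omega> ` K = {\<one>\<^bsub>?F\<^esub>}"
    proof -
      have "\<omega> ` K \<subseteq> L' \<and> f ` \<omega> ` K \<subseteq> \<omega> ` K" if f: "(L', f) \<in> F0" for L' f
      proof -
        have "lift (L', f) \<in> \<F>" using f by (simp add: \<F>_def)
        then have 1: "K \<subseteq> {x \<in> L. \<omega> x \<in> L'}" "(\<kappa> \<circ> (f \<circ> \<omega>)) ` K \<subseteq> K"
          using bspec[OF inv, of "lift (L', f)"] by (simp_all add: lift_def)
        have "f (\<omega> x) \<in> \<omega> ` K" if x: "x \<in> K" for x
        proof -
          have "\<omega> x \<in> L'" using 1(1) x by blast
          then have "f (\<omega> x) \<in> carrier ?F" using F0(2)[OF f] by (auto simp: virtual_hom_def hom_def)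
          then have "\<omega> (\<kappa> (f (\<omega> x))) = f (\<omega> x)" using \<kappa>(2) by blast
          moreover have "\<kappa> (f (\<omega> x)) \<in> K" using 1(2) x by auto
          ultimately show ?thesis by (metis imageI)
        qed
        then show ?thesis using 1(1) by blast
      qed
      then have all: "\<forall>(L', f)\<in>F0. \<omega> ` K \<subseteq> L' \<and> f ` (\<omega> ` K) \<subseteq> \<omega> ` K" by blast
      show ?thesis
        by (rule F0(3)[unfolded trivial_core_def, THEN spec, THEN mp, THEN mp, OF \<omega>K all])
    qed
    then have KB: "K \<subseteq> B" using \<omega>_ker KL by (fastforce simp: one_free_group)
    have "x = \<one>" if x: "x \<in> K" for x
    proof -
      \<comment> \<open>\<open>\<phi>\<close> inverts the power map on \<open>B\<close> and maps
        \<open>K\<close> into itself, so roots can be taken within \<open>K\<close> again and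
        again.\<close>
      have root: "\<exists>y\<in>K. x = y [^] (?p ^ i)" for i :: nat
      proof (induction i)
        case 0
        then show ?case using x K.mem_carrier[OF x] by (intro bexI[of _ x]) auto
      next
        case (Suc i)
        then obtain y where y: "y \<in> K" "x = y [^] (?p ^ i)" by blast
        obtain z where z: "z \<in> carrier G" "y = \<psi> z" using y(1) K\<psi>(1) by blast
        have zK: "z \<in> K" using K\<psi>(2) y(1) z \<psi>(2)[OF z(1)] by (metis image_subset_iff)
        have "y = z [^] ?p" using z(2) \<psi>(3) zK KB by blast
        then have "x = (z [^] ?p) [^] (?p ^ i)" using y(2) by (simp only:)
        also have "\<dots> = z [^] (?p ^ Suc i)" unfolding power_Suc by (rule nat_pow_pow[OF z(1)])
        finally have "x = z [^] (?p ^ Suc i)" .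
        then show ?case using zK by blast
      qed
      have \<alpha>_carr: "\<alpha> g \<in> carrier_mat (n + 1) (n + 1)" if "g \<in> carrier G" for g
        using GL_rat_carrier_mat \<alpha>(1) that by (auto simp: hom_def)
      have xG: "x \<in> carrier G" using x by simp
      have loc: "(\<alpha> g - 1\<^sub>m (n + 1)) $$ (i, j) \<in> int_loc (int ?p)"
        if "g \<in> carrier G" "i < n + 1" "j < n + 1" for g i j
      proof -
        have "\<alpha> g $$ (i, j) \<in> int_loc (int ?p)"
          using d(2)[OF p(1) that(1)] that(2,3) by (simp add: loc_mat_def)
        moreover have "(1\<^sub>m (n + 1) :: rat mat) $$ (i, j) \<in> int_loc (int ?p)" using that(2,3) by simp
        ultimately have "\<alpha> g $$ (i, j) - 1\<^sub>m (n + 1) $$ (i, j) \<in> int_loc (int ?p)" by (rule int_loc_closed(3))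
        then show ?thesis using that \<alpha>_carr[OF that(1)] by simp
      qed
      \<comment> \<open>Roots of \<open>x\<close> of exponent \<open>?p ^ e\<close> make the entries
        divisible by this power within the localisation, for every \<open>e\<close>.\<close>
      have zero: "(\<alpha> x - 1\<^sub>m (n + 1)) $$ (i, j) = 0" if ij: "i < n + 1" "j < n + 1" for i j
      proof (rule int_loc_divisible_eq_0[OF p(2) loc[OF xG ij]])
        fix e :: nat
        obtain y where y: "y \<in> K" "x = y [^] (?p ^ e)" using root by blast
        have yG: "y \<in> carrier G" "y \<in> B" using y(1) KB by auto
        have "\<alpha> x = 1\<^sub>m (n + 1) + of_nat (?p ^ e) \<cdot>\<^sub>m (\<alpha> y - 1\<^sub>m (n + 1))"
          unfolding y(2) by (rule \<alpha>(3)[OF yG(2)])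
        then have "(\<alpha> x - 1\<^sub>m (n + 1)) $$ (i, j) = of_int (int ?p) ^ e * (\<alpha> y - 1\<^sub>m (n + 1)) $$ (i, j)"
          using ij \<alpha>_carr[OF yG(1)] by simp
        then show "\<exists>z\<in>int_loc (int ?p). (\<alpha> x - 1\<^sub>m (n + 1)) $$ (i, j) = of_int (int ?p) ^ e * z"
          using loc[OF yG(1) ij] by blast
      qed
      have "\<alpha> x = 1\<^sub>m (n + 1)"
      proof (rule eq_matI)
        fix i j assume "i < dim_row (1\<^sub>m (n + 1) :: rat mat)" "j < dim_col (1\<^sub>m (n + 1) :: rat mat)"
        then have ij: "i < n + 1" "j < n + 1" by auto
        then show "\<alpha> x $$ (i, j) = 1\<^sub>m (n + 1) $$ (i, j)"
          using zero[OF ij] \<alpha>_carr[OF xG] by (simp del: index_one_mat(1))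
      qed (use \<alpha>_carr[OF xG] in auto)
      then show ?thesis using \<alpha>(2) x KB by blast
    qed
    then show "K = {\<one>}" using K.one_closed by blast
  qed
  show ?thesis
    by (rule self_similar_of_virtual_homs[OF fin card _ core]) (rule v)
qed

end

theorem theorem1p1:
  fixes n :: nat
    and G :: "('g, 'b) monoid_scheme"
    and \<Gamma> :: "('v, 'e, 'a) gog"
    and T :: "('v, 'e) pre_digraph"
  assumes "n \<ge> 1"
    and "GBS_graph_of_groups n \<Gamma>"
    and "maximal_subtree (base \<Gamma>) T"
    and "group G"
    and "G \<cong> fundamental_group \<Gamma> T"
  shows "(self_similar G \<longleftrightarrow> residually_finite G) \<and>
         (residually_finite G \<longleftrightarrow> linear_over_rat G)"
proof -
  obtain f where "f \<in> iso G (fundamental_group \<Gamma> T)"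
    using assms(5) by (auto simp: is_iso_def)
  then have "inv_into (carrier G) f \<in> iso (fundamental_group \<Gamma> T) G"
    by (rule group.iso_set_sym[OF assms(4)])
  then interpret gog_group G \<Gamma> T "inv_into (carrier G) f"
    using assms(2-4) by (simp add: gog_group_def gog_group_axioms_def GBS_graph_of_groups_def)
  obtain c r where "gbs G \<Gamma> T (inv_into (carrier G) f) n c r"
    by (rule gbs_exists[OF assms(2)])
  then interpret gbs G \<Gamma> T "inv_into (carrier G) f" n c r .
  obtain X where X: "finite X" "X \<subseteq> carrier G" "generate G X = carrier G" by (rule finitely_generated)
  have "self_similar G \<and> linear_over_rat G" if rf: "residually_finite G"
  proof -
    obtain B q L l \<omega> where "gbs_split G \<Gamma> T (inv_into (carrier G) f) n c r B q L l \<omega>"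
      by (rule split_exists[OF rf])
    then interpret gbs_split G \<Gamma> T "inv_into (carrier G) f" n c r B q L l \<omega> .
    show ?thesis using self_similar[OF assms(1)] linear by blast
  qed
  then show ?thesis
    using self_similar_residually_finite[OF assms(4)] linear_residually_finite[OF assms(4) X] by blast
qed

end
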